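(* There are absolute constants $C>0$ and $N_0$ such that the following holds. Let $N\ge N_0$ and let $p$ be a prime with $p \le (\log N)/(\log\log N)^2$. Then the number of pairs $(\lambda,\mu)$ of partitions of $N$ such that $\chi^{\lambda}_{\mu}$ is not divisible by $p$ is at most \[ C\, p(N)^2 N^{-\frac{1}{12p}}. \] In particular, almost all entries in the character table of $S_N$ are multiples of $\prod_{p\le (\log N)/(\log\log N)^2} p$ (product over primes), i.e. the proportion of pairs $(\lambda,\mu)$ of partitions of $N$ for which $\chi^\lambda_\mu$ is not divisible by this product tends to $0$ as $N\to\infty$.
   Context: For partitions $\lambda,\mu$ of $N$, $\chi^{\lambda}_{\mu}$ denotes the value of the irreducible character of the symmetric group $S_N$ indexed by $\lambda$ on the conjugacy class of permutations of cycle type $\mu$ (these values are integers). $p(N)$ denotes the number of partitions of $N$; the entries of the character table of $S_N$ are the $p(N)^2$ values $\chi^\lambda_\mu$. $\log$ is the natural logarithm. *)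

theory Defs
  imports
    Complex_Main
    "HOL-Library.Function_Algebras"
    "HOL-Library.Multiset"
    "HOL-Computational_Algebra.Primes"
    "HOL-Combinatorics.Permutations"
    "HOL-Combinatorics.Orbits"
begin

definition partitions :: "nat \<Rightarrow> nat list set" where
  "partitions N = {la. sorted_wrt (\<ge>) la \<and> (\<forall>k\<in>set la. k > 0) \<and> sum_list la = N}"

definition sym_group :: "nat \<Rightarrow> (nat \<Rightarrow> nat) set" where
  "sym_group N = {\<pi>. \<pi> permutes {..<N}}"

text \<open>Fixed points are orbits of size 1, so they contribute parts equal to 1.\<close>

definition cycle_type :: "nat \<Rightarrow> (nat \<Rightarrow> nat) \<Rightarrow> nat multiset" where
  "cycle_type N \<pi> = image_mset card (mset_set (orbit \<pi> ` {..<N}))"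

text \<open>
  The group algebra of the symmetric group over the complex numbers is the space of functions
  \<open>(nat \<Rightarrow> nat) \<Rightarrow> complex\<close> vanishing off \<^term>\<open>sym_group N\<close>; the function \<open>f\<close> stands for
  the formal sum of the \<open>f \<sigma> \<cdot> \<sigma>\<close>, and multiplication is convolution.
\<close>

definition group_algebra :: "nat \<Rightarrow> ((nat \<Rightarrow> nat) \<Rightarrow> complex) set" where
  "group_algebra N = {f. \<forall>\<sigma>. \<sigma> \<notin> sym_group N \<longrightarrow> f \<sigma> = 0}"

definition group_elem :: "(nat \<Rightarrow> nat) \<Rightarrow> (nat \<Rightarrow> nat) \<Rightarrow> complex" where
  "group_elem \<pi> = (\<lambda>\<sigma>. if \<sigma> = \<pi> then 1 else 0)"

definition conv ::
  "nat \<Rightarrow> ((nat \<Rightarrow> nat) \<Rightarrow> complex) \<Rightarrow> ((nat \<Rightarrow> nat) \<Rightarrow> complex) \<Rightarrow> (nat \<Rightarrow> nat) \<Rightarrow> complex" where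
  "conv N f g = (\<lambda>\<sigma>. \<Sum>\<tau>\<in>sym_group N. f \<tau> * g (inv \<tau> \<circ> \<sigma>))"

definition young_diagram :: "nat list \<Rightarrow> (nat \<times> nat) set" where
  "young_diagram la = {(i, j). i < length la \<and> j < la ! i}"

text \<open>
  The tableau of shape \<open>la\<close> in which \<open>0, 1, 2, \<dots>\<close> are filled in row by row from the top, each
  row from left to right.
\<close>

definition canonical_tableau :: "nat list \<Rightarrow> nat \<times> nat \<Rightarrow> nat" where
  "canonical_tableau la = (\<lambda>(i, j). sum_list (take i la) + j)"

definition row_group :: "nat list \<Rightarrow> (nat \<Rightarrow> nat) set" where
  "row_group la = {\<pi> \<in> sym_group (sum_list la). \<forall>(i, j)\<in>young_diagram la. \<exists>j'.
     (i, j') \<in> young_diagram la \<and>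
     \<pi> (canonical_tableau la (i, j)) = canonical_tableau la (i, j')}"

definition column_group :: "nat list \<Rightarrow> (nat \<Rightarrow> nat) set" where
  "column_group la = {\<pi> \<in> sym_group (sum_list la). \<forall>(i, j)\<in>young_diagram la. \<exists>i'.
     (i', j) \<in> young_diagram la \<and>
     \<pi> (canonical_tableau la (i, j)) = canonical_tableau la (i', j)}"

definition row_symmetrizer :: "nat list \<Rightarrow> (nat \<Rightarrow> nat) \<Rightarrow> complex" where
  "row_symmetrizer la = (\<lambda>\<sigma>. if \<sigma> \<in> row_group la then 1 else 0)"

definition column_antisymmetrizer :: "nat list \<Rightarrow> (nat \<Rightarrow> nat) \<Rightarrow> complex" where
  "column_antisymmetrizer la = (\<lambda>\<sigma>. if \<sigma> \<in> column_group la then of_int (sign \<sigma>) else 0)"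

definition young_symmetrizer :: "nat list \<Rightarrow> (nat \<Rightarrow> nat) \<Rightarrow> complex" where
  "young_symmetrizer la =
     conv (sum_list la) (row_symmetrizer la) (column_antisymmetrizer la)"

text \<open>
  The irreducible representation of the symmetric group indexed by \<open>la\<close>: the left ideal of the
  group algebra generated by the Young symmetrizer, on which the group acts by left
  multiplication. With this convention \<open>[N]\<close> indexes the trivial representation.
\<close>

definition irrep_space :: "nat list \<Rightarrow> ((nat \<Rightarrow> nat) \<Rightarrow> complex) set" where
  "irrep_space la = (\<lambda>f. conv (sum_list la) f (young_symmetrizer la)) ` group_algebra (sum_list la)"

global_interpretation fun_space: vector_space "\<lambda>(c::complex) (f::'a \<Rightarrow> complex) x. c * f x"
  by unfold_locales (auto simp: fun_eq_iff algebra_simps)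

text \<open>
  The trace of a linear endomorphism \<open>T\<close> of a finite-dimensional subspace \<open>V\<close>: the sum of the
  diagonal entries of the matrix of \<open>T\<close> with respect to a basis of \<open>V\<close>, which does not depend on
  the basis chosen.
\<close>

definition trace_on ::
  "('a \<Rightarrow> complex) set \<Rightarrow> (('a \<Rightarrow> complex) \<Rightarrow> ('a \<Rightarrow> complex)) \<Rightarrow> complex" where
  "trace_on V T =
     (let B = (SOME B. fun_space.independent B \<and> fun_space.span B = V)
      in \<Sum>b\<in>B. fun_space.representation B (T b) b)"

definition irr_char :: "nat list \<Rightarrow> (nat \<Rightarrow> nat) \<Rightarrow> complex" where
  "irr_char la \<pi> = trace_on (irrep_space la) (conv (sum_list la) (group_elem \<pi>))"

text \<open>
  The value on the conjugacy class of cycle type \<open>mu\<close>, read off at an arbitrary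
  representative of the class.
\<close>

definition char_value :: "nat list \<Rightarrow> nat list \<Rightarrow> complex" where
  "char_value la mu =
     irr_char la (SOME \<pi>. \<pi> \<in> sym_group (sum_list la) \<and> cycle_type (sum_list la) \<pi> = mset mu)"

text \<open>
  Divisibility in the ring of integers, for the complex numbers that are character values
  (divisibility in the field of complex numbers would be vacuous).
\<close>

definition int_divides :: "nat \<Rightarrow> complex \<Rightarrow> bool" where
  "int_divides m z \<longleftrightarrow> (\<exists>k::int. z = of_int (int m * k))"

definition nondivisible_entries :: "nat \<Rightarrow> nat \<Rightarrow> (nat list \<times> nat list) set" where
  "nondivisible_entries N m =
     {(la, mu). la \<in> partitions N \<and> mu \<in> partitions N \<and> \<not> int_divides m (char_value la mu)}"

definition prime_bound :: "nat \<Rightarrow> real" where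
  "prime_bound N = ln (real N) / (ln (ln (real N)))\<^sup>2"

end

theory Submission
  imports Defs "HOL-Analysis.Analysis" "HOL-Real_Asymp.Real_Asymp" "HOL-Number_Theory.Cong"
begin

text \<open>
  The character value at \<open>\<mu>\<close> modulo \<open>p\<close> does not change when \<open>p\<close> equal parts \<open>m\<close> of \<open>\<mu>\<close> are merged
  into one part \<open>pm\<close>, because the power sums satisfy \<open>p\<^sub>m\<^sup>p \<equiv> p\<^sub>p\<^sub>m\<close>. If the parts \<open>m\<^sub>0 p\<^sup>j\<close> of \<open>\<mu>\<close>
  have total size at least \<open>t = m\<^sub>0 p\<^sup>k\<close>, they can be merged until a part \<open>t\<close> appears, and then the
  Murnaghan--Nakayama rule makes the value divisible by \<open>p\<close> for every \<open>t\<close>-core \<open>\<lambda>\<close>.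
  With \<open>s = \<pi>/\<surd>(6N)\<close> and \<open>st\<close> slightly larger than \<open>(log N)/2\<close>, almost every partition is a \<open>t\<close>-core,
  since there are at most \<open>t \<Sum>\<^sub>j p(N - jt)\<close> others. On the other hand almost every \<open>\<mu>\<close> has such a block for
  some \<open>m\<^sub>0\<close> in a short interval: in the Boltzmann model the blocks are independent, and although a
  single one succeeds with probability only about \<open>e\<^bsup>-st\<^esup> (st)\<^sup>J/J!\<close>, there are more than enough of
  them. The growth \<open>p(n) \<asymp> e\<^bsup>\<pi>\<surd>(2n/3)\<^esup>/n\<close> is obtained by Erdos' elementary method, and the characters
  are identified with coefficients of \<open>a\<^sub>\<delta> \<Prod> p\<^bsub>\<mu>\<^sub>i\<^esub>\<close> by Frobenius' formula.
\<close>

section \<open>Characters as traces of projections\<close>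

text \<open>The characters are given as traces on left ideals, so Frobenius' formula is derived from
  Young symmetrizers; two opposite triangularities with respect to dominance pin the characters
  down. The analytic obstacle is to beat two losses at once. With l = log N and L = st, the
  non-cores have proportion about t e^{-L}, roughly l e^{l/2 - L}, so L must exceed l/2; the choice
  L = l/2 + l/(8p) leaves l N^{-1/(8p)}. On the other side there are about N^{1/2} p^{-J} admissible
  m0, up to powers of l, and each block succeeds with probability about e^{-L} L^J/J!. Taking J near
  L/(3p) makes L^J/J! at least (3p)^J: the factor p^J makes up for the loss in the number of m0, and
  3^J, at least about e^{l/(6p)}, beats the excess e^{l/(8p)} by e^{l/(24p)}. Since p is at most
  l/(log l)^2, this exceeds every power of l. The same bound absorbs the stray factor l above, and
  1/8 - 1/24 = 1/12 gives the exponent. Passing from Boltzmann weights to partitions of N costs only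
  a factor N, because p(N) has order e^{2sN}/N.\<close>

lemma sym_group_id [simp]: "id \<in> sym_group N"
  by (simp add: sym_group_def permutes_id)

lemma sym_group_comp [intro]: "\<sigma> \<in> sym_group N \<Longrightarrow> \<tau> \<in> sym_group N \<Longrightarrow> \<sigma> \<circ> \<tau> \<in> sym_group N"
  by (simp add: sym_group_def permutes_compose)

lemma sym_group_inv [intro]: "\<sigma> \<in> sym_group N \<Longrightarrow> inv \<sigma> \<in> sym_group N"
  by (simp add: sym_group_def permutes_inv)

lemma finite_sym_group [simp]: "finite (sym_group N)"
  by (simp add: sym_group_def finite_permutations)

lemma sym_group_bij: "\<sigma> \<in> sym_group N \<Longrightarrow> bij \<sigma>"
  by (simp add: sym_group_def permutes_bij)

lemma sym_group_lt: "\<sigma> \<in> sym_group N \<Longrightarrow> \<sigma> x < N \<longleftrightarrow> x < N"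
  using permutes_in_image[of \<sigma> "{..<N}" x] by (simp add: sym_group_def)

lemma sym_group_inv_simps:
  assumes "\<sigma> \<in> sym_group N"
  shows "inv \<sigma> \<circ> \<sigma> = id" "\<sigma> \<circ> inv \<sigma> = id" "inv (inv \<sigma>) = \<sigma>"
    "inv \<sigma> (\<sigma> x) = x" "\<sigma> (inv \<sigma> x) = x"
  using assms permutes_inverses[of \<sigma> "{..<N}"]
  by (auto simp: sym_group_def permutes_inv_o permutes_inv_inv)

lemma sym_group_inv_comp:
  "\<sigma> \<in> sym_group N \<Longrightarrow> \<tau> \<in> sym_group N \<Longrightarrow> inv (\<sigma> \<circ> \<tau>) = inv \<tau> \<circ> inv \<sigma>"
  by (simp add: o_inv_distrib sym_group_bij)

lemma sum_sym_inv: "(\<Sum>\<tau>\<in>sym_group N. f (inv \<tau>)) = (\<Sum>\<tau>\<in>sym_group N. f \<tau>)"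
  by (rule sum.reindex_bij_witness[where i=inv and j=inv])
     (auto simp: sym_group_inv_simps)

lemma sum_sym_left:
  assumes "\<sigma> \<in> sym_group N"
  shows "(\<Sum>\<tau>\<in>sym_group N. f (\<sigma> \<circ> \<tau>)) = (\<Sum>\<tau>\<in>sym_group N. f \<tau>)"
  using assms
  by (intro sum.reindex_bij_witness[where i="\<lambda>\<tau>. inv \<sigma> \<circ> \<tau>" and j="\<lambda>\<tau>. \<sigma> \<circ> \<tau>"])
     (auto simp: sym_group_inv_simps o_assoc)

lemma conv_assoc: "conv N (conv N f g) h = conv N f (conv N g h)"
proof
  fix \<sigma>
  have "conv N (conv N f g) h \<sigma>
      = (\<Sum>\<rho>\<in>sym_group N. f \<rho> * (\<Sum>\<tau>\<in>sym_group N. g (inv \<rho> \<circ> \<tau>) * h (inv \<tau> \<circ> \<sigma>)))"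
    unfolding conv_def sum_distrib_right sum_distrib_left
    by (subst sum.swap) (simp add: mult.assoc)
  also have "\<dots> = (\<Sum>\<rho>\<in>sym_group N. f \<rho> * (\<Sum>\<tau>\<in>sym_group N. g \<tau> * h (inv \<tau> \<circ> (inv \<rho> \<circ> \<sigma>))))"
  proof (rule sum.cong[OF refl])
    fix \<rho> assume r: "\<rho> \<in> sym_group N"
    have "(\<Sum>\<tau>\<in>sym_group N. g (inv \<rho> \<circ> \<tau>) * h (inv \<tau> \<circ> \<sigma>))
        = (\<Sum>\<tau>\<in>sym_group N. g (inv \<rho> \<circ> (\<rho> \<circ> \<tau>)) * h (inv (\<rho> \<circ> \<tau>) \<circ> \<sigma>))"
      using sum_sym_left[OF r, of "\<lambda>\<tau>. g (inv \<rho> \<circ> \<tau>) * h (inv \<tau> \<circ> \<sigma>)"] by simp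
    also have "\<dots> = (\<Sum>\<tau>\<in>sym_group N. g \<tau> * h (inv \<tau> \<circ> (inv \<rho> \<circ> \<sigma>)))"
    proof (intro sum.cong refl)
      fix \<tau> assume "\<tau> \<in> sym_group N"
      moreover have "inv \<rho> \<circ> (\<rho> \<circ> \<tau>) = \<tau>" by (simp add: o_assoc sym_group_inv_simps[OF r])
      ultimately show "g (inv \<rho> \<circ> (\<rho> \<circ> \<tau>)) * h (inv (\<rho> \<circ> \<tau>) \<circ> \<sigma>) = g \<tau> * h (inv \<tau> \<circ> (inv \<rho> \<circ> \<sigma>))"
        by (simp add: sym_group_inv_comp[OF r] o_assoc)
    qed
    finally show "f \<rho> * (\<Sum>\<tau>\<in>sym_group N. g (inv \<rho> \<circ> \<tau>) * h (inv \<tau> \<circ> \<sigma>))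
        = f \<rho> * (\<Sum>\<tau>\<in>sym_group N. g \<tau> * h (inv \<tau> \<circ> (inv \<rho> \<circ> \<sigma>)))" by simp
  qed
  also have "\<dots> = conv N f (conv N g h) \<sigma>" by (simp add: conv_def)
  finally show "conv N (conv N f g) h \<sigma> = conv N f (conv N g h) \<sigma>" .
qed

lemma conv_group_elem_left:
  assumes "\<sigma> \<in> sym_group N"
  shows "conv N (group_elem \<sigma>) g = (\<lambda>\<rho>. g (inv \<sigma> \<circ> \<rho>))"
proof
  fix \<rho>
  have "conv N (group_elem \<sigma>) g \<rho> = (\<Sum>\<tau>\<in>sym_group N. if \<tau> = \<sigma> then g (inv \<tau> \<circ> \<rho>) else 0)"
    unfolding conv_def group_elem_def by (intro sum.cong) auto
  thus "conv N (group_elem \<sigma>) g \<rho> = g (inv \<sigma> \<circ> \<rho>)" using assms by simp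
qed

lemma comp_eq_iff:
  assumes "s \<in> sym_group N"
  shows "inv s \<circ> \<rho> = t \<longleftrightarrow> \<rho> = s \<circ> t"
proof
  assume "inv s \<circ> \<rho> = t"
  hence "s \<circ> (inv s \<circ> \<rho>) = s \<circ> t" by simp
  thus "\<rho> = s \<circ> t" by (simp add: o_assoc sym_group_inv_simps[OF assms])
qed (simp add: o_assoc sym_group_inv_simps[OF assms])

lemma sym_group_comp_iff:
  assumes "s \<in> sym_group N"
  shows "s \<circ> \<rho> \<in> sym_group N \<longleftrightarrow> \<rho> \<in> sym_group N"
proof
  assume "s \<circ> \<rho> \<in> sym_group N"
  hence "inv s \<circ> (s \<circ> \<rho>) \<in> sym_group N" using assms by blast
  thus "\<rho> \<in> sym_group N" by (simp add: o_assoc sym_group_inv_simps[OF assms])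
qed (use assms in blast)

lemma conv_group_elem_right:
  assumes "\<sigma> \<in> sym_group N" "f \<in> group_algebra N"
  shows "conv N f (group_elem \<sigma>) = (\<lambda>\<rho>. f (\<rho> \<circ> inv \<sigma>))"
proof
  fix \<rho>
  have *: "inv \<tau> \<circ> \<rho> = \<sigma> \<longleftrightarrow> \<tau> = \<rho> \<circ> inv \<sigma>" if "\<tau> \<in> sym_group N" for \<tau>
  proof -
    have "\<rho> = \<tau> \<circ> \<sigma> \<longleftrightarrow> \<tau> = \<rho> \<circ> inv \<sigma>"
      using sym_group_inv_simps[OF assms(1)] by (auto simp flip: o_assoc)
    thus ?thesis using comp_eq_iff[OF that, of \<rho> \<sigma>] by blast
  qed
  have "conv N f (group_elem \<sigma>) \<rho> = (\<Sum>\<tau>\<in>sym_group N. if \<tau> = \<rho> \<circ> inv \<sigma> then f \<tau> else 0)"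
    unfolding conv_def group_elem_def by (intro sum.cong) (auto simp: *)
  also have "\<dots> = f (\<rho> \<circ> inv \<sigma>)" using assms(2) by (auto simp: group_algebra_def)
  finally show "conv N f (group_elem \<sigma>) \<rho> = f (\<rho> \<circ> inv \<sigma>)" .
qed

lemma conv_in [intro]: "g \<in> group_algebra N \<Longrightarrow> conv N f g \<in> group_algebra N"
  unfolding group_algebra_def conv_def
  by (auto intro!: sum.neutral simp: sym_group_comp_iff[OF sym_group_inv])

lemma group_elem_mult:
  "s \<in> sym_group N \<Longrightarrow> conv N (group_elem s) (group_elem t) = group_elem (s \<circ> t)"
  by (subst conv_group_elem_left) (auto simp: group_elem_def comp_eq_iff)

lemma conv_id_commute: "conv N f g id = conv N g f id"
  unfolding conv_def using sum_sym_inv[of "\<lambda>\<tau>. f \<tau> * g (inv \<tau> \<circ> id)" N]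
  by (simp add: sym_group_inv_simps mult.commute)

lemma conv_scale_left: "conv N (\<lambda>\<sigma>. c * f \<sigma>) g = (\<lambda>\<sigma>. c * conv N f g \<sigma>)"
  by (auto simp: conv_def sum_distrib_left mult.assoc)

lemma conv_scale_right: "conv N f (\<lambda>\<sigma>. c * g \<sigma>) = (\<lambda>\<sigma>. c * conv N f g \<sigma>)"
  by (auto simp: conv_def sum_distrib_left intro!: sum.cong)

lemma conv_sum_right: "conv N f (\<lambda>\<rho>. \<Sum>i\<in>I. g i \<rho>) = (\<lambda>\<sigma>. \<Sum>i\<in>I. conv N f (g i) \<sigma>)"
  unfolding conv_def sum_distrib_left by (subst sum.swap) simp

lemma conv_sum_left: "conv N (\<lambda>\<rho>. \<Sum>i\<in>I. g i \<rho>) f = (\<lambda>\<sigma>. \<Sum>i\<in>I. conv N (g i) f \<sigma>)"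
  unfolding conv_def sum_distrib_right by (subst sum.swap) simp

lemma group_algebra_expand:
  assumes "f \<in> group_algebra N"
  shows "f = (\<lambda>\<rho>. \<Sum>\<sigma>\<in>sym_group N. f \<sigma> * group_elem \<sigma> \<rho>)"
proof
  fix \<rho>
  have "(\<Sum>\<sigma>\<in>sym_group N. f \<sigma> * group_elem \<sigma> \<rho>) = (\<Sum>\<sigma>\<in>sym_group N. if \<sigma> = \<rho> then f \<sigma> else 0)"
    by (intro sum.cong) (auto simp: group_elem_def)
  thus "f \<rho> = (\<Sum>\<sigma>\<in>sym_group N. f \<sigma> * group_elem \<sigma> \<rho>)" using assms by (auto simp: group_algebra_def)
qed

section \<open>Stabilisers of colourings and their symmetrizers\<close>

definition stab :: "nat \<Rightarrow> (nat \<Rightarrow> 'c) \<Rightarrow> (nat \<Rightarrow> nat) set" where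
  "stab N f = {\<pi> \<in> sym_group N. \<forall>x<N. f (\<pi> x) = f x}"

text \<open>Colourings \<open>f\<close> serve three purposes: the row index and the column index of
  a tableau, and the colourings counted by permutation characters. The symmetrizers are left
  unnormalised, so they are idempotent only up to the factor \<open>card (stab N f)\<close>.\<close>

definition symz :: "nat \<Rightarrow> (nat \<Rightarrow> 'c) \<Rightarrow> (nat \<Rightarrow> nat) \<Rightarrow> complex" where
  "symz N f = (\<lambda>\<sigma>. if \<sigma> \<in> stab N f then 1 else 0)"

definition asymz :: "nat \<Rightarrow> (nat \<Rightarrow> 'c) \<Rightarrow> (nat \<Rightarrow> nat) \<Rightarrow> complex" where
  "asymz N f = (\<lambda>\<sigma>. if \<sigma> \<in> stab N f then of_int (sign \<sigma>) else 0)"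

lemma stab_sub: "\<sigma> \<in> stab N f \<Longrightarrow> \<sigma> \<in> sym_group N"
  by (simp add: stab_def)

lemma stab_id [simp]: "id \<in> stab N f"
  by (simp add: stab_def)

lemma stab_comp [intro]: "\<sigma> \<in> stab N f \<Longrightarrow> \<tau> \<in> stab N f \<Longrightarrow> \<sigma> \<circ> \<tau> \<in> stab N f"
  by (auto simp: stab_def sym_group_lt)

lemma stab_inv [intro]:
  assumes "\<sigma> \<in> stab N f" shows "inv \<sigma> \<in> stab N f"
proof -
  have s: "\<sigma> \<in> sym_group N" using assms by (rule stab_sub)
  have "f (inv \<sigma> x) = f x" if "x < N" for x
  proof -
    have "inv \<sigma> x < N" using that sym_group_lt[OF sym_group_inv[OF s]] by simp
    hence "f (\<sigma> (inv \<sigma> x)) = f (inv \<sigma> x)" using assms by (simp add: stab_def)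
    thus ?thesis by (simp add: sym_group_inv_simps[OF s])
  qed
  thus ?thesis using s by (auto simp: stab_def)
qed

lemma stab_comp_iff:
  assumes "s \<in> stab N f"
  shows "s \<circ> \<rho> \<in> stab N f \<longleftrightarrow> \<rho> \<in> stab N f" "\<rho> \<circ> s \<in> stab N f \<longleftrightarrow> \<rho> \<in> stab N f"
proof -
  note g = sym_group_inv_simps[OF stab_sub[OF assms]]
  show "s \<circ> \<rho> \<in> stab N f \<longleftrightarrow> \<rho> \<in> stab N f"
  proof
    assume "s \<circ> \<rho> \<in> stab N f"
    hence "inv s \<circ> (s \<circ> \<rho>) \<in> stab N f" using assms by blast
    thus "\<rho> \<in> stab N f" by (simp add: o_assoc g)
  qed (use assms in blast)
  show "\<rho> \<circ> s \<in> stab N f \<longleftrightarrow> \<rho> \<in> stab N f"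
  proof
    assume "\<rho> \<circ> s \<in> stab N f"
    hence "(\<rho> \<circ> s) \<circ> inv s \<in> stab N f" using assms by blast
    thus "\<rho> \<in> stab N f" by (simp add: g flip: o_assoc)
  qed (use assms in blast)
qed

lemma finite_stab [simp]: "finite (stab N f)"
  by (rule finite_subset[of _ "sym_group N"]) (auto simp: stab_def)

lemma card_stab_pos: "card (stab N f) > 0"
  using stab_id[of N f] finite_stab[of N f] by (metis card_gt_0_iff empty_iff)

lemma symz_in [intro]: "symz N f \<in> group_algebra N"
  by (auto simp: symz_def group_algebra_def stab_def)

lemma asymz_in [intro]: "asymz N f \<in> group_algebra N"
  by (auto simp: asymz_def group_algebra_def stab_def)

lemma symz_left: "s \<in> stab N f \<Longrightarrow> conv N (group_elem s) (symz N f) = symz N f"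
  by (subst conv_group_elem_left) (auto simp: symz_def fun_eq_iff stab_comp_iff[OF stab_inv] stab_sub)

lemma sign_sym_comp: "s \<in> sym_group N \<Longrightarrow> t \<in> sym_group N \<Longrightarrow> sign (s \<circ> t) = sign s * sign t"
  by (rule sign_compose) (auto simp: sym_group_def permutation_permutes)

lemma sign_sym_inv: "s \<in> sym_group N \<Longrightarrow> sign (inv s) = sign s"
  by (rule sign_inverse) (auto simp: sym_group_def permutation_permutes)

lemma asymz_right:
  assumes "s \<in> stab N f"
  shows "conv N (asymz N f) (group_elem s) = (\<lambda>\<rho>. of_int (sign s) * asymz N f \<rho>)"
proof -
  have s: "s \<in> sym_group N" using assms by (rule stab_sub)
  show ?thesis
    by (subst conv_group_elem_right[OF s asymz_in])
       (auto simp: asymz_def fun_eq_iff stab_comp_iff[OF stab_inv[OF assms]] s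
         sign_sym_comp[OF stab_sub sym_group_inv[OF s]] sign_sym_inv[OF s])
qed

lemma symz_symz: "conv N (symz N f) (symz N f) = (\<lambda>\<rho>. of_nat (card (stab N f)) * symz N f \<rho>)"
proof
  fix \<rho>
  have "conv N (symz N f) (symz N f) \<rho> = (\<Sum>\<tau>\<in>stab N f. symz N f (inv \<tau> \<circ> \<rho>))"
    unfolding conv_def by (intro sum.mono_neutral_cong_right) (auto simp: symz_def stab_sub)
  also have "\<dots> = (\<Sum>\<tau>\<in>stab N f. symz N f \<rho>)"
    by (intro sum.cong refl) (auto simp: symz_def stab_comp_iff[OF stab_inv])
  finally show "conv N (symz N f) (symz N f) \<rho> = of_nat (card (stab N f)) * symz N f \<rho>" by simp
qed

lemma asymz_asymz: "conv N (asymz N f) (asymz N f) = (\<lambda>\<rho>. of_nat (card (stab N f)) * asymz N f \<rho>)"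
proof
  fix \<rho>
  have "conv N (asymz N f) (asymz N f) \<rho>
      = (\<Sum>\<tau>\<in>stab N f. of_int (sign \<tau>) * asymz N f (inv \<tau> \<circ> \<rho>))"
    unfolding conv_def by (intro sum.mono_neutral_cong_right) (auto simp: asymz_def stab_sub)
  also have "\<dots> = (\<Sum>\<tau>\<in>stab N f. asymz N f \<rho>)"
  proof (intro sum.cong refl)
    fix \<tau> assume t: "\<tau> \<in> stab N f"
    have "sign (inv \<tau> \<circ> \<rho>) = sign \<tau> * sign \<rho>" if "\<rho> \<in> stab N f"
      using sign_sym_comp[OF sym_group_inv[OF stab_sub[OF t]] stab_sub[OF that]] sign_sym_inv[OF stab_sub[OF t]]
      by simp
    moreover have "complex_of_int (sign \<tau>) * of_int (sign \<tau>) = 1"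
      by (simp add: sign_def)
    ultimately show "of_int (sign \<tau>) * asymz N f (inv \<tau> \<circ> \<rho>) = asymz N f \<rho>"
      using stab_comp_iff(1)[OF stab_inv[OF t]] by (auto simp: asymz_def simp flip: mult.assoc)
  qed
  finally show "conv N (asymz N f) (asymz N f) \<rho> = of_nat (card (stab N f)) * asymz N f \<rho>" by simp
qed

text \<open>A transposition of two elements with equal colour and equal image column fixes the
  symmetrizer and negates the antisymmetrizer.\<close>

lemma asymz_conv_symz_eq_0:
  assumes s: "\<sigma> \<in> sym_group N" and uv: "u < N" "v < N" "u \<noteq> v"
    and f: "f u = f v" and g: "g (\<sigma> u) = g (\<sigma> v)"
  shows "conv N (asymz N g) (conv N (group_elem \<sigma>) (symz N f)) = (\<lambda>_. 0)"
proof -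
  define t where "t = Transposition.transpose u v"
  define t' where "t' = Transposition.transpose (\<sigma> u) (\<sigma> v)"
  define X where "X = conv N (asymz N g) (conv N (group_elem \<sigma>) (symz N f))"
  have "t \<in> sym_group N" "t' \<in> sym_group N"
    using uv by (auto simp: t_def t'_def sym_group_def sym_group_lt[OF s] intro!: permutes_swap_id)
  hence t: "t \<in> stab N f" and t': "t' \<in> stab N g"
    using f g by (auto simp: stab_def t_def t'_def Transposition.transpose_def)
  have ne: "\<sigma> u \<noteq> \<sigma> v" using uv sym_group_bij[OF s] by (auto simp: bij_def inj_eq)
  have comm: "\<sigma> \<circ> t = t' \<circ> \<sigma>"
    using sym_group_bij[OF s] by (auto simp: t_def t'_def Transposition.transpose_def bij_def inj_eq fun_eq_iff)
  have "X = conv N (asymz N g) (conv N (group_elem \<sigma>) (conv N (group_elem t) (symz N f)))"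
    by (simp add: X_def symz_left[OF t])
  also have "\<dots> = conv N (asymz N g) (conv N (group_elem (t' \<circ> \<sigma>)) (symz N f))"
    by (simp add: conv_assoc[symmetric] group_elem_mult[OF s] comm)
  also have "\<dots> = conv N (conv N (asymz N g) (group_elem t')) (conv N (group_elem \<sigma>) (symz N f))"
    by (simp add: conv_assoc group_elem_mult[OF stab_sub[OF t'], symmetric])
  also have "\<dots> = (\<lambda>\<rho>. - X \<rho>)"
  proof -
    have "sign t' = - 1" using ne by (simp add: t'_def sign_swap_id)
    thus ?thesis using conv_scale_left[of N "-1" "asymz N g"]
      by (simp add: asymz_right[OF t'] X_def)
  qed
  finally have *: "X = (\<lambda>\<rho>. - X \<rho>)" .
  have "X \<rho> = 0" for \<rho>
  proof -
    have "X \<rho> + X \<rho> = 0" using fun_cong[OF *, of \<rho>] by (metis add.right_inverse)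
    thus ?thesis by (simp flip: mult_2)
  qed
  hence "X = (\<lambda>_. 0)" by (intro ext)
  thus ?thesis by (simp only: X_def)
qed

lemma sum_fun_apply: "(\<Sum>b\<in>B. F b) x = (\<Sum>b\<in>B. F b x)" for F :: "'b \<Rightarrow> 'a \<Rightarrow> complex"
  by (induction B rule: infinite_finite_induct) auto

text \<open>\<open>E x\<close> is the image of the unit vector at \<open>x\<close> under a projection onto \<open>V\<close>.\<close>

lemma trace_on_projection:
  fixes V :: "('a \<Rightarrow> complex) set"
  assumes fin: "finite S" and sub: "fun_space.subspace V"
    and supp: "\<And>v x. v \<in> V \<Longrightarrow> x \<notin> S \<Longrightarrow> v x = 0"
    and E: "\<And>x. x \<in> S \<Longrightarrow> E x \<in> V" "\<And>v. v \<in> V \<Longrightarrow> v = (\<lambda>y. \<Sum>x\<in>S. v x * E x y)"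
    and T: "\<And>v. v \<in> V \<Longrightarrow> T v \<in> V"
    and T_scale: "\<And>c v. T (\<lambda>y. c * v y) = (\<lambda>y. c * T v y)"
    and T_sum: "\<And>(I :: ('a \<Rightarrow> complex) set) F. finite I \<Longrightarrow> T (\<lambda>y. \<Sum>i\<in>I. F i y) = (\<lambda>y. \<Sum>i\<in>I. T (F i) y)"
  shows "trace_on V T = (\<Sum>x\<in>S. T (E x) x)"
proof -
  define B where "B = (SOME B. fun_space.independent B \<and> fun_space.span B = V)"
  have "\<exists>B. fun_space.independent B \<and> fun_space.span B = V"
  proof -
    obtain B where "B \<subseteq> V" "fun_space.independent B" "V \<subseteq> fun_space.span B"
      using fun_space.maximal_independent_subset[of V] by metis
    thus ?thesis using fun_space.span_minimal[OF \<open>B \<subseteq> V\<close> sub] by blast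
  qed
  hence B: "fun_space.independent B" "fun_space.span B = V"
    using someI_ex[of "\<lambda>B. fun_space.independent B \<and> fun_space.span B = V"] unfolding B_def by blast+
  define u where "u = (\<lambda>x y :: 'a. if y = x then 1 else (0::complex))"
  have sumapp: "(\<Sum>x\<in>S. (\<lambda>y. F x y)) = (\<lambda>y. \<Sum>x\<in>S. F x y)" for F :: "'a \<Rightarrow> 'a \<Rightarrow> complex"
    by (rule ext) (simp add: sum_fun_apply)
  have "B \<subseteq> fun_space.span (u ` S)"
  proof
    fix b assume "b \<in> B"
    have "b \<in> V" using \<open>b \<in> B\<close> B fun_space.span_base by blast
    have "b = (\<Sum>x\<in>S. (\<lambda>y. b x * u x y))"
    proof (unfold sumapp, intro ext)
      fix y
      have "(\<Sum>x\<in>S. b x * u x y) = (\<Sum>x\<in>S. if x = y then b x else 0)"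
        by (rule sum.cong) (auto simp: u_def)
      thus "b y = (\<Sum>x\<in>S. b x * u x y)" using supp[OF \<open>b \<in> V\<close>, of y] fin by auto
    qed
    also have "\<dots> \<in> fun_space.span (u ` S)"
      by (intro fun_space.span_sum fun_space.span_scale fun_space.span_base) auto
    finally show "b \<in> fun_space.span (u ` S)" .
  qed
  hence finB: "finite B" using fun_space.independent_span_bound[OF _ B(1)] fin by blast
  define r where "r = fun_space.representation B"
  have exp: "v = (\<lambda>y. \<Sum>b\<in>B. r v b * b y)" if "v \<in> V" for v
    using fun_space.sum_representation_eq[OF B(1) _ finB order_refl, of v] that B(2)
    unfolding r_def by (auto simp: fun_eq_iff sum_fun_apply)
  have rsum: "r v b = (\<Sum>x\<in>S. v x * r (E x) b)" if "v \<in> V" "b \<in> B" for v b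
  proof -
    have "r v b = r (\<Sum>x\<in>S. (\<lambda>y. v x * E x y)) b"
      using E(2)[OF that(1)] unfolding sumapp by simp
    also have "\<dots> = (\<Sum>x\<in>S. r (\<lambda>y. v x * E x y) b)"
      unfolding r_def using B fun_space.subspace_scale[OF sub E(1)]
      by (subst fun_space.representation_sum) auto
    also have "\<dots> = (\<Sum>x\<in>S. v x * r (E x) b)"
      unfolding r_def using B E(1) by (intro sum.cong refl) (simp add: fun_space.representation_scale)
    finally show ?thesis .
  qed
  have BV: "b \<in> V" if "b \<in> B" for b using that B fun_space.span_base by blast
  have "trace_on V T = (\<Sum>b\<in>B. r (T b) b)"
    by (simp add: trace_on_def B_def r_def Let_def)
  also have "\<dots> = (\<Sum>b\<in>B. \<Sum>x\<in>S. T b x * r (E x) b)"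
    by (intro sum.cong refl rsum T BV)
  \<comment> \<open>Cyclicity of the trace in coordinates: for fixed x the inner sum is
    \<open>T\<close> applied to the expansion of \<open>E x\<close> in the basis, evaluated at x, so
    the basis disappears.\<close>
  also have "\<dots> = (\<Sum>x\<in>S. \<Sum>b\<in>B. r (E x) b * T b x)"
    by (subst sum.swap) (simp add: mult.commute)
  also have "\<dots> = (\<Sum>x\<in>S. T (E x) x)"
  proof (intro sum.cong refl)
    fix x assume "x \<in> S"
    have "T (E x) = T (\<lambda>y. \<Sum>b\<in>B. r (E x) b * b y)" using exp[OF E(1)[OF \<open>x \<in> S\<close>]] by simp
    thus "(\<Sum>b\<in>B. r (E x) b * T b x) = T (E x) x"
      using T_sum[OF finB, of "\<lambda>b y. r (E x) b * b y"] by (simp add: T_scale)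
  qed
  finally show ?thesis .
qed

section \<open>Tableaux: row and column groups as stabilisers\<close>

lemma canonical_tableau_bij:
  "bij_betw (canonical_tableau la) (young_diagram la) {..<sum_list la}"
proof (induction la)
  case Nil
  show ?case by (simp add: young_diagram_def bij_betw_def)
next
  case (Cons a la)
  let ?T = "canonical_tableau (a # la)"
  have D: "young_diagram (a # la) = Pair 0 ` {..<a} \<union> (\<lambda>(i, j). (Suc i, j)) ` young_diagram la"
  proof (intro equalityI subsetI)
    fix x assume "x \<in> young_diagram (a # la)"
    then obtain i j where x: "x = (i, j)" "i < length (a # la)" "j < (a # la) ! i"
      by (auto simp: young_diagram_def)
    show "x \<in> Pair 0 ` {..<a} \<union> (\<lambda>(i, j). (Suc i, j)) ` young_diagram la"
    proof (cases i)
      case 0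
      thus ?thesis using x by auto
    next
      case (Suc i')
      hence "(i', j) \<in> young_diagram la" using x by (auto simp: young_diagram_def)
      thus ?thesis using x Suc by (intro UnI2 image_eqI[of _ _ "(i', j)"]) auto
    qed
  qed (auto simp: young_diagram_def)
  have 1: "bij_betw ?T (Pair 0 ` {..<a}) {..<a}"
    by (rule bij_betw_imageI) (auto simp: canonical_tableau_def inj_on_def image_image)
  have "bij_betw (\<lambda>p. a + canonical_tableau la p) (young_diagram la) ((+) a ` {..<sum_list la})"
    using Cons.IH unfolding bij_betw_def
    by (auto simp: inj_on_def image_image[symmetric])
  moreover have "(+) a ` {..<sum_list la} = {a..<a + sum_list la}"
    using image_add_atLeastLessThan[of a 0 "sum_list la"] by (simp add: lessThan_atLeast0 add.commute)
  moreover have "?T (case p of (i, j) \<Rightarrow> (Suc i, j)) = a + canonical_tableau la p" for p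
    by (auto simp: canonical_tableau_def split: prod.split)
  ultimately have "bij_betw (?T \<circ> (\<lambda>(i, j). (Suc i, j))) (young_diagram la) {a..<a + sum_list la}"
    by (simp add: o_def)
  moreover have "bij_betw (\<lambda>(i, j). (Suc i, j)) (young_diagram la) ((\<lambda>(i, j). (Suc i, j)) ` young_diagram la)"
    by (rule inj_on_imp_bij_betw) (auto simp: inj_on_def)
  ultimately have 2: "bij_betw ?T ((\<lambda>(i, j). (Suc i, j)) ` young_diagram la) {a..<a + sum_list la}"
    using bij_betw_comp_iff by blast
  have "bij_betw ?T (young_diagram (a # la)) ({..<a} \<union> {a..<a + sum_list la})"
    unfolding D by (rule bij_betw_combine[OF 1 2]) auto
  moreover have "{..<a} \<union> {a..<a + sum_list la} = {..<sum_list (a # la)}" by auto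
  ultimately show ?case by simp
qed

definition row_of :: "nat list \<Rightarrow> nat \<Rightarrow> nat" where
  "row_of la x = fst (inv_into (young_diagram la) (canonical_tableau la) x)"

definition col_of :: "nat list \<Rightarrow> nat \<Rightarrow> nat" where
  "col_of la x = snd (inv_into (young_diagram la) (canonical_tableau la) x)"

lemma row_col_tableau:
  assumes "(i, j) \<in> young_diagram la"
  shows "row_of la (canonical_tableau la (i, j)) = i" "col_of la (canonical_tableau la (i, j)) = j"
    "canonical_tableau la (i, j) < sum_list la"
  using assms bij_betw_inv_into_left[OF canonical_tableau_bij assms]
    bij_betwE[OF canonical_tableau_bij, of la]
  by (auto simp: row_of_def col_of_def)

lemma tableau_row_col:
  assumes "x < sum_list la"
  shows "(row_of la x, col_of la x) \<in> young_diagram la"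
    "canonical_tableau la (row_of la x, col_of la x) = x"
proof -
  have "x \<in> {..<sum_list la}" using assms by simp
  thus "(row_of la x, col_of la x) \<in> young_diagram la"
    "canonical_tableau la (row_of la x, col_of la x) = x"
    using bij_betw_inv_into[OF canonical_tableau_bij, of la]
      bij_betw_inv_into_right[OF canonical_tableau_bij, of x la]
    by (auto simp: row_of_def col_of_def bij_betw_def)
qed

lemma row_col_inject:
  "x < sum_list la \<Longrightarrow> y < sum_list la \<Longrightarrow> row_of la x = row_of la y \<Longrightarrow> col_of la x = col_of la y \<Longrightarrow> x = y"
  by (metis tableau_row_col(2))

text \<open>Naming a cell of the same row for the image amounts to preserving the row index, because
  an entry is determined by its two coordinates. Row groups, column groups and colour stabilisers
  then share one theory.\<close>

lemma row_group_eq: "row_group la = stab (sum_list la) (row_of la)"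
proof -
  have "(\<forall>(i, j)\<in>young_diagram la. \<exists>j'. (i, j') \<in> young_diagram la \<and>
     \<pi> (canonical_tableau la (i, j)) = canonical_tableau la (i, j'))
     \<longleftrightarrow> (\<forall>x<sum_list la. row_of la (\<pi> x) = row_of la x)" if "\<pi> \<in> sym_group (sum_list la)" for \<pi>
  proof (intro iffI allI impI ballI)
    fix x assume h: "\<forall>(i, j)\<in>young_diagram la. \<exists>j'. (i, j') \<in> young_diagram la \<and>
     \<pi> (canonical_tableau la (i, j)) = canonical_tableau la (i, j')" and x: "x < sum_list la"
    then obtain j' where "(row_of la x, j') \<in> young_diagram la"
      "\<pi> x = canonical_tableau la (row_of la x, j')"
      using tableau_row_col[OF x] by force
    thus "row_of la (\<pi> x) = row_of la x" using row_col_tableau by simp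
  next
    fix z assume h: "\<forall>x<sum_list la. row_of la (\<pi> x) = row_of la x" and z: "z \<in> young_diagram la"
    obtain i j where ij: "z = (i, j)" by force
    define x where "x = canonical_tableau la (i, j)"
    have x: "x < sum_list la" "row_of la x = i" using row_col_tableau z ij by (auto simp: x_def)
    have "\<pi> x < sum_list la" using that x sym_group_lt by blast
    moreover have r: "row_of la (\<pi> x) = i" using h x by simp
    ultimately have "(i, col_of la (\<pi> x)) \<in> young_diagram la" "\<pi> x = canonical_tableau la (i, col_of la (\<pi> x))"
      using tableau_row_col[of "\<pi> x" la, unfolded r] by simp_all
    thus "case z of (i, j) \<Rightarrow> \<exists>j'. (i, j') \<in> young_diagram la \<and>
     \<pi> (canonical_tableau la (i, j)) = canonical_tableau la (i, j')" unfolding ij x_def prod.case by blast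
  qed
  thus ?thesis unfolding row_group_def stab_def by (intro Collect_cong conj_cong refl)
qed

lemma column_group_eq: "column_group la = stab (sum_list la) (col_of la)"
proof -
  have "(\<forall>(i, j)\<in>young_diagram la. \<exists>i'. (i', j) \<in> young_diagram la \<and>
     \<pi> (canonical_tableau la (i, j)) = canonical_tableau la (i', j))
     \<longleftrightarrow> (\<forall>x<sum_list la. col_of la (\<pi> x) = col_of la x)" if "\<pi> \<in> sym_group (sum_list la)" for \<pi>
  proof (intro iffI allI impI ballI)
    fix x assume h: "\<forall>(i, j)\<in>young_diagram la. \<exists>i'. (i', j) \<in> young_diagram la \<and>
     \<pi> (canonical_tableau la (i, j)) = canonical_tableau la (i', j)" and x: "x < sum_list la"
    then obtain i' where "(i', col_of la x) \<in> young_diagram la"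
      "\<pi> x = canonical_tableau la (i', col_of la x)"
      using tableau_row_col[OF x] by force
    thus "col_of la (\<pi> x) = col_of la x" using row_col_tableau by simp
  next
    fix z assume h: "\<forall>x<sum_list la. col_of la (\<pi> x) = col_of la x" and z: "z \<in> young_diagram la"
    obtain i j where ij: "z = (i, j)" by force
    define x where "x = canonical_tableau la (i, j)"
    have x: "x < sum_list la" "col_of la x = j" using row_col_tableau z ij by (auto simp: x_def)
    have "\<pi> x < sum_list la" using that x sym_group_lt by blast
    moreover have r: "col_of la (\<pi> x) = j" using h x by simp
    ultimately have "(row_of la (\<pi> x), j) \<in> young_diagram la" "\<pi> x = canonical_tableau la (row_of la (\<pi> x), j)"
      using tableau_row_col[of "\<pi> x" la, unfolded r] by simp_all
    thus "case z of (i, j) \<Rightarrow> \<exists>i'. (i', j) \<in> young_diagram la \<and>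
     \<pi> (canonical_tableau la (i, j)) = canonical_tableau la (i', j)" unfolding ij x_def prod.case by blast
  qed
  thus ?thesis unfolding column_group_def stab_def by (intro Collect_cong conj_cong refl)
qed

lemma young_symmetrizer_eq:
  "young_symmetrizer la = conv (sum_list la) (symz (sum_list la) (row_of la)) (asymz (sum_list la) (col_of la))"
  by (simp add: young_symmetrizer_def row_symmetrizer_def column_antisymmetrizer_def
      symz_def asymz_def row_group_eq column_group_eq)

text \<open>The elements of \<open>A\<close> outside \<open>{..<card A}\<close> are as many as the
  missing elements of that segment, and each of them is larger. This minimality is reused for rows
  of tableaux, for permuted staircases and for bead configurations.\<close>

lemma sum_lessThan_card:
  fixes A :: "nat set"
  assumes "finite A"
  shows "\<Sum>{..<card A} \<le> \<Sum>A" and "\<Sum>A \<le> \<Sum>{..<card A} \<Longrightarrow> A = {..<card A}"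
proof -
  let ?k = "card A" and ?L = "{..<card A}"
  have c: "card (A - ?L) = card (?L - A)"
    using card_Diff_subset_Int[of A ?L] card_Diff_subset_Int[of ?L A] assms by (simp add: Int_commute)
  have "\<Sum>(?L - A) \<le> card (?L - A) * (?k - 1)"
    using sum_bounded_above[of "?L - A" "\<lambda>x. x" "?k - 1"] by force
  moreover have "card (A - ?L) * ?k \<le> \<Sum>(A - ?L)"
    using sum_bounded_below[of "A - ?L" ?k "\<lambda>x. x"] by force
  moreover have "\<Sum>A = \<Sum>(A \<inter> ?L) + \<Sum>(A - ?L)"
    using assms by (simp add: sum.Int_Diff[of A _ ?L])
  moreover have "\<Sum>?L = \<Sum>(A \<inter> ?L) + \<Sum>(?L - A)"
    by (simp add: sum.Int_Diff[of ?L _ A] Int_commute)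
  ultimately have *: "\<Sum>?L + card (A - ?L) * ?k \<le> \<Sum>A + card (A - ?L) * (?k - 1)"
    using c by simp
  have "card (A - ?L) * (?k - 1) \<le> card (A - ?L) * ?k" by simp
  with * show "\<Sum>?L \<le> \<Sum>A" by linarith
  assume "\<Sum>A \<le> \<Sum>?L"
  hence "card (A - ?L) * ?k \<le> card (A - ?L) * (?k - 1)" using * by linarith
  hence "card (A - ?L) = 0 \<or> ?k = 0" by auto
  hence "A - ?L = {}" using assms by auto
  thus "A = ?L" using c assms by (metis Diff_eq_empty_iff card_eq_0_iff finite_Diff finite_lessThan subset_antisym)
qed

lemma row_fibre:
  assumes "i < length la"
  shows "bij_betw (col_of la) {x. x < sum_list la \<and> row_of la x = i} {..<la ! i}"
proof (rule bij_betw_imageI)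
  show "inj_on (col_of la) {x. x < sum_list la \<and> row_of la x = i}"
    by (auto simp: inj_on_def intro: row_col_inject)
  show "col_of la ` {x. x < sum_list la \<and> row_of la x = i} = {..<la ! i}"
  proof (intro equalityI subsetI)
    fix j assume "j \<in> {..<la ! i}"
    hence "(i, j) \<in> young_diagram la" using assms by (simp add: young_diagram_def)
    thus "j \<in> col_of la ` {x. x < sum_list la \<and> row_of la x = i}"
      using row_col_tableau[of i j la] by force
  qed (use tableau_row_col(1) in \<open>force simp: young_diagram_def\<close>)
qed

lemma row_of_lt: "x < sum_list la \<Longrightarrow> row_of la x < length la"
  using tableau_row_col(1)[of x la] by (simp add: young_diagram_def)

text \<open>The sum of the column indices is invariant under \<open>\<sigma>\<close>, and each row contributes at least
  \<open>0 + 1 + \<dots> + (\<lambda>\<^sub>i - 1)\<close> as its elements land in distinct columns; so equality holds in every row.\<close>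

lemma young_factorization:
  assumes N: "sum_list la = N" and s: "\<sigma> \<in> sym_group N"
    and sep: "\<And>x y. x < N \<Longrightarrow> y < N \<Longrightarrow> x \<noteq> y \<Longrightarrow> row_of la x = row_of la y \<Longrightarrow> col_of la (\<sigma> x) \<noteq> col_of la (\<sigma> y)"
  shows "\<exists>c\<in>stab N (col_of la). \<exists>r\<in>stab N (row_of la). \<sigma> = c \<circ> r"
proof -
  define X where "X i = {x. x < N \<and> row_of la x = i}" for i
  have finX: "finite (X i)" for i by (simp add: X_def)
  have cardX: "card (X i) = la ! i" if "i < length la" for i
    using bij_betw_same_card[OF row_fibre[OF that]] N by (simp add: X_def)
  have inj: "inj_on (\<lambda>x. col_of la (\<sigma> x)) (X i)" for i
  proof (rule inj_onI, rule ccontr)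
    fix x y assume "x \<in> X i" "y \<in> X i" "col_of la (\<sigma> x) = col_of la (\<sigma> y)" "x \<noteq> y"
    thus False using sep[of x y] by (simp add: X_def)
  qed
  define A where "A i = (\<lambda>x. col_of la (\<sigma> x)) ` X i" for i
  have A: "card (A i) = la ! i" "\<Sum>(A i) = (\<Sum>x\<in>X i. col_of la (\<sigma> x))" if "i < length la" for i
    using card_image[OF inj] cardX[OF that] sum.reindex[OF inj, of "\<lambda>x. x"] by (auto simp: A_def)
  have rows: "(\<Sum>x<N. f x) = (\<Sum>i<length la. \<Sum>x\<in>X i. f x)" for f :: "nat \<Rightarrow> nat"
  proof -
    have "(\<Sum>x<N. f x) = (\<Sum>i<length la. \<Sum>x | x \<in> {..<N} \<and> row_of la x = i. f x)"
      using row_of_lt N by (intro sum.group[symmetric]) auto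
    thus ?thesis by (simp add: X_def)
  qed
  have colX: "(\<Sum>x\<in>X i. col_of la x) = \<Sum>{..<la ! i}" if "i < length la" for i
    using sum.reindex_bij_betw[OF row_fibre[OF that], of "\<lambda>x. x"] N by (simp add: X_def)
  have perm: "(\<Sum>x<N. col_of la (\<sigma> x)) = (\<Sum>x<N. col_of la x)"
    using s by (intro sum.reindex_bij_betw permutes_imp_bij) (simp add: sym_group_def)
  have le: "\<Sum>{..<la ! i} \<le> \<Sum>(A i)" if "i < length la" for i
    using sum_lessThan_card(1)[of "A i"] A[OF that] finX by (simp add: A_def)
  have "(\<Sum>i<length la. \<Sum>(A i)) = (\<Sum>i<length la. \<Sum>{..<la ! i})"
    using perm rows[of "col_of la"] rows[of "\<lambda>x. col_of la (\<sigma> x)"] A(2) colX by simp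
  hence eq: "\<Sum>(A i) = \<Sum>{..<la ! i}" if "i < length la" for i
    using that le sum_mono_inv[of "\<lambda>i. \<Sum>{..<la ! i}" "{..<length la}" "\<lambda>i. \<Sum>(A i)" i] by force
  have Aeq: "A i = {..<la ! i}" if "i < length la" for i
    using sum_lessThan_card(2)[of "A i"] eq[OF that] A[OF that] finX by (simp add: A_def)
  have cell: "(row_of la x, col_of la (\<sigma> x)) \<in> young_diagram la" if "x < N" for x
  proof -
    have i: "row_of la x < length la" using row_of_lt that N by blast
    have "col_of la (\<sigma> x) \<in> A (row_of la x)" using that by (auto simp: A_def X_def)
    thus ?thesis using Aeq[OF i] i by (simp add: young_diagram_def)
  qed
  \<comment> \<open>\<open>\<tau>\<close> keeps the row of x and gives it the column that
    \<open>\<sigma>\<close> reaches; \<open>Aeq\<close> ensures that this cell lies in the diagram.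
    The quotient of \<open>\<sigma>\<close> by \<open>\<tau>\<close> then preserves columns.\<close>
  define \<tau> where "\<tau> x = (if x < N then canonical_tableau la (row_of la x, col_of la (\<sigma> x)) else x)" for x
  have tau: "\<tau> x < N" "row_of la (\<tau> x) = row_of la x" "col_of la (\<tau> x) = col_of la (\<sigma> x)" if "x < N" for x
    using row_col_tableau[OF cell[OF that]] that N by (auto simp: \<tau>_def)
  have "inj_on \<tau> {..<N}"
    using tau sep by (auto simp: inj_on_def) metis
  hence "bij_betw \<tau> {..<N} {..<N}"
    using tau by (intro bij_betw_imageI endo_inj_surj) auto
  hence "\<tau> \<in> sym_group N"
    unfolding sym_group_def mem_Collect_eq by (rule bij_imp_permutes) (simp add: \<tau>_def)
  hence t: "\<tau> \<in> stab N (row_of la)" using tau by (simp add: stab_def)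
  note ti = sym_group_inv_simps[OF stab_sub[OF t]]
  have "col_of la ((\<sigma> \<circ> inv \<tau>) x) = col_of la x" if "x < N" for x
  proof -
    have "inv \<tau> x < N" using that sym_group_lt[OF sym_group_inv[OF stab_sub[OF t]]] by simp
    from tau(3)[OF this] show ?thesis by (simp add: ti)
  qed
  hence "\<sigma> \<circ> inv \<tau> \<in> stab N (col_of la)" using s stab_sub[OF t] by (auto simp: stab_def)
  moreover have "\<sigma> = (\<sigma> \<circ> inv \<tau>) \<circ> \<tau>" by (simp add: ti flip: o_assoc)
  ultimately show ?thesis using t by blast
qed

text \<open>Filling row by row makes the first k rows an initial segment of the entries.\<close>

lemma row_lt_iff:
  assumes "x < sum_list la"
  shows "row_of la x < k \<longleftrightarrow> x < sum_list (take k la)"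
proof -
  define i j where "i = row_of la x" and "j = col_of la x"
  have d: "i < length la" "j < la ! i" and x: "x = sum_list (take i la) + j"
    using tableau_row_col[OF assms] by (auto simp: i_def j_def young_diagram_def canonical_tableau_def)
  have mono: "sum_list (take a la) \<le> sum_list (take b la)" if "a \<le> b" for a b
    using that by (metis le_add1 sum_list_append take_add le_add_diff_inverse)
  have "sum_list (take (Suc i) la) = sum_list (take i la) + la ! i"
    using d by (simp add: take_Suc_conv_app_nth)
  thus ?thesis using mono[of "Suc i" k] mono[of k i] d x
    unfolding i_def[symmetric] by (cases "i < k") (auto simp: not_less)
qed

text \<open>Column by column: elements of one colour land in distinct columns, so column j receives
  at most \<open>card K\<close> elements with colours in \<open>K\<close>, and at most as many as it
  has cells. The smaller of the two numbers is the count of its cells in the first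
  \<open>card K\<close> rows, and these rows hold \<open>sum_list (take (card K) la)\<close>
  cells.\<close>

lemma card_colours_le_dominance:
  assumes la: "la \<in> partitions N" and s: "\<sigma> \<in> sym_group N" and K: "finite K"
    and sep: "\<And>x y. x < N \<Longrightarrow> y < N \<Longrightarrow> x \<noteq> y \<Longrightarrow> f x = f y \<Longrightarrow> col_of la (\<sigma> x) \<noteq> col_of la (\<sigma> y)"
  shows "card {x. x < N \<and> f x \<in> K} \<le> sum_list (take (card K) la)"
proof -
  let ?k = "card K"
  have N: "sum_list la = N" using la by (simp add: partitions_def)
  have col_lt: "col_of la x < N" if "x < N" for x
  proof -
    have "(row_of la x, col_of la x) \<in> young_diagram la" using tableau_row_col that N by auto
    hence "row_of la x < length la" "col_of la x < la ! row_of la x" by (auto simp: young_diagram_def)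
    moreover from this have "la ! row_of la x \<le> sum_list la" by (intro member_le_sum_list) auto
    ultimately show ?thesis using N by simp
  qed
  define X where "X = {x. x < N \<and> f x \<in> K}"
  define Y where "Y = {x. x < N \<and> row_of la x < ?k}"
  have group: "card Z = (\<Sum>j<N. card {x \<in> Z. g x = j})" if "\<And>x. x \<in> Z \<Longrightarrow> g x < N" "finite Z" for Z and g :: "nat \<Rightarrow> nat"
  proof -
    have "sum (\<lambda>_. 1::nat) Z = (\<Sum>j<N. sum (\<lambda>_. 1) {x \<in> Z. g x = j})"
      using that by (intro sum.group[symmetric]) auto
    thus ?thesis by simp
  qed
  have le: "card {x \<in> X. col_of la (\<sigma> x) = j} \<le> card {x \<in> Y. col_of la x = j}" for j
  \<comment> \<open>Either column j ends within the first \<open>card K\<close> rows and its length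
    is the bound, or it reaches below them and has a cell in each of these rows.\<close>
  proof (cases "\<forall>x<N. col_of la x = j \<longrightarrow> row_of la x < ?k")
    case True
    have "inj_on \<sigma> A" for A using sym_group_bij[OF s] by (auto simp: bij_def inj_on_def)
    moreover have "\<sigma> ` {x \<in> X. col_of la (\<sigma> x) = j} \<subseteq> {x \<in> Y. col_of la x = j}"
      using True sym_group_lt[OF s] by (auto simp: X_def Y_def)
    moreover have "finite {x \<in> Y. col_of la x = j}" by (simp add: Y_def)
    ultimately show ?thesis using card_inj_on_le by blast
  next
    case False
    then obtain y where y: "y < N" "col_of la y = j" "?k \<le> row_of la y" by (auto simp: not_less)
    have d: "row_of la y < length la" "j < la ! row_of la y"
      using tableau_row_col(1)[of y la] y N by (auto simp: young_diagram_def)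
    have cells: "(i, j) \<in> young_diagram la" if "i < ?k" for i
    proof -
      have "la ! row_of la y \<le> la ! i"
        using la that y d sorted_wrt_nth_less[of "(\<ge>)" la i "row_of la y"] by (simp add: partitions_def)
      thus ?thesis using d that y by (simp add: young_diagram_def)
    qed
    have "inj_on (\<lambda>i. canonical_tableau la (i, j)) {..<?k}"
      using row_col_tableau(1)[OF cells] by (auto simp: inj_on_def) metis
    moreover have "(\<lambda>i. canonical_tableau la (i, j)) ` {..<?k} \<subseteq> {x \<in> Y. col_of la x = j}"
      using row_col_tableau[OF cells] N by (auto simp: Y_def)
    moreover have "finite {x \<in> Y. col_of la x = j}" by (simp add: Y_def)
    ultimately have "?k \<le> card {x \<in> Y. col_of la x = j}" using card_inj_on_le[of _ "{..<?k}"] by simp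
    moreover have "inj_on f {x \<in> X. col_of la (\<sigma> x) = j}"
    proof (rule inj_onI, rule ccontr)
      fix x y assume "x \<in> {x \<in> X. col_of la (\<sigma> x) = j}" "y \<in> {x \<in> X. col_of la (\<sigma> x) = j}"
        "f x = f y" "x \<noteq> y"
      thus False using sep[of x y] by (simp add: X_def)
    qed
    hence "card {x \<in> X. col_of la (\<sigma> x) = j} \<le> ?k"
      by (rule card_inj_on_le) (use K in \<open>auto simp: X_def\<close>)
    ultimately show ?thesis by linarith
  qed
  have "card X = (\<Sum>j<N. card {x \<in> X. col_of la (\<sigma> x) = j})"
    by (rule group) (auto simp: X_def col_lt sym_group_lt[OF s])
  also have "\<dots> \<le> (\<Sum>j<N. card {x \<in> Y. col_of la x = j})" by (rule sum_mono) (rule le)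
  also have "\<dots> = card Y" by (rule group[symmetric]) (auto simp: Y_def col_lt)
  also have "Y = {..<sum_list (take ?k la)}"
  proof -
    have "sum_list (take ?k la) \<le> N" using N by (metis append_take_drop_id le_add1 sum_list_append)
    thus ?thesis using row_lt_iff[of _ la] N by (auto simp: Y_def)
  qed
  finally show ?thesis by (simp add: X_def)
qed

section \<open>Dominance order and Young symmetrizers\<close>

definition dominated :: "nat list \<Rightarrow> nat list \<Rightarrow> bool" where
  "dominated nu la \<longleftrightarrow> (\<forall>k. sum_list (take k nu) \<le> sum_list (take k la))"

lemma dominated_antisym:
  assumes "nu \<in> partitions N" "la \<in> partitions N" "dominated nu la" "dominated la nu"
  shows "nu = la"
proof -
  have eq: "sum_list (take k nu) = sum_list (take k la)" for k
    using assms by (simp add: dominated_def le_antisym)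
  have pos: "\<And>x. x \<in> set nu \<Longrightarrow> x > 0" "\<And>x. x \<in> set la \<Longrightarrow> x > 0"
    using assms by (auto simp: partitions_def)
  have step: "sum_list (take (Suc k) xs) = sum_list (take k xs) + xs ! k" if "k < length xs" for k and xs :: "nat list"
    using that by (simp add: take_Suc_conv_app_nth)
  have len: "length xs \<le> length ys" if "\<And>k. sum_list (take k xs) = sum_list (take k ys)" "\<And>x. x \<in> set xs \<Longrightarrow> x > 0" for xs ys :: "nat list"
  proof (rule ccontr)
    assume "\<not> ?thesis"
    hence l: "length ys < length xs" by simp
    have "sum_list (take (Suc (length ys)) xs) = sum_list (take (length ys) xs) + xs ! length ys"
      by (rule step[OF l])
    moreover have "xs ! length ys > 0" using that(2) l by simp
    ultimately show False using that(1)[of "length ys"] that(1)[of "Suc (length ys)"] by simp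
  qed
  have l: "length nu = length la" using len[of nu la] len[of la nu] eq pos by (simp add: le_antisym)
  show ?thesis
  proof (rule nth_equalityI[OF l])
    fix i assume "i < length nu"
    thus "nu ! i = la ! i" using step[of i nu] step[of i la] eq[of i] eq[of "Suc i"] l by simp
  qed
qed

abbreviation ysym :: "nat list \<Rightarrow> (nat \<Rightarrow> nat) \<Rightarrow> complex" where
  "ysym la \<equiv> young_symmetrizer la"

lemma partition_sum: "la \<in> partitions N \<Longrightarrow> sum_list la = N"
  by (simp add: partitions_def)

lemma ysym_eq: "la \<in> partitions N \<Longrightarrow> ysym la = conv N (symz N (row_of la)) (asymz N (col_of la))"
  using partition_sum by (auto simp: young_symmetrizer_eq)

lemma ysym_in: "la \<in> partitions N \<Longrightarrow> ysym la \<in> group_algebra N"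
  by (auto simp: ysym_eq)

lemma stab_row_col:
  assumes la: "la \<in> partitions N" and "\<sigma> \<in> stab N (row_of la)" "\<sigma> \<in> stab N (col_of la)"
  shows "\<sigma> = id"
proof
  fix x
  have p: "\<sigma> permutes {..<N}" using assms stab_sub by (auto simp: sym_group_def)
  show "\<sigma> x = id x"
  proof (cases "x < N")
    case True
    thus ?thesis using assms row_col_inject[of "\<sigma> x" la x] partition_sum[OF la] sym_group_lt[OF stab_sub[OF assms(2)]]
      by (auto simp: stab_def)
  next
    case False
    thus ?thesis using p by (simp add: permutes_def)
  qed
qed

text \<open>Row and column group meet only in the identity, so one term survives. This coefficient 1
  is what identifies scalars later: a multiple of the symmetrizer is read off at
  \<open>id\<close>.\<close>

lemma ysym_id:
  assumes la: "la \<in> partitions N"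
  shows "ysym la id = 1"
proof -
  have "ysym la id = (\<Sum>\<tau>\<in>sym_group N. symz N (row_of la) \<tau> * asymz N (col_of la) (inv \<tau>))"
    by (simp add: ysym_eq[OF la] conv_def)
  also have "\<dots> = (\<Sum>\<tau>\<in>sym_group N. if \<tau> = id then 1 else 0)"
  proof (intro sum.cong refl)
    fix \<tau> assume t: "\<tau> \<in> sym_group N"
    have "\<tau> \<in> stab N (col_of la)" if "inv \<tau> \<in> stab N (col_of la)"
      using stab_inv[OF that] sym_group_inv_simps(3)[OF t] by simp
    thus "symz N (row_of la) \<tau> * asymz N (col_of la) (inv \<tau>) = (if \<tau> = id then 1 else 0)"
      using stab_row_col[OF la, of \<tau>] by (auto simp: symz_def asymz_def)
  qed
  finally show ?thesis by simp
qed

text \<open>Dichotomy for \<open>inv \<sigma>\<close>: if it sends distinct elements of a row to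
  distinct columns, it factors as in \<open>young_factorization\<close> and z takes, up to sign, its
  value at \<open>id\<close>. Otherwise two elements of one row end in the same column, and the
  corresponding transpositions, one acting on each side, give z \<sigma> = - z \<sigma>.\<close>

lemma biinvariant_eq_0:
  assumes la: "la \<in> partitions N"
    and L: "\<And>r \<sigma>. r \<in> stab N (row_of la) \<Longrightarrow> \<sigma> \<in> sym_group N \<Longrightarrow> z (r \<circ> \<sigma>) = z \<sigma>"
    and R: "\<And>s \<sigma>. s \<in> stab N (col_of la) \<Longrightarrow> \<sigma> \<in> sym_group N \<Longrightarrow> z (\<sigma> \<circ> s) = of_int (sign s) * z \<sigma>"
    and z0: "z id = (0 :: complex)" and s: "\<sigma> \<in> sym_group N"
  shows "z \<sigma> = 0"
proof -
  note si = sym_group_inv[OF s]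
  show ?thesis
  proof (cases "\<forall>x<N. \<forall>y<N. x \<noteq> y \<longrightarrow> row_of la x = row_of la y \<longrightarrow> col_of la (inv \<sigma> x) \<noteq> col_of la (inv \<sigma> y)")
    case True
    then obtain c r where cr: "c \<in> stab N (col_of la)" "r \<in> stab N (row_of la)" "inv \<sigma> = c \<circ> r"
      using young_factorization[OF partition_sum[OF la] si] by blast
    hence "\<sigma> = inv r \<circ> inv c"
      using sym_group_inv_simps(3)[OF s] sym_group_inv_comp[OF stab_sub stab_sub] by metis
    hence "z \<sigma> = z (id \<circ> inv c)"
      using L[OF stab_inv[OF cr(2)] sym_group_inv[OF stab_sub[OF cr(1)]]] by simp
    also have "\<dots> = 0" using R[OF stab_inv[OF cr(1)], of id] z0 by simp
    finally show ?thesis .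
  next
    case False
    then obtain u v where uv: "u < N" "v < N" "u \<noteq> v" "row_of la u = row_of la v"
      "col_of la (inv \<sigma> u) = col_of la (inv \<sigma> v)" by blast
    define t where "t = Transposition.transpose u v"
    define t' where "t' = Transposition.transpose (inv \<sigma> u) (inv \<sigma> v)"
    have "t \<in> sym_group N" "t' \<in> sym_group N"
      using uv by (auto simp: t_def t'_def sym_group_def sym_group_lt[OF si] intro!: permutes_swap_id)
    hence t: "t \<in> stab N (row_of la)" and t': "t' \<in> stab N (col_of la)"
      using uv by (auto simp: stab_def t_def t'_def Transposition.transpose_def)
    have ne: "inv \<sigma> u \<noteq> inv \<sigma> v" using uv sym_group_bij[OF si] by (auto simp: bij_def inj_eq)
    have "t \<circ> \<sigma> = \<sigma> \<circ> t'"
      using sym_group_inv_simps(4,5)[OF s]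
      by (auto simp: t_def t'_def Transposition.transpose_def fun_eq_iff)
    moreover have "sign t' = - 1" using ne by (simp add: t'_def sign_swap_id)
    ultimately have "z \<sigma> = - z \<sigma>" using L[OF t s] R[OF t' s] by simp
    hence "z \<sigma> + z \<sigma> = 0" by (metis add.right_inverse)
    thus ?thesis by (simp flip: mult_2)
  qed
qed

text \<open>Functions that are row-invariant on the left and column-alternating on the right form a
  line, since such a function is determined by its value at \<open>id\<close>. Subtracting from the
  product a x b the multiple of the symmetrizer with the same value at \<open>id\<close> leaves
  zero.\<close>

lemma conv_row_col_eq:
  assumes la: "la \<in> partitions N"
  defines "a \<equiv> symz N (row_of la)" and "b \<equiv> asymz N (col_of la)"
  shows "conv N a (conv N x b) = (\<lambda>\<rho>. conv N a (conv N x b) id * ysym la \<rho>)"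
proof -
  define inva where "inva z \<longleftrightarrow> (\<forall>r\<in>stab N (row_of la). \<forall>\<sigma>\<in>sym_group N. z (r \<circ> \<sigma>) = z \<sigma>) \<and>
    (\<forall>s\<in>stab N (col_of la). \<forall>\<sigma>\<in>sym_group N. z (\<sigma> \<circ> s) = of_int (sign s) * z \<sigma>)"
    for z :: "(nat \<Rightarrow> nat) \<Rightarrow> complex"
  have inv1: "inva (conv N a (conv N x b))" for x
  proof -
    define y where "y = conv N a (conv N x b)"
    have yin: "y \<in> group_algebra N" by (auto simp: y_def b_def)
    have "y (r \<circ> \<sigma>) = y \<sigma>" if "r \<in> stab N (row_of la)" "\<sigma> \<in> sym_group N" for r \<sigma>
    proof -
      have "conv N (group_elem (inv r)) y = y"
        using symz_left[OF stab_inv[OF that(1)]] by (simp add: y_def a_def conv_assoc[symmetric])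
      thus ?thesis using conv_group_elem_left[OF sym_group_inv[OF stab_sub[OF that(1)]], of y]
          sym_group_inv_simps(3)[OF stab_sub[OF that(1)]] by metis
    qed
    moreover have "y (\<sigma> \<circ> s) = of_int (sign s) * y \<sigma>" if "s \<in> stab N (col_of la)" "\<sigma> \<in> sym_group N" for s \<sigma>
    proof -
      have "conv N y (group_elem (inv s)) = (\<lambda>\<rho>. of_int (sign (inv s)) * y \<rho>)"
        using asymz_right[OF stab_inv[OF that(1)]] by (simp add: y_def b_def conv_assoc conv_scale_right)
      thus ?thesis using conv_group_elem_right[OF sym_group_inv[OF stab_sub[OF that(1)]] yin]
          sym_group_inv_simps(3)[OF stab_sub[OF that(1)]] sign_sym_inv[OF stab_sub[OF that(1)]] by metis
    qed
    ultimately show ?thesis unfolding inva_def y_def by blast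
  qed
  have "conv N (group_elem id) b = b"
    by (subst conv_group_elem_left) auto
  hence inv2: "inva (ysym la)" using inv1[of "group_elem id"] ysym_eq[OF la] by (simp add: a_def b_def)
  define y where "y = conv N a (conv N x b)"
  define z where "z = (\<lambda>\<rho>. y \<rho> - y id * ysym la \<rho>)"
  have invz: "inva z"
  proof (unfold inva_def, intro conjI ballI)
    fix r \<sigma> assume "r \<in> stab N (row_of la)" "\<sigma> \<in> sym_group N"
    hence "y (r \<circ> \<sigma>) = y \<sigma>" "ysym la (r \<circ> \<sigma>) = ysym la \<sigma>"
      using inv1[of x] inv2 unfolding inva_def y_def by blast+
    thus "z (r \<circ> \<sigma>) = z \<sigma>" by (simp only: z_def)
  next
    fix s \<sigma> assume "s \<in> stab N (col_of la)" "\<sigma> \<in> sym_group N"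
    hence "y (\<sigma> \<circ> s) = of_int (sign s) * y \<sigma>" "ysym la (\<sigma> \<circ> s) = of_int (sign s) * ysym la \<sigma>"
      using inv1[of x] inv2 unfolding inva_def y_def by blast+
    thus "z (\<sigma> \<circ> s) = of_int (sign s) * z \<sigma>"
      by (simp only: z_def right_diff_distrib mult.left_commute)
  qed
  have "z id = 0" using ysym_id[OF la] by (simp add: z_def)
  have z0: "z \<sigma> = 0" if "\<sigma> \<in> sym_group N" for \<sigma>
  proof (rule biinvariant_eq_0[OF la _ _ _ that])
    show "z (r \<circ> \<sigma>) = z \<sigma>" if "r \<in> stab N (row_of la)" "\<sigma> \<in> sym_group N" for r \<sigma>
      using invz that unfolding inva_def by blast
    show "z (\<sigma> \<circ> s) = of_int (sign s) * z \<sigma>" if "s \<in> stab N (col_of la)" "\<sigma> \<in> sym_group N" for s \<sigma>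
      using invz that unfolding inva_def by blast
  qed (rule \<open>z id = 0\<close>)
  have "y \<rho> = y id * ysym la \<rho>" for \<rho>
  proof (cases "\<rho> \<in> sym_group N")
    case True
    thus ?thesis using z0[OF True] by (simp only: z_def right_minus_eq)
  next
    case False
    moreover have "y \<in> group_algebra N" by (auto simp: y_def b_def)
    ultimately show ?thesis using ysym_in[OF la] by (auto simp: group_algebra_def)
  qed
  thus ?thesis unfolding y_def by (rule ext)
qed

text \<open>The factor n in c c = n c for the Young symmetrizer c, taken at \<open>id\<close> where
  c has coefficient 1; it equals N! divided by the dimension of the ideal.\<close>

definition ynorm :: "nat list \<Rightarrow> complex" where
  "ynorm la = conv (sum_list la) (ysym la) (ysym la) id"

lemma ysym_ysym:
  assumes la: "la \<in> partitions N"
  shows "conv N (ysym la) (ysym la) = (\<lambda>\<rho>. ynorm la * ysym la \<rho>)"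
  using conv_row_col_eq[OF la, of "conv N (asymz N (col_of la)) (symz N (row_of la))"]
  by (simp add: ynorm_def ysym_eq[OF la] partition_sum[OF la] conv_assoc)

lemma conv_reverse:
  assumes s: "\<sigma> \<in> sym_group N"
  shows "conv N f g (inv \<sigma>) = conv N (\<lambda>\<rho>. g (inv \<rho>)) (\<lambda>\<rho>. f (inv \<rho>)) \<sigma>"
proof -
  have "conv N (\<lambda>\<rho>. g (inv \<rho>)) (\<lambda>\<rho>. f (inv \<rho>)) \<sigma>
      = (\<Sum>\<tau>\<in>sym_group N. g (inv (\<sigma> \<circ> \<tau>)) * f (inv (inv (\<sigma> \<circ> \<tau>) \<circ> \<sigma>)))"
    unfolding conv_def
    using sum_sym_left[OF s, of "\<lambda>\<tau>. g (inv \<tau>) * f (inv (inv \<tau> \<circ> \<sigma>))"] by simp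
  also have "\<dots> = (\<Sum>\<tau>\<in>sym_group N. f \<tau> * g (inv \<tau> \<circ> inv \<sigma>))"
  proof (intro sum.cong refl)
    fix \<tau> assume t: "\<tau> \<in> sym_group N"
    have "inv (\<sigma> \<circ> \<tau>) \<circ> \<sigma> = inv \<tau>"
      using sym_group_inv_simps(1)[OF s] by (simp add: sym_group_inv_comp[OF s t] flip: o_assoc)
    thus "g (inv (\<sigma> \<circ> \<tau>)) * f (inv (inv (\<sigma> \<circ> \<tau>) \<circ> \<sigma>)) = f \<tau> * g (inv \<tau> \<circ> inv \<sigma>)"
      using sym_group_inv_simps(3)[OF t] by (simp add: sym_group_inv_comp[OF s t])
  qed
  finally show ?thesis by (simp add: conv_def)
qed

lemma inv_in_stab_iff:
  assumes "\<sigma> \<in> sym_group N"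
  shows "inv \<sigma> \<in> stab N f \<longleftrightarrow> \<sigma> \<in> stab N f"
  using stab_inv[of \<sigma> N f] stab_inv[of "inv \<sigma>" N f] sym_group_inv_simps(3)[OF assms] by auto

lemma symz_inv: "\<sigma> \<in> sym_group N \<Longrightarrow> symz N f (inv \<sigma>) = symz N f \<sigma>"
  by (simp add: symz_def inv_in_stab_iff)

lemma asymz_inv: "\<sigma> \<in> sym_group N \<Longrightarrow> asymz N f (inv \<sigma>) = asymz N f \<sigma>"
  by (simp add: asymz_def inv_in_stab_iff sign_sym_inv)

lemma conv_cong_sym:
  assumes "\<And>\<tau>. \<tau> \<in> sym_group N \<Longrightarrow> f \<tau> = f' \<tau>" "\<And>\<tau>. \<tau> \<in> sym_group N \<Longrightarrow> g \<tau> = g' \<tau>" "\<sigma> \<in> sym_group N"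
  shows "conv N f g \<sigma> = conv N f' g' \<sigma>"
  unfolding conv_def using assms by (intro sum.cong refl) (auto simp: sym_group_comp)

lemma conv_real:
  assumes "\<And>\<tau>. f \<tau> \<in> \<real>" "\<And>\<tau>. g \<tau> \<in> \<real>"
  shows "conv N f g \<sigma> \<in> \<real>"
  unfolding conv_def using assms by auto

text \<open>Positivity: when g is the transpose under inversion of the real function f, the
  coefficient of f g at \<open>id\<close> is the sum of the squares of f.\<close>

lemma conv_transpose_id_eq_0:
  assumes "\<And>\<tau>. f \<tau> \<in> \<real>" "\<And>\<tau>. \<tau> \<in> sym_group N \<Longrightarrow> g (inv \<tau>) = f \<tau>" "conv N f g id = 0" "\<sigma> \<in> sym_group N"
  shows "f \<sigma> = 0"
proof -
  have "complex_of_real (\<Sum>\<tau>\<in>sym_group N. (Re (f \<tau>))\<^sup>2) = (\<Sum>\<tau>\<in>sym_group N. f \<tau> * f \<tau>)"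
    using assms(1) by (simp add: power2_eq_square)
  also have "\<dots> = conv N f g id" unfolding conv_def using assms(2) by (intro sum.cong) auto
  finally have "(\<Sum>\<tau>\<in>sym_group N. (Re (f \<tau>))\<^sup>2) = 0" using assms(3) by (metis of_real_eq_0_iff)
  hence "Re (f \<sigma>) = 0" using assms(4) by (subst (asm) sum_nonneg_eq_0_iff) auto
  thus ?thesis using assms(1)[of \<sigma>] by (metis of_real_0 of_real_Re)
qed

text \<open>Suppose (ab)(ab) = 0 for the row symmetrizer a and the column antisymmetrizer b. Then w
  = aba is invariant under inversion and w w is a multiple of ababa, so positivity gives w = 0. Next
  (ab)(ba) is a multiple of w, and ba is the transpose of ab, so ab = 0, against its coefficient 1
  at \<open>id\<close>.\<close>

lemma ynorm_nonzero:
  assumes la: "la \<in> partitions N"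
  shows "ynorm la \<noteq> 0"
proof
  assume n0: "ynorm la = 0"
  define a where "a = symz N (row_of la)"
  define b where "b = asymz N (col_of la)"
  have y: "ysym la = conv N a b" by (simp add: a_def b_def ysym_eq[OF la])
  have real: "a \<tau> \<in> \<real>" "b \<tau> \<in> \<real>" for \<tau> by (auto simp: a_def b_def symz_def asymz_def)
  have ai: "a (inv \<tau>) = a \<tau>" and bi: "b (inv \<tau>) = b \<tau>" if "\<tau> \<in> sym_group N" for \<tau>
    using that by (simp_all add: a_def b_def symz_inv asymz_inv)
  have ab: "conv N a b (inv \<tau>) = conv N b a \<tau>" and ba: "conv N b a (inv \<tau>) = conv N a b \<tau>"
    if t: "\<tau> \<in> sym_group N" for \<tau>
    unfolding conv_reverse[OF t] using ai bi by (auto intro!: conv_cong_sym t)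
  define w where "w = conv N a (conv N b a)"
  have wi: "w (inv \<tau>) = w \<tau>" if t: "\<tau> \<in> sym_group N" for \<tau>
  proof -
    have "w (inv \<tau>) = conv N (conv N a b) a \<tau>"
      unfolding w_def conv_reverse[OF t] using ai ba by (auto intro!: conv_cong_sym t)
    thus ?thesis by (simp add: w_def conv_assoc)
  qed
  have "conv N w w = conv N a (conv N b (conv N (conv N a a) (conv N b a)))"
    by (simp add: w_def conv_assoc)
  also have "\<dots> = (\<lambda>\<rho>. of_nat (card (stab N (row_of la))) * conv N (conv N (conv N a b) (conv N a b)) a \<rho>)"
    by (simp add: a_def symz_symz conv_scale_left conv_scale_right conv_assoc)
  also have "conv N (conv N a b) (conv N a b) = (\<lambda>_. 0)"
    using ysym_ysym[OF la] n0 y by simp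
  finally have "conv N w w id = 0" by (simp add: conv_def)
  hence w0: "w \<sigma> = 0" if "\<sigma> \<in> sym_group N" for \<sigma>
    using conv_transpose_id_eq_0[of w N w] that wi by (auto simp: w_def intro!: conv_real real)
  have "conv N (conv N a b) (conv N b a) = conv N a (conv N (conv N b b) a)"
    by (simp add: conv_assoc)
  also have "\<dots> = (\<lambda>\<rho>. of_nat (card (stab N (col_of la))) * w \<rho>)"
    by (simp add: b_def asymz_asymz conv_scale_left conv_scale_right w_def)
  finally have "conv N (conv N a b) (conv N b a) id = 0" using w0[of id] by simp
  hence "conv N a b id = 0"
    using conv_transpose_id_eq_0[of "conv N a b" N "conv N b a" id] ba
    by (auto intro!: conv_real real)
  thus False using ysym_id[OF la] y by simp
qed

text \<open>Right multiplication by c/n projects the group algebra onto the ideal, because c c = n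
  c. The trace is therefore computed over all of \<open>sym_group N\<close>, with
  \<open>E \<sigma>\<close> the image of the group element \<sigma>, instead of over a basis of the
  ideal.\<close>

lemma irr_char_eq:
  assumes la: "la \<in> partitions N" and p: "\<pi> \<in> sym_group N"
  shows "irr_char la \<pi> = (\<Sum>\<sigma>\<in>sym_group N. ysym la (inv \<sigma> \<circ> inv \<pi> \<circ> \<sigma>)) / ynorm la"
proof -
  let ?n = "ynorm la" and ?c = "ysym la"
  have n0: "?n \<noteq> 0" by (rule ynorm_nonzero[OF la])
  have V: "irrep_space la = (\<lambda>f. conv N f ?c) ` group_algebra N"
    by (simp add: irrep_space_def partition_sum[OF la])
  define E where "E \<sigma> = (\<lambda>\<rho>. conv N (group_elem \<sigma>) ?c \<rho> / ?n)" for \<sigma>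
  have E_eq: "E \<sigma> = conv N (\<lambda>\<rho>. (1 / ?n) * group_elem \<sigma> \<rho>) ?c" for \<sigma>
    unfolding conv_scale_left by (simp add: E_def)
  have "trace_on (irrep_space la) (conv N (group_elem \<pi>)) = (\<Sum>\<sigma>\<in>sym_group N. conv N (group_elem \<pi>) (E \<sigma>) \<sigma>)"
  proof (rule trace_on_projection)
    show "fun_space.subspace (irrep_space la)"
    proof (rule fun_space.subspaceI)
      show "0 \<in> irrep_space la"
        unfolding V by (rule image_eqI[of _ _ "\<lambda>_. 0"]) (auto simp: conv_def group_algebra_def)
    next
      fix x y assume "x \<in> irrep_space la" "y \<in> irrep_space la"
      then obtain f g where fg: "f \<in> group_algebra N" "g \<in> group_algebra N" "x = conv N f ?c" "y = conv N g ?c"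
        unfolding V by blast
      thus "x + y \<in> irrep_space la"
        unfolding V by (intro image_eqI[of _ _ "\<lambda>\<rho>. f \<rho> + g \<rho>"])
          (auto simp: conv_def group_algebra_def sum.distrib algebra_simps fun_eq_iff)
    next
      fix c x assume "x \<in> irrep_space la"
      then obtain f where f: "f \<in> group_algebra N" "x = conv N f ?c" unfolding V by blast
      thus "(\<lambda>y. c * x y) \<in> irrep_space la"
        unfolding V by (intro image_eqI[of _ _ "\<lambda>\<rho>. c * f \<rho>"])
          (auto simp: conv_scale_left group_algebra_def)
    qed
  next
    fix v x assume "v \<in> irrep_space la" "x \<notin> sym_group N"
    thus "v x = 0" unfolding V using conv_in[OF ysym_in[OF la]] by (auto simp: group_algebra_def)
  next
    fix \<sigma> assume "\<sigma> \<in> sym_group N"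
    thus "E \<sigma> \<in> irrep_space la" unfolding V E_eq
      by (intro imageI) (auto simp: group_algebra_def group_elem_def)
  next
    fix v assume "v \<in> irrep_space la"
    then obtain f where f: "v = conv N f ?c" unfolding V by blast
    hence "conv N v ?c = (\<lambda>\<rho>. ?n * v \<rho>)"
      by (simp add: conv_assoc ysym_ysym[OF la] conv_scale_right)
    hence "v \<rho> = conv N v ?c \<rho> / ?n" for \<rho> using n0 by simp
    also have "conv N v ?c \<rho> / ?n = (\<Sum>\<sigma>\<in>sym_group N. v \<sigma> * E \<sigma> \<rho>)" for \<rho>
      by (simp add: E_def conv_def[of N v] sum_divide_distrib conv_group_elem_left)
    finally show "v = (\<lambda>\<rho>. \<Sum>\<sigma>\<in>sym_group N. v \<sigma> * E \<sigma> \<rho>)" by (rule ext)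
  next
    fix v assume "v \<in> irrep_space la"
    then obtain f where f: "v = conv N f ?c" "f \<in> group_algebra N" unfolding V by blast
    thus "conv N (group_elem \<pi>) v \<in> irrep_space la" unfolding V
      by (intro image_eqI[of _ _ "conv N (group_elem \<pi>) f"]) (auto simp: conv_assoc)
  qed (simp_all add: conv_scale_right conv_sum_right)
  also have "\<dots> = (\<Sum>\<sigma>\<in>sym_group N. ysym la (inv \<sigma> \<circ> inv \<pi> \<circ> \<sigma>) / ynorm la)"
  proof (intro sum.cong refl)
    fix \<sigma> assume s: "\<sigma> \<in> sym_group N"
    show "conv N (group_elem \<pi>) (E \<sigma>) \<sigma> = ysym la (inv \<sigma> \<circ> inv \<pi> \<circ> \<sigma>) / ynorm la"
      by (simp add: conv_group_elem_left[OF p] E_def conv_group_elem_left[OF s] o_assoc)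
  qed
  finally show ?thesis by (simp add: irr_char_def partition_sum[OF la] sum_divide_distrib)
qed

lemma conv_conj_id:
  assumes c: "c \<in> group_algebra N" and y: "y \<in> group_algebra N" and s: "\<sigma> \<in> sym_group N"
  shows "conv N (conv N c (group_elem \<sigma>)) (conv N y (group_elem (inv \<sigma>))) id
    = (\<Sum>\<rho>\<in>sym_group N. c (\<sigma> \<circ> inv \<rho> \<circ> inv \<sigma>) * y \<rho>)"
proof -
  note si = sym_group_inv[OF s] and ss = sym_group_inv_simps[OF s]
  have "conv N (conv N c (group_elem \<sigma>)) (conv N y (group_elem (inv \<sigma>))) id
      = (\<Sum>\<tau>\<in>sym_group N. c (\<tau> \<circ> inv \<sigma>) * y (inv \<tau> \<circ> \<sigma>))"
    unfolding conv_group_elem_right[OF s c] conv_group_elem_right[OF si y] by (simp add: conv_def ss)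
  also have "\<dots> = (\<Sum>\<tau>\<in>sym_group N. c ((\<sigma> \<circ> \<tau>) \<circ> inv \<sigma>) * y (inv (\<sigma> \<circ> \<tau>) \<circ> \<sigma>))"
    by (rule sum_sym_left[OF s, symmetric])
  also have "\<dots> = (\<Sum>\<tau>\<in>sym_group N. c (\<sigma> \<circ> inv \<tau> \<circ> inv \<sigma>) * y (inv (\<sigma> \<circ> inv \<tau>) \<circ> \<sigma>))"
    by (rule sum_sym_inv[symmetric])
  also have "\<dots> = (\<Sum>\<rho>\<in>sym_group N. c (\<sigma> \<circ> inv \<rho> \<circ> inv \<sigma>) * y \<rho>)"
  proof (intro sum.cong refl)
    fix \<tau> assume t: "\<tau> \<in> sym_group N"
    have "inv (\<sigma> \<circ> inv \<tau>) \<circ> \<sigma> = \<tau>"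
      by (simp add: sym_group_inv_comp[OF s sym_group_inv[OF t]] sym_group_inv_simps(3)[OF t] ss flip: o_assoc)
    thus "c (\<sigma> \<circ> inv \<tau> \<circ> inv \<sigma>) * y (inv (\<sigma> \<circ> inv \<tau>) \<circ> \<sigma>) = c (\<sigma> \<circ> inv \<tau> \<circ> inv \<sigma>) * y \<tau>" by simp
  qed
  finally show ?thesis .
qed

text \<open>By the trace formula the pairing is, up to \<open>ynorm la\<close>, a sum of
  coefficients at \<open>id\<close> of c \<sigma> y \<sigma>^{-1}. It vanishes as soon as every
  product c \<sigma> y does, and by \<open>conv_id_commute\<close> also when every y \<sigma> c
  does; the orthogonality relations below rest on this form.\<close>

lemma char_pairing:
  assumes la: "la \<in> partitions N" and y: "y \<in> group_algebra N"
  shows "(\<Sum>\<pi>\<in>sym_group N. irr_char la \<pi> * y \<pi>)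
    = (\<Sum>\<sigma>\<in>sym_group N. conv N (conv N (ysym la) (group_elem \<sigma>)) (conv N y (group_elem (inv \<sigma>))) id) / ynorm la"
proof -
  have "(\<Sum>\<pi>\<in>sym_group N. irr_char la \<pi> * y \<pi>)
     = (\<Sum>\<pi>\<in>sym_group N. \<Sum>\<sigma>\<in>sym_group N. ysym la (inv \<sigma> \<circ> inv \<pi> \<circ> \<sigma>) * y \<pi>) / ynorm la"
    by (simp add: irr_char_eq[OF la] sum_divide_distrib sum_distrib_right)
  also have "(\<Sum>\<pi>\<in>sym_group N. \<Sum>\<sigma>\<in>sym_group N. ysym la (inv \<sigma> \<circ> inv \<pi> \<circ> \<sigma>) * y \<pi>)
     = (\<Sum>\<sigma>\<in>sym_group N. \<Sum>\<pi>\<in>sym_group N. ysym la (inv \<sigma> \<circ> inv \<pi> \<circ> \<sigma>) * y \<pi>)"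
    by (rule sum.swap)
  also have "\<dots> = (\<Sum>\<sigma>\<in>sym_group N. \<Sum>\<pi>\<in>sym_group N. ysym la (\<sigma> \<circ> inv \<pi> \<circ> inv \<sigma>) * y \<pi>)"
    using sum_sym_inv[of "\<lambda>\<sigma>. \<Sum>\<pi>\<in>sym_group N. ysym la (inv \<sigma> \<circ> inv \<pi> \<circ> \<sigma>) * y \<pi>" N]
    by (simp add: sym_group_inv_simps)
  also have "\<dots> = (\<Sum>\<sigma>\<in>sym_group N. conv N (conv N (ysym la) (group_elem \<sigma>)) (conv N y (group_elem (inv \<sigma>))) id)"
    by (intro sum.cong refl conv_conj_id[symmetric] ysym_in la y)
  finally show ?thesis .
qed

text \<open>Too many elements with colours in \<open>K\<close> force two of one colour into one
  column, where the antisymmetrizer and the symmetrizer annihilate each other.\<close>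

lemma ysym_conv_symz_eq_0:
  assumes la: "la \<in> partitions N" and s: "\<sigma> \<in> sym_group N" and K: "finite K"
    and ex: "card {x. x < N \<and> f x \<in> K} > sum_list (take (card K) la)"
  shows "conv N (ysym la) (conv N (group_elem \<sigma>) (symz N f)) = (\<lambda>_. 0)"
proof -
  obtain u v where "u < N" "v < N" "u \<noteq> v" "f u = f v" "col_of la (\<sigma> u) = col_of la (\<sigma> v)"
    using card_colours_le_dominance[OF la s K, of f] ex by force
  hence "conv N (asymz N (col_of la)) (conv N (group_elem \<sigma>) (symz N f)) = (\<lambda>_. 0)"
    using asymz_conv_symz_eq_0[OF s] by blast
  thus ?thesis by (simp add: ysym_eq[OF la] conv_assoc) (simp add: conv_def)
qed

text \<open>Up to the factor \<open>card (stab N f)\<close> the sum is the multiplicity of the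
  character in the permutation module of f. Its vanishing is the triangularity of Kostka numbers,
  seen from the representations.\<close>

lemma char_symz_eq_0:
  assumes la: "la \<in> partitions N" and K: "finite K"
    and ex: "card {x. x < N \<and> f x \<in> K} > sum_list (take (card K) la)"
  shows "(\<Sum>\<pi>\<in>sym_group N. irr_char la \<pi> * symz N f \<pi>) = 0"
proof -
  have "conv N (conv N (ysym la) (group_elem \<sigma>)) (conv N (symz N f) (group_elem (inv \<sigma>))) id = 0"
    if "\<sigma> \<in> sym_group N" for \<sigma>
  proof -
    have "conv N (conv N (ysym la) (group_elem \<sigma>)) (conv N (symz N f) (group_elem (inv \<sigma>)))
      = conv N (conv N (ysym la) (conv N (group_elem \<sigma>) (symz N f))) (group_elem (inv \<sigma>))"
      by (simp add: conv_assoc)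
    thus ?thesis by (simp add: ysym_conv_symz_eq_0[OF la that K ex]) (simp add: conv_def)
  qed
  thus ?thesis by (simp add: char_pairing[OF la symz_in])
qed

lemma symz_ysym_id_eq_0:
  assumes la: "la \<in> partitions N" and K: "finite K"
    and ex: "card {x. x < N \<and> f x \<in> K} > sum_list (take (card K) la)"
  shows "(\<Sum>\<pi>\<in>stab N f. ysym la \<pi>) = 0"
proof -
  have "(\<Sum>\<pi>\<in>stab N f. ysym la \<pi>) = (\<Sum>\<pi>\<in>sym_group N. ysym la \<pi> * symz N f (inv \<pi>))"
    by (intro sum.mono_neutral_cong_left) (auto simp: symz_inv symz_def inv_in_stab_iff stab_sub)
  also have "\<dots> = conv N (ysym la) (symz N f) id" by (simp add: conv_def)
  also have "conv N (ysym la) (symz N f) = conv N (ysym la) (conv N (group_elem id) (symz N f))"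
    by (simp add: conv_group_elem_left)
  also have "\<dots> = (\<lambda>_. 0)" by (rule ysym_conv_symz_eq_0[OF la _ K ex]) simp
  finally show ?thesis by simp
qed

lemma card_row_lt:
  assumes "nu \<in> partitions N"
  shows "card {x. x < N \<and> row_of nu x \<in> {..<k}} = sum_list (take k nu)"
proof -
  have N: "sum_list nu = N" using assms by (rule partition_sum)
  have "sum_list (take k nu) \<le> N" using N by (metis append_take_drop_id le_add1 sum_list_append)
  hence "{x. x < N \<and> row_of nu x \<in> {..<k}} = {..<sum_list (take k nu)}"
    using row_lt_iff[of _ nu k] N by auto
  thus ?thesis by simp
qed

lemma card_take_gt:
  assumes "nu \<in> partitions N" "\<not> dominated nu la"
  shows "\<exists>k. card {x. x < N \<and> row_of nu x \<in> {..<k}} > sum_list (take (card {..<k}) la)"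
  using assms(2) unfolding card_row_lt[OF assms(1)] by (auto simp: dominated_def not_le)

lemma ysym_ysym_eq_0:
  assumes la: "la \<in> partitions N" and ka: "ka \<in> partitions N" and nd: "\<not> dominated ka la"
    and s: "\<sigma> \<in> sym_group N"
  shows "conv N (ysym la) (conv N (group_elem \<sigma>) (ysym ka)) = (\<lambda>_. 0)"
proof -
  have "conv N (ysym la) (conv N (group_elem \<sigma>) (ysym ka))
     = conv N (conv N (ysym la) (conv N (group_elem \<sigma>) (symz N (row_of ka)))) (asymz N (col_of ka))"
    by (simp add: ysym_eq[OF ka] conv_assoc)
  also have "\<dots> = (\<lambda>_. 0)"
    using ysym_conv_symz_eq_0[OF la s, of "{..<_}" "row_of ka"] card_take_gt[OF ka nd]
    by (force simp: conv_def)
  finally show ?thesis .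
qed

text \<open>Distinct partitions cannot dominate each other both ways, so of the two kinds of
  products c \<sigma> c' and c' \<sigma> c of the symmetrizers one vanishes for all \<sigma>; the
  second kind is reached by commuting under the coefficient at \<open>id\<close>.\<close>

lemma char_ysym_orth:
  assumes la: "la \<in> partitions N" and ka: "ka \<in> partitions N" and ne: "ka \<noteq> la"
  shows "(\<Sum>\<pi>\<in>sym_group N. irr_char la \<pi> * ysym ka \<pi>) = 0"
proof -
  have "conv N (conv N (ysym la) (group_elem \<sigma>)) (conv N (ysym ka) (group_elem (inv \<sigma>))) id = 0"
    if s: "\<sigma> \<in> sym_group N" for \<sigma>
  proof (cases "dominated ka la")
    case False
    have "conv N (conv N (ysym la) (group_elem \<sigma>)) (conv N (ysym ka) (group_elem (inv \<sigma>)))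
      = conv N (conv N (ysym la) (conv N (group_elem \<sigma>) (ysym ka))) (group_elem (inv \<sigma>))"
      by (simp add: conv_assoc)
    thus ?thesis by (simp add: ysym_ysym_eq_0[OF la ka False s]) (simp add: conv_def)
  next
    case True
    hence nd: "\<not> dominated la ka" using dominated_antisym[OF ka la] ne by blast
    have "conv N (conv N (ysym ka) (group_elem (inv \<sigma>))) (conv N (ysym la) (group_elem \<sigma>))
      = conv N (conv N (ysym ka) (conv N (group_elem (inv \<sigma>)) (ysym la))) (group_elem \<sigma>)"
      by (simp add: conv_assoc)
    hence "conv N (conv N (ysym ka) (group_elem (inv \<sigma>))) (conv N (ysym la) (group_elem \<sigma>)) id = 0"
      by (simp add: ysym_ysym_eq_0[OF ka la nd sym_group_inv[OF s]]) (simp add: conv_def)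
    thus ?thesis by (subst conv_id_commute)
  qed
  thus ?thesis by (simp add: char_pairing[OF la ysym_in[OF ka]])
qed

lemma conv_ysym_expand:
  assumes la: "la \<in> partitions N"
  shows "(\<Sum>\<sigma>\<in>sym_group N. ysym la \<sigma> * conv N f (conv N (group_elem \<sigma>) g) \<rho>) = conv N f (conv N (ysym la) g) \<rho>"
proof -
  have "conv N (ysym la) g = conv N (\<lambda>\<rho>. \<Sum>\<sigma>\<in>sym_group N. ysym la \<sigma> * group_elem \<sigma> \<rho>) g"
    using group_algebra_expand[OF ysym_in[OF la]] by simp
  also have "\<dots> = (\<lambda>\<rho>. \<Sum>\<sigma>\<in>sym_group N. ysym la \<sigma> * conv N (group_elem \<sigma>) g \<rho>)"
    by (simp add: conv_sum_left conv_scale_left)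
  finally show ?thesis by (simp add: conv_sum_right conv_scale_right)
qed

text \<open>Each product c \<sigma> c is a multiple k(\<sigma>) c, so the pairing is the sum of
  c(\<sigma>) k(\<sigma>) divided by \<open>ynorm la\<close>. That sum is the coefficient of c c c
  at \<open>id\<close>, the square of \<open>ynorm la\<close>.\<close>

lemma char_ysym_self:
  assumes la: "la \<in> partitions N"
  shows "(\<Sum>\<pi>\<in>sym_group N. irr_char la \<pi> * ysym la \<pi>) = ynorm la"
proof -
  let ?c = "ysym la"
  have "conv N (conv N ?c (group_elem \<sigma>)) (conv N ?c (group_elem (inv \<sigma>))) id
     = ?c \<sigma> * conv N ?c (conv N (group_elem \<sigma>) ?c) id" if s: "\<sigma> \<in> sym_group N" for \<sigma>
  proof -
    define k where "k = conv N ?c (conv N (group_elem \<sigma>) ?c) id"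
    have "conv N ?c (conv N (group_elem \<sigma>) ?c) = (\<lambda>\<rho>. k * ?c \<rho>)"
      using conv_row_col_eq[OF la, of "conv N (asymz N (col_of la)) (conv N (group_elem \<sigma>) (symz N (row_of la)))"]
      unfolding k_def by (simp add: ysym_eq[OF la] conv_assoc)
    note eq = this
    have "conv N (conv N ?c (group_elem \<sigma>)) (conv N ?c (group_elem (inv \<sigma>))) id
      = conv N (conv N ?c (conv N (group_elem \<sigma>) ?c)) (group_elem (inv \<sigma>)) id"
      by (simp only: conv_assoc)
    also have "\<dots> = k * ?c \<sigma>"
      unfolding eq conv_scale_left conv_group_elem_right[OF sym_group_inv[OF s] ysym_in[OF la]]
      by (simp add: sym_group_inv_simps(3)[OF s])
    finally show ?thesis by (simp only: k_def mult.commute)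
  qed
  hence "(\<Sum>\<pi>\<in>sym_group N. irr_char la \<pi> * ?c \<pi>)
    = (\<Sum>\<sigma>\<in>sym_group N. ?c \<sigma> * conv N ?c (conv N (group_elem \<sigma>) ?c) id) / ynorm la"
    by (simp add: char_pairing[OF la ysym_in[OF la]])
  also have "\<dots> = conv N ?c (conv N ?c ?c) id / ynorm la" by (simp only: conv_ysym_expand[OF la])
  also have "\<dots> = ynorm la"
    using ynorm_nonzero[OF la] by (simp add: ysym_ysym[OF la] conv_scale_right ysym_id[OF la])
  finally show ?thesis .
qed

text \<open>The same computation with one symmetrizer replaced by the row symmetrizer a: the sum
  reassembles a c c, and a a is \<open>card (stab N (row_of la))\<close> times a. In terms of
  representations, the character occurs exactly once in its own permutation module.\<close>

lemma char_row_self: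
  assumes la: "la \<in> partitions N"
  shows "(\<Sum>\<pi>\<in>sym_group N. irr_char la \<pi> * symz N (row_of la) \<pi>) = of_nat (card (stab N (row_of la)))"
proof -
  let ?c = "ysym la" and ?a = "symz N (row_of la)"
  have "conv N (conv N ?c (group_elem \<sigma>)) (conv N ?a (group_elem (inv \<sigma>))) id
     = ?c (inv \<sigma>) * conv N ?a (conv N (group_elem (inv \<sigma>)) ?c) id" if s: "\<sigma> \<in> sym_group N" for \<sigma>
  proof -
    define k where "k = conv N ?a (conv N (group_elem (inv \<sigma>)) ?c) id"
    have "conv N ?a (conv N (group_elem (inv \<sigma>)) ?c) = (\<lambda>\<rho>. k * ?c \<rho>)"
      using conv_row_col_eq[OF la, of "conv N (group_elem (inv \<sigma>)) (symz N (row_of la))"]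
      unfolding k_def by (simp add: ysym_eq[OF la] conv_assoc)
    note eq = this
    have "conv N (conv N ?c (group_elem \<sigma>)) (conv N ?a (group_elem (inv \<sigma>))) id
      = conv N (conv N ?a (conv N (group_elem (inv \<sigma>)) ?c)) (group_elem \<sigma>) id"
      by (subst conv_id_commute) (simp only: conv_assoc)
    also have "\<dots> = k * ?c (inv \<sigma>)"
      unfolding eq conv_scale_left conv_group_elem_right[OF s ysym_in[OF la]] by simp
    finally show ?thesis by (simp only: k_def mult.commute)
  qed
  hence "(\<Sum>\<pi>\<in>sym_group N. irr_char la \<pi> * ?a \<pi>)
    = (\<Sum>\<sigma>\<in>sym_group N. ?c (inv \<sigma>) * conv N ?a (conv N (group_elem (inv \<sigma>)) ?c) id) / ynorm la"
    by (simp add: char_pairing[OF la symz_in])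
  also have "\<dots> = (\<Sum>\<sigma>\<in>sym_group N. ?c \<sigma> * conv N ?a (conv N (group_elem \<sigma>) ?c) id) / ynorm la"
    by (simp only: sum_sym_inv[of "\<lambda>\<sigma>. ?c \<sigma> * conv N ?a (conv N (group_elem \<sigma>) ?c) id"])
  also have "\<dots> = conv N ?a (conv N ?c ?c) id / ynorm la" by (simp only: conv_ysym_expand[OF la])
  also have "conv N ?a (conv N ?c ?c) = (\<lambda>\<rho>. ynorm la * (of_nat (card (stab N (row_of la))) * ?c \<rho>))"
    by (simp add: ysym_ysym[OF la] conv_scale_right)
      (simp add: ysym_eq[OF la] symz_symz conv_scale_left flip: conv_assoc)
  finally show ?thesis
    using ynorm_nonzero[OF la] ysym_id[OF la] by (simp add: id_def)
qed

lemma irr_char_class: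
  assumes la: "la \<in> partitions N" and p: "\<pi> \<in> sym_group N" and s: "\<sigma> \<in> sym_group N"
  shows "irr_char la (\<sigma> \<circ> \<pi> \<circ> inv \<sigma>) = irr_char la \<pi>"
proof -
  have q: "\<sigma> \<circ> \<pi> \<circ> inv \<sigma> \<in> sym_group N" using p s by blast
  have i: "inv (\<sigma> \<circ> \<pi> \<circ> inv \<sigma>) = \<sigma> \<circ> inv \<pi> \<circ> inv \<sigma>"
    by (simp add: sym_group_inv_comp[OF sym_group_comp[OF s p] sym_group_inv[OF s]]
        sym_group_inv_comp[OF s p] sym_group_inv_simps(3)[OF s] o_assoc)
  have "(\<Sum>\<tau>\<in>sym_group N. ysym la (inv \<tau> \<circ> inv \<pi> \<circ> \<tau>))
      = (\<Sum>\<tau>\<in>sym_group N. ysym la (inv (inv \<sigma> \<circ> \<tau>) \<circ> inv \<pi> \<circ> (inv \<sigma> \<circ> \<tau>)))"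
    by (rule sum_sym_left[OF sym_group_inv[OF s], symmetric])
  also have "\<dots> = (\<Sum>\<tau>\<in>sym_group N. ysym la (inv \<tau> \<circ> inv (\<sigma> \<circ> \<pi> \<circ> inv \<sigma>) \<circ> \<tau>))"
    by (intro sum.cong refl) (simp add: i sym_group_inv_comp[OF sym_group_inv[OF s]] sym_group_inv_simps[OF s] o_assoc)
  finally show ?thesis by (simp add: irr_char_eq[OF la] p q)
qed

section \<open>Cycle types, conjugacy and class functions\<close>

lemma sym_group_permutation: "\<pi> \<in> sym_group N \<Longrightarrow> permutation \<pi>"
  by (auto simp: sym_group_def permutation_permutes)

lemma self_in_orbit: "\<pi> \<in> sym_group N \<Longrightarrow> x \<in> orbit \<pi> x"
  by (rule permutation_self_in_orbit) (rule sym_group_permutation)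

lemma orbit_eq_if_mem:
  assumes p: "\<pi> \<in> sym_group N" and y: "y \<in> orbit \<pi> x"
  shows "orbit \<pi> y = orbit \<pi> x"
  using orbit_cyclic_eq3[OF cyclic_on_orbit'[OF sym_group_permutation[OF p]] y] .

lemma orbit_image_eq: "\<pi> \<in> sym_group N \<Longrightarrow> orbit \<pi> (\<pi> x) = orbit \<pi> x"
  by (rule orbit_eq_if_mem) (auto intro: orbit.base)

lemma orbit_lt: "\<pi> \<in> sym_group N \<Longrightarrow> x < N \<Longrightarrow> orbit \<pi> x \<subseteq> {..<N}"
  by (rule permutes_orbit_subset) (auto simp: sym_group_def)

lemma funpow_eq_iff_mod_orbit:
  assumes p: "\<pi> \<in> sym_group N"
  shows "(\<pi> ^^ m) x = (\<pi> ^^ n) x \<longleftrightarrow> m mod card (orbit \<pi> x) = n mod card (orbit \<pi> x)"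
proof -
  let ?d = "funpow_dist1 \<pi> x x"
  note s = self_in_orbit[OF p, of x]
  have inj: "inj_on (\<lambda>n. (\<pi> ^^ n) x) {0..<?d}" by (rule inj_on_funpow_dist1[OF s])
  have c: "card (orbit \<pi> x) = ?d"
    using card_image[OF inj] orbit_conv_funpow_dist1[OF s] by simp
  have "(\<pi> ^^ ?d) x = x" by (rule funpow_dist1_prop[OF s])
  note md = funpow_mod_eq[OF this]
  have "(\<pi> ^^ m) x = (\<pi> ^^ n) x \<longleftrightarrow> (\<pi> ^^ (m mod ?d)) x = (\<pi> ^^ (n mod ?d)) x"
    by (simp only: md)
  also have "\<dots> \<longleftrightarrow> m mod ?d = n mod ?d" using inj_on_eq_iff[OF inj, of "m mod ?d" "n mod ?d"] by simp
  finally show ?thesis by (simp only: c)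
qed

lemma image_mset_eq_imp_bij:
  assumes fin: "finite A" "finite B" and eq: "image_mset f (mset_set A) = image_mset g (mset_set B)"
  shows "\<exists>\<phi>. bij_betw \<phi> A B \<and> (\<forall>x\<in>A. g (\<phi> x) = f x)"
proof -
  have "card A = card B" using arg_cong[OF eq, of size] by simp
  then obtain h where h: "bij_betw h A B" using finite_same_card_bij[OF fin] by blast
  have "image_mset (g \<circ> h) (mset_set A) = image_mset g (mset_set B)"
    using h image_mset_mset_set[of h A] by (simp add: bij_betw_def flip: multiset.map_comp)
  with eq have "image_mset f (mset_set A) = image_mset (g \<circ> h) (mset_set A)" by simp
  then obtain q where q: "q permutes A" "\<forall>x\<in>A. f x = (g \<circ> h) (q x)"
    using image_mset_eq_implies_permutes[OF fin(1)] by blast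
  have "bij_betw (h \<circ> q) A B" using bij_betw_trans[OF permutes_imp_bij[OF q(1)] h] .
  thus ?thesis using q(2) by (intro exI[of _ "h \<circ> q"]) auto
qed

text \<open>Match the cycles of the two permutations by size, choose a base point in each, and send
  the d-th iterate of a base point to the d-th iterate of the matching one. Since matching cycles
  have equal length, two exponents that agree on one side agree on the other, so the choice of d is
  harmless.\<close>

lemma same_cycle_type_conjugate:
  assumes p: "\<pi> \<in> sym_group N" and p': "\<pi>' \<in> sym_group N" and ct: "cycle_type N \<pi> = cycle_type N \<pi>'"
  shows "\<exists>\<sigma>\<in>sym_group N. \<pi>' = \<sigma> \<circ> \<pi> \<circ> inv \<sigma>"
proof -
  define Or where "Or = orbit \<pi> ` {..<N}"
  define Or' where "Or' = orbit \<pi>' ` {..<N}"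
  obtain \<phi> where \<phi>: "bij_betw \<phi> Or Or'" "\<And>A. A \<in> Or \<Longrightarrow> card (\<phi> A) = card A"
    using image_mset_eq_imp_bij[of Or Or' card card] ct by (auto simp: cycle_type_def Or_def Or'_def)
  define r where "r A = (SOME x. x \<in> A)" for A :: "nat set"
  have r: "r A \<in> A" "orbit \<pi> (r A) = A" if A: "A \<in> Or" for A
  proof -
    obtain x where x: "A = orbit \<pi> x" using A unfolding Or_def by blast
    show "r A \<in> A" using someI[of "\<lambda>y. y \<in> A" x] self_in_orbit[OF p] x by (simp add: r_def)
    thus "orbit \<pi> (r A) = A" using orbit_eq_if_mem[OF p] x by simp
  qed
  have r': "r A \<in> A" "orbit \<pi>' (r A) = A" "A \<subseteq> {..<N}" if A: "A \<in> Or'" for A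
  proof -
    obtain x where x: "A = orbit \<pi>' x" "x < N" using A unfolding Or'_def by blast
    show "r A \<in> A" using someI[of "\<lambda>y. y \<in> A" x] self_in_orbit[OF p'] x by (simp add: r_def)
    thus "orbit \<pi>' (r A) = A" using orbit_eq_if_mem[OF p'] x by simp
    show "A \<subseteq> {..<N}" using orbit_lt[OF p'] x by simp
  qed
  define d where "d y = funpow_dist \<pi> (r (orbit \<pi> y)) y" for y
  define \<sigma> where "\<sigma> y = (if y < N then (\<pi>' ^^ d y) (r (\<phi> (orbit \<pi> y))) else y)" for y
  have inOr: "orbit \<pi> y \<in> Or" if "y < N" for y using that by (auto simp: Or_def)
  have d: "(\<pi> ^^ d y) (r (orbit \<pi> y)) = y" if "y < N" for y
    unfolding d_def using r[OF inOr[OF that]] self_in_orbit[OF p, of y] by (intro funpow_dist_prop) simp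
  have \<phi>in: "\<phi> (orbit \<pi> y) \<in> Or'" if "y < N" for y
    using \<phi>(1) inOr[OF that] by (auto simp: bij_betw_def)
  have key: "(\<pi>' ^^ m) (r (\<phi> A)) = (\<pi>' ^^ n) (r (\<phi> A)) \<longleftrightarrow> (\<pi> ^^ m) (r A) = (\<pi> ^^ n) (r A)"
    if A: "A \<in> Or" for A m n
  proof -
    have "\<phi> A \<in> Or'" using \<phi>(1) A by (auto simp: bij_betw_def)
    thus ?thesis using r(2)[OF A] r'(2) \<phi>(2)[OF A]
      by (simp add: funpow_eq_iff_mod_orbit[OF p] funpow_eq_iff_mod_orbit[OF p'])
  qed
  have in_orb: "\<sigma> y \<in> \<phi> (orbit \<pi> y)" if "y < N" for y
  proof -
    have "(\<pi>' ^^ d y) (r (\<phi> (orbit \<pi> y))) \<in> orbit \<pi>' (r (\<phi> (orbit \<pi> y)))"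
      using self_in_orbit[OF p'] by (rule funpow_in_orbit)
    thus ?thesis using r'(2)[OF \<phi>in[OF that]] that by (simp add: \<sigma>_def)
  qed
  have inj: "inj_on \<sigma> {..<N}"
  proof (rule inj_onI)
    fix y z assume yz: "y \<in> {..<N}" "z \<in> {..<N}" "\<sigma> y = \<sigma> z"
    hence y: "y < N" and z: "z < N" by auto
    have "orbit \<pi>' (\<sigma> x) = \<phi> (orbit \<pi> x)" if "x < N" for x
      using orbit_eq_if_mem[OF p', of "\<sigma> x" "r (\<phi> (orbit \<pi> x))"] r'(2)[OF \<phi>in[OF that]] in_orb[OF that] by simp
    note this[OF y] this[OF z]
    hence "\<phi> (orbit \<pi> y) = \<phi> (orbit \<pi> z)" using yz(3) by simp
    hence o: "orbit \<pi> y = orbit \<pi> z"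
      using inj_onD[OF bij_betw_imp_inj_on[OF \<phi>(1)]] inOr[OF y] inOr[OF z] by blast
    have "(\<pi>' ^^ d y) (r (\<phi> (orbit \<pi> y))) = (\<pi>' ^^ d z) (r (\<phi> (orbit \<pi> y)))"
      using yz(3) o unfolding \<sigma>_def if_P[OF y] if_P[OF z] by (simp only:)
    hence "(\<pi> ^^ d y) (r (orbit \<pi> y)) = (\<pi> ^^ d z) (r (orbit \<pi> y))" by (rule iffD1[OF key[OF inOr[OF y]]])
    thus "y = z" using d[OF y] d[OF z] unfolding o by (simp only:)
  qed
  have "\<sigma> ` {..<N} \<subseteq> {..<N}" using in_orb r'(3)[OF \<phi>in] by blast
  hence "bij_betw \<sigma> {..<N} {..<N}" using inj endo_inj_surj[of "{..<N}" \<sigma>] by (auto simp: bij_betw_def)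
  hence s: "\<sigma> \<in> sym_group N"
    unfolding sym_group_def mem_Collect_eq by (rule bij_imp_permutes) (simp add: \<sigma>_def)
  have "\<sigma> (\<pi> y) = \<pi>' (\<sigma> y)" for y
  proof (cases "y < N")
    case True
    hence py: "\<pi> y < N" using sym_group_lt[OF p] by simp
    note oy = orbit_image_eq[OF p, of y]
    have "(\<pi> ^^ d (\<pi> y)) (r (orbit \<pi> y)) = (\<pi> ^^ Suc (d y)) (r (orbit \<pi> y))"
      using d[OF py] d[OF True] oy by simp
    hence "(\<pi>' ^^ d (\<pi> y)) (r (\<phi> (orbit \<pi> y))) = (\<pi>' ^^ Suc (d y)) (r (\<phi> (orbit \<pi> y)))"
      by (rule iffD2[OF key[OF inOr[OF True]]])
    thus ?thesis using True py oy by (simp add: \<sigma>_def)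
  next
    case False
    have "\<pi> y = y" "\<pi>' y = y" using p p' False by (auto simp: sym_group_def permutes_def)
    thus ?thesis using False by (simp add: \<sigma>_def)
  qed
  hence "\<sigma> \<circ> \<pi> = \<pi>' \<circ> \<sigma>" by (auto simp: fun_eq_iff)
  hence "\<pi>' = \<sigma> \<circ> \<pi> \<circ> inv \<sigma>" using sym_group_inv_simps(2)[OF s] by (metis comp_id o_assoc)
  thus ?thesis using s by blast
qed

lemma partition_of_mset:
  assumes "\<And>k. k \<in># m \<Longrightarrow> k > 0" "sum_mset m = N"
  shows "m \<in> mset ` partitions N"
proof -
  have "rev (sorted_list_of_multiset m) \<in> partitions N"
    using assms sum_mset_sum_list[of "sorted_list_of_multiset m"]
    by (auto simp: partitions_def sorted_wrt_rev)
  moreover have "m = mset (rev (sorted_list_of_multiset m))" by simp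
  ultimately show ?thesis by blast
qed

lemma inj_on_mset_partitions: "inj_on mset (partitions N)"
proof (rule inj_onI)
  fix a b assume a: "a \<in> partitions N" and b: "b \<in> partitions N" and e: "mset a = mset b"
  have "sorted (rev a)" "sorted (rev b)" using a b by (auto simp: partitions_def sorted_wrt_rev)
  hence "rev a = rev b" using e by (metis mset_rev properties_for_sort)
  thus "a = b" by simp
qed

lemma finite_partitions: "finite (partitions N)"
proof -
  have "partitions N \<subseteq> {xs. set xs \<subseteq> {..N} \<and> length xs \<le> N}"
  proof
    fix la assume la: "la \<in> partitions N"
    have "length la \<le> sum_list la" if "\<forall>k\<in>set la. 0 < k" for la :: "nat list"
      using that by (induction la) auto
    moreover have "k \<le> N" if "k \<in> set la" for k using la that member_le_sum_list by (force simp: partitions_def)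
    ultimately show "la \<in> {xs. set xs \<subseteq> {..N} \<and> length xs \<le> N}" using la by (auto simp: partitions_def)
  qed
  thus ?thesis using finite_lists_length_le[of "{..N}" N] finite_subset by blast
qed

lemma cycle_type_in_partitions:
  assumes p: "\<pi> \<in> sym_group N"
  shows "cycle_type N \<pi> \<in> mset ` partitions N"
proof (rule partition_of_mset)
  let ?O = "orbit \<pi> ` {..<N}"
  have fin: "finite A" if "A \<in> ?O" for A using that orbit_lt[OF p] finite_subset by blast
  fix k assume "k \<in># cycle_type N \<pi>"
  then obtain x where "x < N" "k = card (orbit \<pi> x)" by (auto simp: cycle_type_def)
  thus "k > 0" using fin self_in_orbit[OF p, of x] by (auto simp: card_gt_0_iff)
next
  let ?O = "orbit \<pi> ` {..<N}"
  have fin: "finite A" if "A \<in> ?O" for A using that orbit_lt[OF p] finite_subset by blast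
  have "sum_mset (cycle_type N \<pi>) = (\<Sum>A\<in>?O. card A)"
    by (simp add: cycle_type_def sum_unfold_sum_mset)
  also have "\<dots> = card (\<Union>?O)"
  proof (rule card_Union_disjoint[symmetric])
    show "pairwise disjnt ?O" using orbit_eq_if_mem[OF p] by (auto simp: pairwise_def disjnt_def) blast+
  qed (use fin in auto)
  also have "\<Union>?O = {..<N}" using orbit_lt[OF p] self_in_orbit[OF p] by blast
  finally show "sum_mset (cycle_type N \<pi>) = N" by simp
qed

definition class_fun :: "nat \<Rightarrow> ((nat \<Rightarrow> nat) \<Rightarrow> complex) \<Rightarrow> bool" where
  "class_fun N f \<longleftrightarrow> (\<forall>\<pi>\<in>sym_group N. \<forall>\<sigma>\<in>sym_group N. f (\<sigma> \<circ> \<pi> \<circ> inv \<sigma>) = f \<pi>)"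

lemma class_fun_irr_char: "la \<in> partitions N \<Longrightarrow> class_fun N (irr_char la)"
  by (simp add: class_fun_def irr_char_class)

lemma class_fun_cycle_type:
  assumes "class_fun N f" "\<pi> \<in> sym_group N" "\<pi>' \<in> sym_group N" "cycle_type N \<pi> = cycle_type N \<pi>'"
  shows "f \<pi> = f \<pi>'"
  using same_cycle_type_conjugate[OF assms(2-4)] assms(1,2) by (metis class_fun_def)

text \<open>The pairings with the Young symmetrizers show that the characters are linearly
  independent; as there are at most as many cycle types as partitions, they span.\<close>

theorem class_fun_expansion_and_cycle_types:
  shows "class_fun N f \<Longrightarrow> \<pi> \<in> sym_group N \<Longrightarrow>
      f \<pi> = (\<Sum>ka\<in>partitions N. (\<Sum>\<tau>\<in>sym_group N. f \<tau> * ysym ka \<tau>) / ynorm ka * irr_char ka \<pi>)"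
    and "cycle_type N ` sym_group N = mset ` partitions N"
proof -
  define P where "P = partitions N"
  define Ty where "Ty = cycle_type N ` sym_group N"
  define rep where "rep m = (SOME \<pi>. \<pi> \<in> sym_group N \<and> cycle_type N \<pi> = m)" for m
  have rep: "rep m \<in> sym_group N" "cycle_type N (rep m) = m" if "m \<in> Ty" for m
    using someI_ex[of "\<lambda>\<pi>. \<pi> \<in> sym_group N \<and> cycle_type N \<pi> = m"] that unfolding Ty_def rep_def by blast+
  \<comment> \<open>Class functions become vectors indexed by multisets; setting them to 0 outside
    the cycle types that occur places them in a space of dimension \<open>card Ty\<close>.\<close>
  define vec where "vec g m = (if m \<in> Ty then g (rep m) else 0)" for g :: "(nat \<Rightarrow> nat) \<Rightarrow> complex" and m
  have vec: "vec g (cycle_type N \<pi>) = g \<pi>" if "class_fun N g" "\<pi> \<in> sym_group N" for g \<pi>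
    using class_fun_cycle_type[OF that(1) rep(1) that(2)] rep that by (auto simp: vec_def Ty_def)
  define L where "L ka v = (\<Sum>\<tau>\<in>sym_group N. v (cycle_type N \<tau>) * ysym ka \<tau>)" for ka and v :: "nat multiset \<Rightarrow> complex"
  define X where "X ka = vec (irr_char ka)" for ka
  have LX: "L ka (X la) = (if la = ka then ynorm ka else 0)" if "ka \<in> P" "la \<in> P" for ka la
    using that char_ysym_orth[of la N ka] char_ysym_self[of ka N] class_fun_irr_char[of la N]
    by (auto simp: L_def X_def vec P_def)
  have Lsum: "L ka (\<lambda>m. \<Sum>v\<in>V. u v * v m) = (\<Sum>v\<in>V. u v * L ka v)" for ka u and V :: "(nat multiset \<Rightarrow> complex) set"
    unfolding L_def sum_distrib_right sum_distrib_left by (subst sum.swap) (simp only: mult.assoc)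
  have n0: "ynorm ka \<noteq> 0" if "ka \<in> P" for ka using ynorm_nonzero that by (auto simp: P_def)
  have injX: "inj_on X P"
  proof (rule inj_onI)
    fix a b assume "a \<in> P" "b \<in> P" "X a = X b"
    thus "a = b" using LX[of a a] LX[of a b] n0[of a] by presburger
  qed
  have finP: "finite P" by (simp add: P_def finite_partitions)
  have LXsum: "(\<Sum>v\<in>X ` P. u v * L ka v) = u (X ka) * ynorm ka" if "ka \<in> P" for u ka
  proof -
    have "(\<Sum>v\<in>X ` P. u v * L ka v) = (\<Sum>la\<in>P. u (X la) * L ka (X la))"
      by (simp add: sum.reindex[OF injX])
    also have "\<dots> = (\<Sum>la\<in>P. if la = ka then u (X ka) * ynorm ka else 0)"
      using LX that by (intro sum.cong) auto
    finally show ?thesis using that finP by simp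
  qed
  have indep: "fun_space.independent (X ` P)"
  proof
    assume "fun_space.dependent (X ` P)"
    then obtain u where u: "\<exists>v\<in>X ` P. u v \<noteq> 0" "(\<Sum>v\<in>X ` P. (\<lambda>m. u v * v m)) = 0"
      using finP by (subst (asm) fun_space.dependent_finite) auto
    from u(1) obtain ka where ka: "ka \<in> P" "u (X ka) \<noteq> 0" by blast
    have "(\<lambda>m. \<Sum>v\<in>X ` P. u v * v m) = (\<lambda>_. 0)"
    proof
      fix m show "(\<Sum>v\<in>X ` P. u v * v m) = 0"
        using fun_cong[OF u(2), of m] unfolding sum_fun_apply by simp
    qed
    hence "L ka (\<lambda>m. \<Sum>v\<in>X ` P. u v * v m) = 0" by (simp add: L_def)
    hence "u (X ka) * ynorm ka = 0" using Lsum LXsum[OF ka(1)] by simp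
    thus False using ka n0 by simp
  qed
  define \<delta> where "\<delta> = (\<lambda>m m' :: nat multiset. if m' = m then 1 else (0 :: complex))"
  have TyP: "Ty \<subseteq> mset ` P" using cycle_type_in_partitions by (auto simp: Ty_def P_def)
  have finTy: "finite Ty" by (simp add: Ty_def)
  have cTy: "card Ty \<le> card P"
    using card_mono[OF _ TyP] card_image_le[OF finP, of mset] finP by fastforce
  have span\<delta>: "vec g \<in> fun_space.span (\<delta> ` Ty)" for g
  proof -
    have "vec g = (\<Sum>m\<in>Ty. (\<lambda>m'. vec g m * \<delta> m m'))"
    proof
      fix m'
      have "(\<Sum>m\<in>Ty. vec g m * \<delta> m m') = (\<Sum>m\<in>Ty. if m = m' then vec g m else 0)"
        by (rule sum.cong) (auto simp: \<delta>_def)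
      thus "vec g m' = (\<Sum>m\<in>Ty. (\<lambda>m'. vec g m * \<delta> m m')) m'"
        using finTy by (auto simp: sum_fun_apply vec_def)
    qed
    also have "\<dots> \<in> fun_space.span (\<delta> ` Ty)"
      by (intro fun_space.span_sum fun_space.span_scale fun_space.span_base) auto
    finally show ?thesis .
  qed
  have c\<delta>: "card (\<delta> ` Ty) \<le> card P" using card_image_le[OF finTy, of \<delta>] cTy by linarith
  have cX: "card (X ` P) = card P" by (rule card_image[OF injX])
  \<comment> \<open>Independence squeezes the cardinalities: at least as many cycle types occur as
    there are partitions, and every cycle type is a partition. Hence each partition is the cycle
    type of some permutation, without an explicit construction of one.\<close>
  have "card (X ` P) \<le> card (\<delta> ` Ty)"
    using fun_space.independent_span_bound[OF _ indep, of "\<delta> ` Ty"] span\<delta> finTy by (auto simp: X_def)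
  hence "card P \<le> card Ty" using cX card_image_le[OF finTy, of \<delta>] by linarith
  moreover have "card (mset ` P) \<le> card P" by (rule card_image_le[OF finP])
  ultimately have "Ty = mset ` P" using card_subset_eq[OF _ TyP] card_mono[OF _ TyP] finP by fastforce
  thus "cycle_type N ` sym_group N = mset ` partitions N" by (simp add: Ty_def P_def)
  assume f: "class_fun N f" and p: "\<pi> \<in> sym_group N"
  have "vec f \<in> fun_space.span (X ` P)"
  proof (rule ccontr)
    assume n: "vec f \<notin> fun_space.span (X ` P)"
    hence "fun_space.independent (insert (vec f) (X ` P))" using indep by (rule fun_space.independent_insertI)
    hence "card (insert (vec f) (X ` P)) \<le> card (\<delta> ` Ty)"
      using fun_space.independent_span_bound[of "\<delta> ` Ty" "insert (vec f) (X ` P)"] span\<delta> finTy by (auto simp: X_def)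
    moreover have "vec f \<notin> X ` P" using n fun_space.span_base by blast
    ultimately show False using c\<delta> cX finP by simp
  qed
  then obtain u where "vec f = (\<Sum>v\<in>X ` P. (\<lambda>m. u v * v m))"
    using fun_space.span_finite[of "X ` P"] finP by auto
  hence u: "vec f = (\<lambda>m. \<Sum>v\<in>X ` P. u v * v m)" by (intro ext) (simp only: sum_fun_apply)
  have "L ka (vec f) = u (X ka) * ynorm ka" if "ka \<in> P" for ka
    unfolding u Lsum by (rule LXsum[OF that])
  moreover have "L ka (vec f) = (\<Sum>\<tau>\<in>sym_group N. f \<tau> * ysym ka \<tau>)" for ka
    by (simp add: L_def vec[OF f])
  ultimately have uX: "u (X ka) = (\<Sum>\<tau>\<in>sym_group N. f \<tau> * ysym ka \<tau>) / ynorm ka" if "ka \<in> P" for ka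
    using n0[OF that] that by (simp add: field_simps)
  have "f \<pi> = (\<Sum>v\<in>X ` P. u v * v (cycle_type N \<pi>))" using vec[OF f p] u by metis
  also have "\<dots> = (\<Sum>ka\<in>P. u (X ka) * X ka (cycle_type N \<pi>))" by (simp add: sum.reindex[OF injX])
  also have "\<dots> = (\<Sum>ka\<in>P. (\<Sum>\<tau>\<in>sym_group N. f \<tau> * ysym ka \<tau>) / ynorm ka * irr_char ka \<pi>)"
    using uX vec[OF class_fun_irr_char p] by (intro sum.cong) (auto simp: X_def P_def)
  finally show "f \<pi> = (\<Sum>ka\<in>partitions N. (\<Sum>\<tau>\<in>sym_group N. f \<tau> * ysym ka \<tau>) / ynorm ka * irr_char ka \<pi>)"
    by (simp add: P_def)
qed

section \<open>Coefficients of alternants\<close>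

primrec cnt :: "nat \<Rightarrow> (nat \<Rightarrow> nat) set list \<Rightarrow> (nat \<Rightarrow> int) \<Rightarrow> int" where
  "cnt N [] \<alpha> = (if \<forall>i<N. \<alpha> i = 0 then 1 else 0)"
| "cnt N (S # Ss) \<alpha> = (\<Sum>\<gamma>\<in>S. cnt N Ss (\<lambda>i. \<alpha> i - int (\<gamma> i)))"

definition stair :: "nat \<Rightarrow> nat \<Rightarrow> int" where
  "stair N i = int N - 1 - int i"

text \<open>A set of exponent vectors stands for the sum of its monomials. Then \<open>cnt\<close>
  is the coefficient of x^\<alpha> in the product of these polynomials, and \<open>alt\<close> is
  the coefficient of x^\<beta> after multiplication with the Vandermonde determinant, whose terms
  are the signed monomials of the permuted staircases. Exponents are integers so that they can be
  subtracted freely; a negative one has coefficient 0.\<close>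

definition alt :: "nat \<Rightarrow> (nat \<Rightarrow> nat) set list \<Rightarrow> (nat \<Rightarrow> int) \<Rightarrow> int" where
  "alt N Ss \<beta> = (\<Sum>w | w permutes {..<N}. sign w * cnt N Ss (\<lambda>i. \<beta> i - stair N (w i)))"

text \<open>The complete homogeneous polynomial of degree k in N variables; \<open>pstep\<close>
  below is the power sum of degree t. For t = 0 the latter degenerates to a single vector, hence the
  condition t > 0 in \<open>alt_pstep_Cons\<close>.\<close>

definition hstep :: "nat \<Rightarrow> nat \<Rightarrow> (nat \<Rightarrow> nat) set" where
  "hstep N k = {\<gamma>. (\<forall>i\<ge>N. \<gamma> i = 0) \<and> (\<Sum>i<N. \<gamma> i) = k}"

definition pstep :: "nat \<Rightarrow> nat \<Rightarrow> (nat \<Rightarrow> nat) set" where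
  "pstep N t = (\<lambda>i j. if j = i then t else 0) ` {..<N}"

definition symmetric_step :: "nat \<Rightarrow> (nat \<Rightarrow> nat) set \<Rightarrow> bool" where
  "symmetric_step N S \<longleftrightarrow> (\<forall>\<gamma>\<in>S. \<forall>\<tau>. \<tau> permutes {..<N} \<longrightarrow> \<gamma> \<circ> \<tau> \<in> S)"

lemma symmetric_hstep [simp]: "symmetric_step N (hstep N k)"
  unfolding symmetric_step_def hstep_def
  by (auto simp: permutes_def sum.permute[of _ "{..<N}", unfolded o_def, symmetric]
      dest: permutes_not_in)

lemma symmetric_pstep [simp]: "symmetric_step N (pstep N t)"
proof (unfold symmetric_step_def, intro ballI allI impI)
  fix \<gamma> \<tau> assume "\<gamma> \<in> pstep N t" and t: "\<tau> permutes {..<N}"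
  then obtain i where i: "i < N" "\<gamma> = (\<lambda>j. if j = i then t else 0)" by (auto simp: pstep_def)
  have "inv \<tau> i < N" using permutes_in_image[OF permutes_inv[OF t], of i] i by simp
  moreover have "\<gamma> \<circ> \<tau> = (\<lambda>j. if j = inv \<tau> i then t else 0)"
    using permutes_inverses[OF t] i by (auto simp: fun_eq_iff)
  ultimately show "\<gamma> \<circ> \<tau> \<in> pstep N t" unfolding pstep_def by blast
qed

lemma finite_hstep [simp]: "finite (hstep N k)"
proof -
  have "hstep N k \<subseteq> {\<gamma>. \<forall>i. (i \<in> {..<N} \<longrightarrow> \<gamma> i \<in> {..k}) \<and> (i \<notin> {..<N} \<longrightarrow> \<gamma> i = 0)}"
  proof
    fix \<gamma> assume "\<gamma> \<in> hstep N k"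
    hence g: "\<forall>i\<ge>N. \<gamma> i = 0" "(\<Sum>i<N. \<gamma> i) = k" by (auto simp: hstep_def)
    have "\<gamma> i \<le> k" if "i < N" for i using member_le_sum[of i "{..<N}" \<gamma>] that g by auto
    thus "\<gamma> \<in> {\<gamma>. \<forall>i. (i \<in> {..<N} \<longrightarrow> \<gamma> i \<in> {..k}) \<and> (i \<notin> {..<N} \<longrightarrow> \<gamma> i = 0)}" using g by auto
  qed
  thus ?thesis using finite_set_of_finite_funs[of "{..<N}" "{..k}" 0] finite_subset by blast
qed

lemma finite_pstep [simp]: "finite (pstep N t)"
  by (simp add: pstep_def)

lemma cnt_cong: "(\<And>i. i < N \<Longrightarrow> \<alpha> i = \<alpha>' i) \<Longrightarrow> cnt N Ss \<alpha> = cnt N Ss \<alpha>'"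
proof (induction Ss arbitrary: \<alpha> \<alpha>')
  case (Cons S Ss)
  show ?case unfolding cnt.simps by (intro sum.cong refl Cons.IH) (simp add: Cons.prems)
qed auto

lemma cnt_neg: "i < N \<Longrightarrow> \<alpha> i < 0 \<Longrightarrow> cnt N Ss \<alpha> = 0"
proof (induction Ss arbitrary: \<alpha>)
  case (Cons S Ss)
  show ?case unfolding cnt.simps by (intro sum.neutral ballI Cons.IH) (use Cons.prems in auto)
qed auto

lemma alt_Cons: "alt N (S # Ss) \<beta> = (\<Sum>\<gamma>\<in>S. alt N Ss (\<lambda>i. \<beta> i - int (\<gamma> i)))"
  unfolding alt_def cnt.simps sum_distrib_left
  by (subst sum.swap) (intro sum.cong refl arg_cong2[where f="(*)"] cnt_cong, simp)

lemma cnt_permute: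
  assumes "\<And>S. S \<in> set Ss \<Longrightarrow> symmetric_step N S" and t: "\<tau> permutes {..<N}"
  shows "cnt N Ss (\<alpha> \<circ> \<tau>) = cnt N Ss \<alpha>"
  using assms(1)
proof (induction Ss arbitrary: \<alpha>)
  case Nil
  have "(\<forall>i<N. \<alpha> (\<tau> i) = 0) \<longleftrightarrow> (\<forall>i<N. \<alpha> i = 0)"
    using permutes_in_image[OF t] permutes_in_image[OF permutes_inv[OF t]] permutes_inverses[OF t]
    by (metis lessThan_iff)
  thus ?case by simp
next
  case (Cons S Ss)
  have "cnt N (S # Ss) (\<alpha> \<circ> \<tau>) = (\<Sum>\<gamma>\<in>S. cnt N Ss (\<lambda>i. (\<alpha> \<circ> \<tau>) i - int ((\<gamma> \<circ> \<tau>) i)))"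
    unfolding cnt.simps
  proof (rule sum.reindex_bij_witness[where i="\<lambda>\<gamma>. \<gamma> \<circ> \<tau>" and j="\<lambda>\<gamma>. \<gamma> \<circ> inv \<tau>"])
    fix \<gamma> assume "\<gamma> \<in> S"
    show "(\<gamma> \<circ> inv \<tau>) \<circ> \<tau> = \<gamma>" "(\<gamma> \<circ> \<tau>) \<circ> inv \<tau> = \<gamma>"
      using permutes_inverses[OF t] by (auto simp: fun_eq_iff)
    show "\<gamma> \<circ> inv \<tau> \<in> S" "\<gamma> \<circ> \<tau> \<in> S"
      using Cons.prems[of S] \<open>\<gamma> \<in> S\<close> t permutes_inv[OF t] by (auto simp: symmetric_step_def)
    show "cnt N Ss (\<lambda>i. (\<alpha> \<circ> \<tau>) i - int ((\<gamma> \<circ> inv \<tau> \<circ> \<tau>) i)) = cnt N Ss (\<lambda>i. (\<alpha> \<circ> \<tau>) i - int (\<gamma> i))"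
      using permutes_inverses[OF t] by simp
  qed
  also have "\<dots> = (\<Sum>\<gamma>\<in>S. cnt N Ss (\<lambda>i. \<alpha> i - int (\<gamma> i)))"
  proof (rule sum.cong[OF refl])
    fix \<gamma> assume "\<gamma> \<in> S"
    have "(\<lambda>i. (\<alpha> \<circ> \<tau>) i - int ((\<gamma> \<circ> \<tau>) i)) = (\<lambda>i. \<alpha> i - int (\<gamma> i)) \<circ> \<tau>" by auto
    thus "cnt N Ss (\<lambda>i. (\<alpha> \<circ> \<tau>) i - int ((\<gamma> \<circ> \<tau>) i)) = cnt N Ss (\<lambda>i. \<alpha> i - int (\<gamma> i))"
      using Cons.IH Cons.prems by (simp only: list.set_intros)
  qed
  finally show ?case by simp
qed

text \<open>The step sets are symmetric and the Vandermonde determinant is alternating, so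
  relabelling the permutations w by \<tau> costs only the sign.\<close>

lemma alt_permute:
  assumes S: "\<And>S. S \<in> set Ss \<Longrightarrow> symmetric_step N S" and t: "\<tau> permutes {..<N}"
  shows "alt N Ss (\<beta> \<circ> \<tau>) = sign \<tau> * alt N Ss \<beta>"
proof -
  have perm: "permutation w" if "w permutes {..<N}" for w using that permutation_permutes by blast
  have "alt N Ss (\<beta> \<circ> \<tau>) = (\<Sum>w | w permutes {..<N}. sign (w \<circ> \<tau>) * cnt N Ss (\<lambda>i. (\<beta> \<circ> \<tau>) i - stair N ((w \<circ> \<tau>) i)))"
    unfolding alt_def
    by (rule sum.reindex_bij_witness[where i="\<lambda>w. w \<circ> \<tau>" and j="\<lambda>w. w \<circ> inv \<tau>"])
       (auto simp: permutes_compose permutes_inv t o_assoc[symmetric] permutes_inv_o[OF t] simp del: o_apply)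
  also have "\<dots> = (\<Sum>w | w permutes {..<N}. sign \<tau> * (sign w * cnt N Ss (\<lambda>i. \<beta> i - stair N (w i))))"
  proof (intro sum.cong refl)
    fix w assume "w \<in> {w. w permutes {..<N}}"
    hence w: "w permutes {..<N}" by simp
    have "(\<lambda>i. (\<beta> \<circ> \<tau>) i - stair N ((w \<circ> \<tau>) i)) = (\<lambda>i. \<beta> i - stair N (w i)) \<circ> \<tau>" by auto
    thus "sign (w \<circ> \<tau>) * cnt N Ss (\<lambda>i. (\<beta> \<circ> \<tau>) i - stair N ((w \<circ> \<tau>) i))
        = sign \<tau> * (sign w * cnt N Ss (\<lambda>i. \<beta> i - stair N (w i)))"
      using cnt_permute[OF S t] sign_compose[OF perm[OF w] perm[OF t]] by simp
  qed
  finally show ?thesis by (simp add: alt_def sum_distrib_left)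
qed

lemma alt_eq_0_if_repeated:
  assumes S: "\<And>S. S \<in> set Ss \<Longrightarrow> symmetric_step N S" and ij: "i < N" "j < N" "i \<noteq> j" "\<beta> i = \<beta> j"
  shows "alt N Ss \<beta> = 0"
proof -
  have t: "Transposition.transpose i j permutes {..<N}" using ij by (intro permutes_swap_id) auto
  have "\<beta> \<circ> Transposition.transpose i j = \<beta>" using ij by (auto simp: fun_eq_iff Transposition.transpose_def)
  hence "alt N Ss \<beta> = - alt N Ss \<beta>" using alt_permute[OF S t, where \<beta>=\<beta>] ij by (simp add: sign_swap_id)
  thus ?thesis by simp
qed

lemma alt_neg:
  assumes "i < N" "\<beta> i < 0"
  shows "alt N Ss \<beta> = 0"
  unfolding alt_def
proof (rule sum.neutral, intro ballI)
  fix w assume "w \<in> {w. w permutes {..<N}}"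
  hence "w i < N" using permutes_in_image[of w "{..<N}" i] assms by auto
  hence "cnt N Ss (\<lambda>i. \<beta> i - stair N (w i)) = 0" using assms by (intro cnt_neg[of i]) (auto simp: stair_def)
  thus "sign w * cnt N Ss (\<lambda>i. \<beta> i - stair N (w i)) = 0" by simp
qed

definition strict_dec :: "nat \<Rightarrow> (nat \<Rightarrow> int) \<Rightarrow> bool" where
  "strict_dec N \<beta> \<longleftrightarrow> (\<forall>i. Suc i < N \<longrightarrow> \<beta> (Suc i) < \<beta> i)"

text \<open>Pieri's rule: the terms violating the interlacing condition cancel in pairs, by swapping
  two neighbouring entries at the first violation.\<close>

lemma alt_hstep_interlacing:
  assumes S: "\<And>S. S \<in> set Ss \<Longrightarrow> symmetric_step N S" and dec: "strict_dec N \<beta>"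
    and nz: "alt N (hstep N k # Ss) \<beta> \<noteq> 0"
  shows "\<exists>\<gamma>\<in>hstep N k. (\<forall>i. Suc i < N \<longrightarrow> \<beta> (Suc i) < \<beta> i - int (\<gamma> i)) \<and> alt N Ss (\<lambda>i. \<beta> i - int (\<gamma> i)) \<noteq> 0"
proof (rule ccontr)
  define viol where "viol \<gamma> i \<longleftrightarrow> Suc i < N \<and> \<beta> i - int (\<gamma> i) \<le> \<beta> (Suc i)" for \<gamma> :: "nat \<Rightarrow> nat" and i
  define Bad where "Bad = {\<gamma> \<in> hstep N k. \<exists>i. viol \<gamma> i}"
  define f where "f \<gamma> = alt N Ss (\<lambda>i. \<beta> i - int (\<gamma> i))" for \<gamma> :: "nat \<Rightarrow> nat"
  assume "\<not> ?thesis"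
  hence good0: "f \<gamma> = 0" if "\<gamma> \<in> hstep N k - Bad" for \<gamma>
    using that unfolding f_def Bad_def viol_def by (auto simp: not_le)
  define p where "p \<gamma> = (LEAST i. viol \<gamma> i)" for \<gamma>
  \<comment> \<open>\<open>\<theta>\<close> exchanges the entries i and i + 1 of \<beta> - \<gamma>
    at the first violation i, expressed as a change of \<gamma>; the violation is what makes the
    subtraction of naturals exact.\<close>
  define \<theta> where "\<theta> \<gamma> = (let i = p \<gamma> in \<gamma>(i := nat (\<beta> i - \<beta> (Suc i)) + \<gamma> (Suc i), Suc i := \<gamma> i - nat (\<beta> i - \<beta> (Suc i))))" for \<gamma>
  have pv: "viol \<gamma> (p \<gamma>)" if "\<gamma> \<in> Bad" for \<gamma>
    using that LeastI_ex[of "viol \<gamma>"] by (auto simp: Bad_def p_def)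
  have \<theta>: "\<theta> \<gamma> \<in> Bad" "\<theta> (\<theta> \<gamma>) = \<gamma>" "f (\<theta> \<gamma>) = - f \<gamma>" if g: "\<gamma> \<in> Bad" for \<gamma>
  proof -
    define i where "i = p \<gamma>"
    define D where "D = nat (\<beta> i - \<beta> (Suc i))"
    have v: "Suc i < N" "\<beta> i - int (\<gamma> i) \<le> \<beta> (Suc i)" using pv[OF g] by (auto simp: viol_def i_def)
    have D: "int D = \<beta> i - \<beta> (Suc i)" "D \<le> \<gamma> i" using dec v by (auto simp: D_def strict_dec_def)
    have th: "\<theta> \<gamma> = \<gamma>(i := D + \<gamma> (Suc i), Suc i := \<gamma> i - D)"
      by (simp add: \<theta>_def i_def[symmetric] D_def Let_def)
    have gin: "\<gamma> \<in> hstep N k" using g by (simp add: Bad_def)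
    have "(\<Sum>j<N. \<theta> \<gamma> j) = (\<Sum>j<N. \<gamma> j)"
    proof -
      have split: "(\<Sum>j<N. h j) = h i + h (Suc i) + (\<Sum>j\<in>{..<N} - {i, Suc i}. h j)" for h :: "nat \<Rightarrow> nat"
      proof -
        have "(\<Sum>j<N. h j) = h i + (\<Sum>j\<in>{..<N} - {i}. h j)" using v by (intro sum.remove) auto
        also have "(\<Sum>j\<in>{..<N} - {i}. h j) = h (Suc i) + (\<Sum>j\<in>{..<N} - {i} - {Suc i}. h j)"
          using v by (intro sum.remove) auto
        also have "{..<N} - {i} - {Suc i} = {..<N} - {i, Suc i}" by auto
        finally show ?thesis by simp
      qed
      have "(\<Sum>j\<in>{..<N} - {i, Suc i}. \<theta> \<gamma> j) = (\<Sum>j\<in>{..<N} - {i, Suc i}. \<gamma> j)"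
        by (rule sum.cong) (auto simp: th)
      thus ?thesis using split[of "\<theta> \<gamma>"] split[of \<gamma>] D(2) by (simp add: th)
    qed
    moreover have "\<forall>j\<ge>N. \<theta> \<gamma> j = 0" using gin v by (auto simp: th hstep_def)
    ultimately have thin: "\<theta> \<gamma> \<in> hstep N k" using gin by (simp add: hstep_def)
    have "int (\<theta> \<gamma> i) \<ge> \<beta> i - \<beta> (Suc i)" using D by (simp add: th)
    hence vi: "viol (\<theta> \<gamma>) i" using v by (simp add: viol_def)
    thus "\<theta> \<gamma> \<in> Bad" using thin by (auto simp: Bad_def)
    \<comment> \<open>A violation at j involves only the entry j of \<gamma>, so changing the
      entries i and i + 1 creates none before i; this makes \<open>\<theta>\<close> an
      involution.\<close>
    have pth: "p (\<theta> \<gamma>) = i"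
      unfolding p_def
    proof (rule Least_equality[of "viol (\<theta> \<gamma>)", OF vi])
      fix j assume vj: "viol (\<theta> \<gamma>) j"
      show "i \<le> j"
      proof (rule ccontr)
        assume "\<not> i \<le> j"
        hence "viol \<gamma> j" using vj by (auto simp: viol_def th)
        hence "i \<le> j" unfolding i_def p_def by (rule Least_le)
        thus False using \<open>\<not> i \<le> j\<close> by simp
      qed
    qed
    have "\<theta> (\<theta> \<gamma>) = (\<theta> \<gamma>)(i := D + \<theta> \<gamma> (Suc i), Suc i := \<theta> \<gamma> i - D)"
      by (simp add: \<theta>_def[of "\<theta> \<gamma>"] pth D_def Let_def)
    also have "\<dots> = \<gamma>" using D(2) by (auto simp: th fun_eq_iff)
    finally show "\<theta> (\<theta> \<gamma>) = \<gamma>" .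
    have t: "Transposition.transpose i (Suc i) permutes {..<N}" using v by (intro permutes_swap_id) auto
    have "(\<lambda>j. \<beta> j - int (\<theta> \<gamma> j)) = (\<lambda>j. \<beta> j - int (\<gamma> j)) \<circ> Transposition.transpose i (Suc i)"
      using D by (auto simp: fun_eq_iff th Transposition.transpose_def)
    thus "f (\<theta> \<gamma>) = - f \<gamma>" unfolding f_def using alt_permute[OF S t] by (simp add: sign_swap_id)
  qed
  have "(\<Sum>\<gamma>\<in>Bad. f \<gamma>) = (\<Sum>\<gamma>\<in>Bad. - f \<gamma>)"
    by (rule sum.reindex_bij_witness[where i=\<theta> and j=\<theta>]) (auto simp: \<theta>)
  hence "(\<Sum>\<gamma>\<in>Bad. f \<gamma>) = 0" by (simp add: sum_negf)
  moreover have "(\<Sum>\<gamma>\<in>hstep N k. f \<gamma>) = (\<Sum>\<gamma>\<in>Bad. f \<gamma>)"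
    by (rule sum.mono_neutral_right) (use good0 in \<open>auto simp: Bad_def\<close>)
  ultimately show False using nz by (simp add: alt_Cons f_def)
qed

text \<open>The staircase decreases, so the identity maximises its initial sums. At the first index
  moved by w the value of w grows, which makes the initial sum ending there strictly
  smaller.\<close>

lemma sum_permute_le_initial:
  assumes w: "w permutes {..<N}" and k: "k \<le> N"
  shows "(\<Sum>i<k. stair N (w i)) \<le> (\<Sum>i<k. stair N i)"
    and "w \<noteq> id \<Longrightarrow> \<exists>k\<le>N. (\<Sum>i<k. stair N (w i)) < (\<Sum>i<k. stair N i)"
proof -
  have "inj_on w A" for A using permutes_inj[OF w] by (simp add: inj_on_def)
  hence "card (w ` {..<k}) = k" "(\<Sum>i<k. w i) = \<Sum>(w ` {..<k})"
    by (auto simp: card_image sum.reindex)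
  hence "(\<Sum>i<k. i) \<le> (\<Sum>i<k. w i)" using sum_lessThan_card(1)[of "w ` {..<k}"] by simp
  hence "(\<Sum>i<k. int i) \<le> (\<Sum>i<k. int (w i))" by (simp flip: of_nat_sum)
  thus "(\<Sum>i<k. stair N (w i)) \<le> (\<Sum>i<k. stair N i)"
    by (simp add: stair_def sum_subtractf)
  assume "w \<noteq> id"
  hence ex: "\<exists>i. w i \<noteq> i" by (auto simp: fun_eq_iff)
  define m where "m = (LEAST i. w i \<noteq> i)"
  have m: "w m \<noteq> m" unfolding m_def using ex by (rule LeastI_ex)
  have lt: "w i = i" if "i < m" for i using not_less_Least[of i "\<lambda>i. w i \<noteq> i"] that by (auto simp: m_def)
  have "m < N" using m w by (auto simp: permutes_def)
  have "w m > m"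
  proof (rule ccontr)
    assume "\<not> w m > m"
    hence "w m < m" using m by simp
    hence "w (w m) = w m" by (rule lt)
    hence "w m = m" using w by (auto dest: permutes_inj simp: inj_eq)
    thus False using m by simp
  qed
  hence "(\<Sum>i<Suc m. stair N (w i)) < (\<Sum>i<Suc m. stair N i)"
    using lt by (simp add: stair_def)
  thus "\<exists>k\<le>N. (\<Sum>i<k. stair N (w i)) < (\<Sum>i<k. stair N i)" using \<open>m < N\<close> by (intro exI[of _ "Suc m"]) auto
qed

lemma strict_dec_sorted: "strict_dec N \<beta> \<Longrightarrow> i < j \<Longrightarrow> j < N \<Longrightarrow> \<beta> j < \<beta> i"
proof (induction j)
  case (Suc j)
  hence "\<beta> (Suc j) < \<beta> j" by (auto simp: strict_dec_def)
  moreover have "i = j \<or> \<beta> j < \<beta> i" using Suc by fastforce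
  ultimately show ?case by auto
qed simp

text \<open>Pieri's rule peels off one horizontal strip per step, and interlacing shows that each
  strip accounts for at most one new row. So the j strips peeled last lie in the first j rows, which
  is the bound on partial sums: the triangularity of Kostka numbers, here for the vector \<beta> -
  \<open>stair N\<close>.\<close>

lemma alt_hsteps_dominance:
  assumes "strict_dec N \<beta>" "alt N (map (hstep N) ks) \<beta> \<noteq> 0"
  shows "(\<forall>i<N. stair N i \<le> \<beta> i) \<and> (\<forall>i<N. length ks \<le> i \<longrightarrow> \<beta> i = stair N i) \<and>
     (\<Sum>i<N. \<beta> i - stair N i) = int (sum_list ks) \<and>
     (\<forall>j\<le>N. (\<Sum>i<j. \<beta> i - stair N i) \<ge> int (sum_list (drop (length ks - j) ks)))"
  using assms
proof (induction ks arbitrary: \<beta>)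
  case Nil
  then obtain w where w: "w permutes {..<N}" "cnt N [] (\<lambda>i. \<beta> i - stair N (w i)) \<noteq> 0"
    unfolding alt_def by (metis (no_types, lifting) list.map(1) mem_Collect_eq mult_zero_right sum.neutral)
  hence b: "\<beta> i = stair N (w i)" if "i < N" for i using that by (auto split: if_splits)
  \<comment> \<open>A strictly decreasing rearrangement of the staircase is the staircase itself: at
    the first index m moved by w, the larger entry \<open>stair N m\<close> would appear only at a
    later place.\<close>
  have "w = id"
  proof (rule ccontr)
    assume "w \<noteq> id"
    define m where "m = (LEAST i. w i \<noteq> i)"
    have "\<exists>i. w i \<noteq> i" using \<open>w \<noteq> id\<close> by (auto simp: fun_eq_iff)
    hence m: "w m \<noteq> m" unfolding m_def by (rule LeastI_ex)
    have lt: "w i = i" if "i < m" for i using not_less_Least[of i "\<lambda>i. w i \<noteq> i"] that by (auto simp: m_def)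
    have mN: "m < N" using m w by (auto simp: permutes_def)
    define l where "l = inv w m"
    have wl: "w l = m" using permutes_inverses[OF w(1)] by (simp add: l_def)
    have "l < N" using permutes_in_image[OF permutes_inv[OF w(1)], of m] mN by (simp add: l_def)
    have "l \<noteq> m" using wl m by auto
    have "\<not> l < m" using lt[of l] wl \<open>l \<noteq> m\<close> by auto
    hence "m < l" using \<open>l \<noteq> m\<close> by simp
    hence "\<beta> l < \<beta> m" using strict_dec_sorted[OF Nil(1)] \<open>l < N\<close> by blast
    hence "w m < m" using b[OF \<open>l < N\<close>] b[OF mN] wl by (simp add: stair_def)
    hence "w (w m) = w m" by (rule lt)
    hence "w m = m" using w(1) by (auto dest: permutes_inj simp: inj_eq)
    thus False using m by simp
  qed
  thus ?case using b by simp
next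
  case (Cons k ks)
  have "\<exists>\<gamma>\<in>hstep N k. (\<forall>i. Suc i < N \<longrightarrow> \<beta> (Suc i) < \<beta> i - int (\<gamma> i)) \<and>
      alt N (map (hstep N) ks) (\<lambda>i. \<beta> i - int (\<gamma> i)) \<noteq> 0"
    using Cons.prems by (intro alt_hstep_interlacing) auto
  then obtain \<gamma> where \<gamma>: "\<gamma> \<in> hstep N k" "\<And>i. Suc i < N \<Longrightarrow> \<beta> (Suc i) < \<beta> i - int (\<gamma> i)"
    "alt N (map (hstep N) ks) (\<lambda>i. \<beta> i - int (\<gamma> i)) \<noteq> 0" by blast
  define \<zeta> where "\<zeta> i = \<beta> i - int (\<gamma> i)" for i
  have "strict_dec N \<zeta>"
    unfolding strict_dec_def \<zeta>_def using \<gamma>(2) by (smt (verit) of_nat_0_le_iff)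
  from Cons.IH[OF this] \<gamma>(3)
  have IH: "\<And>i. i < N \<Longrightarrow> stair N i \<le> \<zeta> i" "\<And>i. i < N \<Longrightarrow> length ks \<le> i \<Longrightarrow> \<zeta> i = stair N i"
    "(\<Sum>i<N. \<zeta> i - stair N i) = int (sum_list ks)"
    "\<And>j. j \<le> N \<Longrightarrow> (\<Sum>i<j. \<zeta> i - stair N i) \<ge> int (sum_list (drop (length ks - j) ks))"
    by (auto simp: \<zeta>_def)
  have ge: "\<zeta> i \<le> \<beta> i" for i by (simp add: \<zeta>_def)
  have 1: "stair N i \<le> \<beta> i" if "i < N" for i using IH(1)[OF that] ge[of i] by linarith
  have 2: "\<beta> i = stair N i" if i: "i < N" "length (k # ks) \<le> i" for i
  proof -
    obtain i' where i': "i = Suc i'" using i by (cases i) auto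
    have "\<beta> i < \<zeta> i'" using \<gamma>(2)[of i'] i i' by (simp add: \<zeta>_def)
    also have "\<zeta> i' = stair N i'" using IH(2)[of i'] i i' by simp
    finally show ?thesis using 1[OF i(1)] i' by (simp add: stair_def)
  qed
  have "(\<Sum>i<N. \<beta> i - stair N i) = (\<Sum>i<N. \<zeta> i - stair N i) + (\<Sum>i<N. int (\<gamma> i))"
    unfolding sum.distrib[symmetric] by (rule sum.cong) (auto simp: \<zeta>_def)
  also have "(\<Sum>i<N. int (\<gamma> i)) = int k" using \<gamma>(1) by (simp add: hstep_def flip: of_nat_sum)
  finally have 3: "(\<Sum>i<N. \<beta> i - stair N i) = int (sum_list (k # ks))" using IH(3) by simp
  have 4: "(\<Sum>i<j. \<beta> i - stair N i) \<ge> int (sum_list (drop (length (k # ks) - j) (k # ks)))" if j: "j \<le> N" for j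
  proof (cases "j \<le> length ks")
    case True
    have "int (sum_list (drop (length ks - j) ks)) \<le> (\<Sum>i<j. \<zeta> i - stair N i)" by (rule IH(4)[OF j])
    also have "\<dots> \<le> (\<Sum>i<j. \<beta> i - stair N i)" using ge by (intro sum_mono) simp
    finally show ?thesis using True by (simp add: Suc_diff_le)
  next
    case False
    have "(\<Sum>i<N. \<beta> i - stair N i) = (\<Sum>i<j. \<beta> i - stair N i)"
      by (rule sum.mono_neutral_right) (use j False 2 in auto)
    thus ?thesis using 3 False by simp
  qed
  show ?case using 1 2 3 4 by blast
qed

definition step_lists :: "nat \<Rightarrow> (nat \<Rightarrow> nat) set list \<Rightarrow> (nat \<Rightarrow> int) \<Rightarrow> (nat \<Rightarrow> nat) list set" where
  "step_lists N Ss \<alpha> = {cs. list_all2 (\<in>) cs Ss \<and> (\<forall>i<N. int (\<Sum>\<gamma>\<leftarrow>cs. \<gamma> i) = \<alpha> i)}"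

lemma cnt_eq_card:
  assumes "\<And>S. S \<in> set Ss \<Longrightarrow> finite S"
  shows "finite (step_lists N Ss \<alpha>) \<and> cnt N Ss \<alpha> = int (card (step_lists N Ss \<alpha>))"
  using assms
proof (induction Ss arbitrary: \<alpha>)
  case Nil
  have "step_lists N [] \<alpha> = (if \<forall>i<N. \<alpha> i = 0 then {[]} else {})"
    by (auto simp: step_lists_def)
  thus ?case by simp
next
  case (Cons S Ss)
  let ?T = "\<lambda>\<gamma>. step_lists N Ss (\<lambda>i. \<alpha> i - int (\<gamma> i))"
  have eq: "step_lists N (S # Ss) \<alpha> = (\<Union>\<gamma>\<in>S. Cons \<gamma> ` ?T \<gamma>)"
  proof (intro equalityI subsetI)
    fix cs assume cs: "cs \<in> step_lists N (S # Ss) \<alpha>"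
    then obtain \<gamma> cs' where c: "cs = \<gamma> # cs'" "\<gamma> \<in> S" "list_all2 (\<in>) cs' Ss"
      by (auto simp: step_lists_def list_all2_Cons2)
    have "int (\<Sum>\<gamma>\<leftarrow>cs'. \<gamma> i) = \<alpha> i - int (\<gamma> i)" if "i < N" for i
      using cs that unfolding step_lists_def c(1) by fastforce
    hence "cs' \<in> ?T \<gamma>" using c(3) by (simp add: step_lists_def)
    thus "cs \<in> (\<Union>\<gamma>\<in>S. Cons \<gamma> ` ?T \<gamma>)" using c by blast
  next
    fix cs assume "cs \<in> (\<Union>\<gamma>\<in>S. Cons \<gamma> ` ?T \<gamma>)"
    then obtain \<gamma> cs' where c: "cs = \<gamma> # cs'" "\<gamma> \<in> S" "cs' \<in> ?T \<gamma>" by blast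
    thus "cs \<in> step_lists N (S # Ss) \<alpha>" by (simp add: step_lists_def)
  qed
  have S: "finite S" using Cons.prems by simp
  have IH: "finite (?T \<gamma>)" "cnt N Ss (\<lambda>i. \<alpha> i - int (\<gamma> i)) = int (card (?T \<gamma>))" for \<gamma>
    using Cons.IH Cons.prems by auto
  have "card (step_lists N (S # Ss) \<alpha>) = (\<Sum>\<gamma>\<in>S. card (Cons \<gamma> ` ?T \<gamma>))"
    unfolding eq by (rule card_UN_disjoint) (use S IH in auto)
  also have "\<dots> = (\<Sum>\<gamma>\<in>S. card (?T \<gamma>))" by (intro sum.cong refl card_image) (auto simp: inj_on_def)
  finally show ?case using S IH unfolding eq by simp
qed

section \<open>Permutation characters as counts of fixed colourings\<close>

definition colourings :: "nat \<Rightarrow> (nat \<Rightarrow> int) \<Rightarrow> (nat \<Rightarrow> nat) set" where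
  "colourings N \<alpha> = {f \<in> {..<N} \<rightarrow>\<^sub>E {..<N}. \<forall>i<N. int (card {x. x < N \<and> f x = i}) = \<alpha> i}"

text \<open>The permutation character on colourings with prescribed class sizes. The sizes are
  integers because differences of a bead vector and a permuted staircase are substituted for them; a
  negative size leaves no colouring and the value 0.\<close>

definition psi :: "nat \<Rightarrow> (nat \<Rightarrow> int) \<Rightarrow> (nat \<Rightarrow> nat) \<Rightarrow> int" where
  "psi N \<alpha> \<pi> = int (card {f \<in> colourings N \<alpha>. \<pi> \<in> stab N f})"

lemma finite_colourings [simp]: "finite (colourings N \<alpha>)"
  unfolding colourings_def by (rule finite_subset[of _ "{..<N} \<rightarrow>\<^sub>E {..<N}"]) (auto intro: finite_PiE)

lemma colourings_lt: "f \<in> colourings N \<alpha> \<Longrightarrow> x < N \<Longrightarrow> f x < N"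
  by (auto simp: colourings_def)

lemma same_fibres_permute:
  assumes "\<And>c. card {x. x < N \<and> f x = c} = card {x. x < N \<and> g x = c}"
  shows "\<exists>\<sigma>\<in>sym_group N. \<forall>x<N. f x = g (\<sigma> x)"
proof -
  have "image_mset f (mset_set {..<N}) = image_mset g (mset_set {..<N})"
    by (rule multiset_eqI) (use assms in \<open>simp add: count_image_mset_eq_card_vimage\<close>)
  then obtain p where "p permutes {..<N}" "\<forall>x\<in>{..<N}. f x = g (p x)"
    using image_mset_eq_implies_permutes[of "{..<N}" f g] by auto
  thus ?thesis by (auto simp: sym_group_def)
qed

lemma card_compose_sym:
  assumes "\<sigma> \<in> sym_group N"
  shows "card {x. x < N \<and> P (\<sigma> x)} = card {x. x < N \<and> P x}"
proof (rule bij_betw_same_card[of \<sigma>], rule bij_betw_imageI)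
  show "inj_on \<sigma> {x. x < N \<and> P (\<sigma> x)}" using sym_group_bij[OF assms] by (auto simp: bij_def inj_on_def)
  show "\<sigma> ` {x. x < N \<and> P (\<sigma> x)} = {x. x < N \<and> P x}"
  proof (intro equalityI subsetI)
    fix y assume "y \<in> {x. x < N \<and> P x}"
    thus "y \<in> \<sigma> ` {x. x < N \<and> P (\<sigma> x)}"
      using sym_group_lt[OF sym_group_inv[OF assms]] sym_group_inv_simps(5)[OF assms, of y]
      by (intro image_eqI[of _ _ "inv \<sigma> y"]) auto
  qed (auto simp: sym_group_lt[OF assms])
qed

definition act :: "nat \<Rightarrow> (nat \<Rightarrow> nat) \<Rightarrow> (nat \<Rightarrow> nat) \<Rightarrow> nat \<Rightarrow> nat" where
  "act N f \<sigma> = restrict (f \<circ> \<sigma>) {..<N}"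

lemma act_in_colourings:
  assumes "f \<in> colourings N \<alpha>" "\<sigma> \<in> sym_group N"
  shows "act N f \<sigma> \<in> colourings N \<alpha>"
proof -
  have "{x. x < N \<and> act N f \<sigma> x = i} = {x. x < N \<and> f (\<sigma> x) = i}" for i by (auto simp: act_def)
  thus ?thesis using assms card_compose_sym[OF assms(2), of "\<lambda>y. f y = _"] sym_group_lt[OF assms(2)]
    by (auto simp: colourings_def act_def)
qed

lemma colourings_ext:
  assumes "f \<in> colourings N \<alpha>" "f' \<in> colourings N \<alpha>'" "\<And>x. x < N \<Longrightarrow> f x = f' x"
  shows "f = f'"
  by (rule PiE_ext[of f "{..<N}" "\<lambda>_. {..<N}"]) (use assms in \<open>auto simp: colourings_def\<close>)

text \<open>Orbit counting: the elements of \<open>stab g\<close> carrying \<open>f\<^sub>0\<close> to \<open>f\<close> form a coset of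
  \<open>stab f \<inter> stab g\<close>.\<close>

lemma sum_psi_stab:
  fixes g :: "nat \<Rightarrow> nat"
  assumes g: "\<And>x. x < N \<Longrightarrow> g x < l"
  defines "ty \<equiv> \<lambda>f. map (\<lambda>j i. card {x. x < N \<and> f x = i \<and> g x = j}) (rev [0..<l])"
  shows "(\<Sum>\<pi>\<in>stab N g. psi N \<alpha> \<pi>) = int (card (stab N g)) * int (card (ty ` colourings N \<alpha>))"
proof -
  let ?F = "colourings N \<alpha>"
  have cls: "(\<Sum>f\<in>{f \<in> ?F. ty f = m}. card (stab N f \<inter> stab N g)) = card (stab N g)" if m: "m \<in> ty ` ?F" for m
  proof -
    obtain f0 where f0: "f0 \<in> ?F" "ty f0 = m" using m by blast
    let ?C = "{f \<in> ?F. ty f = m}"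
    have sub: "act N f0 \<sigma> \<in> ?C" if s: "\<sigma> \<in> stab N g" for \<sigma>
    proof -
      have sg: "\<sigma> \<in> sym_group N" using s by (rule stab_sub)
      have "card {x. x < N \<and> act N f0 \<sigma> x = i \<and> g x = j} = card {x. x < N \<and> f0 x = i \<and> g x = j}" for i j
      proof -
        have "{x. x < N \<and> act N f0 \<sigma> x = i \<and> g x = j} = {x. x < N \<and> (\<lambda>y. f0 y = i \<and> g y = j) (\<sigma> x)}"
          using s by (auto simp: act_def stab_def)
        thus ?thesis using card_compose_sym[OF sg, of "\<lambda>y. f0 y = i \<and> g y = j"] by simp
      qed
      thus ?thesis using f0 act_in_colourings[OF f0(1) sg] by (simp add: ty_def)
    qed
    have fib: "card (stab N f \<inter> stab N g) = card {\<sigma> \<in> stab N g. act N f0 \<sigma> = f}" if f: "f \<in> ?C" for f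
    proof -
      have cardeq: "card {x. x < N \<and> f x = i \<and> g x = j} = card {x. x < N \<and> f0 x = i \<and> g x = j}" for i j
      proof (cases "j < l")
        case True
        have "ty f = ty f0" using f f0 by simp
        hence "\<forall>j\<in>set (rev [0..<l]). (\<lambda>i. card {x. x < N \<and> f x = i \<and> g x = j}) = (\<lambda>i. card {x. x < N \<and> f0 x = i \<and> g x = j})"
          unfolding ty_def by (simp only: map_eq_conv)
        thus ?thesis using True by (auto dest: fun_cong)
      next
        case False
        hence "{x. x < N \<and> h x = i \<and> g x = j} = {}" for h :: "nat \<Rightarrow> nat" using g by auto
        note this[of f] this[of f0]
        thus ?thesis by (simp only:)
      qed
      have "card {x. x < N \<and> (f x, g x) = c} = card {x. x < N \<and> (f0 x, g x) = c}" for c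
        using cardeq[of "fst c" "snd c"] by (cases c) auto
      from same_fibres_permute[of N "\<lambda>x. (f x, g x)" "\<lambda>x. (f0 x, g x)", OF this]
      obtain \<sigma> where s: "\<sigma> \<in> sym_group N" "\<forall>x<N. f x = f0 (\<sigma> x) \<and> g x = g (\<sigma> x)" by auto
      have sst: "\<sigma> \<in> stab N g" using s by (auto simp: stab_def)
      note si = sym_group_inv_simps[OF s(1)]
      have "bij_betw (\<lambda>\<rho>. \<sigma> \<circ> \<rho>) (stab N f \<inter> stab N g) {\<sigma> \<in> stab N g. act N f0 \<sigma> = f}"
      proof (rule bij_betw_byWitness[where f'="\<lambda>\<rho>. inv \<sigma> \<circ> \<rho>"])
        show "\<forall>\<rho>\<in>stab N f \<inter> stab N g. inv \<sigma> \<circ> (\<sigma> \<circ> \<rho>) = \<rho>" by (simp add: o_assoc si)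
        show "\<forall>\<rho>\<in>{\<sigma> \<in> stab N g. act N f0 \<sigma> = f}. \<sigma> \<circ> (inv \<sigma> \<circ> \<rho>) = \<rho>" by (simp add: o_assoc si)
        show "(\<lambda>\<rho>. \<sigma> \<circ> \<rho>) ` (stab N f \<inter> stab N g) \<subseteq> {\<sigma> \<in> stab N g. act N f0 \<sigma> = f}"
        proof safe
          fix \<rho> assume r: "\<rho> \<in> stab N f" "\<rho> \<in> stab N g"
          show st: "\<sigma> \<circ> \<rho> \<in> stab N g" using sst r by blast
          show "act N f0 (\<sigma> \<circ> \<rho>) = f"
          proof (rule colourings_ext)
            show "act N f0 (\<sigma> \<circ> \<rho>) \<in> ?F" using act_in_colourings[OF f0(1) stab_sub[OF st]] .
            show "f \<in> ?F" using f by simp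
            fix x assume "x < N"
            thus "act N f0 (\<sigma> \<circ> \<rho>) x = f x" using s r sym_group_lt[OF stab_sub[OF r(1)], of x]
              by (auto simp: act_def stab_def)
          qed
        qed
        show "(\<lambda>\<rho>. inv \<sigma> \<circ> \<rho>) ` {\<sigma> \<in> stab N g. act N f0 \<sigma> = f} \<subseteq> stab N f \<inter> stab N g"
        proof safe
          fix \<rho> assume r: "\<rho> \<in> stab N g" "f = act N f0 \<rho>"
          show st: "inv \<sigma> \<circ> \<rho> \<in> stab N g" using stab_inv[OF sst] r by blast
          have "f ((inv \<sigma> \<circ> \<rho>) x) = f x" if "x < N" for x
          proof -
            have "(inv \<sigma> \<circ> \<rho>) x < N" using sym_group_lt[OF stab_sub[OF st]] that by simp
            hence "f ((inv \<sigma> \<circ> \<rho>) x) = f0 (\<rho> x)" using s si by simp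
            thus ?thesis using that r(2) by (simp add: act_def)
          qed
          hence "inv \<sigma> \<circ> \<rho> \<in> stab N f" using stab_sub[OF st] by (simp add: stab_def)
          thus "inv \<sigma> \<circ> \<rho> \<in> stab N (act N f0 \<rho>)" using r(2) by simp
        qed
      qed
      thus ?thesis by (rule bij_betw_same_card)
    qed
    have "card (stab N g) = (\<Sum>f\<in>?C. card {\<sigma> \<in> stab N g. act N f0 \<sigma> = f})"
    proof -
      have "sum (\<lambda>_. 1::nat) (stab N g) = (\<Sum>f\<in>?C. sum (\<lambda>_. 1) {\<sigma> \<in> stab N g. act N f0 \<sigma> = f})"
        using sub by (intro sum.group[symmetric]) auto
      thus ?thesis by simp
    qed
    thus ?thesis using fib by simp
  qed
  have "(\<Sum>\<pi>\<in>stab N g. psi N \<alpha> \<pi>) = int (\<Sum>\<pi>\<in>stab N g. \<Sum>f\<in>?F. if \<pi> \<in> stab N f then 1 else 0)"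
  proof -
    have c: "card {f \<in> ?F. \<pi> \<in> stab N f} = (\<Sum>f\<in>?F. if \<pi> \<in> stab N f then 1 else 0)" for \<pi>
      by (simp add: sum.If_cases Int_def)
    show ?thesis unfolding psi_def c by (simp only: of_nat_sum)
  qed
  also have "(\<Sum>\<pi>\<in>stab N g. \<Sum>f\<in>?F. if \<pi> \<in> stab N f then 1 else (0::nat)) = (\<Sum>f\<in>?F. card (stab N f \<inter> stab N g))"
    by (subst sum.swap) (simp add: sum.If_cases Int_commute)
  also have "\<dots> = (\<Sum>m\<in>ty ` ?F. \<Sum>f\<in>{f \<in> ?F. ty f = m}. card (stab N f \<inter> stab N g))"
    by (intro sum.group[symmetric]) auto
  also have "\<dots> = (\<Sum>m\<in>ty ` ?F. card (stab N g))" by (intro sum.cong refl cls)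
  finally show ?thesis by simp
qed

lemma ex_colouring_fibres:
  assumes "finite X" "\<gamma> \<in> hstep N (card X)"
  shows "\<exists>f. (\<forall>x\<in>X. f x < N) \<and> (\<forall>i. card {x \<in> X. f x = i} = \<gamma> i)"
proof -
  define Y where "Y = (SIGMA i:{..<N}. {..<\<gamma> i})"
  have "card Y = card X" using assms by (simp add: Y_def hstep_def)
  moreover have "finite Y" by (simp add: Y_def)
  ultimately obtain h where h: "bij_betw h X Y" using assms finite_same_card_bij by metis
  have "card {x \<in> X. fst (h x) = i} = \<gamma> i" for i
  proof -
    have "bij_betw h {x \<in> X. fst (h x) = i} {y \<in> Y. fst y = i}"
      using h unfolding bij_betw_def by (auto simp: inj_on_def)
    hence "card {x \<in> X. fst (h x) = i} = card {y \<in> Y. fst y = i}" by (rule bij_betw_same_card)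
    also have "{y \<in> Y. fst y = i} = (if i < N then Pair i ` {..<\<gamma> i} else {})" by (auto simp: Y_def)
    also have "card \<dots> = \<gamma> i" using assms by (auto simp: card_image inj_on_def hstep_def)
    finally show ?thesis .
  qed
  moreover have "fst (h x) < N" if "x \<in> X" for x using bij_betwE[OF h] that by (auto simp: Y_def)
  ultimately show ?thesis by (intro exI[of _ "\<lambda>x. fst (h x)"]) blast
qed

text \<open>The orbits are contingency tables: entry (i, j) counts the x with f x = i and g x = j,
  the entries for j add up to \<open>nu ! j\<close> and those for i to \<alpha> i. The list runs
  through j in reverse so that the strips peeled last in \<open>alt_hsteps_dominance\<close> belong
  to the first rows of \<open>nu\<close>.\<close>

lemma types_eq_step_lists:
  fixes g :: "nat \<Rightarrow> nat"
  assumes g: "\<And>x. x < N \<Longrightarrow> g x < length nu" and nu: "\<And>j. j < length nu \<Longrightarrow> card {x. x < N \<and> g x = j} = nu ! j"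
  shows "(\<lambda>f. map (\<lambda>j i. card {x. x < N \<and> f x = i \<and> g x = j}) (rev [0..<length nu])) ` colourings N \<alpha>
    = step_lists N (map (hstep N) (rev nu)) \<alpha>" (is "?ty ` _ = _")
proof -
  let ?l = "length nu"
  have revnu: "rev nu = map ((!) nu) (rev [0..<?l])" by (simp add: rev_map[symmetric] map_nth)
  have ls: "list_all2 (\<in>) (map c (rev [0..<?l])) (map (hstep N) (rev nu)) \<longleftrightarrow> (\<forall>j<?l. c j \<in> hstep N (nu ! j))" for c
    unfolding revnu by (auto simp: list.rel_map list_all2_same)
  have suml: "(\<Sum>\<gamma>\<leftarrow>map c (rev [0..<?l]). \<gamma> i) = (\<Sum>j<?l. c j i)" for c and i :: nat
    by (simp add: o_def interv_sum_list_conv_sum_set_nat lessThan_atLeast0 rev_map[symmetric] sum_list_rev)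
  have fsum: "(\<Sum>j<?l. card {x. x < N \<and> f x = i \<and> g x = j}) = card {x. x < N \<and> f x = i}" for f :: "nat \<Rightarrow> nat" and i
  proof -
    have "sum (\<lambda>_. 1::nat) {x. x < N \<and> f x = i} = (\<Sum>j<?l. sum (\<lambda>_. 1) {x \<in> {x. x < N \<and> f x = i}. g x = j})"
      using g by (intro sum.group[symmetric]) auto
    moreover have "{x \<in> {x. x < N \<and> f x = i}. g x = j} = {x. x < N \<and> f x = i \<and> g x = j}" for j by auto
    ultimately show ?thesis by simp
  qed
  show ?thesis
  proof (intro equalityI subsetI)
    fix m assume "m \<in> ?ty ` colourings N \<alpha>"
    then obtain f where f: "f \<in> colourings N \<alpha>" "m = ?ty f" by blast
    have "(\<lambda>i. card {x. x < N \<and> f x = i \<and> g x = j}) \<in> hstep N (nu ! j)" if "j < ?l" for j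
    proof -
      have "sum (\<lambda>_. 1::nat) {x. x < N \<and> g x = j} = (\<Sum>i<N. sum (\<lambda>_. 1) {x \<in> {x. x < N \<and> g x = j}. f x = i})"
        using colourings_lt[OF f(1)] by (intro sum.group[symmetric]) auto
      moreover have "{x \<in> {x. x < N \<and> g x = j}. f x = i} = {x. x < N \<and> f x = i \<and> g x = j}" for i by auto
      moreover have "{x. x < N \<and> f x = i \<and> g x = j} = {}" if "i \<ge> N" for i
        using colourings_lt[OF f(1)] that by fastforce
      ultimately show ?thesis using nu[OF that] by (auto simp: hstep_def)
    qed
    moreover have "\<forall>i<N. int (\<Sum>\<gamma>\<leftarrow>m. \<gamma> i) = \<alpha> i"
      unfolding f(2) suml fsum using f(1) by (simp add: colourings_def)
    ultimately show "m \<in> step_lists N (map (hstep N) (rev nu)) \<alpha>"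
      unfolding step_lists_def f(2) using ls by simp
  next
    fix m assume "m \<in> step_lists N (map (hstep N) (rev nu)) \<alpha>"
    hence m: "list_all2 (\<in>) m (map (hstep N) (rev nu))" "\<forall>i<N. int (\<Sum>\<gamma>\<leftarrow>m. \<gamma> i) = \<alpha> i"
      by (auto simp: step_lists_def)
    have len: "length m = ?l" using list_all2_lengthD[OF m(1)] by simp
    define c where "c j = rev m ! j" for j
    have mc: "m = map c (rev [0..<?l])"
    proof -
      have "map c [0..<?l] = rev m" using len map_nth[of "rev m"] unfolding c_def by simp
      thus ?thesis by (simp add: rev_map[symmetric])
    qed
    have c: "c j \<in> hstep N (nu ! j)" if "j < ?l" for j using m(1) ls that unfolding mc by blast
    have "\<exists>f. (\<forall>x\<in>{x. x < N \<and> g x = j}. f x < N) \<and> (\<forall>i. card {x \<in> {x. x < N \<and> g x = j}. f x = i} = c j i)" if "j < ?l" for j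
      using c[OF that] nu[OF that] by (intro ex_colouring_fibres) auto
    then obtain F where F: "\<And>j x. j < ?l \<Longrightarrow> x < N \<Longrightarrow> g x = j \<Longrightarrow> F j x < N"
      "\<And>j i. j < ?l \<Longrightarrow> card {x \<in> {x. x < N \<and> g x = j}. F j x = i} = c j i" by simp metis
    define f where "f = restrict (\<lambda>x. F (g x) x) {..<N}"
    have cf: "card {x. x < N \<and> f x = i \<and> g x = j} = c j i" if "j < ?l" for i j
    proof -
      have "{x. x < N \<and> f x = i \<and> g x = j} = {x \<in> {x. x < N \<and> g x = j}. F j x = i}" by (auto simp: f_def)
      thus ?thesis using F(2)[OF that] by simp
    qed
    have tyf: "?ty f = m" unfolding mc by (rule map_cong) (auto simp: cf)
    moreover have "f \<in> colourings N \<alpha>"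
    proof -
      have "f \<in> {..<N} \<rightarrow>\<^sub>E {..<N}" using F(1) g by (auto simp: f_def)
      moreover have "int (card {x. x < N \<and> f x = i}) = \<alpha> i" if "i < N" for i
      proof -
        have "(\<Sum>\<gamma>\<leftarrow>?ty f. \<gamma> i) = card {x. x < N \<and> f x = i}" unfolding suml fsum ..
        thus ?thesis using m(2)[rule_format, OF that] unfolding tyf by (simp only:)
      qed
      ultimately show ?thesis by (simp add: colourings_def)
    qed
    ultimately show "m \<in> ?ty ` colourings N \<alpha>" by blast
  qed
qed

lemma sum_psi_row_stab:
  assumes nu: "nu \<in> partitions N"
  shows "(\<Sum>\<pi>\<in>stab N (row_of nu). psi N \<alpha> \<pi>) = int (card (stab N (row_of nu))) * cnt N (map (hstep N) (rev nu)) \<alpha>"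
proof -
  have N: "sum_list nu = N" by (rule partition_sum[OF nu])
  have g: "row_of nu x < length nu" if "x < N" for x using row_of_lt that N by blast
  have c: "card {x. x < N \<and> row_of nu x = j} = nu ! j" if "j < length nu" for j
    using bij_betw_same_card[OF row_fibre[OF that]] N by simp
  have "cnt N (map (hstep N) (rev nu)) \<alpha> = int (card (step_lists N (map (hstep N) (rev nu)) \<alpha>))"
    by (rule conjunct2[OF cnt_eq_card]) auto
  thus ?thesis using sum_psi_stab[of N "row_of nu" "length nu" \<alpha>, OF g] types_eq_step_lists[of N "row_of nu" nu \<alpha>, OF g c]
    by simp
qed

lemma image_mset_eq_mset_map:
  "image_mset f M = mset ys \<Longrightarrow> \<exists>xs. mset xs = M \<and> map f xs = ys"
proof (induction ys arbitrary: M)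
  case (Cons y ys)
  hence "image_mset f M = add_mset y (mset ys)" by simp
  then obtain M1 a where "M = add_mset a M1" "f a = y" "image_mset f M1 = mset ys"
    by (auto dest: msed_map_invR)
  moreover from Cons.IH[OF this(3)] obtain xs where "mset xs = M1" "map f xs = ys" by blast
  ultimately show ?case by (intro exI[of _ "a # xs"]) auto
qed auto

lemma stab_orbit_const:
  assumes p: "\<pi> \<in> stab N f" and x: "x < N" and y: "y \<in> orbit \<pi> x"
  shows "f y = f x"
  using y
proof induction
  case base
  thus ?case using p x by (simp add: stab_def)
next
  case (step y)
  have "y < N" using orbit_lt[OF stab_sub[OF p] x] step by auto
  thus ?case using p step by (simp add: stab_def)
qed

text \<open>A colouring fixed by \<pi> is constant on each cycle, so it amounts to one colour for
  each part of the cycle type. A cycle of length t with colour i contributes t to coordinate i,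
  which is a choice from \<open>pstep N t\<close>.\<close>

lemma psi_eq_cnt:
  assumes p: "\<pi> \<in> sym_group N" and ct: "cycle_type N \<pi> = mset mu"
  shows "psi N \<alpha> \<pi> = cnt N (map (pstep N) mu) \<alpha>"
proof -
  obtain os where os: "mset os = mset_set (orbit \<pi> ` {..<N})" "map card os = mu"
    using image_mset_eq_mset_map[of card "mset_set (orbit \<pi> ` {..<N})" mu] ct by (auto simp: cycle_type_def)
  have seto: "set os = orbit \<pi> ` {..<N}" using arg_cong[OF os(1), of set_mset] by simp
  have dist: "distinct os"
  proof -
    have "count (mset os) A \<le> 1" for A unfolding os(1) by (simp add: count_mset_set')
    thus ?thesis by (simp add: distinct_count_atmost_1 count_mset_set' os(1) seto)
  qed
  define r where "r A = (SOME x. x \<in> A)" for A :: "nat set"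
  have O: "r A \<in> A" "r A < N" "A = orbit \<pi> (r A)" "A \<subseteq> {..<N}" "card A > 0" if A: "A \<in> set os" for A
  proof -
    obtain x where x: "x < N" "A = orbit \<pi> x" using A seto by auto
    show "r A \<in> A" using someI[of "\<lambda>y. y \<in> A" x] self_in_orbit[OF p] x by (simp add: r_def)
    moreover show "A \<subseteq> {..<N}" using orbit_lt[OF p] x by simp
    ultimately show "r A < N" "A = orbit \<pi> (r A)" using orbit_eq_if_mem[OF p] x by auto
    show "card A > 0" using \<open>A \<subseteq> {..<N}\<close> \<open>r A \<in> A\<close> finite_subset by (fastforce simp: card_gt_0_iff)
  qed
  have oin: "orbit \<pi> x \<in> set os" if "x < N" for x using seto that by auto
  define e where "e t i = (\<lambda>j. if j = i then t else (0::nat))" for t i :: nat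
  have pst: "pstep N t = e t ` {..<N}" for t by (simp add: pstep_def e_def)
  define \<Theta> where "\<Theta> f = map (\<lambda>A. e (card A) (f (r A))) os" for f :: "nat \<Rightarrow> nat"
  let ?F = "{f \<in> colourings N \<alpha>. \<pi> \<in> stab N f}"
  let ?T = "step_lists N (map (pstep N) mu) \<alpha>"
  have sums: "(\<Sum>A\<leftarrow>os. e (card A) (h A) i) = card {x. x < N \<and> h (orbit \<pi> x) = i}" for h i
  proof -
    have "(\<Sum>A\<leftarrow>os. e (card A) (h A) i) = (\<Sum>A\<in>set os. if h A = i then card A else 0)"
      using dist by (subst sum_list_distinct_conv_sum_set) (auto simp: e_def intro!: sum.cong)
    also have "\<dots> = (\<Sum>A\<in>set os. card {x. x < N \<and> h (orbit \<pi> x) = i \<and> orbit \<pi> x = A})"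
    proof (intro sum.cong refl)
      fix A assume A: "A \<in> set os"
      have "{x. x < N \<and> orbit \<pi> x = A} = A"
      proof (intro equalityI subsetI)
        fix x assume "x \<in> A"
        moreover from this have "x \<in> orbit \<pi> (r A)" using O(3)[OF A] by blast
        ultimately show "x \<in> {x. x < N \<and> orbit \<pi> x = A}"
          using O(3,4)[OF A] orbit_eq_if_mem[OF p, of x "r A"] by blast
      qed (use self_in_orbit[OF p] in blast)
      note fibre = this
      have "{x. x < N \<and> h (orbit \<pi> x) = i \<and> orbit \<pi> x = A} = (if h A = i then {x. x < N \<and> orbit \<pi> x = A} else {})" by auto
      hence "{x. x < N \<and> h (orbit \<pi> x) = i \<and> orbit \<pi> x = A} = (if h A = i then A else {})" unfolding fibre .
      thus "(if h A = i then card A else 0) = card {x. x < N \<and> h (orbit \<pi> x) = i \<and> orbit \<pi> x = A}" by simp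
    qed
    also have "\<dots> = card {x. x < N \<and> h (orbit \<pi> x) = i}"
    proof -
      have "sum (\<lambda>_. 1::nat) {x. x < N \<and> h (orbit \<pi> x) = i} = (\<Sum>A\<in>set os. sum (\<lambda>_. 1) {x \<in> {x. x < N \<and> h (orbit \<pi> x) = i}. orbit \<pi> x = A})"
        using oin by (intro sum.group[symmetric]) auto
      moreover have "{x \<in> {x. x < N \<and> h (orbit \<pi> x) = i}. orbit \<pi> x = A} = {x. x < N \<and> h (orbit \<pi> x) = i \<and> orbit \<pi> x = A}" for A by auto
      ultimately show ?thesis by simp
    qed
    finally show ?thesis .
  qed
  have "bij_betw \<Theta> ?F ?T"
  proof (rule bij_betw_imageI)
    have fr: "f x = f (r (orbit \<pi> x))" if "f \<in> ?F" "x < N" for f x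
      using stab_orbit_const[of \<pi> N f "r (orbit \<pi> x)" x] that O(2,3)[OF oin[OF that(2)]] self_in_orbit[OF p, of x] by auto
    show "inj_on \<Theta> ?F"
    proof (rule inj_onI)
      fix f f' assume f: "f \<in> ?F" and f': "f' \<in> ?F" and eq: "\<Theta> f = \<Theta> f'"
      show "f = f'"
      proof (rule colourings_ext)
        show "f \<in> colourings N \<alpha>" "f' \<in> colourings N \<alpha>" using f f' by auto
        fix x assume x: "x < N"
        let ?A = "orbit \<pi> x"
        have "e (card ?A) (f (r ?A)) = e (card ?A) (f' (r ?A))" using eq oin[OF x] unfolding \<Theta>_def by (auto simp only: map_eq_conv)
        hence "e (card ?A) (f (r ?A)) (f (r ?A)) = e (card ?A) (f' (r ?A)) (f (r ?A))" by simp
        hence "f (r ?A) = f' (r ?A)" using O(5)[OF oin[OF x]] by (auto simp: e_def split: if_splits)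
        thus "f x = f' x" using fr[OF f x] fr[OF f' x] by simp
      qed
    qed
    show "\<Theta> ` ?F = ?T"
    proof (intro equalityI subsetI)
      fix m assume "m \<in> \<Theta> ` ?F"
      then obtain f where f: "f \<in> ?F" "m = \<Theta> f" by blast
      have "list_all2 (\<in>) m (map (pstep N) mu)"
        unfolding f(2) \<Theta>_def os(2)[symmetric] pst using f(1) O(2) colourings_lt[of f N \<alpha>]
        by (auto simp: list.rel_map list_all2_same)
      moreover have "int (\<Sum>\<gamma>\<leftarrow>m. \<gamma> i) = \<alpha> i" if "i < N" for i
      proof -
        have "(\<Sum>\<gamma>\<leftarrow>m. \<gamma> i) = card {x. x < N \<and> f (r (orbit \<pi> x)) = i}"
          using sums[of "\<lambda>A. f (r A)" i] by (simp add: f(2) \<Theta>_def o_def)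
        also have "{x. x < N \<and> f (r (orbit \<pi> x)) = i} = {x. x < N \<and> f x = i}" using fr[OF f(1)] by auto
        finally show ?thesis using f(1) that by (simp add: colourings_def)
      qed
      ultimately show "m \<in> ?T" by (simp add: step_lists_def)
    next
      fix m assume m: "m \<in> ?T"
      hence la: "list_all2 (\<lambda>\<gamma> A. \<gamma> \<in> e (card A) ` {..<N}) m os"
        unfolding step_lists_def os(2)[symmetric] pst by (simp add: list.rel_map)
      hence len: "length m = length os" by (rule list_all2_lengthD)
      have "\<forall>k. \<exists>i. k < length os \<longrightarrow> i < N \<and> m ! k = e (card (os ! k)) i"
        using la by (auto simp: list_all2_conv_all_nth)
      then obtain c where c: "\<And>k. k < length os \<Longrightarrow> c k < N \<and> m ! k = e (card (os ! k)) (c k)" by metis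
      define idx where "idx A = (THE k. k < length os \<and> os ! k = A)" for A
      have idx: "idx (os ! k) = k" if "k < length os" for k
        unfolding idx_def using that dist by (intro the_equality) (auto simp: nth_eq_iff_index_eq)
      define h where "h A = c (idx A)" for A
      have mh: "m = map (\<lambda>A. e (card A) (h A)) os"
        by (rule nth_equalityI) (use len c idx in \<open>auto simp: h_def\<close>)
      have hN: "h A < N" if A: "A \<in> set os" for A
      proof -
        obtain k where "k < length os" "os ! k = A" using A by (auto simp: in_set_conv_nth)
        thus ?thesis using c idx by (auto simp: h_def)
      qed
      define f where "f = restrict (\<lambda>x. h (orbit \<pi> x)) {..<N}"
      have "f \<in> colourings N \<alpha>"
      proof -
        have "f \<in> {..<N} \<rightarrow>\<^sub>E {..<N}" using hN oin by (auto simp: f_def)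
        moreover have "int (card {x. x < N \<and> f x = i}) = \<alpha> i" if "i < N" for i
        proof -
          have "{x. x < N \<and> f x = i} = {x. x < N \<and> h (orbit \<pi> x) = i}" by (auto simp: f_def)
          hence "card {x. x < N \<and> f x = i} = (\<Sum>\<gamma>\<leftarrow>m. \<gamma> i)" using sums[of h i] by (simp add: mh o_def)
          thus ?thesis using m that by (simp add: step_lists_def)
        qed
        ultimately show ?thesis by (simp add: colourings_def)
      qed
      moreover have "\<pi> \<in> stab N f"
        using p sym_group_lt[OF p] orbit_image_eq[OF p] by (auto simp: stab_def f_def)
      moreover have "\<Theta> f = m" unfolding \<Theta>_def mh
        by (rule map_cong) (use O in \<open>auto simp: f_def\<close>)
      ultimately show "m \<in> \<Theta> ` ?F" by blast
    qed
  qed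
  hence "card ?F = card ?T" by (rule bij_betw_same_card)
  moreover have "cnt N (map (pstep N) mu) \<alpha> = int (card ?T)"
    by (rule conjunct2[OF cnt_eq_card]) auto
  ultimately show ?thesis by (simp add: psi_def)
qed

section \<open>Identification of the characters by Frobenius' formula\<close>

definition part :: "nat list \<Rightarrow> nat \<Rightarrow> int" where
  "part la i = (if i < length la then int (la ! i) else 0)"

text \<open>The exponent \<lambda> + \<delta>, that is, the beta-numbers of \<lambda> with N
  beads.\<close>

definition beads :: "nat \<Rightarrow> nat list \<Rightarrow> nat \<Rightarrow> int" where
  "beads N la i = part la i + stair N i"

text \<open>The determinantal candidate for the character: the alternating sum of the permutation
  characters whose class sizes are \<lambda> + \<delta> minus a permuted \<delta>, as in the
  Jacobi-Trudi identity.\<close>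

definition omega :: "nat \<Rightarrow> nat list \<Rightarrow> (nat \<Rightarrow> nat) \<Rightarrow> int" where
  "omega N la \<pi> = (\<Sum>w | w permutes {..<N}. sign w * psi N (\<lambda>i. beads N la i - stair N (w i)) \<pi>)"

lemma length_le_partition: "la \<in> partitions N \<Longrightarrow> length la \<le> N"
proof -
  have "length la \<le> sum_list la" if "\<forall>k\<in>set la. 0 < k" for la :: "nat list"
    using that by (induction la) auto
  thus "la \<in> partitions N \<Longrightarrow> length la \<le> N" by (auto simp: partitions_def)
qed

lemma sum_part: "(\<Sum>i<k. part la i) = int (sum_list (take k la))"
proof (induction k)
  case (Suc k)
  thus ?case by (cases "k < length la") (auto simp: part_def take_Suc_conv_app_nth)
qed simp

lemma strict_dec_beads:
  assumes "la \<in> partitions N"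
  shows "strict_dec N (beads N la)"
  unfolding strict_dec_def
proof (intro allI impI)
  fix i assume "Suc i < N"
  have "part la (Suc i) \<le> part la i"
    using assms sorted_wrt_nth_less[of "(\<ge>)" la i "Suc i"] by (auto simp: part_def partitions_def)
  thus "beads N la (Suc i) < beads N la i" by (simp add: beads_def stair_def)
qed

lemma card_colour_initial:
  assumes f: "f \<in> colourings N \<alpha>" and k: "k \<le> N"
  shows "int (card {x. x < N \<and> f x \<in> {..<k}}) = (\<Sum>i<k. \<alpha> i)"
proof -
  have "sum (\<lambda>_. 1::nat) {x. x < N \<and> f x \<in> {..<k}}
     = (\<Sum>i<k. sum (\<lambda>_. 1) {x \<in> {x. x < N \<and> f x \<in> {..<k}}. f x = i})"
    by (intro sum.group[symmetric]) auto
  moreover have "{x \<in> {x. x < N \<and> f x \<in> {..<k}}. f x = i} = {x. x < N \<and> f x = i}" if "i < k" for i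
    using that by auto
  ultimately have "card {x. x < N \<and> f x \<in> {..<k}} = (\<Sum>i<k. card {x. x < N \<and> f x = i})" by simp
  thus ?thesis using f k by (simp add: colourings_def)
qed

lemma psi_ysym_sum:
  "(\<Sum>\<pi>\<in>sym_group N. of_int (psi N \<alpha> \<pi>) * y \<pi>) = (\<Sum>f\<in>colourings N \<alpha>. \<Sum>\<pi>\<in>stab N f. (y \<pi> :: complex))"
proof -
  have "of_int (psi N \<alpha> \<pi>) * y \<pi> = (\<Sum>f\<in>colourings N \<alpha>. if \<pi> \<in> stab N f then y \<pi> else 0)" for \<pi>
    by (simp add: psi_def sum.If_cases Int_def)
  hence "(\<Sum>\<pi>\<in>sym_group N. of_int (psi N \<alpha> \<pi>) * y \<pi>)
      = (\<Sum>f\<in>colourings N \<alpha>. \<Sum>\<pi>\<in>sym_group N. if \<pi> \<in> stab N f then y \<pi> else 0)"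
    by (simp add: sum.swap[of _ "colourings N \<alpha>"])
  also have "\<dots> = (\<Sum>f\<in>colourings N \<alpha>. \<Sum>\<pi>\<in>stab N f. y \<pi>)"
    by (intro sum.cong refl sum.mono_neutral_cong_right) (auto simp: stab_sub)
  finally show ?thesis .
qed

lemma psi_ysym_eq_0:
  assumes ka: "ka \<in> partitions N" and k: "k \<le> N" and ex: "(\<Sum>i<k. \<alpha> i) > int (sum_list (take k ka))"
  shows "(\<Sum>\<pi>\<in>sym_group N. of_int (psi N \<alpha> \<pi>) * ysym ka \<pi>) = 0"
  unfolding psi_ysym_sum
proof (rule sum.neutral, intro ballI)
  fix f assume f: "f \<in> colourings N \<alpha>"
  have "card {x. x < N \<and> f x \<in> {..<k}} > sum_list (take (card {..<k}) ka)"
    using card_colour_initial[OF f k] ex by simp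
  thus "(\<Sum>\<pi>\<in>stab N f. ysym ka \<pi>) = 0" by (rule symz_ysym_id_eq_0[OF ka, rotated]) simp
qed

lemma row_colouring:
  assumes la: "la \<in> partitions N"
  shows "restrict (row_of la) {..<N} \<in> colourings N (part la)"
proof -
  have N: "sum_list la = N" by (rule partition_sum[OF la])
  have lt: "row_of la x < length la" if "x < N" for x using row_of_lt that N by blast
  have "int (card {x. x < N \<and> restrict (row_of la) {..<N} x = i}) = part la i" for i
  proof -
    have e: "{x. x < N \<and> restrict (row_of la) {..<N} x = i} = {x. x < sum_list la \<and> row_of la x = i}" using N by auto
    show ?thesis
    proof (cases "i < length la")
      case True
      thus ?thesis using bij_betw_same_card[OF row_fibre[OF True]] unfolding e by (simp add: part_def)
    next
      case False
      hence "{x. x < sum_list la \<and> row_of la x = i} = {}" using lt N by auto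
      thus ?thesis using False unfolding e by (simp add: part_def)
    qed
  qed
  thus ?thesis using lt length_le_partition[OF la] by (fastforce simp: colourings_def)
qed

lemma stab_restrict: "stab N (restrict f {..<N}) = stab N f"
  by (auto simp: stab_def sym_group_lt)

text \<open>Every colouring with class sizes \<lambda> is a translate of the row colouring, reached
  by \<open>card ?R\<close> group elements. Replacing the sum over colourings by a sum over the
  group conjugates the row group, and the trace formula turns it into \<open>ynorm la\<close> times
  the sum of the character over the row group, known from \<open>char_row_self\<close>.\<close>

lemma psi_ysym_self:
  assumes la: "la \<in> partitions N"
  shows "(\<Sum>\<pi>\<in>sym_group N. of_int (psi N (part la) \<pi>) * ysym la \<pi>) = ynorm la"
proof -
  let ?F = "colourings N (part la)" and ?R = "stab N (row_of la)"
  define f0 where "f0 = restrict (row_of la) {..<N}"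
  have f0: "f0 \<in> ?F" unfolding f0_def by (rule row_colouring[OF la])
  have st: "stab N f0 = ?R" unfolding f0_def by (rule stab_restrict)
  define h where "h f = (\<Sum>\<pi>\<in>stab N f. ysym la \<pi>)" for f :: "nat \<Rightarrow> nat"
  have fib: "card {\<sigma> \<in> sym_group N. act N f0 \<sigma> = f} = card ?R" if f: "f \<in> ?F" for f
  proof -
    have "card {x. x < N \<and> f x = c} = card {x. x < N \<and> f0 x = c}" for c
    proof (cases "c < N")
      case True
      have "int (card {x. x < N \<and> f x = c}) = int (card {x. x < N \<and> f0 x = c})"
        using f f0 True by (simp add: colourings_def)
      thus ?thesis by simp
    next
      case False
      hence "{x. x < N \<and> g x = c} = {}" if "g \<in> ?F" for g using colourings_lt[OF that] by auto
      thus ?thesis using f f0 by metis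
    qed
    then obtain \<sigma> where s: "\<sigma> \<in> sym_group N" "\<forall>x<N. f x = f0 (\<sigma> x)"
      using same_fibres_permute[of N f f0] by blast
    note si = sym_group_inv_simps[OF s(1)]
    have fs: "f = act N f0 \<sigma>"
      by (rule colourings_ext[OF f act_in_colourings[OF f0 s(1)]]) (use s in \<open>auto simp: act_def\<close>)
    have "bij_betw (\<lambda>\<rho>. \<rho> \<circ> \<sigma>) (stab N f0) {\<sigma> \<in> sym_group N. act N f0 \<sigma> = f}"
    proof (rule bij_betw_byWitness[where f'="\<lambda>\<rho>. \<rho> \<circ> inv \<sigma>"])
      show "\<forall>\<rho>\<in>stab N f0. \<rho> \<circ> \<sigma> \<circ> inv \<sigma> = \<rho>" by (simp add: si flip: o_assoc)
      show "\<forall>\<rho>\<in>{\<sigma> \<in> sym_group N. act N f0 \<sigma> = f}. \<rho> \<circ> inv \<sigma> \<circ> \<sigma> = \<rho>" by (simp add: si flip: o_assoc)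
      show "(\<lambda>\<rho>. \<rho> \<circ> \<sigma>) ` stab N f0 \<subseteq> {\<sigma> \<in> sym_group N. act N f0 \<sigma> = f}"
        unfolding fs using s(1) sym_group_lt[OF s(1)] by (auto simp: act_def stab_def)
      show "(\<lambda>\<rho>. \<rho> \<circ> inv \<sigma>) ` {\<sigma> \<in> sym_group N. act N f0 \<sigma> = f} \<subseteq> stab N f0"
      proof safe
        fix \<rho> assume r: "\<rho> \<in> sym_group N" "f = act N f0 \<rho>"
        have "f0 ((\<rho> \<circ> inv \<sigma>) x) = f0 x" if "x < N" for x
        proof -
          have i: "inv \<sigma> x < N" using sym_group_lt[OF sym_group_inv[OF s(1)]] that by simp
          have "f (inv \<sigma> x) = f0 (\<rho> (inv \<sigma> x))" using i by (simp add: r(2) act_def)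
          moreover have "f (inv \<sigma> x) = f0 x" using s(2) i si by simp
          ultimately show ?thesis by simp
        qed
        thus "\<rho> \<circ> inv \<sigma> \<in> stab N f0" using r s(1) by (auto simp: stab_def)
      qed
    qed
    from bij_betw_same_card[OF this] show ?thesis unfolding st by simp
  qed
  have hact: "h (act N f0 \<sigma>) = (\<Sum>\<rho>\<in>?R. ysym la (inv \<sigma> \<circ> \<rho> \<circ> \<sigma>))" if s: "\<sigma> \<in> sym_group N" for \<sigma>
  proof -
    note si = sym_group_inv_simps[OF s]
    have stabeq: "inv \<sigma> \<circ> \<rho> \<circ> \<sigma> \<in> stab N (act N f0 \<sigma>)" if r: "\<rho> \<in> ?R" for \<rho>
    proof -
      have g: "inv \<sigma> \<circ> \<rho> \<circ> \<sigma> \<in> sym_group N" using s stab_sub[OF r] by blast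
      have "act N f0 \<sigma> ((inv \<sigma> \<circ> \<rho> \<circ> \<sigma>) x) = act N f0 \<sigma> x" if "x < N" for x
        using that sym_group_lt[OF g, of x] r sym_group_lt[OF s, of x] si unfolding st[symmetric]
        by (auto simp: act_def stab_def)
      thus ?thesis using g by (simp add: stab_def)
    qed
    have stabeq2: "\<sigma> \<circ> \<pi> \<circ> inv \<sigma> \<in> ?R" if r: "\<pi> \<in> stab N (act N f0 \<sigma>)" for \<pi>
    proof -
      have g: "\<sigma> \<circ> \<pi> \<circ> inv \<sigma> \<in> sym_group N" using s stab_sub[OF r] by blast
      have "f0 ((\<sigma> \<circ> \<pi> \<circ> inv \<sigma>) x) = f0 x" if x: "x < N" for x
      proof -
        have i: "inv \<sigma> x < N" "\<pi> (inv \<sigma> x) < N"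
          using sym_group_lt[OF sym_group_inv[OF s]] sym_group_lt[OF stab_sub[OF r]] x by auto
        have "act N f0 \<sigma> (\<pi> (inv \<sigma> x)) = act N f0 \<sigma> (inv \<sigma> x)" using r i by (simp add: stab_def)
        thus ?thesis using i si by (simp add: act_def)
      qed
      thus ?thesis using g unfolding st[symmetric] by (simp add: stab_def)
    qed
    show ?thesis unfolding h_def
      by (rule sum.reindex_bij_witness[where i="\<lambda>\<rho>. inv \<sigma> \<circ> \<rho> \<circ> \<sigma>" and j="\<lambda>\<pi>. \<sigma> \<circ> \<pi> \<circ> inv \<sigma>"])
         (auto simp: stabeq stabeq2 o_assoc si, simp_all add: si flip: o_assoc)
  qed
  have "of_nat (card ?R) * (\<Sum>f\<in>?F. h f) = (\<Sum>f\<in>?F. \<Sum>\<sigma>\<in>{\<sigma> \<in> sym_group N. act N f0 \<sigma> = f}. h (act N f0 \<sigma>))"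
    by (simp add: fib sum_distrib_left)
  also have "\<dots> = (\<Sum>\<sigma>\<in>sym_group N. h (act N f0 \<sigma>))"
    using act_in_colourings[OF f0] by (intro sum.group) auto
  also have "\<dots> = (\<Sum>\<sigma>\<in>sym_group N. \<Sum>\<rho>\<in>?R. ysym la (inv \<sigma> \<circ> \<rho> \<circ> \<sigma>))" by (intro sum.cong refl hact)
  also have "\<dots> = (\<Sum>\<rho>\<in>?R. \<Sum>\<sigma>\<in>sym_group N. ysym la (inv \<sigma> \<circ> \<rho> \<circ> \<sigma>))" by (rule sum.swap)
  also have "\<dots> = (\<Sum>\<rho>\<in>?R. \<Sum>\<sigma>\<in>sym_group N. ysym la (inv \<sigma> \<circ> inv \<rho> \<circ> \<sigma>))"
    by (rule sum.reindex_bij_witness[where i=inv and j=inv]) (auto simp: sym_group_inv_simps(3)[OF stab_sub])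
  also have "\<dots> = (\<Sum>\<rho>\<in>?R. ynorm la * irr_char la \<rho>)"
    using ynorm_nonzero[OF la] by (intro sum.cong refl) (simp add: irr_char_eq[OF la stab_sub])
  also have "\<dots> = ynorm la * (\<Sum>\<pi>\<in>sym_group N. irr_char la \<pi> * symz N (row_of la) \<pi>)"
    unfolding sum_distrib_left
    by (intro sum.mono_neutral_cong_left) (auto simp: symz_def stab_sub)
  also have "\<dots> = of_nat (card ?R) * ynorm la" by (simp add: char_row_self[OF la])
  finally have "(\<Sum>f\<in>?F. h f) = ynorm la" using card_stab_pos[of N "row_of la"] by (auto simp: card_gt_0_iff)
  thus ?thesis by (simp add: psi_ysym_sum h_def)
qed

lemma psi_class:
  assumes p: "\<pi> \<in> sym_group N" and s: "\<sigma> \<in> sym_group N"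
  shows "psi N \<alpha> (\<sigma> \<circ> \<pi> \<circ> inv \<sigma>) = psi N \<alpha> \<pi>"
proof -
  note si = sym_group_inv_simps[OF s]
  have lt: "\<sigma> x < N" "inv \<sigma> x < N" "\<pi> x < N" if "x < N" for x
    using that sym_group_lt[OF s] sym_group_lt[OF p] sym_group_lt[OF sym_group_inv[OF s]] by auto
  have "bij_betw (\<lambda>f. act N f \<sigma>) {f \<in> colourings N \<alpha>. \<sigma> \<circ> \<pi> \<circ> inv \<sigma> \<in> stab N f} {f \<in> colourings N \<alpha>. \<pi> \<in> stab N f}"
  proof (rule bij_betw_byWitness[where f'="\<lambda>f. act N f (inv \<sigma>)"])
    have *: "act N (act N f \<sigma>) (inv \<sigma>) = f" "act N (act N f (inv \<sigma>)) \<sigma> = f" if f: "f \<in> colourings N \<alpha>" for f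
    proof -
      note s' = sym_group_inv[OF s]
      show "act N (act N f \<sigma>) (inv \<sigma>) = f"
        by (rule colourings_ext[OF act_in_colourings[OF act_in_colourings[OF f s] s'] f]) (simp add: act_def lt si)
      show "act N (act N f (inv \<sigma>)) \<sigma> = f"
        by (rule colourings_ext[OF act_in_colourings[OF act_in_colourings[OF f s'] s] f]) (simp add: act_def lt si)
    qed
    show "\<forall>f\<in>{f \<in> colourings N \<alpha>. \<sigma> \<circ> \<pi> \<circ> inv \<sigma> \<in> stab N f}. act N (act N f \<sigma>) (inv \<sigma>) = f" using * by blast
    show "\<forall>f\<in>{f \<in> colourings N \<alpha>. \<pi> \<in> stab N f}. act N (act N f (inv \<sigma>)) \<sigma> = f" using * by blast
    show "(\<lambda>f. act N f \<sigma>) ` {f \<in> colourings N \<alpha>. \<sigma> \<circ> \<pi> \<circ> inv \<sigma> \<in> stab N f} \<subseteq> {f \<in> colourings N \<alpha>. \<pi> \<in> stab N f}"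
    proof safe
      fix f assume f: "f \<in> colourings N \<alpha>" "\<sigma> \<circ> \<pi> \<circ> inv \<sigma> \<in> stab N f"
      show "act N f \<sigma> \<in> colourings N \<alpha>" by (rule act_in_colourings[OF f(1) s])
      have "f (\<sigma> (\<pi> x)) = f (\<sigma> x)" if "x < N" for x
      proof -
        have "f ((\<sigma> \<circ> \<pi> \<circ> inv \<sigma>) (\<sigma> x)) = f (\<sigma> x)" using f(2) lt[OF that] unfolding stab_def by blast
        thus ?thesis by (simp add: si)
      qed
      thus "\<pi> \<in> stab N (act N f \<sigma>)" using p lt by (simp add: stab_def act_def)
    qed
    show "(\<lambda>f. act N f (inv \<sigma>)) ` {f \<in> colourings N \<alpha>. \<pi> \<in> stab N f} \<subseteq> {f \<in> colourings N \<alpha>. \<sigma> \<circ> \<pi> \<circ> inv \<sigma> \<in> stab N f}"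
    proof safe
      fix f assume f: "f \<in> colourings N \<alpha>" "\<pi> \<in> stab N f"
      show "act N f (inv \<sigma>) \<in> colourings N \<alpha>" by (rule act_in_colourings[OF f(1) sym_group_inv[OF s]])
      have "f (\<pi> (inv \<sigma> x)) = f (inv \<sigma> x)" if "x < N" for x
        using f(2) lt[OF that] by (simp add: stab_def)
      thus "\<sigma> \<circ> \<pi> \<circ> inv \<sigma> \<in> stab N (act N f (inv \<sigma>))"
        using sym_group_comp[OF sym_group_comp[OF s p] sym_group_inv[OF s]] lt si by (simp add: stab_def act_def)
    qed
  qed
  thus ?thesis unfolding psi_def by (simp add: bij_betw_same_card)
qed

lemma omega_class: "class_fun N (\<lambda>\<pi>. of_int (omega N la \<pi>))"
  unfolding class_fun_def omega_def by (simp add: psi_class)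

lemma beads_minus_stair_sum:
  "(\<Sum>i<k. beads N la i - stair N (w i)) = int (sum_list (take k la)) + ((\<Sum>i<k. stair N i) - (\<Sum>i<k. stair N (w i)))"
  by (simp add: beads_def sum_subtractf sum.distrib sum_part)

lemma not_dominated_bounded:
  assumes "nu \<in> partitions N" "la \<in> partitions N" "\<not> dominated nu la"
  shows "\<exists>k\<le>N. sum_list (take k la) < sum_list (take k nu)"
proof -
  obtain k where k: "sum_list (take k la) < sum_list (take k nu)" using assms by (auto simp: dominated_def not_le)
  have "k \<le> N"
  proof (rule ccontr)
    assume "\<not> k \<le> N"
    hence "take k la = la" "take k nu = nu" using length_le_partition assms by fastforce+
    thus False using k partition_sum assms by simp
  qed
  thus ?thesis using k by blast
qed

lemma omega_ysym_sum:
  "(\<Sum>\<pi>\<in>sym_group N. of_int (omega N la \<pi>) * ysym ka \<pi>)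
    = (\<Sum>w | w permutes {..<N}. of_int (sign w) *
        (\<Sum>\<pi>\<in>sym_group N. of_int (psi N (\<lambda>i. beads N la i - stair N (w i)) \<pi>) * ysym ka \<pi>))"
  unfolding omega_def of_int_sum sum_distrib_right sum_distrib_left of_int_mult
  by (subst sum.swap) (simp add: mult.assoc)

text \<open>Permuting the subtracted staircase can only raise the initial sums of \<lambda> +
  \<delta> - \<delta>, so every term exceeds an initial sum of \<open>ka\<close> as soon as
  \<lambda> does. In the next lemma, where \<open>ka\<close> is \<lambda>, the same comparison
  leaves only the term of the identity.\<close>

lemma omega_ysym_eq_0:
  assumes la: "la \<in> partitions N" and ka: "ka \<in> partitions N" and nd: "\<not> dominated la ka"
  shows "(\<Sum>\<pi>\<in>sym_group N. of_int (omega N la \<pi>) * ysym ka \<pi>) = 0"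
  unfolding omega_ysym_sum
proof (rule sum.neutral, intro ballI)
  fix w assume "w \<in> {w. w permutes {..<N}}"
  hence w: "w permutes {..<N}" by simp
  obtain k where k: "k \<le> N" "sum_list (take k ka) < sum_list (take k la)"
    using not_dominated_bounded[OF la ka nd] by blast
  have "(\<Sum>i<k. beads N la i - stair N (w i)) > int (sum_list (take k ka))"
    unfolding beads_minus_stair_sum using sum_permute_le_initial(1)[OF w k(1)] k(2) by linarith
  from psi_ysym_eq_0[OF ka k(1) this]
  show "of_int (sign w) * (\<Sum>\<pi>\<in>sym_group N. of_int (psi N (\<lambda>i. beads N la i - stair N (w i)) \<pi>) * ysym ka \<pi>) = 0" by simp
qed

lemma omega_ysym_self:
  assumes la: "la \<in> partitions N"
  shows "(\<Sum>\<pi>\<in>sym_group N. of_int (omega N la \<pi>) * ysym la \<pi>) = ynorm la"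
proof -
  let ?g = "\<lambda>w. of_int (sign w) * (\<Sum>\<pi>\<in>sym_group N. of_int (psi N (\<lambda>i. beads N la i - stair N (w i)) \<pi>) * ysym la \<pi>)"
  have "?g w = 0" if w: "w permutes {..<N}" "w \<noteq> id" for w
  proof -
    obtain k where k: "k \<le> N" "(\<Sum>i<k. stair N (w i)) < (\<Sum>i<k. stair N i)"
      using sum_permute_le_initial(2)[OF w(1) le0 w(2)] by blast
    have "(\<Sum>i<k. beads N la i - stair N (w i)) > int (sum_list (take k la))"
      unfolding beads_minus_stair_sum using k(2) by linarith
    from psi_ysym_eq_0[OF la k(1) this] show ?thesis by simp
  qed
  hence "(\<Sum>w | w permutes {..<N}. ?g w) = (\<Sum>w\<in>{id}. ?g w)"
    by (intro sum.mono_neutral_right) (auto simp: finite_permutations permutes_id)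
  also have "\<dots> = ynorm la" using psi_ysym_self[OF la] by (simp add: beads_def)
  finally show ?thesis by (simp add: omega_ysym_sum)
qed

text \<open>Summing over the row group of \<open>nu\<close> replaces power sums by complete
  homogeneous polynomials, for which Pieri's rule gives a dominance condition opposite to the one in
  the pairing with Young symmetrizers.\<close>

lemma omega_symz_eq_0:
  assumes la: "la \<in> partitions N" and nu: "nu \<in> partitions N" and nd: "\<not> dominated nu la"
  shows "(\<Sum>\<pi>\<in>sym_group N. of_int (omega N la \<pi>) * symz N (row_of nu) \<pi>) = 0"
proof -
  let ?R = "stab N (row_of nu)"
  have "(\<Sum>\<pi>\<in>sym_group N. of_int (omega N la \<pi>) * symz N (row_of nu) \<pi>) = of_int (\<Sum>\<pi>\<in>?R. omega N la \<pi>)"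
    unfolding of_int_sum by (intro sum.mono_neutral_cong_right) (auto simp: symz_def stab_sub)
  also have "(\<Sum>\<pi>\<in>?R. omega N la \<pi>)
     = (\<Sum>w | w permutes {..<N}. sign w * (\<Sum>\<pi>\<in>?R. psi N (\<lambda>i. beads N la i - stair N (w i)) \<pi>))"
    unfolding omega_def sum_distrib_left by (rule sum.swap)
  also have "\<dots> = int (card ?R) * alt N (map (hstep N) (rev nu)) (beads N la)"
    unfolding sum_psi_row_stab[OF nu] alt_def sum_distrib_left by (simp add: mult.left_commute)
  also have "alt N (map (hstep N) (rev nu)) (beads N la) = 0"
  proof (rule ccontr)
    assume "\<not> ?thesis"
    from alt_hsteps_dominance[OF strict_dec_beads[OF la] this]
    have *: "(\<Sum>i<j. beads N la i - stair N i) \<ge> int (sum_list (drop (length nu - j) (rev nu)))" if "j \<le> N" for j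
      using that by simp
    obtain k where k: "k \<le> N" "sum_list (take k la) < sum_list (take k nu)"
      using not_dominated_bounded[OF nu la nd] by blast
    have "sum_list (drop (length nu - k) (rev nu)) = sum_list (take k nu)"
      by (cases "k \<le> length nu") (simp_all add: drop_rev sum_list_rev)
    moreover have "(\<Sum>i<k. beads N la i - stair N i) = int (sum_list (take k la))"
      using sum_part[of la k] by (simp add: beads_def)
    ultimately show False using *[OF k(1)] k(2) by simp
  qed
  finally show ?thesis by simp
qed

text \<open>Expand \<open>omega\<close> in the irreducible characters. Pairing with Young
  symmetrizers leaves \<lambda> with coefficient 1 and possibly partitions dominating it. If another
  one occurred, a maximal one \<open>ka\<close> would not be dominated by \<lambda>, so pairing
  \<open>omega\<close> with its row symmetrizer gives 0, while in the expansion only the term of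
  \<open>ka\<close> survives and is nonzero.\<close>

theorem irr_char_eq_omega:
  assumes la: "la \<in> partitions N" and p: "\<pi> \<in> sym_group N"
  shows "irr_char la \<pi> = of_int (omega N la \<pi>)"
proof -
  define P where "P = partitions N"
  define u where "u ka = (\<Sum>\<tau>\<in>sym_group N. of_int (omega N la \<tau>) * ysym ka \<tau>) / ynorm ka" for ka
  have exp: "of_int (omega N la \<pi>) = (\<Sum>ka\<in>P. u ka * irr_char ka \<pi>)" if "\<pi> \<in> sym_group N" for \<pi>
    unfolding u_def P_def by (rule class_fun_expansion_and_cycle_types(1)[OF omega_class that])
  have ula: "u la = 1" using omega_ysym_self[OF la] ynorm_nonzero[OF la] by (simp add: u_def)
  have u0: "u ka = 0" if "ka \<in> P" "\<not> dominated la ka" for ka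
    using omega_ysym_eq_0[OF la _ that(2)] that(1) by (simp add: u_def P_def)
  have finP: "finite P" by (simp add: P_def finite_partitions)
  define S where "S = {ka \<in> P. u ka \<noteq> 0 \<and> ka \<noteq> la}"
  have "S = {}"
  proof (rule ccontr)
    assume "S \<noteq> {}"
    \<comment> \<open>A numerical height that strictly increases along the dominance order, so that
      a maximal \<open>ka\<close> can be picked by \<open>Max\<close>.\<close>
    define M where "M ka = (\<Sum>k\<le>N. sum_list (take k ka))" for ka :: "nat list"
    have finS: "finite S" using finP by (simp add: S_def)
    obtain ka where ka: "ka \<in> S" and max: "\<And>k'. k' \<in> S \<Longrightarrow> M k' \<le> M ka"
    proof -
      have "Max (M ` S) \<in> M ` S" using finS \<open>S \<noteq> {}\<close> by (intro Max_in) auto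
      then obtain ka where "ka \<in> S" "M ka = Max (M ` S)" by auto
      moreover have "M k' \<le> Max (M ` S)" if "k' \<in> S" for k' using finS that by (intro Max_ge) auto
      ultimately show ?thesis using that by metis
    qed
    have kaP: "ka \<in> P" and ka0: "u ka \<noteq> 0" and kal: "ka \<noteq> la" using ka by (auto simp: S_def)
    have kap: "ka \<in> partitions N" using kaP by (simp add: P_def)
    have nd: "\<not> dominated ka la" using u0[OF kaP] ka0 kal dominated_antisym[OF kap la] by blast
    let ?Q = "\<lambda>k'. \<Sum>\<pi>\<in>sym_group N. irr_char k' \<pi> * symz N (row_of ka) \<pi>"
    have "0 = (\<Sum>\<pi>\<in>sym_group N. of_int (omega N la \<pi>) * symz N (row_of ka) \<pi>)"
      using omega_symz_eq_0[OF la kap nd] by simp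
    also have "\<dots> = (\<Sum>k'\<in>P. u k' * ?Q k')"
      by (simp add: exp sum_distrib_right sum_distrib_left mult.assoc) (rule sum.swap)
    also have "\<dots> = (\<Sum>k'\<in>{ka}. u k' * ?Q k')"
    proof (rule sum.mono_neutral_right[OF finP])
      show "{ka} \<subseteq> P" using kaP by simp
      show "\<forall>k'\<in>P - {ka}. u k' * ?Q k' = 0"
      proof
        fix k' assume k': "k' \<in> P - {ka}"
        show "u k' * ?Q k' = 0"
        proof (cases "dominated ka k'")
          case False
          have "?Q k' = 0"
            using card_take_gt[OF kap False] char_symz_eq_0[of k' N "{..<_}" "row_of ka"] k' by (force simp: P_def)
          thus ?thesis by simp
        next
          case True
          have k'p: "k' \<in> partitions N" using k' by (simp add: P_def)
          have "\<not> dominated k' ka" using True k' dominated_antisym[OF kap k'p] by blast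
          then obtain j where j: "j \<le> N" "sum_list (take j ka) < sum_list (take j k')"
            using not_dominated_bounded[OF k'p kap] by blast
          have "M ka < M k'" unfolding M_def
            by (rule sum_strict_mono_ex1) (use True j in \<open>auto simp: dominated_def\<close>)
          hence "k' \<notin> S" using max[of k'] by auto
          moreover have "k' \<noteq> la" using True nd by auto
          ultimately have "u k' = 0" using k' by (auto simp: S_def)
          thus ?thesis by simp
        qed
      qed
    qed
    also have "\<dots> = u ka * of_nat (card (stab N (row_of ka)))" by (simp add: char_row_self[OF kap])
    finally show False using ka0 card_stab_pos[of N "row_of ka"] by simp
  qed
  hence "u ka = (if ka = la then 1 else 0)" if "ka \<in> P" for ka using ula that by (auto simp: S_def)
  hence "(\<Sum>ka\<in>P. u ka * irr_char ka \<pi>) = (\<Sum>ka\<in>P. if ka = la then irr_char ka \<pi> else 0)"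
    by (intro sum.cong) auto
  also have "\<dots> = irr_char la \<pi>" using la finP by (simp add: P_def)
  finally show ?thesis using exp[OF p] by simp
qed

text \<open>Frobenius' formula: the character value is the coefficient of \<open>x\<^bsup>\<lambda>+\<delta>\<^esup>\<close> in the product of the
  Vandermonde determinant with the power sums of \<open>\<mu>\<close>.\<close>

theorem char_value_eq_alt:
  assumes la: "la \<in> partitions N" and mu: "mu \<in> partitions N" and eq: "mset mu' = mset mu"
  shows "char_value la mu = of_int (alt N (map (pstep N) mu') (beads N la))"
proof -
  define \<pi> where "\<pi> = (SOME \<pi>. \<pi> \<in> sym_group N \<and> cycle_type N \<pi> = mset mu)"
  have "mset mu \<in> cycle_type N ` sym_group N"
    using mu class_fun_expansion_and_cycle_types(2) by blast
  hence "\<exists>\<pi>. \<pi> \<in> sym_group N \<and> cycle_type N \<pi> = mset mu" by force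
  hence p: "\<pi> \<in> sym_group N" "cycle_type N \<pi> = mset mu'"
    using someI_ex[of "\<lambda>\<pi>. \<pi> \<in> sym_group N \<and> cycle_type N \<pi> = mset mu"] eq unfolding \<pi>_def by auto
  have "char_value la mu = irr_char la \<pi>"
    by (simp add: char_value_def partition_sum[OF la] \<pi>_def)
  also have "\<dots> = of_int (omega N la \<pi>)" by (rule irr_char_eq_omega[OF la p(1)])
  also have "omega N la \<pi> = alt N (map (pstep N) mu') (beads N la)"
    by (simp add: omega_def alt_def psi_eq_cnt[OF p])
  finally show ?thesis .
qed

section \<open>Divisibility from cores\<close>

lemma alt_pstep_Cons:
  assumes "t > 0"
  shows "alt N (pstep N t # Ss) \<beta> = (\<Sum>i<N. alt N Ss (\<lambda>j. \<beta> j - int (if j = i then t else 0)))"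
proof -
  have "inj_on (\<lambda>i j. if j = i then t else (0::nat)) {..<N}"
  proof (rule inj_onI)
    fix a b assume "(\<lambda>j. if j = a then t else (0::nat)) = (\<lambda>j. if j = b then t else 0)"
    from fun_cong[OF this, of a] show "a = b" using assms by (simp split: if_splits)
  qed
  thus ?thesis by (simp add: alt_Cons pstep_def sum.reindex)
qed

text \<open>The relevant case of the Murnaghan--Nakayama rule: the hypothesis says that \<open>la\<close> is a \<open>t\<close>-core.\<close>

lemma char_value_eq_0:
  assumes la: "la \<in> partitions N" and mu: "mu \<in> partitions N" and t: "t \<in> set mu"
    and core: "\<And>i. i < N \<Longrightarrow> beads N la i - int t < 0 \<or> (\<exists>j<N. beads N la j = beads N la i - int t)"
  shows "char_value la mu = 0"
proof -
  have t0: "t > 0" using mu t by (auto simp: partitions_def)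
  have "mset (t # remove1 t mu) = mset mu" using t by simp
  from char_value_eq_alt[OF la mu this]
  have "char_value la mu = of_int (alt N (pstep N t # map (pstep N) (remove1 t mu)) (beads N la))" by simp
  also have "alt N (pstep N t # map (pstep N) (remove1 t mu)) (beads N la) = 0"
    unfolding alt_pstep_Cons[OF t0]
  proof (rule sum.neutral, intro ballI)
    fix i assume "i \<in> {..<N}"
    hence i: "i < N" by simp
    let ?b = "\<lambda>j. beads N la j - int (if j = i then t else 0)"
    show "alt N (map (pstep N) (remove1 t mu)) ?b = 0"
    proof (cases "beads N la i - int t < 0")
      case True
      thus ?thesis using i by (intro alt_neg[of i]) auto
    next
      case False
      then obtain j where j: "j < N" "beads N la j = beads N la i - int t" using core[OF i] by blast
      hence "j \<noteq> i" using t0 by auto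
      thus ?thesis using i j by (intro alt_eq_0_if_repeated[of _ _ i j]) auto
    qed
  qed
  finally show ?thesis by simp
qed

text \<open>The binomial theorem for commuting operators. The operators are plain functions, so
  linearity is assumed in the form in which it is applied, for weighted sums over
  \<open>{..n}\<close>.\<close>

lemma funpow_sum_binomial:
  fixes A B :: "('b \<Rightarrow> int) \<Rightarrow> ('b \<Rightarrow> int)"
  assumes A: "\<And>n c F. A (\<lambda>\<beta>. \<Sum>k\<le>(n::nat). c k * F k \<beta>) = (\<lambda>\<beta>. \<Sum>k\<le>n. c k * A (F k) \<beta>)"
    and B: "\<And>n c F. B (\<lambda>\<beta>. \<Sum>k\<le>(n::nat). c k * F k \<beta>) = (\<lambda>\<beta>. \<Sum>k\<le>n. c k * B (F k) \<beta>)"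
    and comm: "\<And>X. A (B X) = B (A X)"
  shows "((\<lambda>X \<beta>. A X \<beta> + B X \<beta>) ^^ m) X = (\<lambda>\<beta>. \<Sum>k\<le>m. int (m choose k) * (A ^^ k) ((B ^^ (m - k)) X) \<beta>)"
proof (induction m)
  case (Suc m)
  define g where "g k = (A ^^ k) ((B ^^ (Suc m - k)) X)" for k
  have comm': "B ((A ^^ k) Y) = (A ^^ k) (B Y)" for k Y
    by (induction k) (simp_all add: comm[symmetric])
  have gA: "A ((A ^^ k) ((B ^^ (m - k)) X)) = g (Suc k)" for k by (simp add: g_def)
  have gB: "B ((A ^^ k) ((B ^^ (m - k)) X)) = g k" if "k \<le> m" for k
    using that by (simp add: g_def comm' Suc_diff_le)
  show ?case
  proof
    fix \<beta>
    have "((\<lambda>X \<beta>. A X \<beta> + B X \<beta>) ^^ Suc m) X \<beta>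
        = (\<Sum>k\<le>m. int (m choose k) * g (Suc k) \<beta>) + (\<Sum>k\<le>m. int (m choose k) * g k \<beta>)"
      by (simp add: Suc.IH A B gA gB)
    also have "(\<Sum>k\<le>m. int (m choose k) * g k \<beta>) = (\<Sum>k\<le>Suc m. int (m choose k) * g k \<beta>)"
      by (simp add: binomial_eq_0)
    also have "\<dots> = g 0 \<beta> + (\<Sum>k\<le>m. int (m choose Suc k) * g (Suc k) \<beta>)"
      by (subst sum.atMost_Suc_shift) simp
    also have "(\<Sum>k\<le>m. int (m choose k) * g (Suc k) \<beta>) + (g 0 \<beta> + (\<Sum>k\<le>m. int (m choose Suc k) * g (Suc k) \<beta>))
        = g 0 \<beta> + (\<Sum>k\<le>m. int (Suc m choose Suc k) * g (Suc k) \<beta>)"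
      by (simp add: sum.distrib distrib_right)
    also have "\<dots> = (\<Sum>k\<le>Suc m. int (Suc m choose k) * g k \<beta>)"
      by (subst sum.atMost_Suc_shift) simp
    finally show "((\<lambda>X \<beta>. A X \<beta> + B X \<beta>) ^^ Suc m) X \<beta>
      = (\<Sum>k\<le>Suc m. int (Suc m choose k) * (A ^^ k) ((B ^^ (Suc m - k)) X) \<beta>)" by (simp add: g_def)
  qed
qed simp

lemma funpow_prime_cong:
  fixes A B :: "('b \<Rightarrow> int) \<Rightarrow> ('b \<Rightarrow> int)"
  assumes A: "\<And>n c F. A (\<lambda>\<beta>. \<Sum>k\<le>(n::nat). c k * F k \<beta>) = (\<lambda>\<beta>. \<Sum>k\<le>n. c k * A (F k) \<beta>)"
    and B: "\<And>n c F. B (\<lambda>\<beta>. \<Sum>k\<le>(n::nat). c k * F k \<beta>) = (\<lambda>\<beta>. \<Sum>k\<le>n. c k * B (F k) \<beta>)"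
    and comm: "\<And>X. A (B X) = B (A X)" and p: "prime p"
  shows "[((\<lambda>X \<beta>. A X \<beta> + B X \<beta>) ^^ p) X \<beta> = (A ^^ p) X \<beta> + (B ^^ p) X \<beta>] (mod int p)"
proof -
  let ?g = "\<lambda>k. int (p choose k) * (A ^^ k) ((B ^^ (p - k)) X) \<beta>"
  have p1: "p > 0" using p by (simp add: prime_gt_0_nat)
  have "((\<lambda>X \<beta>. A X \<beta> + B X \<beta>) ^^ p) X \<beta> = (\<Sum>k\<le>p. ?g k)"
    by (simp add: funpow_sum_binomial[OF A B comm])
  also have "\<dots> = (\<Sum>k\<in>{0, p}. ?g k) + (\<Sum>k\<in>{..p} - {0, p}. ?g k)"
    by (subst sum.subset_diff[of "{0, p}" "{..p}"]) auto
  also have "(\<Sum>k\<in>{0, p}. ?g k) = (A ^^ p) X \<beta> + (B ^^ p) X \<beta>" using p1 by simp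
  finally have eq: "((\<lambda>X \<beta>. A X \<beta> + B X \<beta>) ^^ p) X \<beta> = (A ^^ p) X \<beta> + (B ^^ p) X \<beta> + (\<Sum>k\<in>{..p} - {0, p}. ?g k)" .
  have "int p dvd (\<Sum>k\<in>{..p} - {0, p}. ?g k)"
  proof (rule dvd_sum)
    fix k assume "k \<in> {..p} - {0, p}"
    hence "p dvd (p choose k)" using p by (intro dvd_choose_prime) auto
    thus "int p dvd ?g k" by (simp add: dvd_mult2)
  qed
  thus ?thesis unfolding eq by (simp add: cong_iff_dvd_diff)
qed

text \<open>Multiplication by the m-th power of the variable i, seen on coefficient functions;
  \<open>shifts m n\<close> is then multiplication by the power sum of degree m in the first n
  variables.\<close>

definition shift :: "nat \<Rightarrow> nat \<Rightarrow> ((nat \<Rightarrow> int) \<Rightarrow> int) \<Rightarrow> (nat \<Rightarrow> int) \<Rightarrow> int" where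
  "shift m i X = (\<lambda>\<beta>. X (\<lambda>j. \<beta> j - int (if j = i then m else 0)))"

definition shifts :: "nat \<Rightarrow> nat \<Rightarrow> ((nat \<Rightarrow> int) \<Rightarrow> int) \<Rightarrow> (nat \<Rightarrow> int) \<Rightarrow> int" where
  "shifts m n X = (\<lambda>\<beta>. \<Sum>i<n. shift m i X \<beta>)"

lemma funpow_shift: "(shift m i ^^ k) X = shift (k * m) i X"
proof (induction k)
  case (Suc k)
  have "(\<lambda>j. \<beta> j - int (if j = i then m else 0) - int (if j = i then k * m else 0))
      = (\<lambda>j. \<beta> j - int (if j = i then m + k * m else 0))" for \<beta> :: "nat \<Rightarrow> int" by auto
  thus ?case by (simp add: Suc.IH) (simp add: shift_def)
qed (simp add: shift_def)

text \<open>Induction on the number of variables: a new variable adds a commuting operator, p-th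
  powers are additive modulo p, and the p-th iterate of a single shift by m is a shift by p
  m.\<close>

lemma shifts_prime_cong:
  assumes p: "prime p"
  shows "[(shifts m n ^^ p) X \<beta> = shifts (p * m) n X \<beta>] (mod int p)"
proof (induction n)
  case 0
  have "(shifts m 0 ^^ p) X = (\<lambda>_. 0)"
    using prime_gt_0_nat[OF p] by (cases p) (auto simp: shifts_def)
  thus ?case by (simp add: shifts_def[of "p * m"])
next
  case (Suc n)
  have S: "shifts m (Suc n) = (\<lambda>X \<beta>. shifts m n X \<beta> + shift m n X \<beta>)" by (simp add: shifts_def fun_eq_iff)
  have "[((\<lambda>X \<beta>. shifts m n X \<beta> + shift m n X \<beta>) ^^ p) X \<beta> = (shifts m n ^^ p) X \<beta> + (shift m n ^^ p) X \<beta>] (mod int p)"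
  proof (rule funpow_prime_cong[OF _ _ _ p])
    fix l c and F :: "nat \<Rightarrow> (nat \<Rightarrow> int) \<Rightarrow> int"
    show "shifts m n (\<lambda>\<beta>. \<Sum>k\<le>l. c k * F k \<beta>) = (\<lambda>\<beta>. \<Sum>k\<le>l. c k * shifts m n (F k) \<beta>)"
      unfolding shifts_def shift_def sum_distrib_left by (subst sum.swap) simp
    show "shift m n (\<lambda>\<beta>. \<Sum>k\<le>l. c k * F k \<beta>) = (\<lambda>\<beta>. \<Sum>k\<le>l. c k * shift m n (F k) \<beta>)"
      by (simp add: shift_def)
    show "shifts m n (shift m n Y) = shift m n (shifts m n Y)" for Y
      unfolding shifts_def shift_def by (intro ext sum.cong refl arg_cong[where f=Y]) auto
  qed
  also have "[(shifts m n ^^ p) X \<beta> + (shift m n ^^ p) X \<beta> = shifts (p * m) n X \<beta> + shift (p * m) n X \<beta>] (mod int p)"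
    unfolding funpow_shift by (intro cong_add Suc.IH) simp
  finally show ?case unfolding S by (simp add: shifts_def)
qed

lemma alt_merge_cong:
  assumes p: "prime p" and m: "m > 0"
  shows "[alt N (map (pstep N) (replicate p m @ mu)) \<beta> = alt N (map (pstep N) (p * m # mu)) \<beta>] (mod int p)"
proof -
  define X where "X = alt N (map (pstep N) mu)"
  have step: "alt N (pstep N t # Ss) = shifts t N (alt N Ss)" if "t > 0" for t Ss
    by (rule ext) (simp add: alt_pstep_Cons[OF that] shifts_def shift_def)
  have "alt N (map (pstep N) (replicate k m @ mu)) = (shifts m N ^^ k) X" for k
    by (induction k) (simp_all add: step[OF m] X_def)
  moreover have "alt N (map (pstep N) (p * m # mu)) = shifts (p * m) N X"
    using step[of "p * m"] m prime_gt_0_nat[OF p] by (simp add: X_def)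
  ultimately show ?thesis using shifts_prime_cong[OF p] by simp
qed

text \<open>Merging parts acts on multisets, so character values are indexed by them here instead of
  by sorted lists.\<close>

definition mset_char :: "nat list \<Rightarrow> nat multiset \<Rightarrow> complex" where
  "mset_char la M = char_value la (rev (sorted_list_of_multiset M))"

lemma mset_char_eq:
  assumes la: "la \<in> partitions N" and M: "\<And>k. k \<in># M \<Longrightarrow> k > 0" "sum_mset M = N" and mu: "mset mu = M"
  shows "mset_char la M = of_int (alt N (map (pstep N) mu) (beads N la))"
proof -
  have "rev (sorted_list_of_multiset M) \<in> partitions N"
    using M sum_mset_sum_list[of "sorted_list_of_multiset M"] by (auto simp: partitions_def sorted_wrt_rev)
  thus ?thesis unfolding mset_char_def by (rule char_value_eq_alt[OF la]) (simp add: mu)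
qed

lemma mset_char_merge:
  assumes la: "la \<in> partitions N" and p: "prime p" and m: "m > 0"
    and M: "\<And>k. k \<in># M \<Longrightarrow> k > 0" "sum_mset M + p * m = N"
    and dvd: "int_divides p (mset_char la (add_mset (p * m) M))"
  shows "int_divides p (mset_char la (replicate_mset p m + M))"
proof -
  obtain mu where mu: "mset mu = M" using ex_mset by blast
  define a where "a = alt N (map (pstep N) (replicate p m @ mu)) (beads N la)"
  define b where "b = alt N (map (pstep N) (p * m # mu)) (beads N la)"
  have "mset_char la (replicate_mset p m + M) = of_int a" unfolding a_def
    by (rule mset_char_eq[OF la]) (use M m mu in \<open>auto simp: sum_mset_replicate_mset split: if_splits\<close>)
  moreover have "mset_char la (add_mset (p * m) M) = of_int b" unfolding b_def
    by (rule mset_char_eq[OF la]) (use M m mu prime_gt_0_nat[OF p] in \<open>auto\<close>)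
  moreover have "[a = b] (mod int p)" unfolding a_def b_def by (rule alt_merge_cong[OF p m])
  moreover have "int_divides q (of_int c) \<longleftrightarrow> int q dvd c" for q c
    unfolding int_divides_def dvd_def of_int_eq_iff ..
  ultimately show ?thesis using dvd by (simp add: cong_dvd_iff)
qed

text \<open>Merging \<open>p\<close> equal parts \<open>m\<^sub>0 p\<^sup>j\<close> into one part \<open>m\<^sub>0 p\<^bsup>j+1\<^esup>\<close> preserves the sum
  \<open>\<Sum>\<^sub>j p\<^sup>j c(m\<^sub>0 p\<^sup>j)\<close> and is possible as long as the part \<open>m\<^sub>0 p\<^sup>k\<close> does not occur.\<close>

lemma int_divides_of_core:
  assumes la: "la \<in> partitions N" and p: "prime p" and m0: "m0 > 0"
    and M: "\<And>x. x \<in># M \<Longrightarrow> x > 0" "sum_mset M = N"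
    and big: "p ^ k \<le> (\<Sum>j\<le>k. p ^ j * count M (m0 * p ^ j))"
    and core: "\<And>i. i < N \<Longrightarrow> beads N la i - int (m0 * p ^ k) < 0 \<or>
        (\<exists>j<N. beads N la j = beads N la i - int (m0 * p ^ k))"
  shows "int_divides p (mset_char la M)"
  using M big
proof (induction "size M" arbitrary: M rule: less_induct)
  case less
  have p0: "p > 0" and p2: "p \<ge> 2" using p by (auto simp: prime_gt_0_nat prime_ge_2_nat)
  show ?case
  proof (cases "m0 * p ^ k \<in># M")
    case True
    have part: "rev (sorted_list_of_multiset M) \<in> partitions N"
      using less.prems sum_mset_sum_list[of "sorted_list_of_multiset M"] by (auto simp: partitions_def sorted_wrt_rev)
    have "mset_char la M = 0" unfolding mset_char_def
      by (rule char_value_eq_0[OF la part _ core]) (use True in auto)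
    thus ?thesis by (auto simp: int_divides_def)
  next
    case False
    hence "count M (m0 * p ^ k) = 0" by (simp add: not_in_iff)
    moreover have "{..k} = insert k {..<k}" by auto
    ultimately have big: "p ^ k \<le> (\<Sum>j<k. p ^ j * count M (m0 * p ^ j))" using less.prems(3) by simp
    \<comment> \<open>If all multiplicities were below p, they would be the base p digits of a
      number with k digits, hence below p^k.\<close>
    have "\<exists>j<k. p \<le> count M (m0 * p ^ j)"
    proof (rule ccontr)
      assume "\<not> ?thesis"
      hence "(\<Sum>j<k. p ^ j * count M (m0 * p ^ j)) \<le> (\<Sum>j<k. p ^ j * (p - 1))"
        by (intro sum_mono mult_left_mono) fastforce+
      also have "\<dots> < p ^ k"
      proof (induction k)
        case (Suc k)
        have "p ^ k * (p - 1) + p ^ k = p ^ Suc k" using p0 by (cases p) auto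
        thus ?case using Suc by simp
      qed simp
      finally show False using big by simp
    qed
    then obtain j where j: "j < k" "p \<le> count M (m0 * p ^ j)" by blast
    define m where "m = m0 * p ^ j"
    have m: "m > 0" using m0 p0 by (simp add: m_def)
    have "replicate_mset p m \<subseteq># M" using j by (simp add: m_def count_le_replicate_mset_subset_eq[symmetric])
    then obtain M0 where M0: "M = replicate_mset p m + M0" by (metis subset_mset.le_iff_add)
    define M' where "M' = add_mset (p * m) M0"
    have pos: "x > 0" if "x \<in># M'" for x using that less.prems(1) M0 m p0 by (auto simp: M'_def)
    have sum: "sum_mset M' = N" using less.prems(2) M0 by (simp add: M'_def sum_mset_replicate_mset)
    have pm: "p * m = m0 * p ^ Suc j" by (simp add: m_def)
    have inj: "p ^ a = p ^ b \<longleftrightarrow> a = b" for a b using p2 by (simp add: power_inject_exp)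
    have "(\<Sum>i\<le>k. p ^ i * count M' (m0 * p ^ i)) = (\<Sum>i\<le>k. p ^ i * count M0 (m0 * p ^ i) + (if i = Suc j then p ^ Suc j else 0))"
      unfolding M'_def pm by (intro sum.cong refl) (use m0 in \<open>auto simp: inj simp del: power_Suc\<close>)
    also have "\<dots> = (\<Sum>i\<le>k. p ^ i * count M0 (m0 * p ^ i)) + p ^ Suc j"
      using j by (simp add: sum.distrib del: power_Suc)
    also have "\<dots> = (\<Sum>i\<le>k. p ^ i * count M0 (m0 * p ^ i) + (if i = j then p ^ j * p else 0))"
      using j by (simp add: sum.distrib)
    also have "\<dots> = (\<Sum>i\<le>k. p ^ i * count M (m0 * p ^ i))"
      unfolding M0 m_def by (intro sum.cong refl) (use m0 in \<open>auto simp: inj distrib_left\<close>)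
    finally have big': "p ^ k \<le> (\<Sum>i\<le>k. p ^ i * count M' (m0 * p ^ i))" using less.prems(3) by simp
    \<comment> \<open>A merge replaces p parts by one, so the number of parts is the termination
      measure.\<close>
    have "size M' < size M" using p2 by (simp add: M'_def M0)
    from less.hyps[OF this pos sum big'] have "int_divides p (mset_char la (add_mset (p * m) M0))"
      by (simp add: M'_def)
    thus ?thesis unfolding M0
      by (intro mset_char_merge[OF la p m]) (use less.prems M0 in \<open>auto simp: sum_mset_replicate_mset\<close>)
  qed
qed

lemma mset_char_mset: "mu \<in> partitions N \<Longrightarrow> mset_char la (mset mu) = char_value la mu"
proof -
  assume "mu \<in> partitions N"
  hence "sorted (rev mu)" by (simp add: partitions_def sorted_wrt_rev)
  hence "sorted_list_of_multiset (mset mu) = rev mu"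
    by (metis mset_rev sorted_list_of_multiset_mset sorted_sort_id)
  thus ?thesis by (simp add: mset_char_def)
qed

section \<open>Counting non-cores\<close>

text \<open>The abacus: \<lambda> as a set of n occupied positions. The number n is kept apart from
  the size of \<lambda> because removing hooks shrinks the partition while the number of beads
  stays.\<close>

definition bead_set :: "nat \<Rightarrow> nat list \<Rightarrow> nat set" where
  "bead_set n la = (\<lambda>i. nat (beads n la i)) ` {..<n}"

text \<open>The configurations of partitions of size M: the offset \<open>\<Sum>{..<n}\<close>
  belongs to the empty partition. Below, \<open>removable\<close> collects the beads that can slide
  down by t, which correspond to removable rim hooks of length t.\<close>

definition bead_sets :: "nat \<Rightarrow> nat \<Rightarrow> nat set set" where
  "bead_sets n M = {B. finite B \<and> card B = n \<and> \<Sum>B = M + \<Sum>{..<n}}"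

definition removable :: "nat \<Rightarrow> nat set \<Rightarrow> nat set" where
  "removable t B = {b \<in> B. t \<le> b \<and> b - t \<notin> B}"

lemma finite_bead_sets: "finite (bead_sets n M)"
proof -
  have "bead_sets n M \<subseteq> Pow {..M + \<Sum>{..<n}}"
  proof (intro subsetI PowI)
    fix B b assume B: "B \<in> bead_sets n M" "b \<in> B"
    hence "b \<le> \<Sum>B" using member_le_sum[of b B "\<lambda>x. x"] by (auto simp: bead_sets_def)
    thus "b \<in> {..M + \<Sum>{..<n}}" using B by (simp add: bead_sets_def)
  qed
  thus ?thesis using finite_subset by blast
qed

text \<open>Inverse of the abacus: list the beads decreasingly, subtract the staircase, and cut off
  the zeros at the end. The differences are nonincreasing because distinct beads drop by at least
  one at each place.\<close>

lemma bead_sets_subset_image: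
  "bead_sets n M \<subseteq> bead_set n ` partitions M"
proof
  fix B assume "B \<in> bead_sets n M"
  hence B: "finite B" "card B = n" "\<Sum>B = M + \<Sum>{..<n}" by (auto simp: bead_sets_def)
  define x where "x = rev (sorted_list_of_set B)"
  have lx: "length x = n" and sx: "set x = B" using B by (simp_all add: x_def)
  have dec: "x ! j < x ! i" if "i < j" "j < n" for i j
  proof -
    have "sorted_wrt (>) x"
      unfolding x_def sorted_wrt_rev by simp
    thus ?thesis using that lx by (simp add: sorted_wrt_iff_nth_less)
  qed
  have low: "n - 1 - i \<le> x ! i" if "i < n" for i
  proof -
    have "k \<le> n - 1 \<Longrightarrow> k \<le> x ! (n - 1 - k)" for k
    proof (induction k)
      case (Suc k)
      have "x ! (n - 1 - k) < x ! (n - 1 - Suc k)" using Suc.prems that by (intro dec) auto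
      thus ?case using Suc by simp
    qed simp
    from this[of "n - 1 - i"] show ?thesis using that by simp
  qed
  define f where "f i = x ! i - (n - 1 - i)" for i
  have fdec: "f j \<le> f i" if "i \<le> j" "j < n" for i j
    using that
  proof (induction j)
    case (Suc j)
    show ?case
    proof (cases "i = Suc j")
      case False
      hence "f j \<le> f i" using Suc by simp
      moreover have "f (Suc j) \<le> f j"
        using dec[of j "Suc j"] low[of j] low[of "Suc j"] Suc.prems by (simp add: f_def)
      ultimately show ?thesis by simp
    qed simp
  qed simp
  define fl where "fl = map f [0..<n]"
  define la where "la = takeWhile (\<lambda>k. k > 0) fl"
  define l where "l = length la"
  have l: "l \<le> n" using length_takeWhile_le[of "\<lambda>k. k > 0" fl] by (simp add: l_def la_def fl_def)
  have lai: "la ! i = f i" if "i < l" for i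
    using that takeWhile_nth[of i "\<lambda>k. k > 0" fl] l by (simp add: l_def la_def fl_def)
  have f0: "f i = 0" if "l \<le> i" "i < n" for i
  proof -
    have "l < length fl" using that by (simp add: fl_def)
    hence "\<not> fl ! l > 0" using nth_length_takeWhile[of "\<lambda>k. k > 0" fl] by (simp add: l_def la_def)
    hence "f l = 0" using \<open>l < length fl\<close> by (simp add: fl_def)
    thus ?thesis using fdec[OF that] by simp
  qed
  have "sum_list la = (\<Sum>i<l. f i)"
    using lai by (simp add: sum_list_sum_nth l_def lessThan_atLeast0)
  also have "\<dots> = (\<Sum>i<n. f i)" using l f0 by (intro sum.mono_neutral_left) auto
  finally have sl: "sum_list la = (\<Sum>i<n. f i)" .
  have "distinct x" by (simp add: x_def)
  hence "\<Sum>B = sum_list x" using sum_list_distinct_conv_sum_set[of x "\<lambda>x. x"] sx by simp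
  also have "\<dots> = (\<Sum>i<n. x ! i)" using lx by (simp add: sum_list_sum_nth lessThan_atLeast0)
  also have "\<dots> = (\<Sum>i<n. f i + (n - 1 - i))" 
  proof (rule sum.cong[OF refl])
    fix i assume "i \<in> {..<n}"
    thus "x ! i = f i + (n - 1 - i)" unfolding f_def using low[of i] by (simp only: le_add_diff_inverse2 lessThan_iff)
  qed
  also have "\<dots> = (\<Sum>i<n. f i) + (\<Sum>i<n. n - 1 - i)" by (rule sum.distrib)
  also have "(\<Sum>i<n. n - 1 - i) = \<Sum>{..<n}"
    using sum.nat_diff_reindex[of "\<lambda>i. i" n] by simp
  finally have sM: "(\<Sum>i<n. f i) = M" using B by simp
  have "la \<in> partitions M"
    unfolding partitions_def
  proof (intro CollectI conjI)
    show "sorted_wrt (\<ge>) la" using l lai fdec by (auto simp: sorted_wrt_iff_nth_less l_def)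
    show "\<forall>k\<in>set la. 0 < k" by (auto simp: la_def dest: set_takeWhileD)
    show "sum_list la = M" using sl sM by simp
  qed
  moreover have "bead_set n la = B"
  proof -
    have "nat (beads n la i) = x ! i" if "i < n" for i
    proof -
      have "part la i = int (f i)" using lai[of i] f0[of i] that by (auto simp: part_def l_def not_less)
      thus ?thesis using low[OF that] that by (simp add: beads_def stair_def f_def)
    qed
    hence "bead_set n la = (!) x ` {..<n}" by (simp add: bead_set_def)
    also have "\<dots> = B" using sx lx by (auto simp: set_conv_nth)
    finally show ?thesis .
  qed
  ultimately show "B \<in> bead_set n ` partitions M" by blast
qed

lemma card_bead_sets_le: "card (bead_sets n M) \<le> card (partitions M)"
  using card_mono[OF finite_imageI[OF finite_partitions] bead_sets_subset_image]
    card_image_le[OF finite_partitions] le_trans by blast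

lemma beads_nonneg: "i < n \<Longrightarrow> beads n la i \<ge> 0"
  by (simp add: beads_def part_def stair_def)

lemma bead_set_in:
  assumes la: "la \<in> partitions M" and M: "M \<le> n"
  shows "bead_set n la \<in> bead_sets n M"
proof -
  have dec: "strict_dec n (beads n la)"
    unfolding strict_dec_def
  proof (intro allI impI)
    fix i assume "Suc i < n"
    have "part la (Suc i) \<le> part la i"
      using la sorted_wrt_nth_less[of "(\<ge>)" la i "Suc i"] by (auto simp: part_def partitions_def)
    thus "beads n la (Suc i) < beads n la i" by (simp add: beads_def stair_def)
  qed
  have inj: "inj_on (\<lambda>i. nat (beads n la i)) {..<n}"
  proof (rule inj_onI)
    fix i j assume ij: "i \<in> {..<n}" "j \<in> {..<n}" "nat (beads n la i) = nat (beads n la j)"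
    hence "beads n la i = beads n la j" using beads_nonneg[of i n la] beads_nonneg[of j n la] by auto
    thus "i = j" using strict_dec_sorted[OF dec, of i j] strict_dec_sorted[OF dec, of j i] ij
      by (cases i j rule: linorder_cases) auto
  qed
  have "int (\<Sum>(bead_set n la)) = (\<Sum>i<n. beads n la i)"
    using beads_nonneg by (simp add: bead_set_def sum.reindex[OF inj])
  also have "\<dots> = int (sum_list (take n la)) + (\<Sum>i<n. stair n i)"
    by (simp add: beads_def sum.distrib sum_part)
  also have "take n la = la" using length_le_partition[OF la] M by simp
  also have "(\<Sum>i<n. stair n i) = (\<Sum>i<n. int (n - 1 - i))"
    by (intro sum.cong) (auto simp: stair_def)
  also have "\<dots> = int (\<Sum>i<n. n - 1 - i)" by (simp only: of_nat_sum)
  also have "\<dots> = int (\<Sum>{..<n})" using sum.nat_diff_reindex[of "\<lambda>i. i" n] by simp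
  finally have "\<Sum>(bead_set n la) = M + \<Sum>{..<n}" using partition_sum[OF la] by linarith
  moreover have "card (bead_set n la) = n" by (simp add: bead_set_def card_image[OF inj])
  ultimately show ?thesis by (simp add: bead_sets_def bead_set_def)
qed

lemma bead_set_inj: "inj_on (bead_set N) (partitions N)"
proof -
  \<comment> \<open>The index of a bead is the number of larger beads, so the set determines the
    whole sequence.\<close>
  have rank: "card {b \<in> bead_set N la. nat (beads N la i) < b} = i" if la: "la \<in> partitions N" and i: "i < N" for la i
  proof -
    note dec = strict_dec_sorted[OF strict_dec_beads[OF la]]
    have "{b \<in> bead_set N la. nat (beads N la i) < b} = (\<lambda>j. nat (beads N la j)) ` {..<i}"
    proof (intro equalityI subsetI)
      fix b assume "b \<in> {b \<in> bead_set N la. nat (beads N la i) < b}"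
      then obtain j where j: "j < N" "b = nat (beads N la j)" "nat (beads N la i) < b" by (auto simp: bead_set_def)
      hence "beads N la i < beads N la j" using beads_nonneg[of i N la] i by simp
      hence "j < i" using dec[of i j] j by (metis linorder_neqE_nat not_less_iff_gr_or_eq)
      thus "b \<in> (\<lambda>j. nat (beads N la j)) ` {..<i}" using j by blast
    next
      fix b assume "b \<in> (\<lambda>j. nat (beads N la j)) ` {..<i}"
      then obtain j where j: "j < i" "b = nat (beads N la j)" by blast
      thus "b \<in> {b \<in> bead_set N la. nat (beads N la i) < b}"
        using dec[OF j(1) i] beads_nonneg[of i N la] i by (auto simp: bead_set_def)
    qed
    moreover have "inj_on (\<lambda>j. nat (beads N la j)) {..<i}"
    proof (rule inj_onI)
      fix a b assume ab: "a \<in> {..<i}" "b \<in> {..<i}" "nat (beads N la a) = nat (beads N la b)"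
      hence "beads N la a = beads N la b" using beads_nonneg[of a N la] beads_nonneg[of b N la] i by auto
      thus "a = b" using dec[of a b] dec[of b a] ab i by (cases a b rule: linorder_cases) auto
    qed
    ultimately show ?thesis by (simp add: card_image)
  qed
  show ?thesis
  proof (rule inj_onI)
    fix la la' assume la: "la \<in> partitions N" and la': "la' \<in> partitions N" and eq: "bead_set N la = bead_set N la'"
    have beq: "beads N la i = beads N la' i" if i: "i < N" for i
    proof -
      define b where "b = nat (beads N la i)"
      define b' where "b' = nat (beads N la' i)"
      have r: "card {c \<in> bead_set N la. b < c} = i" "card {c \<in> bead_set N la. b' < c} = i"
        using rank[OF la i] rank[OF la' i] eq by (auto simp: b_def b'_def)
      have mem: "b \<in> bead_set N la" "b' \<in> bead_set N la" using i eq by (auto simp: b_def b'_def bead_set_def)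
      have fin: "finite (bead_set N la)" by (simp add: bead_set_def)
      have "\<not> c < d" if "card {e \<in> bead_set N la. c < e} = card {e \<in> bead_set N la. d < e}" "d \<in> bead_set N la" for c d
      proof
        assume "c < d"
        hence "{e \<in> bead_set N la. d < e} \<subset> {e \<in> bead_set N la. c < e}" using that(2) by auto
        hence "card {e \<in> bead_set N la. d < e} < card {e \<in> bead_set N la. c < e}"
          using fin by (intro psubset_card_mono) auto
        thus False using that(1) by simp
      qed
      hence "b = b'" using r mem by (metis linorder_neqE_nat)
      thus ?thesis using beads_nonneg[of i N la] beads_nonneg[of i N la'] i by (simp add: b_def b'_def)
    qed
    have "sum_list (take k la) = sum_list (take k la')" if "k \<le> N" for k
    proof -
      have "(\<Sum>i<k. part la i) = (\<Sum>i<k. part la' i)"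
      proof (rule sum.cong[OF refl])
        fix i assume "i \<in> {..<k}"
        thus "part la i = part la' i" using beq[of i] that by (simp add: beads_def)
      qed
      thus ?thesis by (simp add: sum_part)
    qed
    hence "dominated la la'" "dominated la' la"
      using not_dominated_bounded[OF la la'] not_dominated_bounded[OF la' la] by fastforce+
    thus "la = la'" using dominated_antisym[OF la la'] by blast
  qed
qed

text \<open>If a position c < t were empty, moving every bead above c down by one would keep the
  beads distinct and lower the sum by at least n - c > M, below the minimal sum of n
  positions.\<close>

lemma initial_segment_subset:
  assumes B: "B \<in> bead_sets n M" and t: "t + M \<le> n"
  shows "{..<t} \<subseteq> B"
proof (rule ccontr)
  assume "\<not> ?thesis"
  then obtain c where c: "c < t" "c \<notin> B" by auto
  have fB: "finite B" "card B = n" "\<Sum>B = M + \<Sum>{..<n}" using B by (auto simp: bead_sets_def)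
  define g where "g b = (if b < c then b else b - 1)" for b
  have inj: "inj_on g B"
  proof (rule inj_onI)
    fix a b assume "a \<in> B" "b \<in> B" "g a = g b"
    moreover from this have "a \<noteq> c" "b \<noteq> c" using c by auto
    ultimately show "a = b" by (auto simp: g_def split: if_splits)
  qed
  have "\<Sum>{..<n} \<le> \<Sum>(g ` B)" using sum_lessThan_card(1)[of "g ` B"] fB card_image[OF inj] by simp
  also have "\<dots> = (\<Sum>b\<in>B. g b)" by (simp add: sum.reindex[OF inj])
  finally have 1: "\<Sum>{..<n} \<le> (\<Sum>b\<in>B. g b)" .
  have "\<Sum>B = (\<Sum>b\<in>B. g b + (if b < c then 0 else 1))"
  proof (rule sum.cong[OF refl])
    fix b assume "b \<in> B"
    hence "b \<noteq> c" using c by auto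
    thus "b = g b + (if b < c then 0 else 1)" by (auto simp: g_def)
  qed
  also have "\<dots> = (\<Sum>b\<in>B. g b) + card (B \<inter> - {..<c})"
    using fB by (simp add: sum.distrib sum.If_cases lessThan_def)
  finally have 2: "\<Sum>B = (\<Sum>b\<in>B. g b) + card (B \<inter> - {..<c})" .
  have "card B = card (B \<inter> {..<c}) + card (B \<inter> - {..<c})"
    using fB by (subst card_Un_disjoint[symmetric]) (auto intro: arg_cong[where f=card])
  moreover have "card (B \<inter> {..<c}) \<le> c" using card_mono[of "{..<c}" "B \<inter> {..<c}"] by simp
  ultimately have "n - c \<le> card (B \<inter> - {..<c})" using fB by linarith
  thus False using 1 2 fB c t by linarith
qed

text \<open>Sliding a bead down by t injects pairs (configuration of size M, removable bead) into
  pairs (configuration of size M - t, bead that can slide up). In each configuration the latter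
  beads outnumber the removable ones by exactly t, so the total at M is at most t p(M - t) plus the
  total at M - t.\<close>

lemma sum_removable_le:
  assumes t: "t > 0"
  shows "M \<le> n \<Longrightarrow> (\<Sum>B\<in>bead_sets n M. card (removable t B)) \<le> t * (\<Sum>j\<in>{1..M div t}. card (partitions (M - j * t)))"
proof (induction M rule: less_induct)
  case (less M)
  define Pr where "Pr = (SIGMA B:bead_sets n M. removable t B)"
  have fr: "finite (removable t B)" if "B \<in> bead_sets n M'" for B M'
    using that by (simp add: removable_def bead_sets_def)
  have cPr: "(\<Sum>B\<in>bead_sets n M. card (removable t B)) = card Pr"
    unfolding Pr_def using fr finite_bead_sets by (subst card_SigmaI) auto
  define mv where "mv = (\<lambda>(B, b). (insert (b - t) (B - {b}), b - t))"
  have mvB: "\<Sum>(insert (b - t) (B - {b})) + t = \<Sum>B" "card (insert (b - t) (B - {b})) = card B"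
    if "finite B" "b \<in> removable t B" for B b
  proof -
    have b: "b \<in> B" "t \<le> b" "b - t \<notin> B" using that by (auto simp: removable_def)
    have "\<Sum>B = b + \<Sum>(B - {b})" using that b by (simp add: sum.remove)
    thus "\<Sum>(insert (b - t) (B - {b})) + t = \<Sum>B" using that b by simp
    have "card (insert (b - t) (B - {b})) = Suc (card (B - {b}))"
      using that b by (intro card_insert_disjoint) auto
    thus "card (insert (b - t) (B - {b})) = card B" using card_Suc_Diff1[OF that(1) b(1)] by simp
  qed
  show ?case
  proof (cases "t \<le> M")
    case False
    have "removable t B = {}" if B: "B \<in> bead_sets n M" for B
    proof (rule ccontr)
      assume "removable t B \<noteq> {}"
      then obtain b where b: "b \<in> removable t B" by blast
      have fB: "finite B" "card B = n" "\<Sum>B = M + \<Sum>{..<n}" using B by (auto simp: bead_sets_def)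
      have "\<Sum>{..<n} \<le> \<Sum>(insert (b - t) (B - {b}))"
        using sum_lessThan_card(1)[of "insert (b - t) (B - {b})"] mvB(2)[OF fB(1) b] fB by simp
      thus False using mvB(1)[OF fB(1) b] fB False by linarith
    qed
    thus ?thesis by simp
  next
    case True
    define Ad where "Ad B = {b \<in> B. b + t \<notin> B}" for B
    have fA: "finite (Ad B)" if "B \<in> bead_sets n M'" for B M' using that by (simp add: Ad_def bead_sets_def)
    have "inj_on mv Pr"
    proof (rule inj_onI)
      fix q q' assume q: "q \<in> Pr" "q' \<in> Pr" "mv q = mv q'"
      obtain B b B' b' where qq: "q = (B, b)" "q' = (B', b')" by (metis surj_pair)
      have b: "b \<in> B" "t \<le> b" "b - t \<notin> B" "b' \<in> B'" "t \<le> b'" "b' - t \<notin> B'"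
        using q qq by (auto simp: Pr_def removable_def)
      have e: "b - t = b' - t" "insert (b - t) (B - {b}) = insert (b' - t) (B' - {b'})" using q(3) qq by (auto simp: mv_def)
      hence bb: "b = b'" using b by linarith
      have "B = insert b (insert (b - t) (B - {b}) - {b - t})" using b t by auto
      also have "\<dots> = insert b' (insert (b' - t) (B' - {b'}) - {b' - t})" using e bb by simp
      also have "\<dots> = B'" using b t by auto
      finally show "q = q'" using qq bb by simp
    qed
    moreover have "mv ` Pr \<subseteq> (SIGMA B:bead_sets n (M - t). Ad B)"
    proof
      fix z assume "z \<in> mv ` Pr"
      then obtain B b where z: "z = (insert (b - t) (B - {b}), b - t)" "B \<in> bead_sets n M" "b \<in> removable t B"
        by (auto simp: Pr_def mv_def)
      have fB: "finite B" "card B = n" "\<Sum>B = M + \<Sum>{..<n}" using z by (auto simp: bead_sets_def)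
      have b: "b \<in> B" "t \<le> b" "b - t \<notin> B" using z by (auto simp: removable_def)
      have "insert (b - t) (B - {b}) \<in> bead_sets n (M - t)"
        using mvB[OF fB(1) z(3)] fB True by (simp add: bead_sets_def)
      moreover have "b - t \<in> Ad (insert (b - t) (B - {b}))" using b t by (auto simp: Ad_def)
      ultimately show "z \<in> (SIGMA B:bead_sets n (M - t). Ad B)" using z by auto
    qed
    moreover have "finite (SIGMA B:bead_sets n (M - t). Ad B)" using fA finite_bead_sets by blast
    ultimately have "card Pr \<le> card (SIGMA B:bead_sets n (M - t). Ad B)" by (rule card_inj_on_le)
    also have "\<dots> = (\<Sum>B\<in>bead_sets n (M - t). card (Ad B))"
      using fA finite_bead_sets by (subst card_SigmaI) auto
    \<comment> \<open>Count \<open>B\<close> twice: by whether b + t is occupied, and by whether b -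
      t is. The two families of pairs at distance t are equinumerous, and the second count has the
      additional t beads of \<open>{..<t}\<close>, all present by
      \<open>initial_segment_subset\<close>.\<close>
    also have "\<dots> = (\<Sum>B\<in>bead_sets n (M - t). t + card (removable t B))"
    proof (rule sum.cong[OF refl])
      fix B assume B: "B \<in> bead_sets n (M - t)"
      have fB: "finite B" using B by (simp add: bead_sets_def)
      have sub: "{..<t} \<subseteq> B" using initial_segment_subset[OF B, of t] less.prems True by simp
      define D where "D = {b \<in> B. b + t \<in> B}"
      define D' where "D' = {b \<in> B. t \<le> b \<and> b - t \<in> B}"
      have "bij_betw (\<lambda>b. b + t) D D'"
        by (rule bij_betw_byWitness[where f'="\<lambda>b. b - t"]) (auto simp: D_def D'_def)
      hence c: "card D = card D'" by (rule bij_betw_same_card)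
      have "B = Ad B \<union> D" "Ad B \<inter> D = {}" by (auto simp: Ad_def D_def)
      hence 1: "card B = card (Ad B) + card D" using card_Un_disjoint[of "Ad B" D] fB by (metis finite_Un)
      have "B = {..<t} \<union> (removable t B \<union> D')" using sub by (auto simp: removable_def D'_def)
      moreover have "{..<t} \<inter> (removable t B \<union> D') = {}" "removable t B \<inter> D' = {}" by (auto simp: removable_def D'_def)
      ultimately have 2: "card B = t + (card (removable t B) + card D')"
        using card_Un_disjoint[of "{..<t}" "removable t B \<union> D'"] card_Un_disjoint[of "removable t B" D'] fB
        by (metis card_lessThan finite_Un finite_lessThan)
      show "card (Ad B) = t + card (removable t B)" using 1 2 c by simp
    qed
    also have "\<dots> = t * card (bead_sets n (M - t)) + (\<Sum>B\<in>bead_sets n (M - t). card (removable t B))"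
      by (simp add: sum.distrib)
    also have "\<dots> \<le> t * card (partitions (M - t)) + t * (\<Sum>j\<in>{1..(M - t) div t}. card (partitions (M - t - j * t)))"
      using less.IH[of "M - t"] less.prems t True by (intro add_mono mult_left_mono card_bead_sets_le) auto
    also have "\<dots> = t * (\<Sum>j\<in>{1..M div t}. card (partitions (M - j * t)))"
    proof -
      have "M div t = Suc ((M - t) div t)" using True t by (simp add: le_div_geq)
      moreover have "(\<Sum>j\<in>{1..Suc K}. card (partitions (M - j * t))) = card (partitions (M - t)) + (\<Sum>j\<in>{1..K}. card (partitions (M - t - j * t)))" for K
      proof -
        have "(\<Sum>j\<in>{1..Suc K}. card (partitions (M - j * t))) = card (partitions (M - t)) + (\<Sum>j\<in>{Suc 1..Suc K}. card (partitions (M - j * t)))"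
          by (simp add: sum.atLeast_Suc_atMost)
        also have "(\<Sum>j\<in>{Suc 1..Suc K}. card (partitions (M - j * t))) = (\<Sum>j\<in>{1..K}. card (partitions (M - Suc j * t)))"
          by (rule sum.shift_bounds_cl_Suc_ivl)
        finally show ?thesis by (simp add: diff_diff_left)
      qed
      ultimately show ?thesis by (simp add: distrib_left)
    qed
    finally show ?thesis using cPr by simp
  qed
qed

text \<open>Markov's inequality: a non-core has at least one removable bead, so the total number of
  removable beads bounds the number of non-cores.\<close>

lemma card_noncores_le:
  assumes t: "t > 0"
  shows "card {la \<in> partitions N. \<not> (\<forall>i<N. beads N la i - int t < 0 \<or> (\<exists>j<N. beads N la j = beads N la i - int t))}
     \<le> t * (\<Sum>j\<in>{1..N div t}. card (partitions (N - j * t)))" (is "card ?A \<le> _")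
proof -
  have "card ?A = card (bead_set N ` ?A)"
    by (rule card_image[symmetric]) (rule inj_on_subset[OF bead_set_inj], auto)
  also have "\<dots> \<le> card {B \<in> bead_sets N N. removable t B \<noteq> {}}"
  proof (rule card_mono)
    show "finite {B \<in> bead_sets N N. removable t B \<noteq> {}}" using finite_bead_sets by simp
    show "bead_set N ` ?A \<subseteq> {B \<in> bead_sets N N. removable t B \<noteq> {}}"
    proof
      fix B assume "B \<in> bead_set N ` ?A"
      then obtain la where la: "la \<in> ?A" "B = bead_set N la" by blast
      then obtain i where "i < N" "\<not> (beads N la i - int t < 0 \<or> (\<exists>j<N. beads N la j = beads N la i - int t))"
        by blast
      hence i: "i < N" "beads N la i - int t \<ge> 0" "\<forall>j<N. beads N la j \<noteq> beads N la i - int t"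
        by auto
      define b where "b = nat (beads N la i)"
      have "b \<in> B" using i la(2) by (auto simp: b_def bead_set_def)
      moreover have "t \<le> b" using i by (simp add: b_def)
      moreover have "b - t \<notin> B"
      proof
        assume "b - t \<in> B"
        then obtain j where j: "j < N" "b - t = nat (beads N la j)" using la(2) by (auto simp: bead_set_def)
        hence "beads N la j = beads N la i - int t"
          using i(2) beads_nonneg[of j N la] beads_nonneg[of i N la] i(1) by (simp add: b_def)
        thus False using i(3) j by blast
      qed
      ultimately have "removable t B \<noteq> {}" by (auto simp: removable_def)
      thus "B \<in> {B \<in> bead_sets N N. removable t B \<noteq> {}}" using bead_set_in[of la N N] la by simp
    qed
  qed
  also have "\<dots> = (\<Sum>B\<in>{B \<in> bead_sets N N. removable t B \<noteq> {}}. 1)" by simp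
  also have "\<dots> \<le> (\<Sum>B\<in>{B \<in> bead_sets N N. removable t B \<noteq> {}}. card (removable t B))"
  proof (rule sum_mono)
    fix B assume B: "B \<in> {B \<in> bead_sets N N. removable t B \<noteq> {}}"
    hence "finite (removable t B)" by (simp add: removable_def bead_sets_def)
    thus "1 \<le> card (removable t B)" using B by (simp add: Suc_le_eq card_gt_0_iff)
  qed
  also have "\<dots> \<le> (\<Sum>B\<in>bead_sets N N. card (removable t B))"
    by (rule sum_mono2) (use finite_bead_sets in auto)
  also have "\<dots> \<le> t * (\<Sum>j\<in>{1..N div t}. card (partitions (N - j * t)))"
    by (rule sum_removable_le[OF t order_refl])
  finally show ?thesis .
qed

section \<open>The partition recurrence\<close>

definition pcount :: "nat \<Rightarrow> nat" where
  "pcount n = card (partitions n)"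

definition mpartitions :: "nat \<Rightarrow> nat multiset set" where
  "mpartitions n = {M. (\<forall>x. x \<in># M \<longrightarrow> x > 0) \<and> sum_mset M = n}"

lemma bij_mset_partitions: "bij_betw mset (partitions n) (mpartitions n)"
proof (rule bij_betw_imageI[OF inj_on_mset_partitions], intro equalityI subsetI)
  fix M assume "M \<in> mset ` partitions n"
  thus "M \<in> mpartitions n" by (auto simp: mpartitions_def partitions_def sum_mset_sum_list)
next
  fix M assume "M \<in> mpartitions n"
  thus "M \<in> mset ` partitions n" by (intro partition_of_mset) (auto simp: mpartitions_def)
qed

lemma card_mpartitions: "card (mpartitions n) = pcount n"
  unfolding pcount_def by (rule bij_betw_same_card[OF bij_mset_partitions, symmetric])

lemma finite_mpartitions: "finite (mpartitions n)"
  using bij_betw_finite[OF bij_mset_partitions] finite_partitions by blast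

lemma sum_mset_eq_sum_count:
  assumes "set_mset M \<subseteq> A" "finite A"
  shows "sum_mset M = (\<Sum>m\<in>A. count M m * m)"
  using assms
proof (induction M)
  case (add x M)
  have "(\<Sum>m\<in>A. count (add_mset x M) m * m) = (\<Sum>m\<in>A. count M m * m + (if m = x then x else 0))"
    by (rule sum.cong) auto
  also have "\<dots> = sum_mset M + x" using add by (simp add: sum.distrib)
  finally show ?case by simp
qed simp

lemma mpartition_le: "M \<in> mpartitions n \<Longrightarrow> x \<in># M \<Longrightarrow> x \<in> {1..n}"
proof -
  assume M: "M \<in> mpartitions n" "x \<in># M"
  then obtain M' where "M = add_mset x M'" by (metis multi_member_split)
  thus "x \<in> {1..n}" using M by (auto simp: mpartitions_def Suc_le_eq)
qed

lemma mpartition_count_le: "M \<in> mpartitions n \<Longrightarrow> m > 0 \<Longrightarrow> count M m * m \<le> n"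
proof -
  assume M: "M \<in> mpartitions n" and m: "m > 0"
  show "count M m * m \<le> n"
  proof (cases "m \<in># M")
    case True
    have "set_mset M \<subseteq> {1..n}" using mpartition_le[OF M] by blast
    hence "sum_mset M = (\<Sum>m\<in>{1..n}. count M m * m)" by (rule sum_mset_eq_sum_count) simp
    moreover have "sum_mset M = n" using M unfolding mpartitions_def by blast
    moreover have "count M m * m \<le> (\<Sum>m\<in>{1..n}. count M m * m)"
      using mpartition_le[OF M True] by (intro member_le_sum) auto
    ultimately show ?thesis by simp
  qed (simp add: not_in_iff)
qed

lemma card_mpartitions_count_ge:
  assumes "m > 0"
  shows "card {M \<in> mpartitions n. k \<le> count M m} = (if m * k \<le> n then pcount (n - m * k) else 0)"
proof (cases "m * k \<le> n")
  case True
  have "bij_betw (\<lambda>M. replicate_mset k m + M) (mpartitions (n - m * k)) {M \<in> mpartitions n. k \<le> count M m}"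
  proof (rule bij_betw_byWitness[where f'="\<lambda>M. M - replicate_mset k m"])
    show "(\<lambda>M. replicate_mset k m + M) ` mpartitions (n - m * k) \<subseteq> {M \<in> mpartitions n. k \<le> count M m}"
      using True assms by (auto simp: mpartitions_def sum_mset_replicate_mset mult.commute split: if_splits)
    show "(\<lambda>M. M - replicate_mset k m) ` {M \<in> mpartitions n. k \<le> count M m} \<subseteq> mpartitions (n - m * k)"
    proof safe
      fix M assume M: "M \<in> mpartitions n" "k \<le> count M m"
      hence "replicate_mset k m \<subseteq># M" by (simp add: count_le_replicate_mset_subset_eq[symmetric])
      then obtain M0 where M0: "M = replicate_mset k m + M0" by (metis subset_mset.le_iff_add)
      have "k * m + sum_mset M0 = n" using M(1) unfolding M0 mpartitions_def
        by (simp only: mem_Collect_eq sum_mset.union sum_mset_replicate_mset of_nat_id)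
      hence "sum_mset M0 = n - m * k" by (simp only: mult.commute)
      moreover have "\<forall>x. x \<in># M \<longrightarrow> x > 0" using M(1) unfolding mpartitions_def by blast
      hence "\<forall>x. x \<in># M0 \<longrightarrow> x > 0" unfolding M0 union_iff by blast
      ultimately show "M - replicate_mset k m \<in> mpartitions (n - m * k)"
        unfolding M0 by (simp add: mpartitions_def)
    qed
    show "\<forall>M\<in>{M \<in> mpartitions n. k \<le> count M m}. replicate_mset k m + (M - replicate_mset k m) = M"
    proof
      fix M assume "M \<in> {M \<in> mpartitions n. k \<le> count M m}"
      hence "replicate_mset k m \<subseteq># M" by (simp add: count_le_replicate_mset_subset_eq[symmetric])
      thus "replicate_mset k m + (M - replicate_mset k m) = M" by (rule subset_mset.add_diff_inverse)
    qed
  qed simp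
  from bij_betw_same_card[OF this] show ?thesis using True by (simp add: card_mpartitions)
next
  case False
  have "{M \<in> mpartitions n. k \<le> count M m} = {}"
  proof (rule ccontr)
    assume "\<not> ?thesis"
    then obtain M where M: "M \<in> mpartitions n" "k \<le> count M m" by blast
    have "k * m \<le> count M m * m" using M by simp
    also have "\<dots> \<le> n" using mpartition_count_le[OF M(1) assms] .
    finally show False using False by (simp add: mult.commute)
  qed
  thus ?thesis using False by (simp only: if_False card.empty)
qed

text \<open>Add up all parts of all partitions of n. The multiplicity of m is the number of k such
  that at least k copies of m occur, and deleting k copies leaves an arbitrary partition of n - k
  m.\<close>

lemma pcount_recurrence:
  "n * pcount n = (\<Sum>(k, m)\<in>{(k, m). 1 \<le> k \<and> 1 \<le> m \<and> k * m \<le> n}. m * pcount (n - k * m))"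
proof -
  have "n * pcount n = (\<Sum>M\<in>mpartitions n. sum_mset M)"
    by (simp add: mpartitions_def flip: card_mpartitions)
  also have "\<dots> = (\<Sum>M\<in>mpartitions n. \<Sum>m\<in>{1..n}. count M m * m)"
    using mpartition_le by (intro sum.cong refl sum_mset_eq_sum_count) auto
  also have "\<dots> = (\<Sum>M\<in>mpartitions n. \<Sum>m\<in>{1..n}. \<Sum>k\<in>{1..n}. if k \<le> count M m then m else 0)"
  proof (intro sum.cong refl)
    fix M m assume M: "M \<in> mpartitions n" and m: "m \<in> {1..n}"
    have "count M m * 1 \<le> count M m * m" using m by (intro mult_le_mono2) auto
    moreover have "count M m * m \<le> n" using mpartition_count_le[OF M, of m] m by simp
    ultimately have "count M m \<le> n" by linarith
    hence "{1..n} \<inter> {k. k \<le> count M m} = {1..count M m}" by auto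
    thus "count M m * m = (\<Sum>k\<in>{1..n}. if k \<le> count M m then m else 0)" by (simp add: sum.If_cases)
  qed
  also have "\<dots> = (\<Sum>m\<in>{1..n}. \<Sum>k\<in>{1..n}. \<Sum>M\<in>mpartitions n. if k \<le> count M m then m else 0)"
    by (subst sum.swap) (intro sum.cong refl, subst sum.swap, simp)
  also have "\<dots> = (\<Sum>m\<in>{1..n}. \<Sum>k\<in>{1..n}. if m * k \<le> n then m * pcount (n - m * k) else 0)"
  proof (intro sum.cong refl)
    fix m k assume m: "m \<in> {1..n}" "k \<in> {1..n}"
    have "(\<Sum>M\<in>mpartitions n. if k \<le> count M m then m else 0) = card {M \<in> mpartitions n. k \<le> count M m} * m"
      using finite_mpartitions by (simp add: sum.If_cases Int_def)
    thus "(\<Sum>M\<in>mpartitions n. if k \<le> count M m then m else 0) = (if m * k \<le> n then m * pcount (n - m * k) else 0)"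
      using card_mpartitions_count_ge[of m n k] m by simp
  qed
  also have "\<dots> = (\<Sum>(k, m)\<in>{1..n} \<times> {1..n}. if m * k \<le> n then m * pcount (n - m * k) else 0)"
    by (subst sum.swap) (rule sum.cartesian_product)
  also have "\<dots> = (\<Sum>(k, m)\<in>{(k, m). 1 \<le> k \<and> 1 \<le> m \<and> k * m \<le> n}. m * pcount (n - k * m))"
  proof (rule sum.mono_neutral_cong_right)
    show "{(k, m). 1 \<le> k \<and> 1 \<le> m \<and> k * m \<le> n} \<subseteq> {1..n} \<times> {1..n}"
    proof safe
      fix k m assume km: "1 \<le> k" "1 \<le> m" "k * m \<le> n"
      have "k \<le> k * m" "m \<le> k * m" using km by simp_all
      hence "k \<le> n" "m \<le> n" using km(3) by linarith+
      thus "k \<in> {1..n}" "m \<in> {1..n}" using km by auto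
    qed
  qed (auto simp: mult.commute split: if_splits)
  finally show ?thesis .
qed

lemma pcount_0 [simp]: "pcount 0 = 1"
proof -
  have "mpartitions 0 = {{#}}" by (auto simp: mpartitions_def sum_mset_0_iff) (metis gr_implies_not0 multiset_nonemptyE)
  thus ?thesis by (simp flip: card_mpartitions)
qed

lemma pcount_Suc_ge: "pcount n \<le> pcount (Suc n)"
proof -
  have "card (mpartitions n) \<le> card (mpartitions (Suc n))"
    by (rule card_inj_on_le[of "add_mset 1", OF _ _ finite_mpartitions]) (auto simp: mpartitions_def inj_on_def)
  thus ?thesis by (simp add: card_mpartitions)
qed

lemma pcount_mono: "m \<le> n \<Longrightarrow> pcount m \<le> pcount n"
  by (rule lift_Suc_mono_le[of pcount]) (rule pcount_Suc_ge)

lemma pcount_pos: "pcount n > 0"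
  using pcount_mono[of 0 n] by simp

section \<open>Growth of the partition function\<close>

lemma sinh_ge_self: "0 \<le> u \<Longrightarrow> u \<le> sinh (u::real)"
proof -
  assume u: "0 \<le> u"
  have "sinh 0 - 0 \<le> sinh u - (u::real)"
  proof (rule DERIV_nonneg_imp_nondecreasing[OF u])
    fix x :: real
    show "\<exists>y. ((\<lambda>u. sinh u - u) has_real_derivative y) (at x) \<and> 0 \<le> y"
      by (rule exI[of _ "cosh x - 1"]) (auto intro!: derivative_eq_intros simp: cosh_real_ge_1)
  qed
  thus ?thesis by simp
qed

lemma cosh_le_quadratic:
  assumes "0 \<le> u" "u \<le> (1::real)"
  shows "cosh u \<le> 1 + u\<^sup>2"
proof -
  have "exp u \<le> 1 + u + u\<^sup>2" using exp_bound[OF assms] .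
  moreover have "exp (- u) \<le> 1 - u + u\<^sup>2"
  proof -
    have "1 \<le> (1 + u) * (1 - u + u\<^sup>2)" using assms by (simp add: algebra_simps power2_eq_square)
    also have "\<dots> \<le> exp u * (1 - u + u\<^sup>2)"
      using assms exp_ge_add_one_self[of u] by (intro mult_right_mono) auto
    finally show ?thesis by (simp add: exp_minus field_simps)
  qed
  ultimately show ?thesis by (simp add: cosh_def)
qed

lemma sinh_le_cubic:
  assumes "0 \<le> u" "u \<le> (1::real)"
  shows "sinh u \<le> u + u ^ 3"
proof -
  have "0 + 0 ^ 3 - sinh 0 \<le> u + u ^ 3 - sinh u"
  proof (rule DERIV_nonneg_imp_nondecreasing[OF assms(1)])
    fix x :: real assume x: "0 \<le> x" "x \<le> u"
    have "cosh x \<le> 1 + x\<^sup>2" using x assms by (intro cosh_le_quadratic) auto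
    hence "0 \<le> 1 + 3 * x\<^sup>2 - cosh x" using zero_le_power2[of x] by linarith
    thus "\<exists>y. ((\<lambda>u. u + u ^ 3 - sinh u) has_real_derivative y) (at x) \<and> 0 \<le> y"
      by (intro exI[of _ "1 + 3 * x\<^sup>2 - cosh x"]) (auto intro!: derivative_eq_intros)
  qed
  thus ?thesis by simp
qed

text \<open>Lazarevic's inequality; it makes \<open>1/(4 sinh\<^sup>2(y/2)) - 1/y\<^sup>2\<close> increasing.\<close>

lemma sinh_cube_ge:
  assumes "0 < (u::real)"
  shows "u ^ 3 * cosh u \<le> sinh u ^ 3"
proof -
  define f where "f u = sinh u * cosh u powr (- (1 / 3)) - u" for u :: real
  have "f 0 \<le> f u"
  proof (rule DERIV_nonneg_imp_nondecreasing[where f=f])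
    fix x :: real
    define c where "c = cosh x"
    define z where "z = c powr (2 / 3)"
    have c: "c > 0" by (simp add: c_def)
    have z: "z > 0" using c by (simp add: z_def)
    have "((\<lambda>u. cosh u powr (- (1 / 3))) has_real_derivative - (1 / 3) * cosh x powr (- (1 / 3) - 1) * sinh x) (at x)"
    proof -
      have "(cosh has_real_derivative sinh x) (at x)" by (auto intro!: derivative_eq_intros)
      from DERIV_chain2[OF has_real_derivative_powr[of "cosh x" "- (1 / 3)"] this] show ?thesis by simp
    qed
    hence D: "(f has_real_derivative cosh x * cosh x powr (- (1 / 3)) + (- (1 / 3) * cosh x powr (- (1 / 3) - 1) * sinh x) * sinh x - 1) (at x)"
      unfolding f_def by (auto intro!: derivative_eq_intros)
    have s2: "sinh x * sinh x = c\<^sup>2 - 1" using cosh_square_eq[of x] by (simp add: c_def power2_eq_square)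
    have 1: "c * c powr (- (1 / 3)) = z"
      using c powr_add[of c 1 "- (1 / 3)"] by (simp add: z_def)
    have 2: "c powr (- (1 / 3) - 1) = 1 / z\<^sup>2"
      using c powr_add[of c "2 / 3" "2 / 3"] by (simp add: z_def power2_eq_square powr_minus_divide flip: powr_add)
    have 3: "c\<^sup>2 * (1 / z\<^sup>2) = z"
    proof -
      have "z ^ 3 = c\<^sup>2" using c by (simp add: z_def powr_power)
      thus ?thesis using z by (simp add: field_simps power2_eq_square power3_eq_cube)
    qed
    have "cosh x * cosh x powr (- (1 / 3)) + (- (1 / 3) * cosh x powr (- (1 / 3) - 1) * sinh x) * sinh x - 1
        = z - (1 / 3) * ((1 / z\<^sup>2) * (c\<^sup>2 - 1)) - 1"
      unfolding c_def[symmetric] 1 2 by (simp add: s2[symmetric])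
    also have "\<dots> = (2 / 3) * z + (1 / 3) * (1 / z\<^sup>2) - 1"
    proof -
      have "(1 / z\<^sup>2) * (c\<^sup>2 - 1) = c\<^sup>2 * (1 / z\<^sup>2) - 1 / z\<^sup>2"
        by (simp add: diff_divide_distrib)
      hence "(1 / z\<^sup>2) * (c\<^sup>2 - 1) = z - 1 / z\<^sup>2" by (simp only: 3)
      thus ?thesis by (simp add: diff_divide_distrib)
    qed
    also have "\<dots> = (z - 1)\<^sup>2 * (2 * z + 1) / (3 * z\<^sup>2)"
      using z by (simp add: field_simps power2_eq_square power3_eq_cube)
    also have "\<dots> \<ge> 0" using z by simp
    finally show "\<exists>y. (f has_real_derivative y) (at x) \<and> 0 \<le> y" using D by blast
  qed (use assms in simp)
  hence "u \<le> sinh u * cosh u powr (- (1 / 3))" by (simp add: f_def)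
  hence "u ^ 3 \<le> (sinh u * cosh u powr (- (1 / 3))) ^ 3" using assms by (intro power_mono) auto
  also have "\<dots> = sinh u ^ 3 / cosh u"
    by (simp add: power_mult_distrib power_divide powr_power powr_minus_divide)
  finally show ?thesis by (simp add: field_simps)
qed

text \<open>Summing m e^{-my} over m gives 1/(4 sinh^2(y/2)); \<open>hh\<close> is this function
  without its pole at 0, and \<open>AA\<close> is the antiderivative of \<open>hh\<close> that tends
  to 0 at infinity.\<close>

definition hh :: "real \<Rightarrow> real" where
  "hh y = 1 / (4 * sinh (y / 2) ^ 2) - 1 / y\<^sup>2"

definition AA :: "real \<Rightarrow> real" where
  "AA y = 1 / y + 1 / 2 - cosh (y / 2) / (2 * sinh (y / 2))"

lemma DERIV_AA: "y > 0 \<Longrightarrow> (AA has_real_derivative hh y) (at y)"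
proof -
  assume y: "y > 0"
  have s: "sinh (y / 2) > 0" using y by simp
  have "(AA has_real_derivative - 1 / y\<^sup>2 -
     (sinh (y / 2) * (1 / 2) * (2 * sinh (y / 2)) - cosh (y / 2) * (2 * (cosh (y / 2) * (1 / 2)))) / (2 * sinh (y / 2))\<^sup>2) (at y)"
    unfolding AA_def using y s
    by (auto intro!: derivative_eq_intros simp: power2_eq_square)
  also have "sinh (y / 2) * (1 / 2) * (2 * sinh (y / 2)) - cosh (y / 2) * (2 * (cosh (y / 2) * (1 / 2))) = - 1"
    using cosh_square_eq[of "y / 2"] by (simp add: power2_eq_square)
  finally show ?thesis using s by (simp add: hh_def power_mult_distrib)
qed

lemma hh_mono:
  assumes "0 < a" "a \<le> b"
  shows "hh a \<le> hh b"
proof (rule DERIV_nonneg_imp_nondecreasing[where f=hh, OF assms(2)])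
  fix x assume ab: "a \<le> x" "x \<le> b"
  hence x: "x > 0" using assms by simp
  define u where "u = x / 2"
  have u: "u > 0" "sinh u > 0" "x = 2 * u" using x by (auto simp: u_def)
  have D: "((\<lambda>y. 1 / (4 * sinh (y / 2) ^ 2) - 1 / y\<^sup>2) has_real_derivative
     - (4 * (2 * sinh u * (cosh u * (1 / 2)))) / (4 * sinh u ^ 2)\<^sup>2 + 2 * x / (x\<^sup>2)\<^sup>2) (at x)"
    using x u unfolding u_def by (auto intro!: derivative_eq_intros simp: power2_eq_square)
  have eq: "- (4 * (2 * sinh u * (cosh u * (1 / 2)))) / (4 * sinh u ^ 2)\<^sup>2 + 2 * x / (x\<^sup>2)\<^sup>2
      = (sinh u ^ 3 - u ^ 3 * cosh u) / (4 * u ^ 3 * sinh u ^ 3)"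
  proof -
    define S where "S = sinh u"
    define c where "c = cosh u"
    have S: "S > 0" using u by (simp add: S_def)
    have "(4 * (2 * S * (c * (1 / 2)))) / (4 * S ^ 2)\<^sup>2 = c / (4 * S ^ 3)"
      using S by (simp add: power2_eq_square power3_eq_cube divide_simps)
    moreover have "2 * x / (x\<^sup>2)\<^sup>2 = 1 / (4 * u ^ 3)"
      using u(1) by (simp add: u(3) power2_eq_square power3_eq_cube divide_simps)
    moreover have "1 / (4 * u ^ 3) - c / (4 * S ^ 3) = (S ^ 3 - u ^ 3 * c) / (4 * u ^ 3 * S ^ 3)"
      using S u(1) by (simp add: diff_frac_eq mult.commute mult.left_commute divide_simps)
    ultimately show ?thesis unfolding S_def[symmetric] c_def[symmetric] by simp
  qed
  have nn: "(sinh u ^ 3 - u ^ 3 * cosh u) / (4 * u ^ 3 * sinh u ^ 3) \<ge> 0"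
    using sinh_cube_ge[OF u(1)] u(1,2) by (intro divide_nonneg_nonneg) auto
  have "(hh has_real_derivative (sinh u ^ 3 - u ^ 3 * cosh u) / (4 * u ^ 3 * sinh u ^ 3)) (at x)"
    using D unfolding eq hh_def[abs_def] .
  thus "\<exists>y. (hh has_real_derivative y) (at x) \<and> 0 \<le> y" using nn by blast
qed

lemma AA_diff_bounds:
  assumes "0 < a" "a < b"
  shows "(b - a) * hh a \<le> AA b - AA a" "AA b - AA a \<le> (b - a) * hh b"
proof -
  obtain z where z: "a < z" "z < b" "AA b - AA a = (b - a) * hh z"
    using MVT2[OF assms(2), of AA hh] DERIV_AA assms by auto
  show "(b - a) * hh a \<le> AA b - AA a" "AA b - AA a \<le> (b - a) * hh b"
    unfolding z(3) using z assms hh_mono[of a z] hh_mono[of z b] by (auto intro!: mult_left_mono)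
qed

lemma AA_eq: "y > 0 \<Longrightarrow> AA y = 1 / y - 1 / (exp y - 1)"
proof -
  assume y: "y > 0"
  define e where "e = exp (y / 2)"
  have e: "e > 1" using y by (simp add: e_def)
  have ey: "exp y = e * e" by (simp add: e_def flip: exp_add)
  have S: "cosh (y / 2) = (e * e + 1) / (2 * e)" "sinh (y / 2) = (e * e - 1) / (2 * e)"
    using e by (simp_all add: cosh_def sinh_def exp_minus field_simps flip: e_def)
  define d where "d = e * e - 1"
  have d: "d > 0" using less_1_mult[OF e e] by (simp add: d_def)
  have "e * e + 1 = d + 2" by (simp add: d_def)
  hence "cosh (y / 2) / (2 * sinh (y / 2)) = 1 / 2 + 1 / d"
    unfolding S d_def[symmetric] using e d by (simp add: field_simps)
  thus ?thesis unfolding AA_def ey d_def[symmetric] by simp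
qed

lemma AA_tendsto_0: "(AA \<longlongrightarrow> 0) at_top"
proof -
  have "((\<lambda>y::real. 1 / y - 1 / (exp y - 1)) \<longlongrightarrow> 0) at_top" by real_asymp
  moreover have "eventually (\<lambda>y::real. 1 / y - 1 / (exp y - 1) = AA y) at_top"
    using eventually_gt_at_top[of 0] by eventually_elim (simp add: AA_eq)
  ultimately show ?thesis by (rule Lim_transform_eventually)
qed

text \<open>The limit 1/2 of \<open>AA\<close> at 0 is the source of the term - 1/(2s) in
  \<open>SS0_asymp\<close>, whose coefficient matters because it takes part in the cancellation in
  \<open>half_sum_upper\<close>.\<close>

lemma AA_near_half:
  assumes "0 < s" "s \<le> 1"
  shows "\<bar>AA s - 1 / 2\<bar> \<le> s / 4"
proof -
  define u where "u = s / 2"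
  have u: "0 < u" "u \<le> 1" using assms by (auto simp: u_def)
  have s: "s = 2 * u" by (simp add: u_def)
  have su: "u \<le> sinh u" "sinh u \<le> u + u ^ 3" "1 \<le> cosh u" "cosh u \<le> 1 + u\<^sup>2"
    using sinh_ge_self[of u] sinh_le_cubic[of u] cosh_real_ge_1[of u] cosh_le_quadratic[of u] u by auto
  have "AA s - 1 / 2 = (sinh u - u * cosh u) / (2 * u * sinh u)"
    using u su by (simp add: AA_def s field_simps)
  moreover have "\<bar>sinh u - u * cosh u\<bar> \<le> u ^ 3"
  proof -
    have "u * cosh u \<le> u * (1 + u\<^sup>2)" "u * 1 \<le> u * cosh u" using su u by (intro mult_left_mono; simp)+
    thus ?thesis using su by (simp add: abs_le_iff power2_eq_square power3_eq_cube algebra_simps)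
  qed
  moreover have "2 * u * u \<le> 2 * u * sinh u" using su u by (intro mult_left_mono) auto
  ultimately have "\<bar>AA s - 1 / 2\<bar> \<le> u ^ 3 / (2 * u * u)"
    using u by (simp add: abs_divide abs_mult) (intro frac_le, auto)
  also have "\<dots> = s / 4" using u by (simp add: s power3_eq_cube field_simps)
  finally show ?thesis .
qed

text \<open>The limit at 0 is -1/12; the crude value -1 already keeps the error in
  \<open>SS0_asymp\<close> bounded.\<close>

lemma hh_ge:
  assumes "0 < s" "s \<le> 1"
  shows "hh s \<ge> - 1"
proof -
  define u where "u = s / 2"
  have u: "0 < u" "u \<le> 1" using assms by (auto simp: u_def)
  have s: "s = 2 * u" by (simp add: u_def)
  have su: "u \<le> sinh u" "sinh u \<le> u + u ^ 3" using sinh_ge_self[of u] sinh_le_cubic[of u] u by auto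
  have sp: "sinh u > 0" using u su by simp
  have eq: "hh s + 1 = (4 * (u\<^sup>2 * (sinh u)\<^sup>2) + u\<^sup>2 - (sinh u)\<^sup>2) / (4 * u\<^sup>2 * (sinh u)\<^sup>2)"
    using u sp by (simp add: hh_def s field_simps power2_eq_square)
  have "(sinh u)\<^sup>2 \<le> (u + u ^ 3)\<^sup>2" using su u by (intro power_mono) auto
  also have "\<dots> = u\<^sup>2 + u ^ 4 * (2 + u\<^sup>2)" by (simp add: power2_eq_square eval_nat_numeral algebra_simps)
  also have "\<dots> \<le> u\<^sup>2 + u ^ 4 * 4"
    using u power_le_one[of u 2] by (intro add_left_mono mult_left_mono) auto
  also have "u ^ 4 * 4 = 4 * (u\<^sup>2 * u\<^sup>2)" by (simp add: power2_eq_square eval_nat_numeral)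
  also have "u\<^sup>2 + 4 * (u\<^sup>2 * u\<^sup>2) \<le> u\<^sup>2 + 4 * (u\<^sup>2 * (sinh u)\<^sup>2)"
    using su u by (intro add_left_mono mult_left_mono power_mono) auto
  finally have "hh s + 1 \<ge> 0" unfolding eq by (intro divide_nonneg_nonneg) auto
  thus ?thesis by simp
qed

lemma qq_eq:
  assumes "y > (0::real)"
  shows "exp (- y) / (1 - exp (- y))\<^sup>2 = hh y + 1 / y\<^sup>2"
proof -
  define e where "e = exp (y / 2)"
  have e: "e > 1" using assms by (simp add: e_def)
  have ey: "exp (- y) = 1 / (e * e)" by (simp add: e_def exp_minus field_simps flip: exp_add)
  have S: "sinh (y / 2) = (e * e - 1) / (2 * e)"
    using e by (simp add: sinh_def exp_minus field_simps flip: e_def)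
  define d where "d = e * e - 1"
  have d: "d > 0" using less_1_mult[OF e e] by (simp add: d_def)
  have "1 - 1 / (e * e) = d / (e * e)" using e by (simp add: d_def field_simps)
  thus ?thesis unfolding hh_def ey S d_def[symmetric] using e d by (simp add: power2_eq_square)
qed

lemma hh_le_0: "y > 0 \<Longrightarrow> hh y \<le> 0"
proof -
  assume y: "y > 0"
  have "(y / 2)\<^sup>2 \<le> sinh (y / 2) ^ 2" using sinh_ge_self[of "y / 2"] y by (intro power_mono) auto
  hence "y\<^sup>2 \<le> 4 * sinh (y / 2) ^ 2" by (simp add: power_divide)
  thus ?thesis using y by (simp add: hh_def frac_le)
qed

section \<open>Moments of the generating function of the divisor sums\<close>

definition wt :: "nat \<times> nat \<Rightarrow> real" where "wt z = real (Suc (snd z))"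

definition vv :: "nat \<times> nat \<Rightarrow> real" where "vv z = real (Suc (fst z)) * real (Suc (snd z))"

text \<open>A pair z = (k - 1, m - 1) encodes k, m \<ge> 1, with \<open>vv z\<close> = k m and
  \<open>wt z\<close> = m; the shift makes the index set all of \<open>UNIV\<close>. So
  \<open>SS j s\<close> is the sum of \<sigma>(v) v^j e^{-sv} over v \<ge> 1, with \<sigma> the
  divisor sum, and up to sign the j-th derivative of \<open>SS 0\<close>.\<close>

definition term_S :: "nat \<Rightarrow> real \<Rightarrow> nat \<times> nat \<Rightarrow> real" where
  "term_S j s z = wt z * vv z ^ j * exp (- s * vv z)"

definition SS :: "nat \<Rightarrow> real \<Rightarrow> real" where
  "SS j s = infsum (term_S j s) UNIV"

lemma wt_pos [simp]: "wt z > 0" and vv_pos [simp]: "vv z > 0" and vv_ge1: "vv z \<ge> 1"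
proof -
  show "wt z > 0" "vv z > 0" by (auto simp: wt_def vv_def)
  have "1 * 1 \<le> real (Suc (fst z)) * real (Suc (snd z))" by (rule mult_mono) auto
  thus "vv z \<ge> 1" by (simp add: vv_def)
qed

lemma term_S_nonneg [simp]: "term_S j s z \<ge> 0"
  using wt_pos[of z] vv_pos[of z] by (simp add: term_S_def less_imp_le)

lemma SS0_props:
  assumes s: "s > 0"
  shows "term_S 0 s summable_on UNIV"
    and "(\<lambda>n. hh (s * real (Suc n)) + 1 / (s * real (Suc n))\<^sup>2) sums SS 0 s"
proof -
  define q where "q y = hh y + 1 / y\<^sup>2" for y
  have row: "((\<lambda>b. term_S 0 s (a, b)) has_sum q (s * real (Suc a))) UNIV" for a
  proof (rule sums_nonneg_imp_has_sum)
    define x where "x = exp (- (s * real (Suc a)))"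
    have "s * real (Suc a) > 0" using s by simp
    hence x: "0 < x" "x < 1" by (simp_all add: x_def)
    have "(\<lambda>n. x * (real (Suc n) * x ^ n)) sums (x * (1 / (1 - x)\<^sup>2))"
      by (intro sums_mult geometric_deriv_sums) (use x in auto)
    moreover have "x * (1 / (1 - x)\<^sup>2) = q (s * real (Suc a))"
      using qq_eq[of "s * real (Suc a)"] s by (simp add: x_def q_def)
    moreover have "x * (real (Suc n) * x ^ n) = term_S 0 s (a, n)" for n
    proof -
      have "exp (- s * vv (a, n)) = x ^ Suc n"
        unfolding x_def exp_of_nat_mult[symmetric] by (simp add: vv_def algebra_simps)
      thus ?thesis by (simp add: term_S_def wt_def)
    qed
    ultimately show "(\<lambda>b. term_S 0 s (a, b)) sums q (s * real (Suc a))" by simp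
  qed simp
  have qn: "0 \<le> q y" "q y \<le> 1 / y\<^sup>2" if "y > 0" for y
    using hh_le_0[OF that] by (auto simp: q_def hh_def)
  have sq: "summable (\<lambda>n. 1 / (s * real (Suc n))\<^sup>2)"
  proof -
    have "summable (\<lambda>n. 1 / (real n + 1)\<^sup>2)" using inverse_squares_sums by (simp add: sums_iff add.commute)
    from summable_mult[OF this, of "1 / s\<^sup>2"] show ?thesis by (simp add: power_mult_distrib add.commute)
  qed
  have sumq: "summable (\<lambda>n. q (s * real (Suc n)))"
    by (rule summable_comparison_test'[OF sq, of 0]) (use qn s in auto)
  have hq: "((\<lambda>n. q (s * real (Suc n))) has_sum (\<Sum>n. q (s * real (Suc n)))) UNIV"
    by (rule sums_nonneg_imp_has_sum[OF summable_sums[OF sumq]]) (use qn s in auto)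
  have UN: "(UNIV :: (nat \<times> nat) set) = Sigma UNIV (\<lambda>_. UNIV)" by simp
  show sm: "term_S 0 s summable_on UNIV"
    unfolding UN by (rule summable_on_SigmaI[OF row]) (use hq in \<open>auto simp: summable_on_def\<close>)
  have "(term_S 0 s has_sum (\<Sum>n. q (s * real (Suc n)))) UNIV"
    unfolding UN by (rule has_sum_SigmaI[OF row hq]) (use sm in simp)
  hence "SS 0 s = (\<Sum>n. q (s * real (Suc n)))" unfolding SS_def by (rule infsumI)
  thus "(\<lambda>n. hh (s * real (Suc n)) + 1 / (s * real (Suc n))\<^sup>2) sums SS 0 s"
    using summable_sums[OF sumq] by (simp add: q_def)
qed

text \<open>Split off the pole, which sums to \<pi>^2/(6 s^2). The remaining sum of
  \<open>hh\<close> over multiples of s is compared with its integral: \<open>hh\<close> is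
  increasing, so the differences of \<open>AA\<close> bracket it, up to the one rectangle
  \<open>s * hh s\<close>.\<close>

lemma SS0_asymp:
  assumes s: "0 < s" "s \<le> 1"
  shows "\<bar>SS 0 s - (pi\<^sup>2 / (6 * s\<^sup>2) - 1 / (2 * s))\<bar> \<le> 2"
proof -
  have "(\<lambda>n. (1 / s\<^sup>2) * (1 / (real n + 1)\<^sup>2)) sums ((1 / s\<^sup>2) * (pi\<^sup>2 / 6))"
    using inverse_squares_sums by (intro sums_mult) (simp add: add.commute)
  hence sq: "(\<lambda>n. 1 / (s * real (Suc n))\<^sup>2) sums (pi\<^sup>2 / (6 * s\<^sup>2))"
    by (simp add: power_mult_distrib add.commute mult.commute)
  from sums_diff[OF SS0_props(2)[OF s(1)] this]
  have hs: "(\<lambda>n. hh (s * real (Suc n))) sums (SS 0 s - pi\<^sup>2 / (6 * s\<^sup>2))" by simp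
  define H where "H = SS 0 s - pi\<^sup>2 / (6 * s\<^sup>2)"
  have lim: "(\<lambda>n. \<Sum>k<n. hh (s * real (Suc k))) \<longlonglongrightarrow> H" using hs by (simp add: sums_def H_def)
  have AAlim: "(\<lambda>n. AA (s * real (Suc n))) \<longlonglongrightarrow> 0"
  proof (rule filterlim_compose[OF AA_tendsto_0])
    show "filterlim (\<lambda>n. s * real (Suc n)) at_top sequentially" using s by real_asymp
  qed
  have up: "s * (\<Sum>k<n. hh (s * real (Suc k))) \<le> AA (s * real (Suc n)) - AA s" for n
  proof (induction n)
    case (Suc n)
    have "s * real (Suc (Suc n)) - s * real (Suc n) = s" by (simp add: algebra_simps)
    hence "s * hh (s * real (Suc n)) \<le> AA (s * real (Suc (Suc n))) - AA (s * real (Suc n))"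
      using AA_diff_bounds(1)[of "s * real (Suc n)" "s * real (Suc (Suc n))"] s by simp
    thus ?case using Suc by (simp add: distrib_left)
  qed simp
  have lo: "s * (\<Sum>k<Suc n. hh (s * real (Suc k))) \<ge> s * hh s + (AA (s * real (Suc n)) - AA s)" for n
  proof (induction n)
    case (Suc n)
    have "s * real (Suc (Suc n)) - s * real (Suc n) = s" by (simp add: algebra_simps)
    hence "s * hh (s * real (Suc (Suc n))) \<ge> AA (s * real (Suc (Suc n))) - AA (s * real (Suc n))"
      using AA_diff_bounds(2)[of "s * real (Suc n)" "s * real (Suc (Suc n))"] s by simp
    thus ?case using Suc unfolding sum.lessThan_Suc distrib_left by linarith
  qed simp
  have "s * H \<le> 0 - AA s"
    by (rule LIMSEQ_le[OF tendsto_mult_left[OF lim] tendsto_diff[OF AAlim tendsto_const]]) (use up in auto)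
  moreover have "s * hh s + (0 - AA s) \<le> s * H"
    by (rule LIMSEQ_le[OF tendsto_add[OF tendsto_const tendsto_diff[OF AAlim tendsto_const]]
          tendsto_mult_left[OF LIMSEQ_Suc[OF lim]]]) (use lo in auto)
  moreover have "s * (- 1) \<le> s * hh s" using hh_ge[OF s] s by (intro mult_left_mono) auto
  moreover have "\<bar>AA s - 1 / 2\<bar> \<le> s / 4" by (rule AA_near_half[OF s])
  ultimately have "s * H + 1 / 2 \<le> s * 2" "- (s * 2) \<le> s * H + 1 / 2" using s by linarith+
  hence "\<bar>s * (H + 1 / (2 * s))\<bar> \<le> s * 2" using s by (simp add: distrib_left abs_le_iff)
  hence "\<bar>H + 1 / (2 * s)\<bar> \<le> 2" using s by (simp add: abs_mult)
  thus ?thesis by (simp add: H_def algebra_simps)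
qed

lemma power_le_fact_exp:
  assumes "0 \<le> (x::real)"
  shows "x ^ j \<le> fact j * exp x"
proof -
  have "sum (\<lambda>n. x ^ n /\<^sub>R fact n) {j} \<le> (\<Sum>n. x ^ n /\<^sub>R fact n)"
    by (rule sum_le_suminf[OF summable_exp_generic]) (use assms in auto)
  hence "x ^ j / fact j \<le> exp x" by (simp add: exp_def divide_inverse mult.commute)
  thus ?thesis by (simp add: field_simps)
qed

text \<open>Half of the exponential decay pays for v^j. This gives the convergence of all moments
  and crude bounds for those that enter only as errors.\<close>

lemma term_S_shift_le:
  assumes "s > 0"
  shows "term_S (i + j) s z \<le> (fact j * (2 / s) ^ j) * term_S i (s / 2) z"
proof -
  have "(s / 2 * vv z) ^ j \<le> fact j * exp (s / 2 * vv z)"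
    using assms vv_pos[of z] by (intro power_le_fact_exp) (simp add: less_imp_le)
  hence "(2 / s) ^ j * (s / 2 * vv z) ^ j \<le> (2 / s) ^ j * (fact j * exp (s / 2 * vv z))"
    using assms by (intro mult_left_mono) auto
  moreover have "(2 / s) ^ j * (s / 2 * vv z) ^ j = vv z ^ j" using assms by (simp flip: power_mult_distrib)
  ultimately have "vv z ^ j * (wt z * vv z ^ i * exp (- s * vv z))
      \<le> ((2 / s) ^ j * (fact j * exp (s / 2 * vv z))) * (wt z * vv z ^ i * exp (- s * vv z))"
    using wt_pos[of z] vv_pos[of z] by (intro mult_right_mono) (auto simp: less_imp_le)
  also have "\<dots> = (fact j * (2 / s) ^ j) * (wt z * vv z ^ i * (exp (s / 2 * vv z) * exp (- s * vv z)))"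
    by (simp only: ac_simps)
  also have "exp (s / 2 * vv z) * exp (- s * vv z) = exp (- (s / 2) * vv z)"
    unfolding exp_add[symmetric] by (simp add: field_simps)
  finally show ?thesis by (simp add: term_S_def power_add ac_simps)
qed

lemma summable_term_S:
  assumes "s > 0"
  shows "term_S j s summable_on UNIV"
proof (rule summable_on_comparison_test)
  show "(\<lambda>z. (fact j * (2 / s) ^ j) * term_S 0 (s / 2) z) summable_on UNIV"
    by (intro summable_on_cmult_right SS0_props(1)) (use assms in simp)
  show "term_S j s z \<le> (fact j * (2 / s) ^ j) * term_S 0 (s / 2) z" for z
    using term_S_shift_le[OF assms, of 0 j z] by simp
qed simp

lemma SS_shift_le:
  assumes "s > 0"
  shows "SS (i + j) s \<le> (fact j * (2 / s) ^ j) * SS i (s / 2)"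
proof -
  have "SS (i + j) s \<le> infsum (\<lambda>z. (fact j * (2 / s) ^ j) * term_S i (s / 2) z) UNIV"
    unfolding SS_def
    by (intro infsum_mono summable_term_S summable_on_cmult_right term_S_shift_le) (use assms in auto)
  thus ?thesis by (simp add: infsum_cmult_right' SS_def)
qed

text \<open>\<open>SS (Suc j)\<close> is minus the derivative of \<open>SS j\<close> and decreasing,
  so difference quotients bracket it; both sides come from 1 + x \<le> exp x applied
  termwise.\<close>

lemma SS_diff_bounds:
  assumes "s > 0" "h > 0"
  shows "SS j s - SS j (s + h) \<le> h * SS (Suc j) s"
    and "h * SS (Suc j) (s + h) \<le> SS j s - SS j (s + h)"
proof -
  have sm: "term_S i s summable_on UNIV" "term_S i (s + h) summable_on UNIV" for i
    using assms by (auto intro: summable_term_S)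
  have e: "exp (- s * vv z) = exp (- (s + h) * vv z) * exp (h * vv z)" for z
    unfolding exp_add[symmetric] by (simp add: algebra_simps)
  have pt1: "term_S j s z \<le> term_S j (s + h) z + h * term_S (Suc j) s z" for z
  proof -
    have "1 - exp (- (h * vv z)) \<le> h * vv z" using exp_ge_add_one_self[of "- (h * vv z)"] by simp
    hence "(wt z * vv z ^ j * exp (- s * vv z)) * (1 - exp (- (h * vv z))) \<le> (wt z * vv z ^ j * exp (- s * vv z)) * (h * vv z)"
      using wt_pos[of z] vv_pos[of z] by (intro mult_left_mono) (auto simp: less_imp_le)
    moreover have "exp (- s * vv z) * exp (- (h * vv z)) = exp (- (s + h) * vv z)"
      unfolding exp_add[symmetric] by (simp add: algebra_simps)
    ultimately show ?thesis by (simp add: term_S_def right_diff_distrib mult.assoc) (simp add: algebra_simps)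
  qed
  have pt2: "term_S j (s + h) z + h * term_S (Suc j) (s + h) z \<le> term_S j s z" for z
  proof -
    have "1 + h * vv z \<le> exp (h * vv z)" by (rule exp_ge_add_one_self)
    hence "(wt z * vv z ^ j * exp (- (s + h) * vv z)) * (1 + h * vv z) \<le> (wt z * vv z ^ j * exp (- (s + h) * vv z)) * exp (h * vv z)"
      using wt_pos[of z] vv_pos[of z] by (intro mult_left_mono) (auto simp: less_imp_le)
    thus ?thesis unfolding term_S_def e by (simp add: algebra_simps)
  qed
  have "SS j s \<le> infsum (\<lambda>z. term_S j (s + h) z + h * term_S (Suc j) s z) UNIV"
    unfolding SS_def by (intro infsum_mono sm summable_on_add summable_on_cmult_right pt1)
  also have "\<dots> = SS j (s + h) + h * SS (Suc j) s"
    by (subst infsum_add) (auto intro!: sm summable_on_cmult_right simp: infsum_cmult_right' SS_def)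
  finally show "SS j s - SS j (s + h) \<le> h * SS (Suc j) s" by simp
  have "SS j (s + h) + h * SS (Suc j) (s + h) = infsum (\<lambda>z. term_S j (s + h) z + h * term_S (Suc j) (s + h) z) UNIV"
    by (subst infsum_add) (auto intro!: sm summable_on_cmult_right simp: infsum_cmult_right' SS_def)
  also have "\<dots> \<le> SS j s"
    unfolding SS_def by (intro infsum_mono sm summable_on_add summable_on_cmult_right pt2)
  finally show "h * SS (Suc j) (s + h) \<le> SS j s - SS j (s + h)" by simp
qed

lemma pi_sq_bounds: "9 < pi\<^sup>2" "pi\<^sup>2 < 10"
proof -
  have "3\<^sup>2 < pi\<^sup>2" using pi_gt3 by (intro power_strict_mono) auto
  thus "9 < pi\<^sup>2" by simp
  have "pi < 315 / 100" using pi_approx by simp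
  hence "pi\<^sup>2 < (315 / 100)\<^sup>2" by (intro power_strict_mono) auto
  also have "(315 / 100)\<^sup>2 < (10::real)" by (simp add: power2_eq_square)
  finally show "pi\<^sup>2 < 10" .
qed

text \<open>Difference quotients of \<open>SS 0\<close> with step s^2: the bounded error of
  \<open>SS0_asymp\<close> divided by the step, and the second derivative of order s^{-4} times the
  step, are both of order s^{-2}. The points s(1 - s) and s(1 + s) serve for the two sides.\<close>

lemma SS1_asymp:
  assumes s: "0 < s" "s \<le> 1 / 2"
  shows "SS 1 s \<le> pi\<^sup>2 / (3 * s ^ 3) + 18 / s\<^sup>2" "pi\<^sup>2 / (3 * s ^ 3) - 18 / s\<^sup>2 \<le> SS 1 s"
proof -
  define B where "B = pi\<^sup>2"
  have B: "9 < B" "B < 10" using pi_sq_bounds by (auto simp: B_def)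
  define t where "t = 1 - s"
  have t: "0 < t" "t < 1" "1 / 2 \<le> t" using s by (auto simp: t_def)
  have st: "s * t > 0" "s * t \<le> 1" using s t by (auto intro: mult_le_one)
  have "s * t + s\<^sup>2 = s" by (simp add: t_def power2_eq_square algebra_simps)
  hence 1: "s\<^sup>2 * SS 1 s \<le> SS 0 (s * t) - SS 0 s"
    using SS_diff_bounds(2)[of "s * t" "s\<^sup>2" 0] st s by simp
  have 2: "SS 0 (s * t) \<le> B / (6 * (s * t)\<^sup>2) - 1 / (2 * (s * t)) + 2"
    using SS0_asymp[OF st] by (simp add: B_def abs_le_iff)
  have 3: "B / (6 * s\<^sup>2) - 1 / (2 * s) - 2 \<le> SS 0 s"
    using SS0_asymp[of s] s by (simp add: B_def abs_le_iff)
  have 4: "1 / (2 * s) \<le> 1 / (2 * (s * t))" using s t by (intro divide_left_mono) (auto intro: mult_pos_pos)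
  have 5: "1 / t\<^sup>2 \<le> 1 + 2 * s + 8 * s\<^sup>2"
  proof -
    have "(1 + 2 * s + 8 * s\<^sup>2) * t\<^sup>2 - 1 = s\<^sup>2 * ((1 - 2 * s) * (5 - 4 * s))"
      by (simp add: t_def power2_eq_square algebra_simps)
    also have "\<dots> \<ge> 0" using s by (intro mult_nonneg_nonneg) auto
    finally show ?thesis using t by (simp add: field_simps)
  qed
  have "B / (6 * (s * t)\<^sup>2) = (B / (6 * s\<^sup>2)) * (1 / t\<^sup>2)" by (simp add: power_mult_distrib)
  also have "\<dots> \<le> (B / (6 * s\<^sup>2)) * (1 + 2 * s + 8 * s\<^sup>2)" using 5 B s by (intro mult_left_mono) auto
  also have "\<dots> = B / (6 * s\<^sup>2) + (B / (3 * s) + 4 * B / 3)"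
    using s by (simp add: field_simps power2_eq_square)
  finally have "s\<^sup>2 * SS 1 s \<le> B / (3 * s) + 4 * B / 3 + 4" using 1 2 3 4 by linarith
  also have "\<dots> \<le> B / (3 * s) + 18" using B by simp
  finally have "SS 1 s \<le> (B / (3 * s) + 18) / s\<^sup>2" using s by (simp add: field_simps)
  thus "SS 1 s \<le> pi\<^sup>2 / (3 * s ^ 3) + 18 / s\<^sup>2"
    unfolding B_def[symmetric] by (simp add: add_divide_distrib power2_eq_square power3_eq_cube ac_simps)
  define u where "u = 1 + s"
  have u: "1 < u" "u \<le> 3 / 2" using s by (auto simp: u_def)
  have su: "s * u > 0" "s * u \<le> 1"
    using s u mult_mono[of s "1 / 2" u "3 / 2"] by auto
  have "s + s\<^sup>2 = s * u" by (simp add: u_def power2_eq_square algebra_simps)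
  hence 1: "SS 0 s - SS 0 (s * u) \<le> s\<^sup>2 * SS 1 s"
    using SS_diff_bounds(1)[of s "s\<^sup>2" 0] s by simp
  have 2: "SS 0 (s * u) \<le> B / (6 * (s * u)\<^sup>2) - 1 / (2 * (s * u)) + 2"
    using SS0_asymp[OF su] by (simp add: B_def abs_le_iff)
  have 4: "1 / (2 * s) \<le> 1 / (2 * (s * u)) + 1 / 2"
  proof -
    have "1 / (2 * s) - 1 / (2 * (s * u)) = (u - 1) / (2 * s * u)" using s u by (simp add: field_simps)
    also have "\<dots> = 1 / (2 * u)" using s by (simp add: u_def)
    also have "\<dots> \<le> 1 / 2" using u by simp
    finally show ?thesis by simp
  qed
  have 5: "1 / u\<^sup>2 \<le> 1 - 2 * s + 3 * s\<^sup>2"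
  proof -
    have "(1 - 2 * s + 3 * s\<^sup>2) * u\<^sup>2 - 1 = s ^ 3 * (4 + 3 * s)"
      by (simp add: u_def power2_eq_square power3_eq_cube algebra_simps)
    also have "\<dots> \<ge> 0" using s by (intro mult_nonneg_nonneg) auto
    finally show ?thesis using u by (simp add: field_simps)
  qed
  have "B / (6 * (s * u)\<^sup>2) = (B / (6 * s\<^sup>2)) * (1 / u\<^sup>2)" by (simp add: power_mult_distrib)
  also have "\<dots> \<le> (B / (6 * s\<^sup>2)) * (1 - 2 * s + 3 * s\<^sup>2)" using 5 B s by (intro mult_left_mono) auto
  also have "\<dots> = B / (6 * s\<^sup>2) - B / (3 * s) + B / 2"
    using s by (simp add: field_simps power2_eq_square)
  finally have "B / (3 * s) - B / 2 - 5 \<le> s\<^sup>2 * SS 1 s" using 1 2 3 4 by linarith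
  hence "B / (3 * s) - 18 \<le> s\<^sup>2 * SS 1 s" using B by simp
  hence "(B / (3 * s) - 18) / s\<^sup>2 \<le> SS 1 s" using s by (simp add: field_simps)
  thus "pi\<^sup>2 / (3 * s ^ 3) - 18 / s\<^sup>2 \<le> SS 1 s"
    unfolding B_def[symmetric] by (simp add: diff_divide_distrib power2_eq_square power3_eq_cube ac_simps)
qed

text \<open>The error s^{-2} of \<open>SS 1\<close> divided by a step h balances against the
  curvature term s^{-5} h at h = s^{3/2}; hence the parametrisation by r with s = r^2, the step r^3
  and the error r^{-7}.\<close>

lemma SS2_asymp:
  assumes r: "0 < r" "r \<le> 1 / 2"
  shows "SS 2 (r\<^sup>2) \<le> pi\<^sup>2 / r ^ 8 + 170 / r ^ 7" "pi\<^sup>2 / r ^ 8 - 170 / r ^ 7 \<le> SS 2 (r\<^sup>2)"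
proof -
  define B where "B = pi\<^sup>2"
  have B: "9 < B" "B < 10" using pi_sq_bounds by (auto simp: B_def)
  define s where "s = r\<^sup>2"
  have "r * r \<le> (1 / 2) * (1 / 2)" using r by (intro mult_mono) auto
  hence s: "0 < s" "s \<le> 1 / 4" using r by (auto simp: s_def power2_eq_square)
  define t where "t = 1 - r"
  have t: "0 < t" "t < 1" "1 / 2 \<le> t" using r by (auto simp: t_def)
  have st: "s * t > 0" "s * t \<le> 1 / 2" using s t mult_mono[of s "1 / 4" t 1] by auto
  have "s * t + r ^ 3 = s" by (simp add: s_def t_def power2_eq_square power3_eq_cube algebra_simps)
  hence 1: "r ^ 3 * SS 2 s \<le> SS 1 (s * t) - SS 1 s"
    using SS_diff_bounds(2)[of "s * t" "r ^ 3" 1] st r by (simp add: numeral_2_eq_2)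
  have 2: "SS 1 (s * t) \<le> B / (3 * (s * t) ^ 3) + 18 / (s * t)\<^sup>2"
    using SS1_asymp(1)[OF st] by (simp add: B_def)
  have 3: "B / (3 * s ^ 3) - 18 / s\<^sup>2 \<le> SS 1 s" "SS 1 s \<le> B / (3 * s ^ 3) + 18 / s\<^sup>2"
    using SS1_asymp[of s] s by (auto simp: B_def)
  have 4: "18 / (s * t)\<^sup>2 \<le> 72 / s\<^sup>2"
  proof -
    have "(1 / 2)\<^sup>2 \<le> t\<^sup>2" using t by (intro power_mono) auto
    hence "s\<^sup>2 * (1 / 4) \<le> s\<^sup>2 * t\<^sup>2" by (intro mult_left_mono) (auto simp: power2_eq_square)
    hence "18 / (s * t)\<^sup>2 \<le> 18 / (s\<^sup>2 * (1 / 4))" using s t by (intro divide_left_mono) (auto simp: power_mult_distrib)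
    thus ?thesis by simp
  qed
  have 5: "1 / t ^ 3 \<le> 1 + 3 * r + 22 * r\<^sup>2"
  proof -
    have "(1 + 3 * r + 22 * r\<^sup>2) * t ^ 3 - 1 = r\<^sup>2 * ((1 - 2 * r) * (16 - 26 * r + 11 * r\<^sup>2))"
      by (simp add: t_def power2_eq_square power3_eq_cube algebra_simps)
    also have "\<dots> \<ge> 0" using r zero_le_power2[of r] by (intro mult_nonneg_nonneg) linarith+
    finally show ?thesis using t by (simp add: field_simps)
  qed
  have "B / (3 * (s * t) ^ 3) = (B / (3 * s ^ 3)) * (1 / t ^ 3)" by (simp add: power_mult_distrib)
  also have "\<dots> \<le> (B / (3 * s ^ 3)) * (1 + 3 * r + 22 * r\<^sup>2)" using 5 B s by (intro mult_left_mono) auto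
  finally have "r ^ 3 * SS 2 s \<le> (B / (3 * s ^ 3)) * (3 * r + 22 * r\<^sup>2) + 90 / s\<^sup>2"
    using 1 2 3(1) 4 by (simp add: distrib_left)
  also have "\<dots> = B * r / s ^ 3 + (22 * B / 3) * (r\<^sup>2 / s ^ 3) + 90 / s\<^sup>2" using s by (simp add: field_simps)
  also have "\<dots> \<le> B * r / s ^ 3 + (220 / 3) * (r\<^sup>2 / s ^ 3) + 90 / s\<^sup>2"
    using B s by (intro add_mono mult_right_mono) auto
  also have "\<dots> \<le> B * r / s ^ 3 + 170 / s\<^sup>2"
  proof -
    have "r\<^sup>2 / s ^ 3 = 1 / s\<^sup>2" unfolding s_def[symmetric] using s by (simp add: power2_eq_square power3_eq_cube)
    moreover have "(220 / 3) * (1 / s\<^sup>2) + 90 / s\<^sup>2 \<le> 170 / s\<^sup>2" using s by (simp add: field_simps)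
    ultimately show ?thesis by (simp only:)
  qed
  finally have "SS 2 s \<le> (B * r / s ^ 3 + 170 / s\<^sup>2) / r ^ 3" using r by (simp add: field_simps)
  also have "\<dots> = B / r ^ 8 + 170 / r ^ 7"
    using r by (simp add: s_def field_simps eval_nat_numeral)
  finally show "SS 2 (r\<^sup>2) \<le> pi\<^sup>2 / r ^ 8 + 170 / r ^ 7" by (simp add: s_def B_def)
  define u where "u = 1 + r"
  have u: "1 < u" "u \<le> 3 / 2" using r by (auto simp: u_def)
  have su: "s * u > 0" "s * u \<le> 1 / 2" using s u mult_mono[of s "1 / 4" u "3 / 2"] by auto
  have "s + r ^ 3 = s * u" by (simp add: s_def u_def power2_eq_square power3_eq_cube algebra_simps)
  hence 1: "SS 1 s - SS 1 (s * u) \<le> r ^ 3 * SS 2 s"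
    using SS_diff_bounds(1)[of s "r ^ 3" 1] s r by (simp add: numeral_2_eq_2)
  have 2: "SS 1 (s * u) \<le> B / (3 * (s * u) ^ 3) + 18 / (s * u)\<^sup>2"
    using SS1_asymp(1)[OF su] by (simp add: B_def)
  have 4: "18 / (s * u)\<^sup>2 \<le> 18 / s\<^sup>2"
  proof -
    have "s * 1 \<le> s * u" using s u by (intro mult_left_mono) auto
    hence "s\<^sup>2 \<le> (s * u)\<^sup>2" using s by (intro power_mono) auto
    thus ?thesis using s su by (intro divide_left_mono) auto
  qed
  have 5: "1 / u ^ 3 \<le> 1 - 3 * r + 6 * r\<^sup>2"
  proof -
    have "(1 - 3 * r + 6 * r\<^sup>2) * u ^ 3 - 1 = r ^ 3 * (10 + 15 * r + 6 * r\<^sup>2)"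
      by (simp add: u_def power2_eq_square power3_eq_cube algebra_simps)
    also have "\<dots> \<ge> 0" using r by (intro mult_nonneg_nonneg) auto
    finally show ?thesis using u by (simp add: field_simps)
  qed
  have "B / (3 * (s * u) ^ 3) = (B / (3 * s ^ 3)) * (1 / u ^ 3)" by (simp add: power_mult_distrib)
  also have "\<dots> \<le> (B / (3 * s ^ 3)) * (1 - 3 * r + 6 * r\<^sup>2)" using 5 B s by (intro mult_left_mono) auto
  finally have "(B / (3 * s ^ 3)) * (3 * r - 6 * r\<^sup>2) - 36 / s\<^sup>2 \<le> r ^ 3 * SS 2 s"
    using 1 2 3(1) 4 by (simp add: algebra_simps)
  also have "(B / (3 * s ^ 3)) * (3 * r - 6 * r\<^sup>2) - 36 / s\<^sup>2 = B * r / s ^ 3 - (2 * B) * (r\<^sup>2 / s ^ 3) - 36 / s\<^sup>2"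
    using s by (simp add: field_simps)
  finally have "B * r / s ^ 3 - (2 * B) * (r\<^sup>2 / s ^ 3) - 36 / s\<^sup>2 \<le> r ^ 3 * SS 2 s" .
  moreover have "r\<^sup>2 / s ^ 3 = 1 / s\<^sup>2" unfolding s_def[symmetric] using s by (simp add: power2_eq_square power3_eq_cube)
  moreover have "(2 * B) * (1 / s\<^sup>2) + 36 / s\<^sup>2 \<le> 170 / s\<^sup>2" using B s by (simp add: field_simps)
  ultimately have "B * r / s ^ 3 - 170 / s\<^sup>2 \<le> r ^ 3 * SS 2 s" by simp
  hence "(B * r / s ^ 3 - 170 / s\<^sup>2) / r ^ 3 \<le> SS 2 s" using r by (simp add: field_simps)
  moreover have "(B * r / s ^ 3 - 170 / s\<^sup>2) / r ^ 3 = B / r ^ 8 - 170 / r ^ 7"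
    using r by (simp add: s_def field_simps eval_nat_numeral)
  ultimately show "pi\<^sup>2 / r ^ 8 - 170 / r ^ 7 \<le> SS 2 (r\<^sup>2)" by (simp add: s_def B_def)
qed

section \<open>The comparison function and its behaviour in the recurrence\<close>

definition cc :: real where "cc = pi * sqrt (2 / 3)"

definition phi :: "real \<Rightarrow> real" where "phi x = exp (cc * sqrt x) / x"

text \<open>The saddle point: the s for which the main term \<pi>^2/(6 s^2) of \<open>SS 0 s\<close>
  equals n. In this parameter the exponent \<open>cc * sqrt n\<close> of \<open>phi\<close> is 2 s
  n.\<close>

definition sad :: "real \<Rightarrow> real" where "sad n = pi / sqrt (6 * n)"

lemma sad_pos: "n > 0 \<Longrightarrow> sad n > 0"
  by (simp add: sad_def)

lemma sad_n: "n > 0 \<Longrightarrow> cc * sqrt n = 2 * sad n * n" "n > 0 \<Longrightarrow> n = pi\<^sup>2 / (6 * (sad n)\<^sup>2)"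
proof -
  assume n: "n > 0"
  have "sqrt (2 / 3) = 2 / sqrt 6"
  proof -
    have "sqrt (2 / 3) = sqrt (4 / 6)" by simp
    also have "\<dots> = sqrt 4 / sqrt 6" by (rule real_sqrt_divide)
    finally show ?thesis by simp
  qed
  hence "cc * sqrt n = 2 * pi / sqrt 6 * sqrt n" by (simp add: cc_def)
  moreover have "2 * sad n * n = 2 * pi / sqrt 6 * (n / sqrt n)" by (simp add: sad_def real_sqrt_mult)
  moreover have "n / sqrt n = sqrt n" using n by (simp add: real_div_sqrt)
  ultimately show "cc * sqrt n = 2 * sad n * n" by simp
  show "n = pi\<^sup>2 / (6 * (sad n)\<^sup>2)" using n by (simp add: sad_def power_divide)
qed

lemma phi_pos: "x > 0 \<Longrightarrow> phi x > 0"
  by (simp add: phi_def)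

lemma sqrt_one_minus_le: "0 \<le> x \<Longrightarrow> x \<le> 1 / 2 \<Longrightarrow> sqrt (1 - x) \<le> 1 - x / 2 - x\<^sup>2 / (8::real)"
proof -
  assume x: "0 \<le> x" "x \<le> 1 / 2"
  have x2: "x\<^sup>2 \<le> 1" using x by (simp add: power_le_one)
  have "(1 - x / 2 - x\<^sup>2 / 8)\<^sup>2 = 1 - x + x ^ 3 / 8 + x ^ 4 / 64"
    by (simp add: power2_eq_square eval_nat_numeral field_simps)
  hence "1 - x \<le> (1 - x / 2 - x\<^sup>2 / 8)\<^sup>2" using x by simp
  thus ?thesis using x x2 by (intro real_le_lsqrt) linarith+
qed

lemma sqrt_one_minus_ge: "0 \<le> x \<Longrightarrow> x \<le> 1 / 2 \<Longrightarrow> 1 - x / 2 - x\<^sup>2 / 8 - x ^ 3 / 8 \<le> sqrt (1 - (x::real))"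
proof (rule real_le_rsqrt)
  assume x: "0 \<le> x" "x \<le> 1 / 2"
  have "(1 - x / 2 - x\<^sup>2 / 8 - x ^ 3 / 8)\<^sup>2 = 1 - x - x ^ 3 * (1 / 8 - 9 / 64 * x - x\<^sup>2 / 32 - x ^ 3 / 64)"
    by (simp add: power2_eq_square eval_nat_numeral field_simps)
  moreover have "x\<^sup>2 \<le> 1 / 4" "x ^ 3 \<le> 1 / 8"
    using power_mono[of x "1 / 2" 2] power_mono[of x "1 / 2" 3] x by (auto simp: power2_eq_square power3_eq_cube)
  hence "0 \<le> x ^ 3 * (1 / 8 - 9 / 64 * x - x\<^sup>2 / 32 - x ^ 3 / 64)"
    using x by (intro mult_nonneg_nonneg) auto
  ultimately show "(1 - x / 2 - x\<^sup>2 / 8 - x ^ 3 / 8)\<^sup>2 \<le> 1 - x" by linarith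
qed

lemma phi_diff:
  assumes n: "n > 0" and v: "0 \<le> v" "v \<le> n / 2"
  shows "phi (n - v) = phi n * (exp (2 * sad n * n * (sqrt (1 - v / n) - 1)) * (1 / (1 - v / n)))"
proof -
  have "sqrt (n - v) = sqrt n * sqrt (1 - v / n)"
    using n by (simp add: right_diff_distrib flip: real_sqrt_mult)
  hence "cc * sqrt (n - v) = 2 * sad n * n * sqrt (1 - v / n)" using sad_n(1)[OF n] by simp
  hence "exp (cc * sqrt (n - v)) = exp (cc * sqrt n) * exp (2 * sad n * n * (sqrt (1 - v / n) - 1))"
    unfolding sad_n(1)[OF n] exp_add[symmetric] by (simp add: algebra_simps)
  moreover have "n - v = n * (1 - v / n)" using n by (simp add: field_simps)
  ultimately show ?thesis by (simp add: phi_def)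
qed

text \<open>Taylor expansion in v/n. The terms v/n, from the denominator of \<open>phi\<close>, and
  s v^2/(4n), from the second order of the square root, keep their exact coefficients; what is of
  higher order goes into the two squares.\<close>

lemma phi_ratio_upper:
  assumes n: "n > 0" and v: "0 \<le> v" "v \<le> n / 2"
  defines "s \<equiv> sad n"
  shows "phi (n - v) \<le> phi n * (exp (- s * v) * (1 + v / n - s * v\<^sup>2 / (4 * n) + 2 * (v / n)\<^sup>2 + 2 * (s * v\<^sup>2 / (4 * n))\<^sup>2))"
proof -
  define x where "x = v / n"
  define a where "a = s * v\<^sup>2 / (4 * n)"
  have x: "0 \<le> x" "x \<le> 1 / 2" using n v by (auto simp: x_def field_simps)
  have s: "s > 0" using sad_pos[OF n] by (simp add: s_def)
  have a: "a \<ge> 0" using s n by (simp add: a_def)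
  have e1: "2 * s * n * (- x / 2 - x\<^sup>2 / 8) = - s * v - a"
    using n by (simp add: x_def a_def field_simps power2_eq_square)
  have "2 * s * n * (sqrt (1 - x) - 1) \<le> 2 * s * n * (- x / 2 - x\<^sup>2 / 8)"
    using sqrt_one_minus_le[OF x] s n by (intro mult_left_mono) auto
  hence "exp (2 * s * n * (sqrt (1 - x) - 1)) \<le> exp (- s * v) * exp (- a)"
    unfolding e1 exp_add[symmetric] by simp
  moreover have "exp (- a) \<le> 1 - a + a\<^sup>2"
  proof -
    have "1 \<le> (1 + a) * (1 - a + a\<^sup>2)" using a by (simp add: algebra_simps power2_eq_square)
    also have "\<dots> \<le> exp a * (1 - a + a\<^sup>2)"
    proof (rule mult_right_mono)
      have "1 - a + a\<^sup>2 = (a - 1 / 2)\<^sup>2 + 3 / 4" by (simp add: power2_eq_square algebra_simps)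
      thus "0 \<le> 1 - a + a\<^sup>2" by simp
    qed (rule exp_ge_add_one_self)
    finally show ?thesis by (simp add: exp_minus field_simps)
  qed
  hence "exp (- s * v) * exp (- a) \<le> exp (- s * v) * (1 - a + a\<^sup>2)" by (intro mult_left_mono) auto
  ultimately have E: "exp (2 * s * n * (sqrt (1 - x) - 1)) \<le> exp (- s * v) * (1 - a + a\<^sup>2)" by linarith
  have P: "1 - a + a\<^sup>2 \<ge> 0"
  proof -
    have "1 - a + a\<^sup>2 = (a - 1 / 2)\<^sup>2 + 3 / 4" by (simp add: power2_eq_square algebra_simps)
    thus ?thesis by simp
  qed
  have I: "1 / (1 - x) \<le> 1 + x + 2 * x\<^sup>2"
  proof -
    have "(1 + x + 2 * x\<^sup>2) * (1 - x) = 1 + x\<^sup>2 * (1 - 2 * x)" by (simp add: algebra_simps power2_eq_square)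
    moreover have "x\<^sup>2 * (1 - 2 * x) \<ge> 0" using x by (intro mult_nonneg_nonneg) auto
    ultimately have "1 \<le> (1 + x + 2 * x\<^sup>2) * (1 - x)" by linarith
    thus ?thesis using x by (simp add: field_simps)
  qed
  have "exp (2 * s * n * (sqrt (1 - x) - 1)) * (1 / (1 - x)) \<le> (exp (- s * v) * (1 - a + a\<^sup>2)) * (1 + x + 2 * x\<^sup>2)"
    using E I P x by (intro mult_mono) auto
  also have "\<dots> = exp (- s * v) * ((1 - a + a\<^sup>2) * (1 + x + 2 * x\<^sup>2))" by simp
  also have "\<dots> \<le> exp (- s * v) * (1 + x - a + 2 * x\<^sup>2 + 2 * a\<^sup>2)"
  proof (intro mult_left_mono)
    have "x\<^sup>2 \<le> x * (1 / 2)" unfolding power2_eq_square using x by (intro mult_left_mono) auto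
    hence "x + 2 * x\<^sup>2 \<le> 1" using x by linarith
    hence "a\<^sup>2 * (x + 2 * x\<^sup>2) \<le> a\<^sup>2 * 1" by (intro mult_left_mono) auto
    moreover have "0 \<le> a * (x + 2 * x\<^sup>2)" using a x by simp
    moreover have "(1 - a + a\<^sup>2) * (1 + x + 2 * x\<^sup>2) = 1 + x - a + 2 * x\<^sup>2 + a\<^sup>2 + a\<^sup>2 * (x + 2 * x\<^sup>2) - a * (x + 2 * x\<^sup>2)"
      by (simp add: algebra_simps)
    ultimately show "(1 - a + a\<^sup>2) * (1 + x + 2 * x\<^sup>2) \<le> 1 + x - a + 2 * x\<^sup>2 + 2 * a\<^sup>2" by linarith
  qed simp
  finally have "exp (2 * s * n * (sqrt (1 - x) - 1)) * (1 / (1 - x)) \<le> exp (- s * v) * (1 + x - a + 2 * x\<^sup>2 + 2 * a\<^sup>2)" .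
  hence "phi n * (exp (2 * s * n * (sqrt (1 - x) - 1)) * (1 / (1 - x))) \<le> phi n * (exp (- s * v) * (1 + x - a + 2 * x\<^sup>2 + 2 * a\<^sup>2))"
    using phi_pos[OF n] by (intro mult_left_mono) auto
  thus ?thesis unfolding phi_diff[OF n v] s_def[symmetric] x_def a_def by simp
qed

lemma phi_ratio_lower:
  assumes n: "n > 0" and v: "0 \<le> v" "v \<le> n / 2"
  defines "s \<equiv> sad n"
  shows "phi n * (exp (- s * v) * (1 + v / n - s * v\<^sup>2 / (4 * n) - 3 * (s * v ^ 3 / (4 * n\<^sup>2)))) \<le> phi (n - v)"
proof -
  define x where "x = v / n"
  define a where "a = s * v\<^sup>2 / (4 * n)"
  have x: "0 \<le> x" "x \<le> 1 / 2" using n v by (auto simp: x_def field_simps)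
  have s: "s > 0" using sad_pos[OF n] by (simp add: s_def)
  have a: "a \<ge> 0" using s n by (simp add: a_def)
  have ax: "s * v ^ 3 / (4 * n\<^sup>2) = a * x" by (simp add: a_def x_def power2_eq_square power3_eq_cube)
  have e1: "2 * s * n * (- x / 2 - x\<^sup>2 / 8 - x ^ 3 / 8) = - s * v - (a + a * x)"
    using n by (simp add: x_def a_def field_simps power2_eq_square power3_eq_cube)
  have "2 * s * n * (- x / 2 - x\<^sup>2 / 8 - x ^ 3 / 8) \<le> 2 * s * n * (sqrt (1 - x) - 1)"
    using sqrt_one_minus_ge[OF x] s n by (intro mult_left_mono) auto
  hence E: "exp (- s * v) * exp (- (a + a * x)) \<le> exp (2 * s * n * (sqrt (1 - x) - 1))"
    unfolding e1 exp_add[symmetric] by simp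
  have I: "1 + x \<le> 1 / (1 - x)"
    using x by (simp add: field_simps)
  have "exp (- s * v) * (1 + x - a - 3 * (a * x)) \<le> exp (- s * v) * (exp (- (a + a * x)) * (1 + x))"
  proof (intro mult_left_mono)
    have "1 - (a + a * x) \<le> exp (- (a + a * x))" using exp_ge_add_one_self[of "- (a + a * x)"] by linarith
    hence "(1 - (a + a * x)) * (1 + x) \<le> exp (- (a + a * x)) * (1 + x)" using x by (intro mult_right_mono) auto
    moreover have "a * x * x \<le> a * x * 1" using a x by (intro mult_left_mono) auto
    moreover have "(1 - (a + a * x)) * (1 + x) = 1 + x - a - 2 * (a * x) - a * x * x" by (simp add: algebra_simps)
    ultimately show "1 + x - a - 3 * (a * x) \<le> exp (- (a + a * x)) * (1 + x)" by linarith
  qed simp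
  also have "\<dots> = exp (- s * v) * exp (- (a + a * x)) * (1 + x)" by simp
  also have "\<dots> \<le> exp (2 * s * n * (sqrt (1 - x) - 1)) * (1 / (1 - x))"
    using E I x by (intro mult_mono) auto
  finally have "phi n * (exp (- s * v) * (1 + x - a - 3 * (a * x))) \<le> phi n * (exp (2 * s * n * (sqrt (1 - x) - 1)) * (1 / (1 - x)))"
    using phi_pos[OF n] by (intro mult_left_mono) auto
  thus ?thesis unfolding phi_diff[OF n v] s_def[symmetric] ax x_def[symmetric] a_def[symmetric] by simp
qed

text \<open>The range in which the expansions of \<open>phi\<close> are valid.\<close>

definition half_set :: "real \<Rightarrow> (nat \<times> nat) set" where
  "half_set n = {z. vv z \<le> n / 2}"

lemma finite_vv_le: "finite {z. vv z \<le> c}"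
proof -
  have "{z. vv z \<le> c} \<subseteq> {..nat \<lceil>c\<rceil>} \<times> {..nat \<lceil>c\<rceil>}"
  proof
    fix z assume z: "z \<in> {z. vv z \<le> c}"
    have "real (fst z) \<le> vv z"
    proof -
      have "real (fst z) * 1 \<le> real (Suc (fst z)) * real (Suc (snd z))" by (intro mult_mono) auto
      thus ?thesis by (simp add: vv_def)
    qed
    moreover have "real (snd z) \<le> vv z"
    proof -
      have "1 * real (snd z) \<le> real (Suc (fst z)) * real (Suc (snd z))" by (intro mult_mono) auto
      thus ?thesis by (simp add: vv_def)
    qed
    ultimately have "real (fst z) \<le> c" "real (snd z) \<le> c" using z by auto
    hence "fst z \<le> nat \<lceil>c\<rceil>" "snd z \<le> nat \<lceil>c\<rceil>" by linarith+
    thus "z \<in> {..nat \<lceil>c\<rceil>} \<times> {..nat \<lceil>c\<rceil>}" by (cases z) auto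
  qed
  thus ?thesis by (rule finite_subset) simp
qed

lemma finite_half_set [simp]: "finite (half_set n)"
  unfolding half_set_def by (rule finite_vv_le)

lemma SS2_upper:
  assumes "0 < s" "s \<le> 1 / 4"
  shows "SS 2 s \<le> 180 / s ^ 4"
proof -
  define r where "r = sqrt s"
  have r: "0 < r" "r \<le> 1 / 2" "r\<^sup>2 = s"
    using assms real_sqrt_le_mono[OF assms(2)] by (auto simp: r_def real_sqrt_divide)
  have "SS 2 s \<le> pi\<^sup>2 / r ^ 8 + 170 / r ^ 7" using SS2_asymp(1)[OF r(1,2)] r by simp
  also have "\<dots> \<le> 10 / r ^ 8 + 170 / r ^ 8"
    using pi_sq_bounds r power_decreasing[of 7 8 r] by (intro add_mono divide_right_mono divide_left_mono) auto
  also have "r ^ 8 = s ^ 4" unfolding r(3)[symmetric] by (simp flip: power_mult)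
  finally show ?thesis by simp
qed

lemma has_sum_SS: "s > 0 \<Longrightarrow> (term_S j s has_sum SS j s) UNIV"
  unfolding SS_def by (intro has_sum_infsum summable_term_S)

text \<open>The contributions of order 1/s have coefficients - 1/2 from \<open>SS 0\<close>, + 2
  from the term v/n and - 3/2 from s v^2/(4n). They cancel, and this singles out the denominator x
  in \<open>phi\<close>. What remains is of order s^{-1/2}, caused by the weaker error in
  \<open>SS2_asymp\<close>; the constant 9000 is generous.\<close>

lemma half_sum_upper:
  assumes n: "n \<ge> 100"
  shows "(\<Sum>z\<in>half_set n. wt z * phi (n - vv z)) \<le> phi n * (n + 9000 / sqrt (sad n))"
    and "phi n * (n - 9000 / sqrt (sad n)) \<le> (\<Sum>z\<in>half_set n. wt z * phi (n - vv z))"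
proof -
  define s where "s = sad n"
  define B where "B = pi\<^sup>2"
  define r where "r = sqrt s"
  have B: "9 < B" "B < 10" using pi_sq_bounds by (auto simp: B_def)
  have n0: "n > 0" using n by simp
  have s0: "s > 0" using sad_pos[OF n0] by (simp add: s_def)
  have ns: "n = B / (6 * s\<^sup>2)" using sad_n(2)[OF n0] by (simp add: B_def s_def)
  have s14: "s \<le> 1 / 4"
  proof -
    have "s\<^sup>2 = B / (6 * n)" using ns s0 n0 by (simp add: field_simps)
    also have "\<dots> \<le> 10 / (6 * 100)" using B n by (intro frac_le) auto
    also have "\<dots> \<le> (1 / 4)\<^sup>2" by (simp add: power2_eq_square)
    finally show ?thesis by (rule power2_le_imp_le) simp
  qed
  have r: "0 < r" "r \<le> 1 / 2" "r\<^sup>2 = s"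
    using s0 real_sqrt_le_mono[OF s14] by (auto simp: r_def real_sqrt_divide)
  have r8: "s ^ 4 = r ^ 8" "s ^ 3 = r ^ 6" unfolding r(3)[symmetric] by (simp_all flip: power_mult)
  have S0: "SS 0 s \<le> n - 1 / (2 * s) + 2" "n - 1 / (2 * s) - 2 \<le> SS 0 s"
    using SS0_asymp[of s] s0 s14 unfolding ns B_def by (auto simp: abs_le_iff)
  have S1: "6 * s\<^sup>2 / B * SS 1 s \<le> 2 / s + 12" "2 / s - 12 \<le> 6 * s\<^sup>2 / B * SS 1 s"
  proof -
    have "SS 1 s \<le> B / (3 * s ^ 3) + 18 / s\<^sup>2" "B / (3 * s ^ 3) - 18 / s\<^sup>2 \<le> SS 1 s"
      using SS1_asymp[of s] s0 s14 by (auto simp: B_def)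
    hence "6 * s\<^sup>2 / B * SS 1 s \<le> 6 * s\<^sup>2 / B * (B / (3 * s ^ 3) + 18 / s\<^sup>2)"
      "6 * s\<^sup>2 / B * (B / (3 * s ^ 3) - 18 / s\<^sup>2) \<le> 6 * s\<^sup>2 / B * SS 1 s"
      using B by (intro mult_left_mono; simp)+
    moreover have "6 * s\<^sup>2 / B * (B / (3 * s ^ 3) + 18 / s\<^sup>2) = 2 / s + 108 / B"
      "6 * s\<^sup>2 / B * (B / (3 * s ^ 3) - 18 / s\<^sup>2) = 2 / s - 108 / B"
      using s0 B by (simp_all add: field_simps power2_eq_square power3_eq_cube)
    moreover have "108 / B \<le> 12" using B by (simp add: field_simps)
    ultimately show "6 * s\<^sup>2 / B * SS 1 s \<le> 2 / s + 12" "2 / s - 12 \<le> 6 * s\<^sup>2 / B * SS 1 s" by linarith+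
  qed
  have S2: "3 / (2 * s) - 29 / r \<le> 3 * s ^ 3 / (2 * B) * SS 2 s" "3 * s ^ 3 / (2 * B) * SS 2 s \<le> 3 / (2 * s) + 29 / r"
  proof -
    have "SS 2 s \<le> B / r ^ 8 + 170 / r ^ 7" "B / r ^ 8 - 170 / r ^ 7 \<le> SS 2 s"
      using SS2_asymp[OF r(1,2)] r by (auto simp: B_def)
    hence "3 * s ^ 3 / (2 * B) * SS 2 s \<le> 3 * s ^ 3 / (2 * B) * (B / r ^ 8 + 170 / r ^ 7)"
      "3 * s ^ 3 / (2 * B) * (B / r ^ 8 - 170 / r ^ 7) \<le> 3 * s ^ 3 / (2 * B) * SS 2 s"
      using B s0 by (intro mult_left_mono; simp)+
    moreover have "3 * s ^ 3 / (2 * B) * (B / r ^ 8) = 3 / (2 * s)"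
      unfolding r8 using B r(1) by (simp add: r(3)[symmetric] divide_simps eval_nat_numeral)
    moreover have "3 * s ^ 3 / (2 * B) * (170 / r ^ 7) = (255 / B) / r"
      unfolding r8 using B r(1) by (simp add: divide_simps eval_nat_numeral)
    moreover have "(255 / B) / r \<le> 29 / r" using B r by (intro divide_right_mono) (auto simp: field_simps)
    ultimately show "3 / (2 * s) - 29 / r \<le> 3 * s ^ 3 / (2 * B) * SS 2 s" "3 * s ^ 3 / (2 * B) * SS 2 s \<le> 3 / (2 * s) + 29 / r"
      by (simp_all add: distrib_left right_diff_distrib)
  qed
  have S2': "72 * s ^ 4 / B\<^sup>2 * SS 2 s \<le> 160"
  proof -
    have "72 * s ^ 4 / B\<^sup>2 * SS 2 s \<le> 72 * s ^ 4 / B\<^sup>2 * (180 / s ^ 4)"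
      using SS2_upper[OF s0 s14] by (intro mult_left_mono) auto
    also have "\<dots> = 12960 / B\<^sup>2" using s0 by simp
    also have "\<dots> \<le> 12960 / 9\<^sup>2" using B by (intro divide_left_mono power_mono) auto
    finally show ?thesis by simp
  qed
  have half: "SS 2 (s / 2) \<le> 2880 / s ^ 4"
    using SS2_upper[of "s / 2"] s0 s14 by (simp add: power_divide)
  have S4: "SS 4 s \<le> 23040 / s ^ 6"
  proof -
    have "SS 4 s \<le> (fact 2 * (2 / s)\<^sup>2) * SS 2 (s / 2)" using SS_shift_le[OF s0, of 2 2] by simp
    also have "\<dots> \<le> (fact 2 * (2 / s)\<^sup>2) * (2880 / s ^ 4)" using half by (intro mult_left_mono) auto
    also have "\<dots> = 23040 / s ^ 6" using s0 by (simp add: power_divide eval_nat_numeral fact_numeral field_simps)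
    finally show ?thesis .
  qed
  have S3: "SS 3 s \<le> 5760 / s ^ 5"
  proof -
    have "SS 3 s \<le> (fact 1 * (2 / s) ^ 1) * SS 2 (s / 2)" using SS_shift_le[OF s0, of 2 1] by (simp add: numeral_3_eq_3)
    also have "\<dots> \<le> (fact 1 * (2 / s) ^ 1) * (2880 / s ^ 4)" using half s0 by (intro mult_left_mono) auto
    also have "\<dots> = 5760 / s ^ 5" using s0 by (simp add: eval_nat_numeral field_simps)
    finally show ?thesis .
  qed
  have S4': "9 * s ^ 6 / (2 * B\<^sup>2) * SS 4 s \<le> 1280"
  proof -
    have "9 * s ^ 6 / (2 * B\<^sup>2) * SS 4 s \<le> 9 * s ^ 6 / (2 * B\<^sup>2) * (23040 / s ^ 6)" using S4 by (intro mult_left_mono) auto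
    also have "\<dots> = 103680 / B\<^sup>2" using s0 by simp
    also have "\<dots> \<le> 103680 / 9\<^sup>2" using B by (intro divide_left_mono power_mono) auto
    finally show ?thesis by simp
  qed
  have S3': "27 * s ^ 5 / B\<^sup>2 * (SS 3 s) \<le> 1920"
  proof -
    have "27 * s ^ 5 / B\<^sup>2 * SS 3 s \<le> 27 * s ^ 5 / B\<^sup>2 * (5760 / s ^ 5)" using S3 s0 by (intro mult_left_mono) auto
    also have "\<dots> = 155520 / B\<^sup>2" using s0 by simp
    also have "\<dots> \<le> 155520 / 9\<^sup>2" using B by (intro divide_left_mono power_mono) auto
    finally show ?thesis by simp
  qed
  have S4'': "24 / n ^ 4 * SS 4 s \<le> 6900"
  proof -
    have "24 / n ^ 4 * SS 4 s \<le> 24 / n ^ 4 * (23040 / s ^ 6)" using S4 by (intro mult_left_mono) auto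
    also have "\<dots> = 24 * 1296 * 23040 * s\<^sup>2 / B ^ 4" unfolding ns using s0 B
      by (simp add: power_divide power_mult_distrib eval_nat_numeral field_simps)
    also have "\<dots> \<le> 24 * 1296 * 23040 * (1 / 4)\<^sup>2 / 9 ^ 4"
      using B s0 s14 by (intro frac_le mult_left_mono power_mono mult_nonneg_nonneg) auto
    finally show ?thesis by (simp add: power2_eq_square eval_nat_numeral)
  qed
  have r1: "1 \<le> 1 / r" using r by simp
  have in1: "1 / n = 6 * s\<^sup>2 / B" unfolding ns by simp
  have in2: "s / (4 * n) = 3 * s ^ 3 / (2 * B)" unfolding ns using s0 B by (simp add: field_simps power2_eq_square power3_eq_cube)
  have in3: "2 / n\<^sup>2 = 72 * s ^ 4 / B\<^sup>2" unfolding ns using s0 B by (simp add: field_simps eval_nat_numeral)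
  have in4: "2 * (s / (4 * n))\<^sup>2 = 9 * s ^ 6 / (2 * B\<^sup>2)" unfolding in2 by (simp add: power_divide power_mult_distrib eval_nat_numeral)
  have in5: "3 * (s / (4 * n\<^sup>2)) = 27 * s ^ 5 / B\<^sup>2" unfolding ns using s0 B by (simp add: field_simps eval_nat_numeral)
  have half_v: "0 \<le> vv z" "vv z \<le> n / 2" if "z \<in> half_set n" for z
    using that vv_pos[of z] by (auto simp: half_set_def less_imp_le)
  define F where "F z = term_S 0 s z + (1 / n) * term_S 1 s z + (2 / n\<^sup>2 - s / (4 * n)) * term_S 2 s z
     + 2 * (s / (4 * n))\<^sup>2 * term_S 4 s z" for z
  have F_eq: "F z = wt z * (exp (- s * vv z) * (1 + vv z / n - s * (vv z)\<^sup>2 / (4 * n) + 2 * (vv z / n)\<^sup>2 + 2 * (s * (vv z)\<^sup>2 / (4 * n))\<^sup>2))" for z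
  proof -
    have "2 * (vv z / n)\<^sup>2 = 2 / n\<^sup>2 * (vv z)\<^sup>2" by (simp add: power_divide)
    moreover have "2 * (s * (vv z)\<^sup>2 / (4 * n))\<^sup>2 = 2 * (s / (4 * n))\<^sup>2 * vv z ^ 4"
      by (simp add: power_divide power_mult_distrib flip: power_mult)
    ultimately show ?thesis by (simp add: F_def term_S_def algebra_simps)
  qed
  have F_nonneg: "F z \<ge> 0" for z
  proof -
    define a where "a = s * (vv z)\<^sup>2 / (4 * n)"
    have "1 - a + 2 * a\<^sup>2 = 2 * (a - 1 / 4)\<^sup>2 + 7 / 8" by (simp add: power2_eq_square algebra_simps)
    hence "0 \<le> 1 - a + 2 * a\<^sup>2" by simp
    moreover have "0 \<le> vv z / n" "0 \<le> 2 * (vv z / n)\<^sup>2" using vv_pos[of z] n0 by (auto simp: less_imp_le)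
    ultimately have "0 \<le> 1 + vv z / n - a + 2 * (vv z / n)\<^sup>2 + 2 * a\<^sup>2" by linarith
    thus ?thesis unfolding F_eq a_def using wt_pos[of z] by (intro mult_nonneg_nonneg) (auto simp: less_imp_le)
  qed
  have F_sum: "(F has_sum (SS 0 s + (1 / n) * SS 1 s + (2 / n\<^sup>2 - s / (4 * n)) * SS 2 s + 2 * (s / (4 * n))\<^sup>2 * SS 4 s)) UNIV"
    unfolding F_def by (intro has_sum_add has_sum_cmult_right has_sum_SS s0)
  have "(\<Sum>z\<in>half_set n. wt z * phi (n - vv z)) \<le> (\<Sum>z\<in>half_set n. phi n * F z)"
  proof (rule sum_mono)
    fix z assume z: "z \<in> half_set n"
    have "wt z * phi (n - vv z) \<le> wt z * (phi n * (exp (- s * vv z) * (1 + vv z / n - s * (vv z)\<^sup>2 / (4 * n) + 2 * (vv z / n)\<^sup>2 + 2 * (s * (vv z)\<^sup>2 / (4 * n))\<^sup>2)))"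
      using phi_ratio_upper[OF n0 half_v[OF z]] wt_pos[of z] unfolding s_def by (intro mult_left_mono) (auto simp: less_imp_le)
    thus "wt z * phi (n - vv z) \<le> phi n * F z" unfolding F_eq by (simp only: mult.left_commute)
  qed
  also have "\<dots> = phi n * (\<Sum>z\<in>half_set n. F z)" by (simp add: sum_distrib_left)
  also have "\<dots> \<le> phi n * (n + 9000 / r)"
  proof (intro mult_left_mono)
    have "(\<Sum>z\<in>half_set n. F z) \<le> SS 0 s + (1 / n) * SS 1 s + (2 / n\<^sup>2 - s / (4 * n)) * SS 2 s + 2 * (s / (4 * n))\<^sup>2 * SS 4 s"
      by (rule finite_sum_le_has_sum[OF F_sum]) (auto simp: F_nonneg)
    also have "\<dots> = SS 0 s + 6 * s\<^sup>2 / B * SS 1 s + 72 * s ^ 4 / B\<^sup>2 * SS 2 s - 3 * s ^ 3 / (2 * B) * SS 2 s + 9 * s ^ 6 / (2 * B\<^sup>2) * SS 4 s"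
      unfolding in1 in2[symmetric] in3[symmetric] in4[symmetric] by (simp add: left_diff_distrib)
    also have "\<dots> \<le> (n - 1 / (2 * s) + 2) + (2 / s + 12) + 160 - (3 / (2 * s) - 29 / r) + 1280"
      using S0(1) S1(1) S2(1) S2' S4' by linarith
    also have "\<dots> = n + 1454 + 29 / r" using s0 by (simp add: field_simps)
    also have "\<dots> \<le> n + 9000 / r" using r1 r(1) by (simp add: field_simps)
    finally show "(\<Sum>z\<in>half_set n. F z) \<le> n + 9000 / r" .
  qed (use phi_pos[OF n0] in simp)
  finally show "(\<Sum>z\<in>half_set n. wt z * phi (n - vv z)) \<le> phi n * (n + 9000 / sqrt (sad n))" by (simp add: r_def s_def)
  define L where "L z = term_S 0 s z + (1 / n) * term_S 1 s z + (- (s / (4 * n))) * term_S 2 s z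
     + (- (3 * (s / (4 * n\<^sup>2)))) * term_S 3 s z" for z
  have L_eq: "L z = wt z * (exp (- s * vv z) * (1 + vv z / n - s * (vv z)\<^sup>2 / (4 * n) - 3 * (s * vv z ^ 3 / (4 * n\<^sup>2))))" for z
    by (simp add: L_def term_S_def algebra_simps)
  \<comment> \<open>To bound a sum over \<open>half_set n\<close> from below by full series, the
    term 24 v^4/n^4 is subtracted. For v > n/2 it equals 3/2 (2v/n)^4 and exceeds 1 + v/n, so all
    terms outside become nonpositive.\<close>
  define Q where "Q z = L z + (- (24 / n ^ 4)) * term_S 4 s z" for z
  have Q_sum: "(Q has_sum (SS 0 s + (1 / n) * SS 1 s + (- (s / (4 * n))) * SS 2 s + (- (3 * (s / (4 * n\<^sup>2)))) * SS 3 s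
      + (- (24 / n ^ 4)) * SS 4 s)) UNIV"
    unfolding Q_def L_def by (intro has_sum_add has_sum_cmult_right has_sum_SS s0)
  have Qneg: "Q z \<le> 0" if "z \<notin> half_set n" for z
  proof -
    have v: "vv z > n / 2" using that by (simp add: half_set_def not_le)
    define y where "y = 2 * vv z / n"
    have y: "y \<ge> 1" using v n0 by (simp add: y_def field_simps)
    have "1 + vv z / n = 1 + y / 2" by (simp add: y_def)
    also have "\<dots> \<le> 3 / 2 * y" using y by simp
    also have "\<dots> \<le> 3 / 2 * y ^ 4" using y power_increasing[of 1 4 y] by simp
    also have "\<dots> = 24 / n ^ 4 * vv z ^ 4" by (simp add: y_def power_divide power_mult_distrib)
    finally have "1 + vv z / n - s * (vv z)\<^sup>2 / (4 * n) - 3 * (s * vv z ^ 3 / (4 * n\<^sup>2)) - 24 / n ^ 4 * vv z ^ 4 \<le> 0"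
      using s0 n0 vv_pos[of z] by (smt (verit) divide_nonneg_pos mult_nonneg_nonneg zero_le_power zero_less_power)
    hence "wt z * (exp (- s * vv z) * (1 + vv z / n - s * (vv z)\<^sup>2 / (4 * n) - 3 * (s * vv z ^ 3 / (4 * n\<^sup>2)) - 24 / n ^ 4 * vv z ^ 4)) \<le> 0"
      using wt_pos[of z] by (intro mult_nonneg_nonpos) (auto simp: less_imp_le)
    thus ?thesis unfolding Q_def L_eq by (simp add: term_S_def algebra_simps)
  qed
  have "SS 0 s + (1 / n) * SS 1 s + (- (s / (4 * n))) * SS 2 s + (- (3 * (s / (4 * n\<^sup>2)))) * SS 3 s
      + (- (24 / n ^ 4)) * SS 4 s \<le> (\<Sum>z\<in>half_set n. Q z)"
    by (rule has_sum_mono_neutral[OF Q_sum has_sum_finite[OF finite_half_set]]) (use Qneg in auto)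
  also have "\<dots> \<le> (\<Sum>z\<in>half_set n. L z)"
    by (rule sum_mono) (simp add: Q_def)
  finally have "SS 0 s + 6 * s\<^sup>2 / B * SS 1 s - 3 * s ^ 3 / (2 * B) * SS 2 s - 27 * s ^ 5 / B\<^sup>2 * SS 3 s - 24 / n ^ 4 * SS 4 s \<le> (\<Sum>z\<in>half_set n. L z)"
    unfolding in1 in2 in5 by simp
  hence "n - 9000 / r \<le> (\<Sum>z\<in>half_set n. L z)"
  proof -
    assume *: "SS 0 s + 6 * s\<^sup>2 / B * SS 1 s - 3 * s ^ 3 / (2 * B) * SS 2 s - 27 * s ^ 5 / B\<^sup>2 * SS 3 s - 24 / n ^ 4 * SS 4 s \<le> (\<Sum>z\<in>half_set n. L z)"
    have le: "(n - 1 / (2 * s) - 2) + (2 / s - 12) - (3 / (2 * s) + 29 / r) - 1920 - 6900 \<le> (\<Sum>z\<in>half_set n. L z)"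
      using * S0(2) S1(2) S2(2) S3' S4'' by linarith
    have e: "(n - 1 / (2 * s) - 2) + (2 / s - 12) - (3 / (2 * s) + 29 / r) - 1920 - 6900 = n - 8834 - 29 / r"
      using s0 by (simp add: field_simps)
    have "8834 + 29 / r \<le> 9000 / r" using r1 r(1) by (simp add: field_simps)
    thus ?thesis using le unfolding e by linarith
  qed
  hence "phi n * (n - 9000 / r) \<le> phi n * (\<Sum>z\<in>half_set n. L z)"
    using phi_pos[OF n0] by (intro mult_left_mono) auto
  also have "\<dots> = (\<Sum>z\<in>half_set n. phi n * L z)" by (simp add: sum_distrib_left)
  also have "\<dots> \<le> (\<Sum>z\<in>half_set n. wt z * phi (n - vv z))"
  proof (rule sum_mono)
    fix z assume z: "z \<in> half_set n"
    have "wt z * (phi n * (exp (- s * vv z) * (1 + vv z / n - s * (vv z)\<^sup>2 / (4 * n) - 3 * (s * vv z ^ 3 / (4 * n\<^sup>2))))) \<le> wt z * phi (n - vv z)"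
      using phi_ratio_lower[OF n0 half_v[OF z]] wt_pos[of z] unfolding s_def by (intro mult_left_mono) (auto simp: less_imp_le)
    thus "phi n * L z \<le> wt z * phi (n - vv z)" unfolding L_eq by (simp only: mult.left_commute)
  qed
  finally show "phi n * (n - 9000 / sqrt (sad n)) \<le> (\<Sum>z\<in>half_set n. wt z * phi (n - vv z))" by (simp add: r_def s_def)
qed

lemma inv_sqrt_sad_le:
  assumes "n > 0"
  shows "1 / sqrt (sad n) \<le> n powr (1 / 4)"
proof -
  have "sqrt 6 \<le> sqrt 9" by (rule real_sqrt_le_mono) simp
  hence "sqrt 6 \<le> pi" using pi_gt3 by simp
  hence "sqrt (6 * n) \<le> pi * sqrt n" using assms by (simp add: real_sqrt_mult)
  hence "1 / sad n \<le> sqrt n" using assms by (simp add: sad_def field_simps)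
  hence "sqrt (1 / sad n) \<le> sqrt (sqrt n)" by (rule real_sqrt_le_mono)
  also have "\<dots> = n powr (1 / 4)" using assms by (simp add: powr_powr flip: powr_half_sqrt)
  finally show ?thesis by (simp add: real_sqrt_divide)
qed

lemma sum_squares_ge: "(\<Sum>m\<in>{1..M}. (real m)\<^sup>2) \<ge> real M ^ 3 / 3"
proof (induction M)
  case (Suc M)
  have "real (Suc M) ^ 3 / 3 = real M ^ 3 / 3 + (real M)\<^sup>2 + real M + 1 / 3"
    by (simp add: power2_eq_square power3_eq_cube algebra_simps add_divide_distrib)
  also have "\<dots> \<le> (\<Sum>m\<in>{1..M}. (real m)\<^sup>2) + (real (Suc M))\<^sup>2"
    using Suc by (simp add: power2_eq_square algebra_simps)
  finally show ?case by simp
qed simp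

text \<open>The terms with k = 1 and m up to sqrt n already suffice: there \<open>phi\<close> loses
  at most the factor \<open>exp (- cc)\<close>, and the squares of m add up to order n^{3/2}. After
  division by n and with the correction n^{-1/8} this becomes n^{3/8}, more than the error n^{1/4}
  of \<open>half_sum_upper\<close>.\<close>

lemma half_sum_moment:
  assumes n: "n \<ge> 100"
  shows "exp (- cc) / 24 * (n * sqrt n) * phi n \<le> (\<Sum>z\<in>half_set n. wt z * vv z * phi (n - vv z))"
proof -
  define M where "M = nat \<lfloor>sqrt n\<rfloor>"
  have n0: "n > 0" using n by simp
  have sq: "sqrt n \<ge> 10" using real_sqrt_le_mono[OF n] by simp
  have "0 \<le> \<lfloor>sqrt n\<rfloor>" using n0 by simp
  hence "real M = of_int \<lfloor>sqrt n\<rfloor>" unfolding M_def by (rule of_nat_nat)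
  hence M: "real M \<le> sqrt n" "sqrt n < real M + 1" by linarith+
  have cc0: "cc > 0" by (simp add: cc_def)
  have half: "real m \<le> n / 2" "exp (- cc) * phi n \<le> phi (n - real m)" if m: "m \<in> {1..M}" for m
  proof -
    have mr: "real m \<le> sqrt n" "real m \<ge> 1" using m M by auto
    have nn: "n = sqrt n * sqrt n" using n0 by simp
    have "2 * sqrt n \<le> sqrt n * sqrt n" using sq n0 by (intro mult_right_mono) auto
    thus h: "real m \<le> n / 2" using mr nn by linarith
    have pos: "n - real m > 0" using h n0 by linarith
    have "(sqrt n - 1)\<^sup>2 \<le> n - real m"
      using mr nn by (simp add: power2_eq_square algebra_simps)
    hence "sqrt n - 1 \<le> sqrt (n - real m)" using real_le_rsqrt by blast
    hence "cc * (sqrt n - 1) \<le> cc * sqrt (n - real m)" using cc0 by (intro mult_left_mono) auto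
    hence "exp (- cc + cc * sqrt n) \<le> exp (cc * sqrt (n - real m))" by (simp add: algebra_simps)
    hence "exp (- cc) * exp (cc * sqrt n) / n \<le> exp (cc * sqrt (n - real m)) / (n - real m)"
      unfolding exp_add using pos n0 by (intro frac_le) auto
    thus "exp (- cc) * phi n \<le> phi (n - real m)" by (simp add: phi_def)
  qed
  have "exp (- cc) / 24 * (n * sqrt n) * phi n \<le> (real M ^ 3 / 3) * (exp (- cc) * phi n)"
  proof -
    have "sqrt n / 2 \<le> real M" using M sq by linarith
    hence "(sqrt n / 2) ^ 3 \<le> real M ^ 3" using sq n0 by (intro power_mono) auto
    moreover have "(sqrt n / 2) ^ 3 = n * sqrt n / 8" using n0 by (simp add: power_divide power3_eq_cube)
    ultimately have "n * sqrt n / 24 \<le> real M ^ 3 / 3" by simp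
    hence "(n * sqrt n / 24) * (exp (- cc) * phi n) \<le> (real M ^ 3 / 3) * (exp (- cc) * phi n)"
      using phi_pos[OF n0] by (intro mult_right_mono) auto
    thus ?thesis by (simp add: ac_simps)
  qed
  also have "\<dots> \<le> (\<Sum>m\<in>{1..M}. (real m)\<^sup>2) * (exp (- cc) * phi n)"
    using sum_squares_ge[of M] phi_pos[OF n0] by (intro mult_right_mono) auto
  also have "\<dots> \<le> (\<Sum>m\<in>{1..M}. (real m)\<^sup>2 * phi (n - real m))"
    unfolding sum_distrib_right using half(2) by (intro sum_mono mult_left_mono) auto
  also have "\<dots> = (\<Sum>z\<in>(\<lambda>m. (0, m - 1)) ` {1..M}. wt z * vv z * phi (n - vv z))"
    by (subst sum.reindex) (auto simp: inj_on_def wt_def vv_def power2_eq_square intro!: sum.cong)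
  also have "\<dots> \<le> (\<Sum>z\<in>half_set n. wt z * vv z * phi (n - vv z))"
  proof (rule sum_mono2)
    show "(\<lambda>m. (0, m - 1)) ` {1..M} \<subseteq> half_set n"
      using half(1) by (auto simp: half_set_def vv_def)
    fix z assume "z \<in> half_set n - (\<lambda>m. (0, m - 1)) ` {1..M}"
    hence "n - vv z > 0" using n0 by (auto simp: half_set_def)
    thus "0 \<le> wt z * vv z * phi (n - vv z)" using phi_pos wt_pos[of z] vv_pos[of z] by (simp add: less_imp_le)
  qed simp
  finally show ?thesis .
qed

text \<open>The tangent line of a convex function: the correction grows as the argument decreases,
  at a rate proportional to v, which produces the moment of \<open>half_sum_moment\<close>.\<close>

lemma powr_neg_convex:
  fixes n v :: real
  assumes n: "n > 0" and v: "0 \<le> v" "v < n"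
  shows "n powr (- (1 / 8)) + (1 / 8) * (v / n) * n powr (- (1 / 8)) \<le> (n - v) powr (- (1 / 8))"
proof -
  define x where "x = v / n"
  have x: "0 \<le> x" "x < 1" using assms by (simp_all add: x_def divide_simps)
  have "ln (1 - x) \<le> - x" using ln_add_one_self_le_self2[of "- x"] x by simp
  hence "(1 / 8) * x \<le> - (1 / 8) * ln (1 - x)" by simp
  hence "1 + (1 / 8) * x \<le> exp (- (1 / 8) * ln (1 - x))"
    using exp_ge_add_one_self[of "- (1 / 8) * ln (1 - x)"] by linarith
  also have "\<dots> = (1 - x) powr (- (1 / 8))" using x by (simp add: powr_def)
  finally have "n powr (- (1 / 8)) * (1 + (1 / 8) * x) \<le> n powr (- (1 / 8)) * (1 - x) powr (- (1 / 8))"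
    by (intro mult_left_mono) auto
  also have "\<dots> = (n * (1 - x)) powr (- (1 / 8))" using n x by (simp add: powr_mult)
  also have "n * (1 - x) = n - v" using n by (simp add: x_def field_simps)
  finally show ?thesis by (simp add: x_def algebra_simps)
qed

lemma pair_sum_reindex:
  fixes g :: "nat \<Rightarrow> real"
  shows "(\<Sum>(k, m)\<in>{(k, m). 1 \<le> k \<and> 1 \<le> m \<and> k * m \<le> n}. real m * g (n - k * m))
    = (\<Sum>z\<in>{z. vv z \<le> real n}. wt z * g (n - Suc (fst z) * Suc (snd z)))"
proof (rule sum.reindex_bij_witness[where i="\<lambda>z. (Suc (fst z), Suc (snd z))" and j="\<lambda>(k, m). (k - 1, m - 1)"])
  fix a assume a: "a \<in> {(k, m). 1 \<le> k \<and> 1 \<le> m \<and> k * m \<le> n}"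
  then obtain k m where km: "a = (k, m)" "1 \<le> k" "1 \<le> m" "k * m \<le> n" by auto
  have "real k * real m \<le> real n" using km(4) by (simp flip: of_nat_mult)
  thus "(case a of (k, m) \<Rightarrow> (k - 1, m - 1)) \<in> {z. vv z \<le> real n}"
    using km by (simp add: vv_def)
  show "wt (case a of (k, m) \<Rightarrow> (k - 1, m - 1)) * g (n - Suc (fst (case a of (k, m) \<Rightarrow> (k - 1, m - 1))) * Suc (snd (case a of (k, m) \<Rightarrow> (k - 1, m - 1)))) =
         (case a of (k, m) \<Rightarrow> real m * g (n - k * m))"
    using km by (simp add: wt_def)
next
  fix z assume z: "z \<in> {z. vv z \<le> real n}"
  hence "real (Suc (fst z) * Suc (snd z)) \<le> real n" unfolding vv_def of_nat_mult by blast
  hence "Suc (fst z) * Suc (snd z) \<le> n" unfolding of_nat_le_iff .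
  thus "(Suc (fst z), Suc (snd z)) \<in> {(k, m). 1 \<le> k \<and> 1 \<le> m \<and> k * m \<le> n}" by simp
qed auto

text \<open>Erdos' argument: \<open>\<phi>(n)(2 - n\<^bsup>-1/8\<^esup>)\<close> and \<open>\<phi>(n)(1 + n\<^bsup>-1/8\<^esup>)\<close> are a super- and a subsolution
  of the recurrence.\<close>

theorem recurrence_growth:
  fixes p :: "nat \<Rightarrow> real"
  assumes pos: "\<And>n. p n > 0" and mono: "\<And>m n. m \<le> n \<Longrightarrow> p m \<le> p n"
    and rec: "\<And>n. real n * p n = (\<Sum>(k, m)\<in>{(k, m). 1 \<le> k \<and> 1 \<le> m \<and> k * m \<le> n}. real m * p (n - k * m))"
  shows "\<exists>a A. a > 0 \<and> A > 0 \<and> (\<forall>n\<ge>1. a * phi (real n) \<le> p n \<and> p n \<le> A * phi (real n))"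
proof -
  define c where "c = exp (- cc) / 24"
  have c0: "c > 0" by (simp add: c_def)
  have cc2: "cc \<ge> 2"
  proof -
    have "sqrt (4 / 9) \<le> sqrt (2 / 3)" by (rule real_sqrt_le_mono) simp
    hence "2 / 3 \<le> sqrt (2 / 3)" by (simp add: real_sqrt_divide)
    hence "3 * (2 / 3) \<le> pi * sqrt (2 / 3)" using pi_gt3 by (intro mult_mono) auto
    thus ?thesis by (simp add: cc_def)
  qed
  \<comment> \<open>The factor 18000 is twice the constant 9000 of \<open>half_sum_upper\<close>,
    since 2 - d and 1 + d are at most 2; the summand 1 is for the terms with v > n/2.\<close>
  have ev1: "eventually (\<lambda>x::real. 18000 * x powr (1 / 4) + 1 \<le> (1 / 8) * c * x powr (3 / 8)) at_top"
    using c0 by real_asymp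
  have ev2: "eventually (\<lambda>x::real. 2 * x ^ 4 * exp (- sqrt x / 2) \<le> 1) at_top" by real_asymp
  obtain X where X: "\<And>x. x \<ge> X \<Longrightarrow> 18000 * x powr (1 / 4) + 1 \<le> (1 / 8) * c * x powr (3 / 8)"
     "\<And>x. x \<ge> X \<Longrightarrow> 2 * x ^ 4 * exp (- sqrt x / 2) \<le> 1"
    using eventually_conj[OF ev1 ev2] by (auto simp: eventually_at_top_linorder)
  define n0 where "n0 = max 100 (nat \<lceil>X\<rceil>)"
  have n0: "real n \<ge> 100" "real n \<ge> X" if "n \<ge> n0" for n using that by (auto simp: n0_def)
  define d where "d n = n powr (- (1 / 8))" for n :: real
  have d1: "0 < d (real n)" "d (real n) \<le> 1" if "n \<ge> 1" for n
    using that ge_one_powr_ge_zero[of "real n" "1 / 8"] by (auto simp: d_def powr_minus_divide)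
  have nat_sub: "real (n - Suc (fst z) * Suc (snd z)) = real n - vv z" if "vv z \<le> real n" for n z
  proof -
    have "real (Suc (fst z) * Suc (snd z)) \<le> real n" using that unfolding vv_def of_nat_mult .
    hence "Suc (fst z) * Suc (snd z) \<le> n" unfolding of_nat_le_iff .
    thus ?thesis by (simp only: of_nat_diff vv_def of_nat_mult)
  qed
  have halfnat: "n - Suc (fst z) * Suc (snd z) < n" "n - Suc (fst z) * Suc (snd z) \<ge> 1"
    if z: "z \<in> half_set (real n)" and n: "n \<ge> 100" for n z
  proof -
    have v: "vv z \<le> real n / 2" using z by (simp add: half_set_def)
    have "real (n - Suc (fst z) * Suc (snd z)) = real n - vv z" using v n by (intro nat_sub) simp
    hence "real (n - Suc (fst z) * Suc (snd z)) \<ge> 50" using v n by linarith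
    thus "n - Suc (fst z) * Suc (snd z) \<ge> 1" by linarith
    show "n - Suc (fst z) * Suc (snd z) < n" using n by simp
  qed
  have sub: "half_set (real n) \<subseteq> {z. vv z \<le> real n}" for n by (auto simp: half_set_def)
  have recz: "real n * p n = (\<Sum>z\<in>{z. vv z \<le> real n}. wt z * p (n - Suc (fst z) * Suc (snd z)))" for n
    unfolding rec by (rule pair_sum_reindex)
  have dv: "d (real n) + (1 / 8) * (vv z / real n) * d (real n) \<le> d (real n - vv z)"
    if "z \<in> half_set (real n)" "n \<ge> 100" for n z
    unfolding d_def by (rule powr_neg_convex) (use that vv_pos[of z] in \<open>auto simp: half_set_def less_imp_le\<close>)
  have moment: "(1 / 8) * c * real n powr (3 / 8) * phi (real n) \<le> (1 / 8) * (d (real n) / real n) * (\<Sum>z\<in>half_set (real n). wt z * vv z * phi (real n - vv z))"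
    if n: "n \<ge> 100" for n
  proof -
    have "(1 / 8) * (d (real n) / real n) * (c * (real n * sqrt (real n)) * phi (real n)) \<le> (1 / 8) * (d (real n) / real n) * (\<Sum>z\<in>half_set (real n). wt z * vv z * phi (real n - vv z))"
      using half_sum_moment[of "real n"] n d1[of n] by (intro mult_left_mono) (auto simp: c_def)
    moreover have "(d (real n) / real n) * (real n * sqrt (real n)) = real n powr (3 / 8)"
    proof -
      have "d (real n) * sqrt (real n) = real n powr (- (1 / 8) + 1 / 2)"
        unfolding powr_add d_def using n by (simp add: powr_half_sqrt)
      thus ?thesis using n by simp
    qed
    moreover have "(1 / 8) * (d (real n) / real n) * (c * (real n * sqrt (real n)) * phi (real n))
        = (1 / 8) * c * ((d (real n) / real n) * (real n * sqrt (real n))) * phi (real n)"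
      by (simp only: ac_simps)
    ultimately show ?thesis by (simp only:)
  qed
  have quarter: "9000 / sqrt (sad (real n)) \<le> 9000 * real n powr (1 / 4)" if "n \<ge> 100" for n
    using inv_sqrt_sad_le[of "real n"] that by simp
  \<comment> \<open>Chosen so that the induction can start: for n up to \<open>n0\<close> the
    quotient \<open>p n / phi (real n)\<close> is one of the summands, and 2 - d is at least
    1.\<close>
  define A where "A = 1 + (\<Sum>m\<in>{1..n0}. p m / phi (real m))"
  have phn: "phi (real n) > 0" if "n \<ge> 1" for n using that by (intro phi_pos) simp
  have A0: "A > 0" unfolding A_def using pos phn
    by (intro add_pos_nonneg sum_nonneg) (auto simp: less_imp_le)
  have upper: "p n \<le> A * (phi (real n) * (2 - d (real n)))" if "n \<ge> 1" for n
    using that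
  proof (induction n rule: less_induct)
    case (less n)
    show ?case
    proof (cases "n \<le> n0")
      case True
      have "p n / phi (real n) \<le> (\<Sum>m\<in>{1..n0}. p m / phi (real m))"
        using True less.prems pos phn by (intro member_le_sum) (auto simp: less_imp_le)
      hence "p n / phi (real n) \<le> A" by (simp add: A_def)
      hence "p n \<le> A * phi (real n)" using phn[OF less.prems] by (simp add: field_simps)
      also have "\<dots> * 1 \<le> A * phi (real n) * (2 - d (real n))"
        using d1[OF less.prems] A0 phn[OF less.prems] by (intro mult_left_mono) auto
      finally show ?thesis by (simp add: mult.assoc)
    next
      case False
      have "100 \<le> n0" by (simp add: n0_def)
      hence n: "n \<ge> n0" "n \<ge> 100" using False by linarith+
      define h where "h = half_set (real n)"
      let ?w = "\<lambda>z. n - Suc (fst z) * Suc (snd z)"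
      have n1: "real n > 0" using n by simp
      have main: "(\<Sum>z\<in>h. wt z * p (?w z)) \<le> A * (phi (real n) * ((2 - d (real n)) * (real n + 9000 * real n powr (1 / 4)) - (1 / 8) * c * real n powr (3 / 8)))"
      proof -
        have "(\<Sum>z\<in>h. wt z * p (?w z)) \<le> (\<Sum>z\<in>h. A * ((2 - d (real n)) * (wt z * phi (real n - vv z)) - (1 / 8) * (d (real n) / real n) * (wt z * vv z * phi (real n - vv z))))"
        proof (rule sum_mono)
          fix z assume z: "z \<in> h"
          have v: "vv z \<le> real n" using z sub h_def by blast
          have w: "?w z < n" "?w z \<ge> 1" using halfnat[of z n] z n by (auto simp: h_def)
          have "p (?w z) \<le> A * (phi (real n - vv z) * (2 - d (real n - vv z)))"
            using less.IH[OF w] unfolding nat_sub[OF v] .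
          also have "\<dots> \<le> A * (phi (real n - vv z) * (2 - (d (real n) + (1 / 8) * (vv z / real n) * d (real n))))"
            using dv[of z n] z n A0 phn[OF w(2)] unfolding nat_sub[OF v] h_def by (intro mult_left_mono) auto
          finally have "wt z * p (?w z) \<le> wt z * (A * (phi (real n - vv z) * (2 - (d (real n) + (1 / 8) * (vv z / real n) * d (real n)))))"
            by (intro mult_left_mono less_imp_le[OF wt_pos])
          thus "wt z * p (?w z) \<le> A * ((2 - d (real n)) * (wt z * phi (real n - vv z)) - (1 / 8) * (d (real n) / real n) * (wt z * vv z * phi (real n - vv z)))"
            by (simp add: algebra_simps)
        qed
        also have "\<dots> = A * ((2 - d (real n)) * (\<Sum>z\<in>h. wt z * phi (real n - vv z)) - (1 / 8) * (d (real n) / real n) * (\<Sum>z\<in>h. wt z * vv z * phi (real n - vv z)))"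
          by (simp add: sum_distrib_left sum_subtractf right_diff_distrib)
        also have "\<dots> \<le> A * ((2 - d (real n)) * (phi (real n) * (real n + 9000 * real n powr (1 / 4))) - (1 / 8) * c * real n powr (3 / 8) * phi (real n))"
        proof (intro mult_left_mono diff_mono)
          have "(\<Sum>z\<in>h. wt z * phi (real n - vv z)) \<le> phi (real n) * (real n + 9000 / sqrt (sad (real n)))"
            unfolding h_def using n by (intro half_sum_upper(1)) simp
          also have "\<dots> \<le> phi (real n) * (real n + 9000 * real n powr (1 / 4))"
            using quarter[OF n(2)] phn[OF less.prems] by (intro mult_left_mono) auto
          finally show "(\<Sum>z\<in>h. wt z * phi (real n - vv z)) \<le> phi (real n) * (real n + 9000 * real n powr (1 / 4))" .
          show "0 \<le> 2 - d (real n)" using d1[OF less.prems] by simp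
          show "(1 / 8) * c * real n powr (3 / 8) * phi (real n) \<le> (1 / 8) * (d (real n) / real n) * (\<Sum>z\<in>h. wt z * vv z * phi (real n - vv z))"
            unfolding h_def by (rule moment[OF n(2)])
        qed (use A0 in simp)
        finally show ?thesis by (simp add: algebra_simps)
      qed
      \<comment> \<open>For v > n/2 monotonicity replaces the value by that at
        \<open>n div 2\<close>, which is exponentially smaller than \<open>phi (real n)\<close>. In
        the lower bound these terms are dropped by positivity.\<close>
      have tail: "(\<Sum>z\<in>{z. vv z \<le> real n} - h. wt z * p (?w z)) \<le> A * phi (real n)"
      proof -
        define m where "m = n div 2"
        have m: "m \<ge> 1" "m < n" "real m \<le> real n / 2" using n by (auto simp: m_def)
        have pm: "p m \<le> 2 * A * exp (cc * sqrt (real n / 2))"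
        proof -
          have "p m \<le> A * (phi (real m) * (2 - d (real m)))" by (rule less.IH[OF m(2,1)])
          also have "\<dots> \<le> A * (phi (real m) * 2)" using A0 phn[OF m(1)] d1[OF m(1)] by (intro mult_left_mono) auto
          also have "phi (real m) \<le> exp (cc * sqrt (real n / 2))"
          proof -
            have "phi (real m) \<le> exp (cc * sqrt (real m)) / 1" unfolding phi_def using m by (intro frac_le) auto
            also have "\<dots> \<le> exp (cc * sqrt (real n / 2))" using m cc2 by (auto intro!: mult_left_mono)
            finally show ?thesis .
          qed
          hence "A * (phi (real m) * 2) \<le> A * (exp (cc * sqrt (real n / 2)) * 2)" using A0 by (intro mult_left_mono mult_right_mono) auto
          finally show ?thesis by (simp add: ac_simps)
        qed
        have "(\<Sum>z\<in>{z. vv z \<le> real n} - h. wt z * p (?w z)) \<le> (\<Sum>z\<in>{z. vv z \<le> real n} - h. real n * p m)"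
        proof (rule sum_mono)
          fix z assume z: "z \<in> {z. vv z \<le> real n} - h"
          have "real (?w z) \<le> real n / 2" using z nat_sub[of z n] by (auto simp: h_def half_set_def)
          hence "?w z \<le> m" by (simp add: m_def)
          hence "p (?w z) \<le> p m" by (rule mono)
          moreover have "wt z \<le> vv z"
          proof -
            have "1 * real (Suc (snd z)) \<le> real (Suc (fst z)) * real (Suc (snd z))" by (intro mult_right_mono) auto
            thus ?thesis by (simp add: wt_def vv_def)
          qed
          hence "wt z \<le> real n" using z by auto
          ultimately show "wt z * p (?w z) \<le> real n * p m"
            using pos[of "?w z"] wt_pos[of z] by (intro mult_mono) (auto simp: less_imp_le)
        qed
        also have "\<dots> = real (card ({z. vv z \<le> real n} - h)) * (real n * p m)" by simp
        also have "\<dots> \<le> real (n * n) * (real n * p m)"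
        proof (intro mult_right_mono)
          have "{z. vv z \<le> real n} - h \<subseteq> {..<n} \<times> {..<n}"
          proof
            fix z assume "z \<in> {z. vv z \<le> real n} - h"
            hence "real (Suc (fst z) * Suc (snd z)) \<le> real n" unfolding vv_def of_nat_mult by blast
            hence le: "Suc (fst z) * Suc (snd z) \<le> n" unfolding of_nat_le_iff .
            have "Suc (fst z) \<le> Suc (fst z) * Suc (snd z)" "Suc (snd z) \<le> Suc (fst z) * Suc (snd z)" by simp_all
            hence "Suc (fst z) \<le> n" "Suc (snd z) \<le> n" using le by linarith+
            thus "z \<in> {..<n} \<times> {..<n}" by (cases z) auto
          qed
          from card_mono[OF _ this] show "real (card ({z. vv z \<le> real n} - h)) \<le> real (n * n)"
            unfolding of_nat_le_iff by (simp add: card_cartesian_product)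
        qed (use pos[of m] in \<open>auto simp: less_imp_le\<close>)
        also have "\<dots> = real n ^ 3 * p m" by (simp add: power3_eq_cube)
        also have "\<dots> \<le> real n ^ 3 * (2 * A * exp (cc * sqrt (real n / 2)))" using pm by (intro mult_left_mono) auto
        also have "\<dots> \<le> A * phi (real n)"
        proof -
          have "sqrt (real n / 2) \<le> (3 / 4) * sqrt (real n)"
          proof -
            have "sqrt (real n / 2) \<le> sqrt ((9 / 16) * real n)" by (rule real_sqrt_le_mono) simp
            also have "\<dots> = sqrt (9 / 16) * sqrt (real n)" by (rule real_sqrt_mult)
            finally show ?thesis by (simp add: real_sqrt_divide)
          qed
          hence "cc * sqrt (real n / 2) \<le> cc * ((3 / 4) * sqrt (real n))" using cc2 by (intro mult_left_mono) auto
          also have "\<dots> = cc * sqrt (real n) - cc * (sqrt (real n) / 4)" by (simp add: algebra_simps)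
          also have "\<dots> \<le> cc * sqrt (real n) - 2 * (sqrt (real n) / 4)" using cc2 by (intro diff_left_mono mult_right_mono) auto
          finally have E: "exp (cc * sqrt (real n / 2)) \<le> exp (cc * sqrt (real n)) * exp (- sqrt (real n) / 2)"
            unfolding exp_add[symmetric] by simp
          have "real n ^ 3 * (2 * A * exp (cc * sqrt (real n / 2))) \<le> real n ^ 3 * (2 * A * (exp (cc * sqrt (real n)) * exp (- sqrt (real n) / 2)))"
            using A0 E by (intro mult_left_mono) auto
          also have "\<dots> = A * phi (real n) * (2 * real n ^ 4 * exp (- sqrt (real n) / 2))"
            using n1 by (simp add: phi_def field_simps eval_nat_numeral)
          also have "\<dots> \<le> A * phi (real n) * 1"
            using X(2)[of "real n"] n0[OF n(1)] A0 phn[OF less.prems] by (intro mult_left_mono) auto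
          finally show ?thesis by simp
        qed
        finally show ?thesis .
      qed
      have "real n * p n = (\<Sum>z\<in>h. wt z * p (?w z)) + (\<Sum>z\<in>{z. vv z \<le> real n} - h. wt z * p (?w z))"
        unfolding recz h_def by (subst sum.subset_diff[OF sub]) (auto simp: finite_vv_le)
      also have "\<dots> \<le> A * (phi (real n) * ((2 - d (real n)) * (real n + 9000 * real n powr (1 / 4)) - (1 / 8) * c * real n powr (3 / 8))) + A * phi (real n)"
        using main tail by linarith
      also have "\<dots> = A * phi (real n) * ((2 - d (real n)) * real n + ((2 - d (real n)) * (9000 * real n powr (1 / 4)) - (1 / 8) * c * real n powr (3 / 8) + 1))"
        by (simp add: algebra_simps)
      also have "\<dots> \<le> A * phi (real n) * ((2 - d (real n)) * real n + 0)"
      proof (intro mult_left_mono add_left_mono)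
        have "(2 - d (real n)) * (9000 * real n powr (1 / 4)) \<le> 2 * (9000 * real n powr (1 / 4))"
          using d1[OF less.prems] by (intro mult_right_mono) auto
        thus "(2 - d (real n)) * (9000 * real n powr (1 / 4)) - (1 / 8) * c * real n powr (3 / 8) + 1 \<le> 0"
          using X(1)[of "real n"] n0[OF n(1)] by linarith
      qed (use A0 phn[OF less.prems] in simp)
      finally have "real n * p n \<le> real n * (A * (phi (real n) * (2 - d (real n))))" by (simp add: ac_simps)
      thus ?thesis using n1 by simp
    qed
  qed
  \<comment> \<open>The factor 2 accommodates 1 + d \<le> 2 for the initial values.\<close>
  define a where "a = 1 / (2 * (1 + (\<Sum>m\<in>{1..n0}. phi (real m) / p m)))"
  have sn: "(\<Sum>m\<in>{1..n0}. phi (real m) / p m) \<ge> 0"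
    using pos phn by (intro sum_nonneg) (auto simp: less_imp_le)
  hence a0: "a > 0" unfolding a_def by (intro divide_pos_pos) auto
  have lower: "a * (phi (real n) * (1 + d (real n))) \<le> p n" if "n \<ge> 1" for n
    using that
  proof (induction n rule: less_induct)
    case (less n)
    show ?case
    proof (cases "n \<le> n0")
      case True
      have "phi (real n) / p n \<le> (\<Sum>m\<in>{1..n0}. phi (real m) / p m)"
        using True less.prems pos phn by (intro member_le_sum) (auto simp: less_imp_le)
      moreover have "1 / (2 * a) = 1 + (\<Sum>m\<in>{1..n0}. phi (real m) / p m)" by (simp add: a_def)
      ultimately have "phi (real n) / p n \<le> 1 / (2 * a)" by linarith
      hence "2 * a * phi (real n) \<le> p n" using a0 pos[of n] by (simp add: field_simps)
      moreover have "a * (phi (real n) * (1 + d (real n))) \<le> a * (phi (real n) * 2)"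
        using d1[OF less.prems] a0 phn[OF less.prems] by (intro mult_left_mono) auto
      ultimately show ?thesis by linarith
    next
      case False
      have "100 \<le> n0" by (simp add: n0_def)
      hence n: "n \<ge> n0" "n \<ge> 100" using False by linarith+
      define h where "h = half_set (real n)"
      let ?w = "\<lambda>z. n - Suc (fst z) * Suc (snd z)"
      have n1: "real n > 0" using n by simp
      have "a * phi (real n) * ((1 + d (real n)) * real n) \<le> a * phi (real n) * ((1 + d (real n)) * (real n - 9000 * real n powr (1 / 4)) + (1 / 8) * c * real n powr (3 / 8))"
      proof (intro mult_left_mono)
        have "(1 + d (real n)) * (9000 * real n powr (1 / 4)) \<le> 2 * (9000 * real n powr (1 / 4))"
          using d1[OF less.prems] by (intro mult_right_mono) auto
        thus "(1 + d (real n)) * real n \<le> (1 + d (real n)) * (real n - 9000 * real n powr (1 / 4)) + (1 / 8) * c * real n powr (3 / 8)"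
          using X(1)[of "real n"] n0[OF n(1)] unfolding right_diff_distrib by linarith
      qed (use a0 phn[OF less.prems] in simp)
      also have "\<dots> = a * ((1 + d (real n)) * (phi (real n) * (real n - 9000 * real n powr (1 / 4))) + (1 / 8) * c * real n powr (3 / 8) * phi (real n))"
        by (simp add: algebra_simps)
      also have "\<dots> \<le> a * ((1 + d (real n)) * (\<Sum>z\<in>h. wt z * phi (real n - vv z)) + (1 / 8) * (d (real n) / real n) * (\<Sum>z\<in>h. wt z * vv z * phi (real n - vv z)))"
      proof (intro mult_left_mono add_mono)
        have "phi (real n) * (real n - 9000 * real n powr (1 / 4)) \<le> phi (real n) * (real n - 9000 / sqrt (sad (real n)))"
          using quarter[OF n(2)] phn[OF less.prems] by (intro mult_left_mono) auto
        also have "\<dots> \<le> (\<Sum>z\<in>h. wt z * phi (real n - vv z))"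
          unfolding h_def using n by (intro half_sum_upper(2)) simp
        finally show "phi (real n) * (real n - 9000 * real n powr (1 / 4)) \<le> (\<Sum>z\<in>h. wt z * phi (real n - vv z))" .
        show "(1 / 8) * c * real n powr (3 / 8) * phi (real n) \<le> (1 / 8) * (d (real n) / real n) * (\<Sum>z\<in>h. wt z * vv z * phi (real n - vv z))"
          unfolding h_def by (rule moment[OF n(2)])
      qed (use a0 d1[OF less.prems] in auto)
      also have "\<dots> = (\<Sum>z\<in>h. a * ((1 + d (real n)) * (wt z * phi (real n - vv z)) + (1 / 8) * (d (real n) / real n) * (wt z * vv z * phi (real n - vv z))))"
        by (simp add: sum_distrib_left sum.distrib distrib_left)
      also have "\<dots> \<le> (\<Sum>z\<in>h. wt z * p (?w z))"
      proof (rule sum_mono)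
        fix z assume z: "z \<in> h"
        have v: "vv z \<le> real n" using z sub h_def by blast
        have w: "?w z < n" "?w z \<ge> 1" using halfnat[of z n] z n by (auto simp: h_def)
        have "a * (phi (real n - vv z) * (1 + (d (real n) + (1 / 8) * (vv z / real n) * d (real n)))) \<le> a * (phi (real n - vv z) * (1 + d (real n - vv z)))"
          using dv[of z n] z n a0 phn[OF w(2)] unfolding nat_sub[OF v] h_def by (intro mult_left_mono) auto
        also have "\<dots> \<le> p (?w z)" using less.IH[OF w] unfolding nat_sub[OF v] .
        finally have "wt z * (a * (phi (real n - vv z) * (1 + (d (real n) + (1 / 8) * (vv z / real n) * d (real n))))) \<le> wt z * p (?w z)"
          by (intro mult_left_mono less_imp_le[OF wt_pos])
        thus "a * ((1 + d (real n)) * (wt z * phi (real n - vv z)) + (1 / 8) * (d (real n) / real n) * (wt z * vv z * phi (real n - vv z))) \<le> wt z * p (?w z)"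
          by (simp add: algebra_simps)
      qed
      also have "\<dots> \<le> (\<Sum>z\<in>{z. vv z \<le> real n}. wt z * p (?w z))"
        unfolding h_def using sub pos wt_pos by (intro sum_mono2) (auto simp: finite_vv_le less_imp_le)
      also have "\<dots> = real n * p n" by (rule recz[symmetric])
      finally have "real n * (a * (phi (real n) * (1 + d (real n)))) \<le> real n * p n" by (simp add: ac_simps)
      thus ?thesis using n1 by simp
    qed
  qed
  have "a * phi (real n) \<le> p n \<and> p n \<le> (2 * A) * phi (real n)" if n: "n \<ge> 1" for n
  proof
    have "a * (phi (real n) * 1) \<le> a * (phi (real n) * (1 + d (real n)))"
      using d1[OF n] a0 phn[OF n] by (intro mult_left_mono) auto
    thus "a * phi (real n) \<le> p n" using lower[OF n] by simp
    have "A * (phi (real n) * (2 - d (real n))) \<le> A * (phi (real n) * 2)"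
      using d1[OF n] A0 phn[OF n] by (intro mult_left_mono) auto
    thus "p n \<le> (2 * A) * phi (real n)" using upper[OF n] by simp
  qed
  thus ?thesis using a0 A0 by (intro exI[of _ a] exI[of _ "2 * A"]) auto
qed

section \<open>Parts of a typical partition\<close>

lemma power_diff_le:
  fixes a b :: real
  assumes "0 \<le> b" "b \<le> a"
  shows "a ^ Suc n - b ^ Suc n \<le> real (Suc n) * (a - b) * a ^ n"
proof -
  have "a ^ Suc n - b ^ Suc n = (a - b) * (\<Sum>i<Suc n. a ^ i * b ^ (n - i))"
    using power_diff_sumr2[of a "Suc n" b] by (simp add: mult.commute)
  also have "(\<Sum>i<Suc n. a ^ i * b ^ (n - i)) \<le> (\<Sum>i<Suc n. a ^ n)"
  proof (rule sum_mono)
    fix i assume "i \<in> {..<Suc n}"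
    hence i: "i \<le> n" by simp
    have "a ^ i * b ^ (n - i) \<le> a ^ i * a ^ (n - i)" using assms by (intro mult_left_mono power_mono) auto
    thus "a ^ i * b ^ (n - i) \<le> a ^ n" using i by (simp flip: power_add)
  qed
  hence "(a - b) * (\<Sum>i<Suc n. a ^ i * b ^ (n - i)) \<le> (a - b) * (\<Sum>i<Suc n. a ^ n)"
    using assms by (intro mult_left_mono) auto
  finally show ?thesis by (simp add: ac_simps)
qed

text \<open>A left Riemann sum with mesh q of the decreasing function (y - x)^n on [0, y], compared
  with its integral.\<close>

lemma sum_power_steps_ge:
  fixes y q :: real
  assumes q: "q > 0"
  shows "y \<ge> 0 \<Longrightarrow> y < q * real (Suc C) \<Longrightarrow> y ^ Suc n / (real (Suc n) * q) \<le> (\<Sum>c\<le>C. if q * real c \<le> y then (y - q * real c) ^ n else 0)"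
proof (induction C arbitrary: y)
  case 0
  have "y ^ Suc n - 0 ^ Suc n \<le> real (Suc n) * (y - 0) * y ^ n" using 0 by (intro power_diff_le) auto
  also have "\<dots> \<le> real (Suc n) * q * y ^ n" using 0 by (intro mult_right_mono mult_left_mono) auto
  finally have "y ^ Suc n \<le> y ^ n * (real (Suc n) * q)" by (simp add: ac_simps)
  hence "y ^ Suc n / (real (Suc n) * q) \<le> y ^ n" using q by (simp add: pos_divide_le_eq)
  thus ?case using 0 by simp
next
  case (Suc C)
  show ?case
  proof (cases "y < q")
    case True
    have "y ^ Suc n - 0 ^ Suc n \<le> real (Suc n) * (y - 0) * y ^ n" using Suc by (intro power_diff_le) auto
    also have "\<dots> \<le> real (Suc n) * q * y ^ n" using Suc True by (intro mult_right_mono mult_left_mono) auto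
    finally have "y ^ Suc n \<le> y ^ n * (real (Suc n) * q)" by (simp add: ac_simps)
    hence "y ^ Suc n / (real (Suc n) * q) \<le> y ^ n" using q by (simp add: pos_divide_le_eq)
    also have "\<dots> \<le> (\<Sum>c\<le>Suc C. if q * real c \<le> y then (y - q * real c) ^ n else 0)"
      using Suc.prems(1) member_le_sum[of 0 "{..Suc C}" "\<lambda>c. if q * real c \<le> y then (y - q * real c) ^ n else 0"] by simp
    finally show ?thesis .
  next
    case False
    have "y ^ Suc n - (y - q) ^ Suc n \<le> real (Suc n) * (y - (y - q)) * y ^ n"
      using False q by (intro power_diff_le) auto
    hence "y ^ Suc n \<le> (y - q) ^ Suc n + y ^ n * (real (Suc n) * q)" by (simp add: ac_simps)
    hence "y ^ Suc n / (real (Suc n) * q) \<le> ((y - q) ^ Suc n + y ^ n * (real (Suc n) * q)) / (real (Suc n) * q)"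
      using q by (intro divide_right_mono) auto
    also have "\<dots> = (y - q) ^ Suc n / (real (Suc n) * q) + y ^ n"
      using q by (subst add_divide_distrib) simp
    also have "(y - q) ^ Suc n / (real (Suc n) * q) \<le> (\<Sum>c\<le>C. if q * real c \<le> y - q then (y - q - q * real c) ^ n else 0)"
      using Suc.prems False by (intro Suc.IH) (auto simp: algebra_simps)
    also have "\<dots> = (\<Sum>c\<le>C. if q * real (Suc c) \<le> y then (y - q * real (Suc c)) ^ n else 0)"
      by (intro sum.cong refl) (auto simp: algebra_simps)
    finally have "y ^ Suc n / (real (Suc n) * q) \<le> (\<Sum>c\<le>C. if q * real (Suc c) \<le> y then (y - q * real (Suc c)) ^ n else 0) + y ^ n"
      by simp
    thus ?thesis using Suc.prems(1) by (subst sum.atMost_Suc_shift) simp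
  qed
qed

text \<open>Coordinate 0 is left out: its weight p^0 = 1 lets it fill up any remaining total
  exactly.\<close>

definition lsimplex :: "nat \<Rightarrow> nat \<Rightarrow> nat \<Rightarrow> (nat \<Rightarrow> nat) set" where
  "lsimplex p J y = {d \<in> {1..J} \<rightarrow>\<^sub>E {..y}. (\<Sum>j\<in>{1..J}. p ^ j * d j) \<le> y}"

lemma finite_lsimplex [simp]: "finite (lsimplex p J y)"
  unfolding lsimplex_def by (rule finite_subset[of _ "{1..J} \<rightarrow>\<^sub>E {..y}"]) (auto intro: finite_PiE)

text \<open>There are at least as many lattice points as the volume of the simplex, by slicing along
  the last coordinate.\<close>

lemma card_lsimplex_ge:
  assumes p: "p > 0"
  shows "real y ^ J / (fact J * (\<Prod>j\<in>{1..J}. real p ^ j)) \<le> real (card (lsimplex p J y))"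
proof (induction J arbitrary: y)
  case 0
  have "lsimplex p 0 y = {\<lambda>_. undefined}" by (auto simp: lsimplex_def)
  thus ?case by simp
next
  case (Suc J)
  let ?q = "p ^ Suc J"
  define C where "C = {c. c \<le> y \<and> ?q * c \<le> y}"
  define V where "V = fact J * (\<Prod>j\<in>{1..J}. real p ^ j)"
  have V: "V > 0" using p by (auto simp: V_def intro!: mult_pos_pos prod_pos)
  have finC: "finite C" by (simp add: C_def)
  have ext: "{1..Suc J} = insert (Suc J) {1..J}" by auto
  have "(\<Union>c\<in>C. (\<lambda>d. d(Suc J := c)) ` lsimplex p J (y - ?q * c)) \<subseteq> lsimplex p (Suc J) y"
  proof
    fix e assume "e \<in> (\<Union>c\<in>C. (\<lambda>d. d(Suc J := c)) ` lsimplex p J (y - ?q * c))"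
    then obtain c d where cd: "c \<in> C" "d \<in> lsimplex p J (y - ?q * c)" "e = d(Suc J := c)" by blast
    have "(\<Sum>j\<in>{1..Suc J}. p ^ j * e j) = ?q * c + (\<Sum>j\<in>{1..J}. p ^ j * e j)" unfolding ext using cd by simp
    also have "(\<Sum>j\<in>{1..J}. p ^ j * e j) = (\<Sum>j\<in>{1..J}. p ^ j * d j)" by (rule sum.cong) (use cd in auto)
    finally have "(\<Sum>j\<in>{1..Suc J}. p ^ j * e j) \<le> y" using cd by (auto simp: lsimplex_def C_def)
    moreover have "e \<in> {1..Suc J} \<rightarrow>\<^sub>E {..y}"
    proof (rule PiE_I)
      have d: "d \<in> {1..J} \<rightarrow>\<^sub>E {..y - ?q * c}" using cd(2) unfolding lsimplex_def by blast
      fix j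
      show "e j \<in> {..y}" if j: "j \<in> {1..Suc J}"
      proof (cases "j = Suc J")
        case True
        thus ?thesis using cd by (simp add: C_def)
      next
        case False
        hence "d j \<in> {..y - ?q * c}" using PiE_mem[OF d, of j] j by simp
        hence "d j \<le> y" by (simp only: atMost_iff)
        thus ?thesis using False cd(3) by simp
      qed
      show "e j = undefined" if j: "j \<notin> {1..Suc J}"
        using PiE_arb[OF d, of j] j cd(3) by auto
    qed
    ultimately show "e \<in> lsimplex p (Suc J) y" by (simp add: lsimplex_def)
  qed
  hence "card (\<Union>c\<in>C. (\<lambda>d. d(Suc J := c)) ` lsimplex p J (y - ?q * c)) \<le> card (lsimplex p (Suc J) y)"
    by (intro card_mono) auto
  moreover have "card (\<Union>c\<in>C. (\<lambda>d. d(Suc J := c)) ` lsimplex p J (y - ?q * c)) = (\<Sum>c\<in>C. card ((\<lambda>d. d(Suc J := c)) ` lsimplex p J (y - ?q * c)))"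
  proof (rule card_UN_disjoint[OF finC])
    show "\<forall>i\<in>C. \<forall>j\<in>C. i \<noteq> j \<longrightarrow> (\<lambda>d. d(Suc J := i)) ` lsimplex p J (y - ?q * i) \<inter> (\<lambda>d. d(Suc J := j)) ` lsimplex p J (y - ?q * j) = {}"
    proof (intro ballI impI)
      fix i j :: nat assume "i \<noteq> j"
      show "(\<lambda>d. d(Suc J := i)) ` lsimplex p J (y - ?q * i) \<inter> (\<lambda>d. d(Suc J := j)) ` lsimplex p J (y - ?q * j) = {}"
        using \<open>i \<noteq> j\<close> by (auto simp: fun_upd_def fun_eq_iff) metis
    qed
  qed auto
  moreover have "card ((\<lambda>d. d(Suc J := c)) ` lsimplex p J (y - ?q * c)) = card (lsimplex p J (y - ?q * c))" for c
  proof (rule card_image, rule inj_onI)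
    fix d d' assume d: "d \<in> lsimplex p J (y - ?q * c)" "d' \<in> lsimplex p J (y - ?q * c)" and eq: "d(Suc J := c) = d'(Suc J := c)"
    have "d j = d' j" for j
    proof (cases "j = Suc J")
      case True
      thus ?thesis using d by (auto simp: lsimplex_def PiE_def extensional_def)
    next
      case False
      thus ?thesis using fun_cong[OF eq, of j] by simp
    qed
    hence "\<forall>j. d j = d' j" by blast
    thus "d = d'" by auto
  qed
  ultimately have card: "(\<Sum>c\<in>C. card (lsimplex p J (y - ?q * c))) \<le> card (lsimplex p (Suc J) y)" by simp
  have "real y ^ Suc J / (real (Suc J) * real ?q) \<le> (\<Sum>c\<le>y. if real ?q * real c \<le> real y then (real y - real ?q * real c) ^ J else 0)"
  proof (rule sum_power_steps_ge)
    show "real ?q > 0" using p by simp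
    have "?q \<ge> 1" using p by (simp add: Suc_le_eq)
    hence "real ?q \<ge> 1" using of_nat_mono[of 1 ?q] by (simp only: of_nat_1)
    hence "1 * real (Suc y) \<le> real ?q * real (Suc y)" by (rule mult_right_mono) simp
    moreover have "real y < 1 * real (Suc y)" by simp
    ultimately show "real y < real ?q * real (Suc y)" by (rule less_le_trans[rotated])
  qed simp
  also have "\<dots> = (\<Sum>c\<in>C. real (y - ?q * c) ^ J)"
  proof -
    have "(real ?q * real c \<le> real y) = (?q * c \<le> y)" for c
      unfolding of_nat_mult[symmetric] of_nat_le_iff ..
    hence "(\<Sum>c\<le>y. if real ?q * real c \<le> real y then (real y - real ?q * real c) ^ J else 0) = (\<Sum>c\<le>y. if ?q * c \<le> y then real (y - ?q * c) ^ J else 0)"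
      by (intro sum.cong refl) (auto simp: of_nat_diff simp flip: of_nat_mult of_nat_power)
    also have "\<dots> = (\<Sum>c\<in>C. real (y - ?q * c) ^ J)"
      by (rule sum.mono_neutral_cong_right) (auto simp: C_def)
    finally show ?thesis .
  qed
  finally have "real y ^ Suc J / (real (Suc J) * real ?q) / V \<le> (\<Sum>c\<in>C. real (y - ?q * c) ^ J) / V"
    using V by (intro divide_right_mono) auto
  also have "\<dots> = (\<Sum>c\<in>C. real (y - ?q * c) ^ J / V)" by (simp add: sum_divide_distrib)
  also have "\<dots> \<le> (\<Sum>c\<in>C. real (card (lsimplex p J (y - ?q * c))))"
    using Suc.IH by (intro sum_mono) (simp add: V_def)
  also have "\<dots> \<le> real (card (lsimplex p (Suc J) y))" using card by (simp flip: of_nat_sum)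
  finally have "real y ^ Suc J / (real (Suc J) * real ?q) / V \<le> real (card (lsimplex p (Suc J) y))" .
  moreover have "real (Suc J) * real ?q * V = fact (Suc J) * (\<Prod>j\<in>{1..Suc J}. real p ^ j)"
    by (simp add: V_def)
  ultimately show ?case by (simp only: divide_divide_eq_left)
qed

lemma one_minus_exp_ge: "0 \<le> y \<Longrightarrow> y * exp (- y / 2) \<le> 1 - exp (- (y::real))"
proof -
  assume y: "0 \<le> y"
  have "exp (- y / 2) * (y / 2) \<le> exp (- y / 2) * sinh (y / 2)"
    using sinh_ge_self[of "y / 2"] y by (intro mult_left_mono) auto
  also have "\<dots> = (1 - exp (- y)) / 2"
    by (simp add: sinh_def exp_add[symmetric] right_diff_distrib algebra_simps flip: exp_add)
  finally show ?thesis by (simp add: mult.commute)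
qed

lemma geometric_partial_le:
  fixes x :: real
  assumes "0 \<le> x" "x < 1"
  shows "(\<Sum>c\<le>n. x ^ c) \<le> 1 / (1 - x)"
proof -
  have "(\<Sum>c\<le>n. x ^ c) = (1 - x ^ Suc n) / (1 - x)" using assms by (simp add: sum_gp0)
  also have "\<dots> \<le> 1 / (1 - x)" using assms by (intro divide_right_mono) auto
  finally show ?thesis .
qed

lemma geometric_tail_le:
  fixes z :: real
  assumes z: "0 < z" "z < 1"
  shows "(\<Sum>j\<in>{1..n}. z ^ j) \<le> z / (1 - z)"
proof -
  have "(\<Sum>j\<in>{1..n}. z ^ j) = (\<Sum>j<n. z ^ Suc j)"
    by (rule sum.reindex_bij_witness[where i=Suc and j="\<lambda>m. m - 1"]) auto
  also have "\<dots> = z * (\<Sum>j<n. z ^ j)" by (simp add: sum_distrib_left)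
  also have "(\<Sum>j<n. z ^ j) \<le> (\<Sum>j\<le>n. z ^ j)" using z by (intro sum_mono2) auto
  also have "\<dots> \<le> 1 / (1 - z)" using z by (intro geometric_partial_le) auto
  finally show ?thesis using z by (simp add: mult_left_mono)
qed

section \<open>Boltzmann weights of a single block and of partitions without a large block\<close>

definition fail_set :: "nat \<Rightarrow> nat \<Rightarrow> nat \<Rightarrow> nat \<Rightarrow> (nat \<Rightarrow> nat) set" where
  "fail_set p J y N = {d \<in> {..J} \<rightarrow>\<^sub>E {..N}. (\<Sum>j\<le>J. p ^ j * d j) < y}"

text \<open>The weight of success is bounded from below. A lattice point of the simplex for the
  coordinates 1 to J and a total n between y and about y + 1/s determine one successful vector, of
  weight x^{m0 n}; for each lattice point these add up to at least half of e^{-L}/(1 - x^{m0}). The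
  volume has the denominator J! times the product of the p^j, and the factors 1 - x^{m0 p^j},
  comparable to s m0 p^j by \<open>small\<close>, turn it into L^J/J!.\<close>

lemma fail_set_weight:
  fixes s :: real and y :: nat
  assumes p: "p \<ge> 2" and m0: "m0 \<ge> 1" and s: "s > 0" and small: "s * real m0 * real p ^ J \<le> 1"
  defines "x \<equiv> exp (- s)"
  defines "L \<equiv> s * real m0 * real y"
  shows "(\<Sum>d\<in>fail_set p J y N. \<Prod>j\<le>J. x ^ (m0 * p ^ j * d j))
    \<le> (1 - exp (- 1) / 2 * exp (- L) * (L ^ J / fact J)) * (\<Prod>j\<le>J. 1 / (1 - x ^ (m0 * p ^ j)))"
proof -
  have x: "0 < x" "x < 1" using s by (auto simp: x_def)
  define xm where "xm = x ^ m0"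
  have xm: "0 < xm" "xm < 1" using x m0 by (auto simp: xm_def power_less_one_iff)
  \<comment> \<open>About 1/s further totals collect half of the geometric series, as e^{-1} \<le>
    1/2.\<close>
  define Lc where "Lc = nat \<lceil>1 / s\<rceil>"
  \<comment> \<open>A truncation that contains both the failing vectors and the successful ones
    constructed below; the product of the truncated series stays below that of the full
    ones.\<close>
  define N' where "N' = max N (y + Lc)"
  define w where "w d = (\<Prod>j\<le>J. x ^ (m0 * p ^ j * d j))" for d :: "nat \<Rightarrow> nat"
  have w_pos: "w d \<ge> 0" for d using x by (auto simp: w_def intro!: prod_nonneg)
  have w_eq: "w d = xm ^ (\<Sum>j\<le>J. p ^ j * d j)" for d
    unfolding w_def xm_def power_mult[symmetric] power_sum[symmetric]
    by (simp add: power_sum sum_distrib_left mult.assoc)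
  define Suc' where "Suc' = {d \<in> {..J} \<rightarrow>\<^sub>E {..N'}. y \<le> (\<Sum>j\<le>J. p ^ j * d j)}"
  have finS: "finite Suc'" unfolding Suc'_def by (rule finite_subset[of _ "{..J} \<rightarrow>\<^sub>E {..N'}"]) (auto intro: finite_PiE)
  have finF: "finite (fail_set p J y N)" unfolding fail_set_def by (rule finite_subset[of _ "{..J} \<rightarrow>\<^sub>E {..N}"]) (auto intro: finite_PiE)
  have fl: "1 - x ^ (m0 * p ^ j) > 0" for j
  proof -
    have "m0 * p ^ j > 0" using m0 p by simp
    thus ?thesis using x by (simp add: power_less_one_iff)
  qed
  have tot: "(\<Sum>d\<in>fail_set p J y N. w d) + (\<Sum>d\<in>Suc'. w d) \<le> (\<Prod>j\<le>J. 1 / (1 - x ^ (m0 * p ^ j)))"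
  proof -
    have "(\<Sum>d\<in>fail_set p J y N. w d) + (\<Sum>d\<in>Suc'. w d) = (\<Sum>d\<in>fail_set p J y N \<union> Suc'. w d)"
      using finS finF by (intro sum.union_disjoint[symmetric]) (auto simp: fail_set_def Suc'_def)
    also have "\<dots> \<le> (\<Sum>d\<in>{..J} \<rightarrow>\<^sub>E {..N'}. w d)"
    proof (rule sum_mono2)
      show "finite ({..J} \<rightarrow>\<^sub>E {..N'})" by (intro finite_PiE) auto
      have "{..J} \<rightarrow>\<^sub>E {..N} \<subseteq> {..J} \<rightarrow>\<^sub>E {..N'}" by (rule PiE_mono) (auto simp: N'_def)
      thus "fail_set p J y N \<union> Suc' \<subseteq> {..J} \<rightarrow>\<^sub>E {..N'}" by (auto simp: fail_set_def Suc'_def)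
    qed (rule w_pos)
    also have "\<dots> = (\<Prod>j\<le>J. \<Sum>c\<in>{..N'}. x ^ (m0 * p ^ j * c))"
      unfolding w_def by (rule prod_sum_PiE[symmetric]) auto
    also have "\<dots> \<le> (\<Prod>j\<le>J. 1 / (1 - x ^ (m0 * p ^ j)))"
    proof (rule prod_mono, safe)
      fix j
      show "0 \<le> (\<Sum>c\<in>{..N'}. x ^ (m0 * p ^ j * c))" using x by (intro sum_nonneg) auto
      show "(\<Sum>c\<in>{..N'}. x ^ (m0 * p ^ j * c)) \<le> 1 / (1 - x ^ (m0 * p ^ j))"
        unfolding power_mult[of x "m0 * p ^ j"] using x fl[of j] by (intro geometric_partial_le) auto
    qed
    finally show ?thesis .
  qed
  define D where "D = lsimplex p J y"
  have split0: "(\<Sum>j\<le>J. g j) = g 0 + (\<Sum>j\<in>{1..J}. g j)" for g :: "nat \<Rightarrow> nat"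
  proof -
    have "{..J} = insert 0 {1..J}" by auto
    thus ?thesis by simp
  qed
  have succ: "real (card D) * (xm ^ y / (2 * (1 - xm))) \<le> (\<Sum>d\<in>Suc'. w d)"
  proof -
    \<comment> \<open>Coordinate 0 takes up what the lattice point lacks to the total n; it is
      nonnegative because the point stays within y \<le> n.\<close>
    define mk where "mk = (\<lambda>(d :: nat \<Rightarrow> nat, n). \<lambda>j. if j = 0 then n - (\<Sum>j\<in>{1..J}. p ^ j * d j) else d j)"
    have sd: "(\<Sum>j\<in>{1..J}. p ^ j * d j) \<le> y" if "d \<in> D" for d using that by (simp add: D_def lsimplex_def)
    have mks: "(\<Sum>j\<le>J. p ^ j * mk (d, n) j) = n" if "d \<in> D" "n \<in> {y..y + Lc}" for d n
    proof -
      have "(\<Sum>j\<in>{1..J}. p ^ j * mk (d, n) j) = (\<Sum>j\<in>{1..J}. p ^ j * d j)" by (rule sum.cong) (auto simp: mk_def)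
      thus ?thesis using sd[OF that(1)] that(2) unfolding split0 by (simp add: mk_def)
    qed
    have inj: "inj_on mk (D \<times> {y..y + Lc})"
    proof (rule inj_onI)
      fix a b assume ab: "a \<in> D \<times> {y..y + Lc}" "b \<in> D \<times> {y..y + Lc}" "mk a = mk b"
      obtain d n d' n' where q: "a = (d, n)" "b = (d', n')" by (metis surj_pair)
      have dd: "d \<in> D" "n \<in> {y..y + Lc}" "d' \<in> D" "n' \<in> {y..y + Lc}" using ab q by auto
      have "n = n'" using mks[OF dd(1,2)] mks[OF dd(3,4)] ab(3) q by simp
      moreover have "d = d'"
      proof
        fix j
        show "d j = d' j"
        proof (cases "j = 0")
          case True
          thus ?thesis using dd by (auto simp: D_def lsimplex_def PiE_def extensional_def)
        next
          case False
          thus ?thesis using fun_cong[OF ab(3), of j] q by (simp add: mk_def)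
        qed
      qed
      ultimately show "a = b" using q by simp
    qed
    have img: "mk ` (D \<times> {y..y + Lc}) \<subseteq> Suc'"
    proof
      fix e assume "e \<in> mk ` (D \<times> {y..y + Lc})"
      then obtain d n where dn: "d \<in> D" "n \<in> {y..y + Lc}" "e = mk (d, n)" by auto
      have "e j \<le> N'" if "j \<le> J" for j
      proof (cases "j = 0")
        case True
        thus ?thesis using dn by (auto simp: mk_def N'_def)
      next
        case False
        hence "d j \<le> y" using dn(1) that by (auto simp: D_def lsimplex_def PiE_def Pi_def)
        thus ?thesis using dn False by (simp add: mk_def N'_def)
      qed
      moreover have "e j = undefined" if "\<not> j \<le> J" for j
        using dn that by (auto simp: mk_def D_def lsimplex_def PiE_def extensional_def)
      ultimately show "e \<in> Suc'" using mks[OF dn(1,2)] dn by (auto simp: Suc'_def PiE_def Pi_def extensional_def)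
    qed
    have geo: "xm ^ y / (2 * (1 - xm)) \<le> (\<Sum>n\<in>{y..y + Lc}. xm ^ n)"
    proof -
      have "(\<Sum>n\<in>{y..y + Lc}. xm ^ n) = xm ^ y * (\<Sum>n\<le>Lc. xm ^ n)"
      proof -
        have "(\<Sum>n\<in>{0 + y..Lc + y}. xm ^ n) = (\<Sum>n\<in>{0..Lc}. xm ^ (n + y))" by (rule sum.shift_bounds_cl_nat_ivl)
        thus ?thesis by (simp add: power_add sum_distrib_left add.commute mult.commute atLeast0AtMost)
      qed
      also have "(\<Sum>n\<le>Lc. xm ^ n) = (1 - xm ^ Suc Lc) / (1 - xm)" using xm by (simp add: sum_gp0)
      also have "xm ^ Suc Lc \<le> 1 / 2"
      proof -
        have "1 / s \<le> real Lc" unfolding Lc_def by linarith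
        hence "1 \<le> s * real Lc" using s by (simp add: field_simps)
        also have "\<dots> \<le> s * real (m0 * Suc Lc)"
        proof -
          have "Lc \<le> m0 * Suc Lc" using m0 by (metis le_SucI le_trans mult_le_mono1 nat_mult_1 order_refl)
          hence "real Lc \<le> real (m0 * Suc Lc)" by (simp only: of_nat_le_iff)
          thus ?thesis by (rule mult_left_mono[OF _ less_imp_le[OF s]])
        qed
        finally have "1 \<le> s * real (m0 * Suc Lc)" .
        moreover have "xm ^ Suc Lc = exp (- (s * real (m0 * Suc Lc)))"
          unfolding xm_def x_def power_mult[symmetric] exp_of_nat_mult[symmetric] by (simp add: algebra_simps)
        ultimately have "xm ^ Suc Lc \<le> exp (- 1)" by simp
        also have "exp (- 1) \<le> 1 / (2::real)" using exp_ge_add_one_self[of 1] by (simp add: exp_minus field_simps)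
        finally show ?thesis .
      qed
      hence "xm ^ y * ((1 / 2) / (1 - xm)) \<le> xm ^ y * ((1 - xm ^ Suc Lc) / (1 - xm))"
        using xm by (intro mult_left_mono divide_right_mono) auto
      finally show ?thesis by simp
    qed
    have "real (card D) * (xm ^ y / (2 * (1 - xm))) \<le> (\<Sum>d\<in>D. \<Sum>n\<in>{y..y + Lc}. xm ^ n)"
      using mult_left_mono[OF geo, of "real (card D)"] by simp
    also have "\<dots> = (\<Sum>(d, n)\<in>D \<times> {y..y + Lc}. w (mk (d, n)))"
      unfolding sum.cartesian_product by (intro sum.cong refl) (auto simp: w_eq mks)
    also have "\<dots> = (\<Sum>e\<in>mk ` (D \<times> {y..y + Lc}). w e)"
      by (subst sum.reindex[OF inj]) (auto intro!: sum.cong)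
    also have "\<dots> \<le> (\<Sum>d\<in>Suc'. w d)" by (rule sum_mono2[OF finS img]) (simp add: w_pos)
    finally show ?thesis .
  qed
  define Pr where "Pr = (\<Prod>j\<le>J. 1 / (1 - x ^ (m0 * p ^ j)))"
  have Pr0: "Pr > 0" unfolding Pr_def using fl by (intro prod_pos) auto
  have prod_split: "(\<Prod>j\<le>J. g j) = g 0 * (\<Prod>j\<in>{1..J}. g j)" for g :: "nat \<Rightarrow> real"
  proof -
    have "{..J} = insert 0 {1..J}" by auto
    thus ?thesis by simp
  qed
  define yj where "yj j = s * real m0 * real p ^ j" for j
  have xy: "x ^ (m0 * p ^ j) = exp (- yj j)" for j
    unfolding x_def exp_of_nat_mult[symmetric] by (simp add: yj_def algebra_simps)
  have yj0: "yj j > 0" for j using s m0 p by (simp add: yj_def)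
  \<comment> \<open>The numbers s m0 p^j at least double at each step and the last is at most 1, so
    the factors e^{-y/2} lost in 1 - e^{-y} \<ge> y e^{-y/2} multiply to at least e^{-1}.\<close>
  have sumy: "(\<Sum>j\<in>{1..J}. yj j) \<le> 2"
  proof -
    have "(\<Sum>j\<in>{1..i}. yj j) \<le> 2 * yj i" for i
    proof (induction i)
      case (Suc i)
      have "2 * yj i \<le> real p * yj i" using p yj0[of i] by (intro mult_right_mono) auto
      hence "2 * yj i \<le> yj (Suc i)" by (simp add: yj_def ac_simps)
      thus ?case using Suc by simp
    qed (use yj0[of 0] in simp)
    from this[of J] show ?thesis using small by (simp add: yj_def)
  qed
  have lower: "exp (- 1) * (\<Prod>j\<in>{1..J}. yj j) \<le> (\<Prod>j\<in>{1..J}. 1 - x ^ (m0 * p ^ j))"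
  proof -
    have "exp (- 1) \<le> exp (- (\<Sum>j\<in>{1..J}. yj j) / 2)" using sumy by simp
    hence "exp (- 1) * (\<Prod>j\<in>{1..J}. yj j) \<le> exp (- (\<Sum>j\<in>{1..J}. yj j) / 2) * (\<Prod>j\<in>{1..J}. yj j)"
      using yj0 by (intro mult_right_mono prod_nonneg) (auto simp: less_imp_le)
    also have "exp (- (\<Sum>j\<in>{1..J}. yj j) / 2) = (\<Prod>j\<in>{1..J}. exp (- yj j / 2))"
      by (simp add: exp_sum[symmetric] sum_negf sum_divide_distrib)
    also have "\<dots> * (\<Prod>j\<in>{1..J}. yj j) = (\<Prod>j\<in>{1..J}. yj j * exp (- yj j / 2))" by (simp add: prod.distrib mult.commute)
    also have "\<dots> \<le> (\<Prod>j\<in>{1..J}. 1 - x ^ (m0 * p ^ j))"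
      unfolding xy using yj0 one_minus_exp_ge by (intro prod_mono) (auto simp: less_imp_le)
    finally show ?thesis .
  qed
  have "exp (- 1) / 2 * exp (- L) * (L ^ J / fact J) * Pr \<le> (\<Sum>d\<in>Suc'. w d)"
  proof -
    have xmy: "xm ^ y = exp (- L)"
      unfolding xm_def x_def L_def power_mult[symmetric] exp_of_nat_mult[symmetric] by (simp add: algebra_simps)
    have fp: "(\<Prod>j\<in>{1..J}. real p ^ j) > 0" using p by (intro prod_pos) auto
    have prody: "(\<Prod>j\<in>{1..J}. yj j) = (s * real m0) ^ J * (\<Prod>j\<in>{1..J}. real p ^ j)"
      by (simp add: yj_def prod.distrib)
    have "L ^ J / fact J * exp (- 1) = (real y ^ J / (fact J * (\<Prod>j\<in>{1..J}. real p ^ j))) * (exp (- 1) * (\<Prod>j\<in>{1..J}. yj j))"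
    proof -
      define W where "W = (\<Prod>j\<in>{1..J}. real p ^ j)"
      have "W \<noteq> 0" using fp unfolding W_def by (rule less_imp_neq[THEN not_sym])
      thus ?thesis unfolding prody L_def W_def[symmetric] by (simp add: power_mult_distrib field_simps)
    qed
    also have "\<dots> \<le> real (card D) * (\<Prod>j\<in>{1..J}. 1 - x ^ (m0 * p ^ j))"
      unfolding D_def using card_lsimplex_ge[of p y J] lower p yj0
      by (intro mult_mono mult_nonneg_nonneg prod_nonneg) (auto simp: less_imp_le)
    finally have 1: "L ^ J / fact J * exp (- 1) \<le> real (card D) * (\<Prod>j\<in>{1..J}. 1 - x ^ (m0 * p ^ j))" .
    have "Pr * (\<Prod>j\<in>{1..J}. 1 - x ^ (m0 * p ^ j)) = 1 / (1 - xm)"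
    proof -
      have "Pr = 1 / (1 - xm) * (\<Prod>j\<in>{1..J}. 1 / (1 - x ^ (m0 * p ^ j)))"
        unfolding Pr_def prod_split by (simp add: xm_def)
      moreover have "(\<Prod>j\<in>{1..J}. 1 / (1 - x ^ (m0 * p ^ j))) * (\<Prod>j\<in>{1..J}. 1 - x ^ (m0 * p ^ j)) = 1"
        unfolding prod.distrib[symmetric] by (rule prod.neutral) (use fl in \<open>auto simp: less_imp_neq\<close>)
      ultimately show ?thesis by simp
    qed
    hence inv1: "1 / (1 - xm) = Pr * (\<Prod>j\<in>{1..J}. 1 - x ^ (m0 * p ^ j))" by (rule sym)
    have e2: "xm ^ y / (2 * (1 - xm)) = exp (- L) / 2 * (1 / (1 - xm))" unfolding xmy by simp
    have 2: "real (card D) * (xm ^ y / (2 * (1 - xm))) = (real (card D) * (\<Prod>j\<in>{1..J}. 1 - x ^ (m0 * p ^ j))) * (exp (- L) / 2 * Pr)"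
      unfolding e2 inv1 by (simp only: ac_simps)
    have "exp (- 1) / 2 * exp (- L) * (L ^ J / fact J) * Pr = (L ^ J / fact J * exp (- 1)) * (exp (- L) / 2 * Pr)" by (simp add: ac_simps)
    also have "\<dots> \<le> (real (card D) * (\<Prod>j\<in>{1..J}. 1 - x ^ (m0 * p ^ j))) * (exp (- L) / 2 * Pr)"
      using 1 Pr0 by (intro mult_right_mono) auto
    finally show ?thesis using 2 succ by linarith
  qed
  thus ?thesis using tot unfolding Pr_def w_def by (simp add: left_diff_distrib)
qed

text \<open>Expand - ln (1 - x^m) and sum over m first: for each n the geometric series in z =
  e^{-sn} is at most 1/(sn), so the exponent is at most the sum of 1/(s n^2).\<close>

lemma euler_product_le:
  assumes s: "s > (0::real)"
  shows "(\<Prod>m\<in>{1..N}. 1 / (1 - exp (- s) ^ m)) \<le> exp (pi\<^sup>2 / (6 * s))"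
proof -
  define x where "x = exp (- s)"
  have x: "0 < x" "x < 1" using s by (auto simp: x_def)
  have xm: "0 < x ^ m" "x ^ m < 1" if "m \<in> {1..N}" for m using x that by (auto simp: power_less_one_iff)
  have ser: "(\<lambda>n. (1 / real (n + 1)) * (x ^ m) ^ Suc n) sums (- ln (1 - x ^ m))" if m: "m \<in> {1..N}" for m
  proof -
    have "ln (1 - x ^ m) = (\<Sum>n. (- 1) ^ n * (1 / real (n + 1)) * (1 - x ^ m - 1) ^ Suc n)"
      using xm[OF m] by (intro ln_series) auto
    moreover have "(- 1) ^ n * (1 / real (n + 1)) * (1 - x ^ m - 1) ^ Suc n = - ((1 / real (n + 1)) * (x ^ m) ^ Suc n)" for n
    proof -
      have "1 - x ^ m - 1 = - (x ^ m)" by simp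
      hence e1: "(1 - x ^ m - 1) ^ Suc n = (- 1) ^ Suc n * (x ^ m) ^ Suc n" by (simp only: power_minus[of "x ^ m" "Suc n"])
      have e2: "(- 1) ^ n * (- 1) ^ Suc n = (- 1 :: real)" by (simp flip: power_add mult_2)
      have "(- 1) ^ n * (1 / real (n + 1)) * (1 - x ^ m - 1) ^ Suc n = ((- 1) ^ n * (- 1) ^ Suc n) * ((1 / real (n + 1)) * (x ^ m) ^ Suc n)"
        unfolding e1 by (simp only: ac_simps)
      thus ?thesis unfolding e2 by simp
    qed
    ultimately have l: "ln (1 - x ^ m) = (\<Sum>n. - ((1 / real (n + 1)) * (x ^ m) ^ Suc n))" by presburger
    have "summable (\<lambda>n. (1 / real (n + 1)) * (x ^ m) ^ Suc n)"
    proof (rule summable_comparison_test'[of "\<lambda>n. (x ^ m) ^ Suc n" 0])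
      show "summable (\<lambda>n. (x ^ m) ^ Suc n)" using xm[OF m] by (simp add: summable_mult)
      fix n
      have "1 / real (n + 1) * (x ^ m) ^ Suc n \<le> 1 * (x ^ m) ^ Suc n"
        using xm[OF m] by (intro mult_right_mono) auto
      thus "norm ((1 / real (n + 1)) * (x ^ m) ^ Suc n) \<le> (x ^ m) ^ Suc n" using xm[OF m] by simp
    qed
    thus ?thesis using l by (simp add: suminf_minus sums_iff)
  qed
  have tot: "(\<lambda>n. \<Sum>m\<in>{1..N}. (1 / real (n + 1)) * (x ^ m) ^ Suc n) sums (\<Sum>m\<in>{1..N}. - ln (1 - x ^ m))"
    by (rule sums_sum) (rule ser)
  have cmp: "(\<lambda>n. (1 / s) * (1 / (real n + 1)\<^sup>2)) sums ((1 / s) * (pi\<^sup>2 / 6))"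
    using inverse_squares_sums by (intro sums_mult) (simp add: add.commute)
  have "(\<Sum>m\<in>{1..N}. - ln (1 - x ^ m)) \<le> (1 / s) * (pi\<^sup>2 / 6)"
  proof (rule sums_le[OF _ tot cmp])
    fix n
    define z where "z = x ^ Suc n"
    have z: "0 < z" "z < 1" using x by (auto simp: z_def power_less_one_iff simp del: power_Suc)
    have zz: "(x ^ m) ^ Suc n = z ^ m" for m by (simp only: z_def power_mult[symmetric] mult.commute)
    have "z = exp (- (s * real (Suc n)))" unfolding z_def x_def exp_of_nat_mult[symmetric] by (simp add: algebra_simps)
    hence inv: "1 / z = exp (s * real (Suc n))" by (simp only: exp_minus divide_inverse inverse_inverse_eq mult_1_left)
    have "(\<Sum>m\<in>{1..N}. z ^ m) \<le> z / (1 - z)" using z by (rule geometric_tail_le)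
    also have "\<dots> = 1 / (1 / z - 1)" using z by (simp add: field_simps)
    also have "\<dots> \<le> 1 / (s * real (Suc n))"
    proof (rule divide_left_mono)
      show le: "s * real (Suc n) \<le> 1 / z - 1" unfolding inv using exp_ge_add_one_self[of "s * real (Suc n)"] by linarith
      have "s * real (Suc n) > 0" using s by simp
      thus "0 < (1 / z - 1) * (s * real (Suc n))" using le by (intro mult_pos_pos[of "1 / z - 1" "s * real (Suc n)"]) linarith+
    qed simp
    finally have "(1 / real (n + 1)) * (\<Sum>m\<in>{1..N}. z ^ m) \<le> (1 / real (n + 1)) * (1 / (s * real (Suc n)))"
      by (intro mult_left_mono) auto
    thus "(\<Sum>m\<in>{1..N}. (1 / real (n + 1)) * (x ^ m) ^ Suc n) \<le> (1 / s) * (1 / (real n + 1)\<^sup>2)"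
      unfolding zz sum_distrib_left[symmetric] by (simp add: power2_eq_square ac_simps)
  qed
  hence "exp (\<Sum>m\<in>{1..N}. - ln (1 - x ^ m)) \<le> exp (pi\<^sup>2 / (6 * s))" by (simp add: mult.commute)
  also have "exp (\<Sum>m\<in>{1..N}. - ln (1 - x ^ m)) = (\<Prod>m\<in>{1..N}. 1 / (1 - x ^ m))"
    unfolding exp_sum[OF finite_atLeastAtMost] using xm by (intro prod.cong refl) (auto simp: exp_minus inverse_eq_divide)
  finally show ?thesis by (simp add: x_def)
qed

definition fails :: "nat \<Rightarrow> nat \<Rightarrow> nat \<Rightarrow> nat \<Rightarrow> nat set \<Rightarrow> nat multiset set" where
  "fails N p J y R = {M \<in> mpartitions N. \<forall>m0\<in>R. (\<Sum>j\<le>J. p ^ j * count M (m0 * p ^ j)) < y}"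

text \<open>In the Boltzmann measure, where a partition \<open>\<mu>\<close> has weight \<open>e\<^bsup>-s|\<mu>|\<^esup>\<close>, the multiplicities of
  distinct parts are independent; the blocks \<open>{m\<^sub>0 p\<^sup>j}\<close> are disjoint for different \<open>m\<^sub>0\<close>.\<close>

lemma card_fails_le:
  fixes s P :: real
  assumes p: "p \<ge> 2" and s: "s > 0" and R: "finite R"
    and m0: "\<And>m. m \<in> R \<Longrightarrow> m \<ge> 1 \<and> m mod p = 1 \<and> m * p ^ J \<le> N \<and> s * real m * real p ^ J \<le> 1"
    and P: "\<And>m. m \<in> R \<Longrightarrow> P \<le> exp (- 1) / 2 * exp (- (s * real m * real y)) * ((s * real m * real y) ^ J / fact J)"
  shows "real (card (fails N p J y R)) * exp (- s) ^ N \<le> (1 - P) ^ card R * (\<Prod>m\<in>{1..N}. 1 / (1 - exp (- s) ^ m))"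
proof -
  define x where "x = exp (- s)"
  have x: "0 < x" "x < 1" using s by (auto simp: x_def)
  have fl: "1 / (1 - x ^ m) > 0" if "m \<ge> 1" for m using x that by (auto simp: power_less_one_iff)
  define g where "g = (\<lambda>(m, j). m * p ^ j)"
  define I where "I = R \<times> {..J}"
  define rest where "rest = {1..N} - g ` I"
  \<comment> \<open>The residue 1 modulo p makes the elements of \<open>R\<close> indivisible by p,
    so m p^j determines m and j, and the blocks are disjoint.\<close>
  have ndvd: "\<not> p dvd m" if "m \<in> R" for m using m0[OF that] p by (auto simp: dvd_eq_mod_eq_0)
  have key: False if "a \<in> R" "a * p ^ i = b * p ^ j" "i < j" for a b i j
  proof -
    have "a * p ^ i = (b * p ^ (j - i)) * p ^ i" using that(2,3) by (simp add: mult.assoc flip: power_add)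
    hence "a = b * p ^ (j - i)" using p by simp
    moreover have "p dvd p ^ (j - i)" using that(3) by simp
    ultimately show False using ndvd[OF that(1)] by simp
  qed
  have injg: "inj_on g I"
  proof (rule inj_onI)
    fix u v assume uv: "u \<in> I" "v \<in> I" "g u = g v"
    obtain a i b j where q: "u = (a, i)" "v = (b, j)" by (metis surj_pair)
    have ab: "a \<in> R" "b \<in> R" "a * p ^ i = b * p ^ j" using uv q by (auto simp: I_def g_def)
    have "i = j" using key[OF ab(1) ab(3)] key[OF ab(2) ab(3)[symmetric]] by (metis linorder_neqE_nat)
    thus "u = v" using ab(3) p q by simp
  qed
  have gI: "g ` I \<subseteq> {1..N}"
  proof
    fix m assume "m \<in> g ` I"
    then obtain a j where a: "a \<in> R" "j \<le> J" "m = a * p ^ j" by (auto simp: I_def g_def)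
    have "a * p ^ j \<le> a * p ^ J" using a p by (intro mult_le_mono2 power_increasing) auto
    moreover have "a * p ^ J \<le> N" "a \<ge> 1" using m0[OF a(1)] by auto
    moreover have "a * p ^ j \<ge> 1" using m0[OF a(1)] p by (simp add: Suc_le_eq)
    ultimately have "1 \<le> a * p ^ j \<and> a * p ^ j \<le> N" by linarith
    thus "m \<in> {1..N}" unfolding a(3) by (simp only: atLeastAtMost_iff)
  qed
  have split: "(\<Prod>m\<in>{1..N}. h m) = (\<Prod>a\<in>R. \<Prod>j\<le>J. h (a * p ^ j)) * (\<Prod>m\<in>rest. h m)" for h :: "nat \<Rightarrow> real"
  proof -
    have "(\<Prod>m\<in>{1..N}. h m) = (\<Prod>m\<in>rest. h m) * (\<Prod>m\<in>g ` I. h m)"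
      unfolding rest_def by (rule prod.subset_diff[OF gI]) simp
    also have "(\<Prod>m\<in>g ` I. h m) = (\<Prod>z\<in>I. h (g z))" by (simp add: prod.reindex[OF injg])
    also have "\<dots> = (\<Prod>(a, j)\<in>R \<times> {..J}. h (a * p ^ j))" unfolding I_def by (intro prod.cong refl) (auto simp: g_def)
    also have "\<dots> = (\<Prod>a\<in>R. \<Prod>j\<le>J. h (a * p ^ j))" by (rule prod.cartesian_product[symmetric])
    finally show ?thesis by (simp add: mult.commute)
  qed
  \<comment> \<open>A partition as the family of its block vectors together with the multiplicities
    outside all blocks.\<close>
  define \<Phi> where "\<Phi> M = (restrict (\<lambda>a. restrict (\<lambda>j. count M (a * p ^ j)) {..J}) R, restrict (count M) rest)" for M :: "nat multiset"
  define Fw where "Fw = (\<lambda>(D, c). (\<Prod>a\<in>R. \<Prod>j\<le>J. x ^ (a * p ^ j * D a j)) * (\<Prod>m\<in>rest. x ^ (m * c m)))"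
  define T where "T = (R \<rightarrow>\<^sub>E fail_set p J y N) \<times> (rest \<rightarrow>\<^sub>E {..N})"
  have fin_fail: "finite (fail_set p J y N)"
    unfolding fail_set_def by (rule finite_subset[of _ "{..J} \<rightarrow>\<^sub>E {..N}"]) (auto intro: finite_PiE)
  have finT: "finite T" unfolding T_def using R fin_fail by (auto intro!: finite_PiE simp: rest_def)
  have wM: "x ^ N = Fw (\<Phi> M)" if M: "M \<in> mpartitions N" for M
  proof -
    have "set_mset M \<subseteq> {1..N}" using mpartition_le[OF M] by blast
    hence "sum_mset M = (\<Sum>m\<in>{1..N}. count M m * m)" by (rule sum_mset_eq_sum_count) simp
    moreover have "sum_mset M = N" using M unfolding mpartitions_def by blast
    ultimately have "N = (\<Sum>m\<in>{1..N}. m * count M m)" by (simp add: mult.commute)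
    hence "x ^ N = x ^ (\<Sum>m\<in>{1..N}. m * count M m)" by (rule arg_cong)
    also have "\<dots> = (\<Prod>m\<in>{1..N}. x ^ (m * count M m))" by (rule power_sum)
    also have "\<dots> = (\<Prod>a\<in>R. \<Prod>j\<le>J. x ^ (a * p ^ j * count M (a * p ^ j))) * (\<Prod>m\<in>rest. x ^ (m * count M m))"
      by (rule split)
    also have "\<dots> = Fw (\<Phi> M)" unfolding Fw_def \<Phi>_def by simp
    finally show ?thesis .
  qed
  have cle: "count M m \<le> N" if "M \<in> mpartitions N" "m \<ge> 1" for M m
  proof -
    have "count M m * 1 \<le> count M m * m" using that by (intro mult_le_mono2) auto
    moreover have "count M m * m \<le> N" using mpartition_count_le[OF that(1), of m] that by simp
    ultimately show ?thesis by linarith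
  qed
  have inT: "\<Phi> M \<in> T" if M: "M \<in> fails N p J y R" for M
  proof -
    have Mp: "M \<in> mpartitions N" using M by (simp add: fails_def)
    have "restrict (\<lambda>j. count M (a * p ^ j)) {..J} \<in> fail_set p J y N" if a: "a \<in> R" for a
    proof -
      have "a * p ^ j \<ge> 1" for j using m0[OF a] p by (simp add: Suc_le_eq)
      thus ?thesis using M a cle[OF Mp] by (auto simp: fails_def fail_set_def)
    qed
    moreover have "count M m \<le> N" if "m \<in> rest" for m using cle[OF Mp] that by (simp add: rest_def)
    ultimately show ?thesis by (auto simp: \<Phi>_def T_def)
  qed
  have inj: "inj_on \<Phi> (fails N p J y R)"
  proof (rule inj_onI)
    fix M M' assume M: "M \<in> fails N p J y R" "M' \<in> fails N p J y R" and eq: "\<Phi> M = \<Phi> M'"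
    have Mp: "M \<in> mpartitions N" "M' \<in> mpartitions N" using M by (auto simp: fails_def)
    have e1: "restrict (\<lambda>a. restrict (\<lambda>j. count M (a * p ^ j)) {..J}) R = restrict (\<lambda>a. restrict (\<lambda>j. count M' (a * p ^ j)) {..J}) R"
      and e2: "restrict (count M) rest = restrict (count M') rest" using eq by (auto simp: \<Phi>_def)
    show "M = M'"
    proof (rule multiset_eqI)
      fix m
      consider "m \<in> rest" | "m \<in> g ` I" | "m \<notin> {1..N}" by (auto simp: rest_def)
      thus "count M m = count M' m"
      proof cases
        case 1
        thus ?thesis using fun_cong[OF e2, of m] by simp
      next
        case 2
        then obtain a j where a: "a \<in> R" "j \<le> J" "m = a * p ^ j" by (auto simp: I_def g_def)
        have "restrict (\<lambda>j. count M (a * p ^ j)) {..J} = restrict (\<lambda>j. count M' (a * p ^ j)) {..J}"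
          using fun_cong[OF e1, of a] a by simp
        from fun_cong[OF this, of j] show ?thesis using a by simp
      next
        case 3
        thus ?thesis using mpartition_le[OF Mp(1), of m] mpartition_le[OF Mp(2), of m] by (metis count_eq_zero_iff)
      qed
    qed
  qed
  have Fw0: "Fw z \<ge> 0" for z using x by (cases z) (auto simp: Fw_def intro!: mult_nonneg_nonneg prod_nonneg)
  have wt0: "0 \<le> (\<Sum>d\<in>fail_set p J y N. \<Prod>j\<le>J. x ^ (a * p ^ j * d j))" for a using x by (intro sum_nonneg prod_nonneg) auto
  have wt: "(\<Sum>d\<in>fail_set p J y N. \<Prod>j\<le>J. x ^ (a * p ^ j * d j)) \<le> (1 - P) * (\<Prod>j\<le>J. 1 / (1 - x ^ (a * p ^ j)))" if a: "a \<in> R" for a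
  proof -
    have pa: "1 \<le> a * p ^ j" for j using m0[OF a] p by (simp add: Suc_le_eq)
    have "(\<Sum>d\<in>fail_set p J y N. \<Prod>j\<le>J. x ^ (a * p ^ j * d j)) \<le> (1 - exp (- 1) / 2 * exp (- (s * real a * real y)) * ((s * real a * real y) ^ J / fact J)) * (\<Prod>j\<le>J. 1 / (1 - x ^ (a * p ^ j)))"
      unfolding x_def by (rule fail_set_weight) (use m0[OF a] p s in auto)
    also have "\<dots> \<le> (1 - P) * (\<Prod>j\<le>J. 1 / (1 - x ^ (a * p ^ j)))"
      using P[OF a] fl[OF pa] by (intro mult_right_mono prod_nonneg) (auto simp: less_imp_le)
    finally show ?thesis .
  qed
  have "real (card (fails N p J y R)) * x ^ N = (\<Sum>M\<in>fails N p J y R. Fw (\<Phi> M))"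
  proof -
    have "Fw (\<Phi> M) = x ^ N" if "M \<in> fails N p J y R" for M using wM[of M] that by (simp add: fails_def)
    thus ?thesis by simp
  qed
  also have "\<dots> = (\<Sum>z\<in>\<Phi> ` fails N p J y R. Fw z)" by (simp add: sum.reindex[OF inj])
  \<comment> \<open>Here the condition of having size N is given up; over the product set
    \<open>T\<close> the weight factorises.\<close>
  also have "\<dots> \<le> (\<Sum>z\<in>T. Fw z)" by (rule sum_mono2[OF finT]) (use inT Fw0 in auto)
  also have "\<dots> = (\<Sum>D\<in>R \<rightarrow>\<^sub>E fail_set p J y N. \<Prod>a\<in>R. \<Prod>j\<le>J. x ^ (a * p ^ j * D a j)) * (\<Sum>c\<in>rest \<rightarrow>\<^sub>E {..N}. \<Prod>m\<in>rest. x ^ (m * c m))"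
    unfolding T_def Fw_def sum_product sum.cartesian_product by (intro sum.cong refl)
  also have "(\<Sum>D\<in>R \<rightarrow>\<^sub>E fail_set p J y N. \<Prod>a\<in>R. \<Prod>j\<le>J. x ^ (a * p ^ j * D a j)) = (\<Prod>a\<in>R. \<Sum>d\<in>fail_set p J y N. \<Prod>j\<le>J. x ^ (a * p ^ j * d j))"
    using prod_sum_PiE[OF R, of "\<lambda>_. fail_set p J y N" "\<lambda>a d. \<Prod>j\<le>J. x ^ (a * p ^ j * d j)"] fin_fail by simp
  also have "(\<Sum>c\<in>rest \<rightarrow>\<^sub>E {..N}. \<Prod>m\<in>rest. x ^ (m * c m)) = (\<Prod>m\<in>rest. \<Sum>c\<in>{..N}. x ^ (m * c))"
    using prod_sum_PiE[of rest "\<lambda>_. {..N}" "\<lambda>m c. x ^ (m * c)"] by (simp add: rest_def)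
  also have "(\<Prod>a\<in>R. \<Sum>d\<in>fail_set p J y N. \<Prod>j\<le>J. x ^ (a * p ^ j * d j)) * (\<Prod>m\<in>rest. \<Sum>c\<in>{..N}. x ^ (m * c))
     \<le> (\<Prod>a\<in>R. (1 - P) * (\<Prod>j\<le>J. 1 / (1 - x ^ (a * p ^ j)))) * (\<Prod>m\<in>rest. 1 / (1 - x ^ m))"
  proof (intro mult_mono prod_mono conjI)
    fix a assume a: "a \<in> R"
    show "(\<Sum>d\<in>fail_set p J y N. \<Prod>j\<le>J. x ^ (a * p ^ j * d j)) \<le> (1 - P) * (\<Prod>j\<le>J. 1 / (1 - x ^ (a * p ^ j)))" by (rule wt[OF a])
    show "0 \<le> (\<Sum>d\<in>fail_set p J y N. \<Prod>j\<le>J. x ^ (a * p ^ j * d j))" by (rule wt0)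
  next
    fix m assume m: "m \<in> rest"
    show "0 \<le> (\<Sum>c\<in>{..N}. x ^ (m * c))" using x by (intro sum_nonneg) auto
    show "(\<Sum>c\<in>{..N}. x ^ (m * c)) \<le> 1 / (1 - x ^ m)"
      unfolding power_mult using x m by (intro geometric_partial_le) (auto simp: rest_def power_less_one_iff)
  next
    show "0 \<le> (\<Prod>m\<in>rest. \<Sum>c\<in>{..N}. x ^ (m * c))" using x by (intro prod_nonneg sum_nonneg) auto
    show "0 \<le> (\<Prod>a\<in>R. (1 - P) * (\<Prod>j\<le>J. 1 / (1 - x ^ (a * p ^ j))))"
      by (rule prod_nonneg) (rule order_trans[OF wt0 wt])
  qed
  also have "\<dots> = (1 - P) ^ card R * ((\<Prod>a\<in>R. \<Prod>j\<le>J. 1 / (1 - x ^ (a * p ^ j))) * (\<Prod>m\<in>rest. 1 / (1 - x ^ m)))"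
    by (simp add: prod.distrib)
  also have "(\<Prod>a\<in>R. \<Prod>j\<le>J. 1 / (1 - x ^ (a * p ^ j))) * (\<Prod>m\<in>rest. 1 / (1 - x ^ m)) = (\<Prod>m\<in>{1..N}. 1 / (1 - x ^ m))"
    by (rule split[symmetric])
  finally show ?thesis by (simp add: x_def)
qed

text \<open>At the saddle point the Euler product and the reciprocal of the weight e^{-sN} each
  contribute e^{sN}, together \<open>exp (cc * sqrt (real N))\<close>, which exceeds
  \<open>pcount N\<close> only by a factor of order N.\<close>

lemma card_fails_exp_le:
  fixes P :: real
  assumes N: "N \<ge> 1" and p: "p \<ge> 2" and R: "finite R"
    and m0: "\<And>m. m \<in> R \<Longrightarrow> m \<ge> 1 \<and> m mod p = 1 \<and> m * p ^ J \<le> N \<and> sad (real N) * real m * real p ^ J \<le> 1"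
    and P: "0 \<le> P" "P \<le> 1" "\<And>m. m \<in> R \<Longrightarrow> P \<le> exp (- 1) / 2 * exp (- (sad (real N) * real m * real y)) * ((sad (real N) * real m * real y) ^ J / fact J)"
  shows "real (card (fails N p J y R)) \<le> exp (cc * sqrt (real N)) * exp (- (P * real (card R)))"
proof -
  define s where "s = sad (real N)"
  have s: "s > 0" using sad_pos[of "real N"] N by (simp add: s_def)
  have "real (card (fails N p J y R)) * exp (- s) ^ N \<le> (1 - P) ^ card R * (\<Prod>m\<in>{1..N}. 1 / (1 - exp (- s) ^ m))"
    by (rule card_fails_le[OF p s R]) (use m0 P in \<open>auto simp: s_def\<close>)
  also have "\<dots> \<le> exp (- P) ^ card R * exp (pi\<^sup>2 / (6 * s))"
  proof (intro mult_mono power_mono)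
    show "1 - P \<le> exp (- P)" using exp_ge_add_one_self[of "- P"] by simp
    show "(\<Prod>m\<in>{1..N}. 1 / (1 - exp (- s) ^ m)) \<le> exp (pi\<^sup>2 / (6 * s))" by (rule euler_product_le[OF s])
    have "exp (- s) ^ m \<le> 1" for m using s by (simp add: power_le_one)
    thus "0 \<le> (\<Prod>m\<in>{1..N}. 1 / (1 - exp (- s) ^ m))" by (intro prod_nonneg) auto
  qed (use P in auto)
  also have "exp (- P) ^ card R = exp (- (P * real (card R)))" by (simp add: mult.commute flip: exp_of_nat_mult)
  also have "pi\<^sup>2 / (6 * s) = s * real N"
  proof -
    have "real N = pi\<^sup>2 / (6 * s\<^sup>2)" using sad_n(2)[of "real N"] N by (simp add: s_def)
    thus ?thesis using s by (simp add: power2_eq_square)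
  qed
  finally have "real (card (fails N p J y R)) * exp (- s) ^ N \<le> exp (- (P * real (card R))) * exp (s * real N)" .
  hence le: "real (card (fails N p J y R)) * exp (- s) ^ N * exp (s * real N) \<le> exp (- (P * real (card R))) * exp (s * real N) * exp (s * real N)"
    by (intro mult_right_mono) auto
  have e1: "exp (- s) ^ N * exp (s * real N) = 1"
    by (simp add: exp_of_nat_mult[symmetric] exp_add[symmetric] mult.commute)
  have e2: "exp (s * real N) * exp (s * real N) = exp (cc * sqrt (real N))"
    using sad_n(1)[of "real N"] N unfolding exp_add[symmetric] by (simp add: s_def)
  show ?thesis using le unfolding mult.assoc e1 e2 by (simp add: mult.commute)
qed

section \<open>The counting argument\<close>

text \<open>With q = N - m, the inequality of arithmetic and geometric means for q and N gives cc
  sqrt q \<le> 2 s N - s m directly. For q = 0, outside the range of \<open>growth\<close>, the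
  value 1 is covered by \<open>max 1\<close> and by A + 1 in place of A.\<close>

lemma pcount_diff_le:
  fixes a A :: real
  assumes a: "a > 0" "A > 0" and growth: "\<forall>n\<ge>1. a * phi (real n) \<le> real (pcount n) \<and> real (pcount n) \<le> A * phi (real n)"
    and N: "N \<ge> 1" and m: "m \<le> N"
  shows "real (pcount (N - m)) \<le> (A + 1) / a * (real N / max 1 (real (N - m))) * exp (- (sad (real N) * real m)) * real (pcount N)"
proof -
  define s where "s = sad (real N)"
  define q where "q = N - m"
  have N0: "real N > 0" using N by simp
  have s: "s > 0" using sad_pos[of "real N"] N by (simp add: s_def)
  have ccN: "cc * sqrt (real N) = 2 * s * real N" using sad_n(1)[of "real N"] N by (simp add: s_def)
  have lo: "a * (exp (2 * s * real N) / real N) \<le> real (pcount N)" using spec[OF growth, of N] N by (simp add: phi_def ccN)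
  have q: "real q = real N - real m" using m by (simp add: q_def of_nat_diff)
  have up: "real (pcount q) \<le> (A + 1) * (exp (2 * s * real N - s * real m) / max 1 (real q))"
  proof (cases "q = 0")
    case True
    hence "real m = real N" using q by simp
    hence "1 \<le> exp (2 * s * real N - s * real m)" using s N0 by simp
    also have "1 * exp (2 * s * real N - s * real m) \<le> (A + 1) * exp (2 * s * real N - s * real m)"
      using a by (intro mult_right_mono) auto
    finally show ?thesis using True by (simp add: pcount_0)
  next
    case False
    have "cc * sqrt (real q) \<le> 2 * s * real N - s * real m"
    proof -
      have "sqrt (real q) * sqrt (real N) \<le> (real q + real N) / 2"
        using arith_geo_mean_sqrt[of "real q" "real N"] by (simp add: real_sqrt_mult)
      hence "s * (2 * (sqrt (real q) * sqrt (real N))) \<le> s * (real q + real N)" using s by (intro mult_left_mono) auto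
      moreover have "cc = 2 * s * sqrt (real N)"
      proof -
        have "cc * sqrt (real N) = (2 * s * sqrt (real N)) * sqrt (real N)" using ccN by (simp add: mult.assoc)
        thus ?thesis using N0 by simp
      qed
      moreover have "cc * sqrt (real q) = s * (2 * (sqrt (real q) * sqrt (real N)))" using calculation(2) by (simp add: ac_simps)
      moreover have "s * (real q + real N) = 2 * s * real N - s * real m" unfolding q by (simp add: algebra_simps)
      ultimately show ?thesis by linarith
    qed
    hence "exp (cc * sqrt (real q)) / real q \<le> exp (2 * s * real N - s * real m) / real q"
      by (intro divide_right_mono) auto
    moreover have "real (pcount q) \<le> A * (exp (cc * sqrt (real q)) / real q)" using spec[OF growth, of q] False by (simp add: phi_def)
    moreover have mx: "max 1 (real q) = real q" using False by simp
    ultimately have "real (pcount q) \<le> A * (exp (2 * s * real N - s * real m) / max 1 (real q))" unfolding mx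
      using mult_left_mono[of "exp (cc * sqrt (real q)) / real q" "exp (2 * s * real N - s * real m) / real q" A] a by linarith
    also have "\<dots> \<le> (A + 1) * (exp (2 * s * real N - s * real m) / max 1 (real q))" by (intro mult_right_mono) auto
    finally show ?thesis .
  qed
  also have "\<dots> = (A + 1) / a * (real N / max 1 (real q)) * exp (- (s * real m)) * (a * (exp (2 * s * real N) / real N))"
    using a N0 by (simp add: exp_diff exp_minus field_simps)
  also have "\<dots> \<le> (A + 1) / a * (real N / max 1 (real q)) * exp (- (s * real m)) * real (pcount N)"
    using a by (intro mult_left_mono[OF lo]) auto
  finally show ?thesis by (simp add: q_def s_def)
qed

text \<open>For j t \<le> N/2 the quotient of the denominators is at most 2 and the terms form a
  geometric series of ratio z \<le> 1/2. For larger j the crude factor N comes with the decay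
  e^{-sN/2}; t times the number of all j is at most N.\<close>

lemma noncore_sum_le:
  fixes a A :: real
  assumes a: "a > 0" "A > 0" and growth: "\<forall>n\<ge>1. a * phi (real n) \<le> real (pcount n) \<and> real (pcount n) \<le> A * phi (real n)"
    and N: "N \<ge> 1" and t: "t > 0" "1 \<le> sad (real N) * real t"
  shows "real (t * (\<Sum>j\<in>{1..N div t}. pcount (N - j * t)))
    \<le> (A + 1) / a * real (pcount N) * (4 * (real t * exp (- (sad (real N) * real t))) + (real N)\<^sup>2 * exp (- (sad (real N) * real N / 2)))"
proof -
  define s where "s = sad (real N)"
  have s: "s > 0" using sad_pos[of "real N"] N by (simp add: s_def)
  define K where "K = (A + 1) / a * real (pcount N)"
  have K: "K \<ge> 0" using a by (simp add: K_def)
  define z where "z = exp (- (s * real t))"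
  define w where "w = real N * exp (- (s * real N / 2))"
  have w: "w \<ge> 0" by (simp add: w_def)
  have "z \<le> exp (- 1)" using t by (simp add: z_def s_def)
  also have "exp (- 1) \<le> 1 / (2::real)" using exp_ge_add_one_self[of 1] by (simp add: exp_minus field_simps)
  finally have z: "0 < z" "z \<le> 1 / 2" by (auto simp: z_def)
  have trm: "real (pcount (N - j * t)) \<le> K * (2 * z ^ j + w)" if j: "j \<in> {1..N div t}" for j
  proof -
    have jt: "j * t \<le> N" using j by (metis atLeastAtMost_iff le_trans mult_le_mono1 div_times_less_eq_dividend)
    have zj: "exp (- (s * real (j * t))) = z ^ j" unfolding z_def exp_of_nat_mult[symmetric] by (simp add: algebra_simps)
    have "real (pcount (N - j * t)) \<le> (A + 1) / a * (real N / max 1 (real (N - j * t))) * exp (- (s * real (j * t))) * real (pcount N)"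
      unfolding s_def by (rule pcount_diff_le[OF a growth N jt])
    also have "\<dots> = K * ((real N / max 1 (real (N - j * t))) * exp (- (s * real (j * t))))" by (simp add: K_def)
    also have "(real N / max 1 (real (N - j * t))) * exp (- (s * real (j * t))) \<le> 2 * z ^ j + w"
    proof (cases "2 * (j * t) \<le> N")
      case True
      hence "real N \<le> 2 * real (N - j * t)" by linarith
      also have "\<dots> \<le> 2 * max 1 (real (N - j * t))" by simp
      finally have "real N / max 1 (real (N - j * t)) \<le> 2" by (simp add: pos_divide_le_eq)
      hence "(real N / max 1 (real (N - j * t))) * exp (- (s * real (j * t))) \<le> 2 * exp (- (s * real (j * t)))"
        by (intro mult_right_mono) auto
      thus ?thesis unfolding zj using w by simp
    next
      case False
      have "real N / max 1 (real (N - j * t)) \<le> real N / 1" by (intro divide_left_mono) auto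
      moreover have "exp (- (s * real (j * t))) \<le> exp (- (s * real N / 2))"
      proof -
        have "real N / 2 \<le> real (j * t)" using False by linarith
        hence "s * (real N / 2) \<le> s * real (j * t)" using s by (intro mult_left_mono) auto
        thus ?thesis by simp
      qed
      ultimately have "(real N / max 1 (real (N - j * t))) * exp (- (s * real (j * t))) \<le> w"
        unfolding w_def by (intro mult_mono) auto
      moreover have "0 \<le> 2 * z ^ j" using z by simp
      ultimately show ?thesis by linarith
    qed
    finally show ?thesis using K by (simp add: mult_left_mono)
  qed
  have "(\<Sum>j\<in>{1..N div t}. z ^ j) \<le> z / (1 - z)" using z by (intro geometric_tail_le) auto
  also have "\<dots> \<le> z / (1 / 2)" using z by (intro divide_left_mono) auto
  finally have "(\<Sum>j\<in>{1..N div t}. z ^ j) \<le> 2 * z" by simp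
  hence sz: "(\<Sum>j\<in>{1..N div t}. 2 * z ^ j + w) \<le> 4 * z + real (N div t) * w"
    by (simp add: sum.distrib sum_distrib_left[symmetric])
  have tN: "real t * real (N div t) \<le> real N"
    using div_times_less_eq_dividend[of N t] by (metis mult.commute of_nat_mult of_nat_le_iff)
  have "real (t * (\<Sum>j\<in>{1..N div t}. pcount (N - j * t))) = real t * (\<Sum>j\<in>{1..N div t}. real (pcount (N - j * t)))" by simp
  also have "\<dots> \<le> real t * (\<Sum>j\<in>{1..N div t}. K * (2 * z ^ j + w))" by (intro mult_left_mono sum_mono trm) auto
  also have "\<dots> = real t * (K * (\<Sum>j\<in>{1..N div t}. 2 * z ^ j + w))" by (simp only: sum_distrib_left)
  also have "\<dots> \<le> real t * (K * (4 * z + real (N div t) * w))" using K by (intro mult_left_mono sz) auto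
  also have "\<dots> = K * (4 * (real t * z) + (real t * real (N div t)) * w)" by (simp add: algebra_simps)
  also have "\<dots> \<le> K * (4 * (real t * z) + real N * w)"
    using K w by (intro mult_left_mono add_left_mono mult_right_mono tN) auto
  finally show ?thesis by (simp add: K_def z_def w_def s_def power2_eq_square mult.assoc)
qed

definition noncores :: "nat \<Rightarrow> nat \<Rightarrow> nat list set" where
  "noncores N t = {la \<in> partitions N. \<not> (\<forall>i<N. beads N la i - int t < 0 \<or> (\<exists>j<N. beads N la j = beads N la i - int t))}"

text \<open>In a nondivisible pair either \<open>mu\<close> is bad, or some block of
  \<open>mu\<close> reaches p^k and then \<open>la\<close> is not a core for the corresponding t.
  This t depends on \<open>mu\<close>, and non-cores are counted for a single t per
  \<open>mu\<close>, so no union over \<open>R\<close> is paid for.\<close>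

lemma card_nondivisible_le:
  fixes B :: real
  assumes p: "prime p" and R: "\<And>m. m \<in> R \<Longrightarrow> m \<ge> 1" and Jk: "J \<le> k" and B: "B \<ge> 0" "\<And>m. m \<in> R \<Longrightarrow> real (card (noncores N (m * p ^ k))) \<le> B"
  shows "real (card (nondivisible_entries N p)) \<le> real (pcount N) * (real (card (fails N p J (p ^ k) R)) + B)"
proof -
  let ?F = "fails N p J (p ^ k) R"
  define bad where "bad = {mu \<in> partitions N. mset mu \<in> ?F}"
  define good where "good = partitions N - bad"
  have fin: "finite (partitions N)" by (rule finite_partitions)
  define f where "f mu = (SOME m. m \<in> R \<and> p ^ k \<le> (\<Sum>j\<le>J. p ^ j * count (mset mu) (m * p ^ j)))" for mu :: "nat list"
  have f: "f mu \<in> R \<and> p ^ k \<le> (\<Sum>j\<le>J. p ^ j * count (mset mu) (f mu * p ^ j))" if "mu \<in> good" for mu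
  proof -
    have "mu \<in> partitions N" using that by (simp add: good_def)
    moreover from this have "mset mu \<in> mpartitions N" using bij_mset_partitions[of N] by (auto simp: bij_betw_def)
    ultimately have "\<exists>m. m \<in> R \<and> p ^ k \<le> (\<Sum>j\<le>J. p ^ j * count (mset mu) (m * p ^ j))"
      using that by (auto simp: good_def bad_def fails_def not_less)
    thus ?thesis unfolding f_def by (rule someI_ex)
  qed
  have sub: "nondivisible_entries N p \<subseteq> (partitions N \<times> bad) \<union> (\<Union>mu\<in>good. noncores N (f mu * p ^ k) \<times> {mu})"
  proof
    fix z assume z: "z \<in> nondivisible_entries N p"
    obtain la mu where zz: "z = (la, mu)" by (cases z)
    have lm: "la \<in> partitions N" "mu \<in> partitions N" "\<not> int_divides p (char_value la mu)"
      using z zz by (auto simp: nondivisible_entries_def)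
    show "z \<in> (partitions N \<times> bad) \<union> (\<Union>mu\<in>good. noncores N (f mu * p ^ k) \<times> {mu})"
    proof (cases "mu \<in> bad")
      case True
      thus ?thesis using lm zz by simp
    next
      case False
      hence g: "mu \<in> good" using lm by (simp add: good_def)
      have "la \<in> noncores N (f mu * p ^ k)"
      proof (rule ccontr)
        assume "la \<notin> noncores N (f mu * p ^ k)"
        hence core: "beads N la i - int (f mu * p ^ k) < 0 \<or> (\<exists>j<N. beads N la j = beads N la i - int (f mu * p ^ k))" if "i < N" for i
          using lm(1) that by (auto simp: noncores_def)
        have pos: "x > 0" if "x \<in># mset mu" for x using lm(2) that by (auto simp: partitions_def)
        have sm: "sum_mset (mset mu) = N" using lm(2) by (auto simp: partitions_def sum_mset_sum_list)
        have fp: "f mu > 0" using R[of "f mu"] f[OF g] by simp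
        have "p ^ k \<le> (\<Sum>j\<le>J. p ^ j * count (mset mu) (f mu * p ^ j))" using f[OF g] by simp
        also have "\<dots> \<le> (\<Sum>j\<le>k. p ^ j * count (mset mu) (f mu * p ^ j))" using Jk by (intro sum_mono2) auto
        finally have ge: "p ^ k \<le> (\<Sum>j\<le>k. p ^ j * count (mset mu) (f mu * p ^ j))" .
        have "int_divides p (mset_char la (mset mu))"
          by (rule int_divides_of_core[OF lm(1) p fp pos sm ge core])
        thus False using lm(3) mset_char_mset[OF lm(2)] by simp
      qed
      thus ?thesis using zz g by blast
    qed
  qed
  have finn: "finite (noncores N t)" for t using fin by (simp add: noncores_def)
  have fing: "finite good" "finite bad" using fin by (auto simp: good_def bad_def)
  have "card (nondivisible_entries N p) \<le> card ((partitions N \<times> bad) \<union> (\<Union>mu\<in>good. noncores N (f mu * p ^ k) \<times> {mu}))"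
    by (rule card_mono[OF _ sub]) (use fin fing finn in auto)
  also have "\<dots> \<le> card (partitions N \<times> bad) + card (\<Union>mu\<in>good. noncores N (f mu * p ^ k) \<times> {mu})" by (rule card_Un_le)
  also have "\<dots> \<le> pcount N * card bad + (\<Sum>mu\<in>good. card (noncores N (f mu * p ^ k) \<times> {mu}))"
    by (intro add_mono card_UN_le fing) (simp add: card_cartesian_product pcount_def)
  also have "\<dots> = pcount N * card bad + (\<Sum>mu\<in>good. card (noncores N (f mu * p ^ k)))" by (simp add: card_cartesian_product)
  finally have "real (card (nondivisible_entries N p)) \<le> real (pcount N * card bad + (\<Sum>mu\<in>good. card (noncores N (f mu * p ^ k))))"
    by (simp only: of_nat_le_iff)
  hence le: "real (card (nondivisible_entries N p)) \<le> real (pcount N) * real (card bad) + (\<Sum>mu\<in>good. real (card (noncores N (f mu * p ^ k))))"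
    by simp
  have "card bad \<le> card ?F"
  proof (rule card_inj_on_le[of mset])
    show "inj_on mset bad" using bij_mset_partitions[of N] unfolding bij_betw_def bad_def by (auto intro: inj_on_subset)
    show "mset ` bad \<subseteq> ?F" by (auto simp: bad_def)
    show "finite ?F" using finite_mpartitions[of N] by (simp add: fails_def)
  qed
  moreover have "(\<Sum>mu\<in>good. real (card (noncores N (f mu * p ^ k)))) \<le> real (pcount N) * B"
  proof -
    have "(\<Sum>mu\<in>good. real (card (noncores N (f mu * p ^ k)))) \<le> real (card good) * B"
      by (rule sum_bounded_above) (use f B in blast)
    also have "\<dots> \<le> real (pcount N) * B"
      using B card_mono[OF fin, of good] by (intro mult_right_mono) (auto simp: good_def pcount_def)
    finally show ?thesis .
  qed
  moreover have "real (pcount N) * real (card bad) \<le> real (pcount N) * real (card ?F)"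
    using \<open>card bad \<le> card ?F\<close> by (intro mult_left_mono) auto
  ultimately show ?thesis using le by (simp add: algebra_simps)
qed

lemma card_residue_interval_ge:
  fixes M e :: real
  assumes p: "p \<ge> (2::nat)" and M: "M \<ge> 1" and e: "e \<ge> 0"
  defines "R \<equiv> {m::nat. m mod p = 1 \<and> M \<le> real m \<and> real m \<le> M + e}"
  shows "finite R" "e / real p - 1 \<le> real (card R)"
proof -
  show fin: "finite R"
  proof (rule finite_subset)
    show "R \<subseteq> {..nat \<lfloor>M + e\<rfloor>}" unfolding R_def by (auto simp: le_nat_floor)
  qed simp
  define u where "u = (M - 1) / real p"
  define v where "v = (M + e - 1) / real p"
  have p0: "real p > 0" using p by simp
  have u: "u \<ge> 0" using M by (simp add: u_def)
  have vu: "v - u = e / real p" unfolding u_def v_def by (simp add: diff_divide_distrib[symmetric])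
  have v: "v \<ge> 0" using vu u e p0 by (metis add_increasing2 diff_add_cancel divide_nonneg_nonneg less_imp_le add.commute)
  let ?I = "{nat \<lceil>u\<rceil>..nat \<lfloor>v\<rfloor>}"
  have sub: "(\<lambda>q. 1 + p * q) ` ?I \<subseteq> R"
  proof
    fix m assume "m \<in> (\<lambda>q. 1 + p * q) ` ?I"
    then obtain q where q: "q \<in> ?I" "m = 1 + p * q" by blast
    have q1: "u \<le> real q" using q(1) by (simp add: nat_le_iff ceiling_le_iff)
    have q2: "real q \<le> v" using q(1) v by (simp add: le_nat_iff le_floor_iff)
    have "M \<le> 1 + real p * real q" using q1 p0 by (simp add: u_def pos_divide_le_eq algebra_simps)
    moreover have "1 + real p * real q \<le> M + e" using q2 p0 by (simp add: v_def pos_le_divide_eq algebra_simps)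
    moreover have "(1 + p * q) mod p = 1"
    proof -
      have "(1 + p * q) mod p = 1 mod p" by (rule mod_mult_self2)
      also have "\<dots> = 1" using p by (intro mod_less) simp
      finally show ?thesis .
    qed
    ultimately show "m \<in> R" unfolding R_def q(2) by simp
  qed
  have "inj_on (\<lambda>q. 1 + p * q) ?I" using p by (auto simp: inj_on_def)
  hence "card ?I \<le> card R" using card_image card_mono[OF fin sub] by metis
  moreover have "v - u - 1 \<le> real (card ?I)"
  proof -
    have c: "real (nat \<lceil>u\<rceil>) \<le> u + 1" using u by (simp add: ceiling_correct)
    have d: "v - 1 \<le> real (nat \<lfloor>v\<rfloor>)" using v by linarith
    have "card ?I = Suc (nat \<lfloor>v\<rfloor>) - nat \<lceil>u\<rceil>" by simp
    hence "real (card ?I) \<ge> real (Suc (nat \<lfloor>v\<rfloor>)) - real (nat \<lceil>u\<rceil>)" by linarith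
    thus ?thesis using c d by linarith
  qed
  ultimately show "e / real p - 1 \<le> real (card R)" using vu by linarith
qed

lemma sad_sqrt_bounds:
  assumes "n > 0"
  shows "1 \<le> sad n * sqrt n" "sad n * sqrt n \<le> 2"
proof -
  have e: "sad n * sqrt n = pi / sqrt 6" using assms by (simp add: sad_def real_sqrt_mult)
  have a: "2 \<le> sqrt 6" by (rule real_le_rsqrt) simp
  have b: "sqrt 6 \<le> 3" by (rule real_le_lsqrt) auto
  show "1 \<le> sad n * sqrt n" unfolding e using a b pi_gt3 by (subst pos_le_divide_eq) auto
  show "sad n * sqrt n \<le> 2" unfolding e using a b pi_less_4 by (subst pos_divide_le_eq) auto
qed

text \<open>Cutting the block at J about L0/(3p) makes L^J/J! at least (3p)^J. The exponent k
  exceeds J by i, the least number with p^i \<ge> 2 L0, which gives s m p^J \<le> 1. The m run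
  through an interval starting at M = L0/(s p^k) of relative length 1/l, so that L varies by at most
  1 and the success probability is bounded below uniformly.\<close>

lemma parameters_exist:
  fixes N p :: nat
  defines "l \<equiv> ln (real N)" and "u \<equiv> ln (ln (real N))" and "s \<equiv> sad (real N)"
  defines "L0 \<equiv> l / 2 + l / (8 * real p)"
  assumes N: "N \<ge> 1" and p: "p \<ge> 2" "real p * u\<^sup>2 \<le> l" and l: "l \<ge> 16" "u \<ge> 3"
    and big: "8 * l ^ 3 \<le> exp (13 / 32 * l)" "48 * exp 3 * l ^ 4 \<le> exp (u\<^sup>2 / 24)"
  shows "\<exists>J k R P. J \<le> k \<and> finite R
    \<and> (\<forall>m\<in>R. m \<ge> 1 \<and> m mod p = 1 \<and> m * p ^ J \<le> N \<and> s * real m * real p ^ J \<le> 1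
          \<and> L0 \<le> s * real m * real (p ^ k) \<and> s * real m * real (p ^ k) \<le> L0 + 1
          \<and> P \<le> exp (- 1) / 2 * exp (- (s * real m * real (p ^ k))) * ((s * real m * real (p ^ k)) ^ J / fact J))
    \<and> 0 \<le> P \<and> P \<le> 1 \<and> 3 * l \<le> P * real (card R)"
proof -
  define pp where "pp = real p"
  have pp: "pp \<ge> 2" using p by (simp add: pp_def)
  have "3\<^sup>2 \<le> u\<^sup>2" using l by (intro power_mono) auto
  hence u2: "9 \<le> u\<^sup>2" by simp
  have pu: "pp * u\<^sup>2 \<le> l" using p by (simp add: pp_def)
  have "pp * 9 \<le> pp * u\<^sup>2" using u2 pp by (intro mult_left_mono) auto
  hence p9: "9 * pp \<le> l" using pu by linarith
  define w where "w = l / pp"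
  have lp: "u\<^sup>2 \<le> w" using pu pp by (simp add: w_def pos_le_divide_eq mult.commute)
  have L0e: "L0 = l / 2 + w / 8" by (simp add: w_def L0_def pp_def)
  have "w \<le> l / 2" unfolding w_def using pp l by (intro divide_left_mono) auto
  hence L0: "l / 2 \<le> L0" "L0 \<le> 9 / 16 * l" using L0e lp u2 by linarith+
  have L00: "L0 \<ge> 8" using L0 l by linarith
  have s: "s > 0" using sad_pos[of "real N"] N by (simp add: s_def)
  have sqN: "sqrt (real N) = exp (l / 2)"
  proof -
    have "exp (l / 2) * exp (l / 2) = real N" using N unfolding exp_add[symmetric] by (simp add: l_def)
    thus ?thesis by (intro real_sqrt_unique) (simp_all add: power2_eq_square)
  qed
  have sN: "1 \<le> s * sqrt (real N)" "s * sqrt (real N) \<le> 2"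
    using sad_sqrt_bounds[of "real N"] N by (auto simp: s_def)
  define x where "x = L0 / (3 * pp)"
  define J where "J = nat \<lfloor>x\<rfloor>"
  have x6: "w / 6 \<le> x"
  proof -
    have "(l / 2) / (3 * pp) \<le> L0 / (3 * pp)" using L0 pp by (intro divide_right_mono) auto
    thus ?thesis by (simp add: x_def w_def)
  qed
  have x1: "x \<ge> 1" using x6 lp u2 by linarith
  have J: "real J \<le> x" "x - 1 \<le> real J" using x1 unfolding J_def by linarith+
  have J3: "3 * pp * real J \<le> L0" using J(1) pp by (simp add: x_def pos_le_divide_eq mult.commute)
  have pow: "(3 * pp) ^ J \<le> L ^ J / fact J" if "L0 \<le> L" for L
  proof -
    have "fact J \<le> real J ^ J" using fact_le_power[of J, where 'a=real] by simp
    hence "(3 * pp) ^ J * fact J \<le> (3 * pp) ^ J * real J ^ J" using pp by (intro mult_left_mono) auto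
    also have "\<dots> = (3 * pp * real J) ^ J" by (rule power_mult_distrib[symmetric])
    also have "\<dots> \<le> L ^ J" using J3 that pp by (intro power_mono) auto
    finally show ?thesis by (simp add: pos_le_divide_eq)
  qed
  have expow: "z ^ J = exp (real J * ln z)" if "z > 0" for z :: real using that by (simp add: exp_of_nat_mult)
  have up3: "(3 * pp) ^ J \<le> exp L0"
  proof -
    have "real J * ln (3 * pp) \<le> real J * (3 * pp)" using pp by (intro mult_left_mono ln_bound) auto
    hence "exp (real J * ln (3 * pp)) \<le> exp L0" using J3 by (simp add: ac_simps)
    thus ?thesis using expow[of "3 * pp"] pp by simp
  qed
  \<comment> \<open>From ln p \<le> p/2 and J p \<le> L0/3 \<le> 3l/16. This leaves M at least
    e^{13l/32}/(4p), whence the exponent 13/32 in \<open>big\<close>.\<close>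
  have upp: "pp ^ J \<le> exp (3 / 32 * l)"
  proof -
    have "ln pp = ln (pp / 2) + ln 2" using pp by (simp add: ln_div)
    also have "\<dots> \<le> (pp / 2 - 1) + (2 - 1)" using pp by (intro add_mono ln_le_minus_one) auto
    finally have "real J * ln pp \<le> real J * (pp / 2)" by (intro mult_left_mono) auto
    also have "\<dots> = 3 * pp * real J / 6" by simp
    also have "\<dots> \<le> 3 / 32 * l" using J3 L0 by linarith
    finally show ?thesis using pp by (simp add: expow)
  qed
  define P where "P = exp (- 1) / 2 * exp (- (L0 + 1)) * (3 * pp) ^ J"
  have P0: "P > 0" using pp by (simp add: P_def)
  have P1: "P \<le> 1"
  proof -
    have "P \<le> exp (- 1) / 2 * exp (- (L0 + 1)) * exp L0" unfolding P_def by (intro mult_left_mono up3) auto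
    also have "\<dots> = exp (- 1) * exp (- 1) / 2" by (simp add: exp_add[symmetric] mult.assoc)
    also have "\<dots> = exp (- 2) / 2" by (simp add: exp_add[symmetric])
    also have "\<dots> \<le> 1 / 2" by (intro divide_right_mono) simp_all
    finally show ?thesis by simp
  qed
  have "\<exists>n. 2 * L0 \<le> pp ^ n" using real_arch_pow[of pp "2 * L0"] pp by (auto intro: less_imp_le)
  then obtain i where i: "2 * L0 \<le> pp ^ i" "\<And>n. n < i \<Longrightarrow> \<not> 2 * L0 \<le> pp ^ n"
    using LeastI_ex[of "\<lambda>n. 2 * L0 \<le> pp ^ n"] not_less_Least[of _ "\<lambda>n. 2 * L0 \<le> pp ^ n"] by blast
  have "i \<noteq> 0" using i(1) L00 by (intro notI) simp
  then obtain i' where i': "i = Suc i'" using not0_implies_Suc by blast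
  have "pp ^ i' \<le> 2 * L0" using i(2)[of i'] i' by simp
  hence iu: "pp ^ i \<le> pp * (2 * L0)" unfolding i' power_Suc using pp by (intro mult_left_mono) auto
  define k where "k = J + i"
  define M where "M = L0 / (s * pp ^ k)"
  have ppk: "pp ^ k = pp ^ J * pp ^ i" "pp ^ k > 0" using pp by (auto simp: k_def power_add)
  have ppJ: "pp ^ J > 0" using pp by simp
  have M: "exp (l / 2) / (4 * pp * pp ^ J) \<le> M"
  proof -
    have "exp (l / 2) / (4 * pp * pp ^ J) * (s * pp ^ k) = (s * exp (l / 2)) * (pp ^ i / (4 * pp))"
      using ppJ pp unfolding ppk(1) by (simp add: field_simps)
    also have "\<dots> \<le> 2 * (pp * (2 * L0) / (4 * pp))"
      using sN(2) iu pp s unfolding sqN by (intro mult_mono divide_right_mono) auto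
    also have "\<dots> = L0" using pp by simp
    finally show ?thesis using s ppk unfolding M_def by (simp add: pos_le_divide_eq)
  qed
  \<comment> \<open>The interval has length at least 2p, so the rounding in the count of a residue
    class costs at most half of it.\<close>
  have M2: "2 * (l * pp) \<le> M"
  proof -
    have "8 * (l * pp\<^sup>2) \<le> 8 * (l * l\<^sup>2)" using p9 pp l by (intro mult_left_mono power_mono) auto
    also have "\<dots> \<le> exp (13 / 32 * l)" using big(1) by (simp add: power3_eq_cube power2_eq_square mult.assoc)
    finally have "8 * (l * pp\<^sup>2) * pp ^ J \<le> exp (13 / 32 * l) * exp (3 / 32 * l)" using upp pp by (intro mult_mono) auto
    also have "\<dots> = exp (l / 2)" unfolding exp_add[symmetric] by simp
    finally have "2 * (l * pp) * (4 * pp * pp ^ J) \<le> exp (l / 2)" by (simp add: power2_eq_square ac_simps)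
    hence "2 * (l * pp) \<le> exp (l / 2) / (4 * pp * pp ^ J)" using pp ppJ by (simp add: pos_le_divide_eq)
    thus ?thesis using M by linarith
  qed
  have lpp: "l * pp \<ge> 1" using l pp mult_mono[of 1 l 1 pp] by simp
  have M1: "M \<ge> 1" using M2 lpp by linarith
  define R where "R = {m::nat. m mod p = 1 \<and> M \<le> real m \<and> real m \<le> M + M / l}"
  have Rf: "finite R" and Rc: "M / l / pp - 1 \<le> real (card R)"
    using card_residue_interval_ge[of p M "M / l"] p M1 l unfolding R_def pp_def by auto
  have Rc2: "M / (2 * (l * pp)) \<le> real (card R)"
  proof -
    have "2 \<le> M / (l * pp)" using M2 lpp by (simp add: pos_le_divide_eq)
    moreover have "M / l / pp = M / (l * pp)" by simp
    moreover have "M / (2 * (l * pp)) = M / (l * pp) / 2" by simp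
    ultimately show ?thesis using Rc by linarith
  qed
  have sM: "s * M * pp ^ k = L0" using s pp by (simp add: M_def)
  have elem: "m \<ge> 1 \<and> m mod p = 1 \<and> m * p ^ J \<le> N \<and> s * real m * real p ^ J \<le> 1
          \<and> L0 \<le> s * real m * real (p ^ k) \<and> s * real m * real (p ^ k) \<le> L0 + 1
          \<and> P \<le> exp (- 1) / 2 * exp (- (s * real m * real (p ^ k))) * ((s * real m * real (p ^ k)) ^ J / fact J)"
    if m: "m \<in> R" for m
  proof -
    have m': "m mod p = 1" "M \<le> real m" "real m \<le> M + M / l" using m by (auto simp: R_def)
    define L where "L = s * real m * pp ^ k"
    have a: "L0 \<le> L" unfolding L_def sM[symmetric] using m' s ppk by (intro mult_right_mono mult_left_mono) auto
    have "L \<le> s * (M + M / l) * pp ^ k" unfolding L_def using m' s ppk by (intro mult_right_mono mult_left_mono) auto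
    also have "\<dots> = L0 + L0 / l" unfolding sM[symmetric] by (simp add: algebra_simps)
    also have "L0 / l \<le> 1" using L0 l by (simp add: pos_divide_le_eq)
    finally have b: "L \<le> L0 + 1" by simp
    have c: "s * real m * pp ^ J \<le> 1"
    proof -
      have "s * real m * pp ^ J * pp ^ i = L" by (simp add: L_def ppk)
      also have "\<dots> \<le> 1 * pp ^ i" using b i(1) L00 by linarith
      finally show ?thesis using pp by (simp add: mult_le_cancel_right)
    qed
    have d: "m * p ^ J \<le> N"
    proof -
      have "sqrt (real N) \<le> real N" using N by (simp add: sqrt_le_D real_le_lsqrt power2_eq_square)
      hence "s * sqrt (real N) \<le> s * real N" using s by (intro mult_left_mono) auto
      hence "s * (real m * pp ^ J) \<le> s * real N" using c sN(1) by (simp add: mult.assoc)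
      hence "real m * pp ^ J \<le> real N" using s by simp
      hence "real (m * p ^ J) \<le> real N" by (simp add: pp_def)
      thus ?thesis by (simp only: of_nat_le_iff)
    qed
    have "P \<le> exp (- 1) / 2 * exp (- L) * (L ^ J / fact J)"
      unfolding P_def using b pow[OF a] pp by (intro mult_mono) auto
    moreover have "m \<ge> 1" using m'(1) by (cases m) auto
    ultimately show ?thesis using a b c d m' by (auto simp: L_def pp_def)
  qed
  have "3 * l \<le> P * real (card R)"
  proof -
    have ex: "exp (w / 6 - 1) \<le> 3 ^ J"
    proof -
      have "exp (w / 6 - 1) \<le> exp (real J * 1)" using x6 J(2) by simp
      also have "\<dots> = exp 1 ^ J" by (rule exp_of_nat_mult)
      also have "\<dots> \<le> 3 ^ J" by (intro power_mono exp_le) auto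
      finally show ?thesis .
    qed
    have q: "l * pp\<^sup>2 > 0" using l pp by (intro mult_pos_pos) auto
    have "3 * l * (16 * (l * pp\<^sup>2)) \<le> 3 * l * (16 * (l * l\<^sup>2))"
      using p9 pp l by (intro mult_left_mono power_mono) auto
    also have "\<dots> = exp (- 3) * (48 * exp 3 * l ^ 4)"
      by (simp add: exp_minus power2_eq_square power4_eq_xxxx)
    also have "\<dots> \<le> exp (- 3) * exp (u\<^sup>2 / 24)" by (intro mult_left_mono big(2)) auto
    also have "\<dots> \<le> exp (- 3) * exp (w / 24)" using lp by simp
    \<comment> \<open>With w = l/p, the exponent w/24 = w/6 - w/8 is the gain of 3^J over the excess
      of L0 above l/2.\<close>
    also have "\<dots> = exp (- 2) * exp (l / 2 - L0) * exp (w / 6 - 1)" unfolding L0e by (simp add: exp_add[symmetric])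
    also have "\<dots> \<le> exp (- 2) * exp (l / 2 - L0) * 3 ^ J" by (intro mult_left_mono ex) auto
    finally have "3 * l * (16 * (l * pp\<^sup>2)) \<le> exp (- 2) * exp (l / 2 - L0) * 3 ^ J" .
    hence "3 * l \<le> exp (- 2) * exp (l / 2 - L0) * 3 ^ J / (16 * (l * pp\<^sup>2))" using q by (simp add: pos_le_divide_eq)
    also have "\<dots> = P * (exp (l / 2) / (4 * pp * pp ^ J) / (2 * (l * pp)))"
    proof -
      have "exp (- 2) * exp (l / 2 - L0) = exp (- 1) * exp (- (L0 + 1)) * exp (l / 2)" by (simp add: exp_add[symmetric])
      moreover have "(3 * pp) ^ J = 3 ^ J * pp ^ J" by (rule power_mult_distrib)
      ultimately show ?thesis unfolding P_def using ppJ q by (simp add: power2_eq_square) (simp add: ac_simps)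
    qed
    also have "\<dots> \<le> P * (M / (2 * (l * pp)))" using P0 M lpp by (intro mult_left_mono divide_right_mono) auto
    also have "\<dots> \<le> P * real (card R)" using P0 Rc2 by (intro mult_left_mono) auto
    finally show ?thesis .
  qed
  moreover have "J \<le> k" by (simp add: k_def)
  ultimately show ?thesis using Rf elem P0 P1 by (intro exI[of _ J] exI[of _ k] exI[of _ R] exI[of _ P]) auto
qed

text \<open>The failures number at most e^{2sN} e^{-3l}: one factor N = e^l turns e^{2sN} into a
  multiple of \<open>pcount N\<close>, and N^{-2} is left, well below the target. The exponent of
  the theorem is decided by the non-cores.\<close>

lemma nondivisible_bound:
  "\<exists>C::real. C > 0 \<and> (\<exists>N\<^sub>0::nat. \<forall>N\<ge>N\<^sub>0. \<forall>p::nat. prime p \<longrightarrow> real p \<le> prime_bound N \<longrightarrow>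
     real (card (nondivisible_entries N p)) \<le> C * (real (pcount N))\<^sup>2 * real N powr (- (1 / (12 * real p))))"
proof -
  obtain a A where a: "a > 0" "A > 0" and growth: "\<forall>n\<ge>1. a * phi (real n) \<le> real (pcount n) \<and> real (pcount n) \<le> A * phi (real n)"
  proof -
    have rec: "real n * real (pcount n) = (\<Sum>(k, m)\<in>{(k, m). 1 \<le> k \<and> 1 \<le> m \<and> k * m \<le> n}. real m * real (pcount (n - k * m)))" for n
    proof -
      have "real (n * pcount n) = real (\<Sum>(k, m)\<in>{(k, m). 1 \<le> k \<and> 1 \<le> m \<and> k * m \<le> n}. m * pcount (n - k * m))"
        by (simp only: pcount_recurrence[of n])
      also have "\<dots> = (\<Sum>z\<in>{(k, m). 1 \<le> k \<and> 1 \<le> m \<and> k * m \<le> n}. real (case z of (k, m) \<Rightarrow> m * pcount (n - k * m)))"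
        by (rule of_nat_sum)
      also have "\<dots> = (\<Sum>(k, m)\<in>{(k, m). 1 \<le> k \<and> 1 \<le> m \<and> k * m \<le> n}. real m * real (pcount (n - k * m)))"
        by (intro sum.cong refl) auto
      finally show ?thesis by simp
    qed
    have "\<exists>a A. a > 0 \<and> A > 0 \<and> (\<forall>n\<ge>1. a * phi (real n) \<le> real (pcount n) \<and> real (pcount n) \<le> A * phi (real n))"
      by (rule recurrence_growth[of "\<lambda>n. real (pcount n)"]) (simp_all add: pcount_pos pcount_mono rec)
    thus ?thesis using that by blast
  qed
  have ev: "\<forall>\<^sub>F N::nat in at_top. N \<ge> 1 \<and> ln (real N) \<ge> 16 \<and> ln (ln (real N)) \<ge> 3
      \<and> 8 * (ln (real N)) ^ 3 \<le> exp (13 / 32 * ln (real N)) \<and> 48 * exp 3 * (ln (real N)) ^ 4 \<le> exp ((ln (ln (real N)))\<^sup>2 / 24)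
      \<and> (real N) ^ 3 \<le> exp (sad (real N) * real N / 2)"
    unfolding sad_def by (intro eventually_conj; real_asymp)
  then obtain N0 where N0: "\<And>N. N \<ge> N0 \<Longrightarrow> N \<ge> 1 \<and> ln (real N) \<ge> 16 \<and> ln (ln (real N)) \<ge> 3
      \<and> 8 * (ln (real N)) ^ 3 \<le> exp (13 / 32 * ln (real N)) \<and> 48 * exp 3 * (ln (real N)) ^ 4 \<le> exp ((ln (ln (real N)))\<^sup>2 / 24)
      \<and> (real N) ^ 3 \<le> exp (sad (real N) * real N / 2)"
    unfolding eventually_at_top_linorder by blast
  define K where "K = (A + 1) / a"
  have K: "K > 0" using a by (simp add: K_def)
  have main: "real (card (nondivisible_entries N p)) \<le> (1 / a + 5 * K) * (real (pcount N))\<^sup>2 * real N powr (- (1 / (12 * real p)))"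
    if N: "N \<ge> N0" and p: "prime p" "real p \<le> prime_bound N" for N p
  proof -
    define l where "l = ln (real N)"
    define u where "u = ln (ln (real N))"
    define s where "s = sad (real N)"
    define L0 where "L0 = l / 2 + l / (8 * real p)"
    have h: "N \<ge> 1" "l \<ge> 16" "u \<ge> 3" "8 * l ^ 3 \<le> exp (13 / 32 * l)" "48 * exp 3 * l ^ 4 \<le> exp (u\<^sup>2 / 24)"
       "(real N) ^ 3 \<le> exp (s * real N / 2)" using N0[OF N] by (auto simp: l_def u_def s_def)
    have p2: "p \<ge> 2" using p(1) by (rule prime_ge_2_nat)
    have pu: "real p * u\<^sup>2 \<le> l" using p(2) h(3) by (simp add: prime_bound_def l_def u_def pos_le_divide_eq)
    obtain J k R P where JkRP: "J \<le> k" "finite R"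
      "\<forall>m\<in>R. m \<ge> 1 \<and> m mod p = 1 \<and> m * p ^ J \<le> N \<and> s * real m * real p ^ J \<le> 1
          \<and> L0 \<le> s * real m * real (p ^ k) \<and> s * real m * real (p ^ k) \<le> L0 + 1
          \<and> P \<le> exp (- 1) / 2 * exp (- (s * real m * real (p ^ k))) * ((s * real m * real (p ^ k)) ^ J / fact J)"
      "0 \<le> P" "P \<le> 1" "3 * l \<le> P * real (card R)"
      using parameters_exist[of N p] h p2 pu unfolding l_def u_def s_def L0_def by blast
    have Rm: "m \<ge> 1" "m mod p = 1" "m * p ^ J \<le> N" "s * real m * real p ^ J \<le> 1"
          "L0 \<le> s * real m * real (p ^ k)" "s * real m * real (p ^ k) \<le> L0 + 1"
          "P \<le> exp (- 1) / 2 * exp (- (s * real m * real (p ^ k))) * ((s * real m * real (p ^ k)) ^ J / fact J)" if "m \<in> R" for m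
      using bspec[OF JkRP(3) that] by auto
    define E where "E = exp (- (l / (12 * real p)))"
    have Ep: "real N powr (- (1 / (12 * real p))) = E" using h(1) by (simp add: powr_def E_def l_def)
    have Nl: "real N = exp l" using h(1) by (simp add: l_def)
    have lp: "l / (12 * real p) \<le> l" using p2 h(2) by (simp add: pos_divide_le_eq mult_le_cancel_left1)
    have "1 / real N = exp (- l)" unfolding Nl by (simp add: exp_minus divide_inverse)
    hence EN: "1 / real N \<le> E" using lp by (simp add: E_def)
    have s: "s > 0" using sad_pos[of "real N"] h(1) by (simp add: s_def)
    have F: "real (card (fails N p J (p ^ k) R)) \<le> 1 / a * real (pcount N) * E"
    proof -
      have "real (card (fails N p J (p ^ k) R)) \<le> exp (cc * sqrt (real N)) * exp (- (P * real (card R)))"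
        by (rule card_fails_exp_le[OF h(1) p2 JkRP(2) _ JkRP(4,5)]) (use Rm in \<open>auto simp: s_def\<close>)
      also have "\<dots> \<le> exp (cc * sqrt (real N)) * exp (- (3 * l))" using JkRP(6) by simp
      also have "exp (cc * sqrt (real N)) \<le> 1 / a * real (pcount N) * real N"
      proof -
        have "a * (exp (cc * sqrt (real N)) / real N) \<le> real (pcount N)" using spec[OF growth, of N] h(1) by (simp add: phi_def)
        thus ?thesis using a h(1) by (simp add: field_simps)
      qed
      also have "1 / a * real (pcount N) * real N * exp (- (3 * l)) = 1 / a * real (pcount N) * exp (- (2 * l))"
        unfolding Nl by (simp add: exp_add[symmetric] mult.assoc)
      also have "\<dots> \<le> 1 / a * real (pcount N) * E" unfolding E_def using a lp h(2) by (intro mult_left_mono) auto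
      finally show ?thesis by simp
    qed
    have NC: "real (card (noncores N (m * p ^ k))) \<le> K * real (pcount N) * (5 * E)" if m: "m \<in> R" for m
    proof -
      define t where "t = m * p ^ k"
      have t0: "t > 0" using Rm(1)[OF m] p2 by (simp add: t_def)
      have st: "L0 \<le> s * real t" "s * real t \<le> L0 + 1" using Rm(5,6)[OF m] by (simp_all add: t_def mult.assoc)
      have L0: "l / 2 \<le> L0" using h(2) by (simp add: L0_def)
      have "l / (8 * real p) \<le> l / 16" using p2 h(2) by (intro divide_left_mono) auto
      hence L0u: "L0 + 1 \<le> l" unfolding L0_def using h(2) by linarith
      have "card (noncores N t) \<le> t * (\<Sum>j\<in>{1..N div t}. pcount (N - j * t))"
        using card_noncores_le[OF t0, of N] by (simp add: noncores_def pcount_def)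
      hence "real (card (noncores N t)) \<le> real (t * (\<Sum>j\<in>{1..N div t}. pcount (N - j * t)))" by (simp only: of_nat_le_iff)
      also have "\<dots> \<le> K * real (pcount N) * (4 * (real t * exp (- (s * real t))) + (real N)\<^sup>2 * exp (- (s * real N / 2)))"
        unfolding K_def s_def by (rule noncore_sum_le[OF a growth h(1) t0]) (use st L0 h(2) in \<open>simp add: s_def\<close>)
      also have "\<dots> \<le> K * real (pcount N) * (4 * E + E)"
      proof (rule mult_left_mono[OF add_mono])
        have "1 \<le> s * sqrt (real N)" using sad_sqrt_bounds(1)[of "real N"] h(1) by (simp add: s_def)
        moreover have "sqrt (real N) = exp (l / 2)"
          using Nl by (intro real_sqrt_unique) (simp_all add: power2_eq_square exp_add[symmetric])
        ultimately have sN: "1 \<le> s * exp (l / 2)" by simp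
        have "real t * 1 \<le> real t * (s * exp (l / 2))" using sN by (intro mult_left_mono) auto
        also have "\<dots> = (s * real t) * exp (l / 2)" by (simp add: ac_simps)
        also have "\<dots> \<le> l * exp (l / 2)" using st L0u by (intro mult_right_mono) auto
        finally have "real t * exp (- (s * real t)) \<le> l * exp (l / 2) * exp (- L0)"
          using st h(2) by (intro mult_mono) auto
        also have "\<dots> = l * exp (- (l / (8 * real p)))" by (simp add: L0_def mult.assoc exp_add[symmetric])
        \<comment> \<open>The bound on p enters through l \<le> e^{u^2/24} \<le> e^{l/(24p)}; this
          removes the logarithm at the cost of lowering the exponent 1/(8p) to 1/(12p).\<close>
        also have "\<dots> \<le> exp (l / (24 * real p)) * exp (- (l / (8 * real p)))"
        proof (intro mult_right_mono)
          have "l \<le> l ^ 4" using power_increasing[of 1 4 l] h(2) by simp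
          moreover have "1 \<le> 48 * exp (3::real)" using exp_ge_add_one_self[of "3::real"] by linarith
          ultimately have "1 * l \<le> (48 * exp 3) * l ^ 4" using h(2) by (intro mult_mono) auto
          hence "l \<le> exp (u\<^sup>2 / 24)" using h(5) by linarith
          moreover have "u\<^sup>2 \<le> l / real p" using pu p2 by (simp add: pos_le_divide_eq mult.commute)
          hence "exp (u\<^sup>2 / 24) \<le> exp (l / real p / 24)" by simp
          moreover have "l / real p / 24 = l / (24 * real p)" by simp
          ultimately show "l \<le> exp (l / (24 * real p))" by (metis order_trans)
        qed simp
        also have "\<dots> = E" unfolding E_def exp_add[symmetric] using p2 by (simp add: field_simps)
        finally show "4 * (real t * exp (- (s * real t))) \<le> 4 * E" by simp
        have "(real N)\<^sup>2 * real N \<le> exp (s * real N / 2)" using h(6) by (simp add: power3_eq_cube power2_eq_square)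
        hence "(real N)\<^sup>2 * exp (- (s * real N / 2)) \<le> 1 / real N" using h(1) by (simp add: exp_minus field_simps)
        thus "(real N)\<^sup>2 * exp (- (s * real N / 2)) \<le> E" using EN by linarith
        show "0 \<le> K * real (pcount N)" using K by simp
      qed
      finally show ?thesis by (simp add: t_def)
    qed
    have "real (card (nondivisible_entries N p)) \<le> real (pcount N) * (real (card (fails N p J (p ^ k) R)) + K * real (pcount N) * (5 * E))"
      by (rule card_nondivisible_le[OF p(1) _ JkRP(1)]) (use Rm(1) NC K in \<open>auto simp: E_def\<close>)
    also have "\<dots> \<le> real (pcount N) * (1 / a * real (pcount N) * E + K * real (pcount N) * (5 * E))"
      by (intro mult_left_mono add_right_mono F) auto
    also have "\<dots> = (1 / a + 5 * K) * (real (pcount N))\<^sup>2 * E" by (simp add: algebra_simps power2_eq_square)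
    finally show ?thesis unfolding Ep .
  qed
  have "1 / a + 5 * K > 0" using a K by (simp add: add_pos_pos)
  thus ?thesis using main by blast
qed

lemma prod_primes_dvd:
  fixes w :: int
  assumes "finite S" "\<And>p. p \<in> S \<Longrightarrow> prime p \<and> int p dvd w"
  shows "int (\<Prod>S) dvd w"
  using assms
proof (induction S rule: finite_induct)
  case (insert q S)
  have "coprime q (\<Prod>S)"
  proof (rule prod_coprime_right)
    fix r assume r: "r \<in> S"
    thus "coprime q r" using insert by (intro primes_coprime) auto
  qed
  hence "coprime (int q) (int (\<Prod>S))" by (simp only: coprime_int_iff)
  hence "int q * int (\<Prod>S) dvd w" using insert by (intro divides_mult) auto
  thus ?case using insert by simp
qed simp

text \<open>Character values are integers by \<open>char_value_eq_alt\<close>, and an integer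
  divisible by distinct primes is divisible by their product.\<close>

lemma nondivisible_entries_prod_subset:
  assumes S: "finite S" "\<And>p. p \<in> S \<Longrightarrow> prime p"
  shows "nondivisible_entries N (\<Prod>S) \<subseteq> (\<Union>p\<in>S. nondivisible_entries N p)"
proof
  fix z assume z: "z \<in> nondivisible_entries N (\<Prod>S)"
  obtain la mu where zz: "z = (la, mu)" by (cases z)
  have lm: "la \<in> partitions N" "mu \<in> partitions N" and nd: "\<not> int_divides (\<Prod>S) (char_value la mu)"
    using z zz by (auto simp: nondivisible_entries_def)
  obtain w :: int where w: "char_value la mu = of_int w" using char_value_eq_alt[OF lm refl] by blast
  have eq: "int_divides m (char_value la mu) \<longleftrightarrow> int m dvd w" for m
    unfolding int_divides_def w of_int_eq_iff dvd_def by simp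
  have "\<exists>p\<in>S. \<not> int p dvd w" using prod_primes_dvd[OF S(1), of w] S(2) nd eq by blast
  thus "z \<in> (\<Union>p\<in>S. nondivisible_entries N p)" using zz lm eq by (auto simp: nondivisible_entries_def)
qed

theorem theorem1:
  shows "(\<exists>C::real. C > 0 \<and> (\<exists>N\<^sub>0::nat. \<forall>N\<ge>N\<^sub>0. \<forall>p::nat.
            prime p \<longrightarrow> real p \<le> prime_bound N \<longrightarrow>
            real (card (nondivisible_entries N p))
              \<le> C * (real (card (partitions N)))\<^sup>2 * real N powr (- (1 / (12 * real p)))))
       \<and> (\<lambda>N. real (card (nondivisible_entries N (\<Prod>{p::nat. prime p \<and> real p \<le> prime_bound N})))
               / (real (card (partitions N)))\<^sup>2) \<longlonglongrightarrow> 0"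
proof (rule conjI)
  show bnd: "\<exists>C::real. C > 0 \<and> (\<exists>N\<^sub>0::nat. \<forall>N\<ge>N\<^sub>0. \<forall>p::nat.
            prime p \<longrightarrow> real p \<le> prime_bound N \<longrightarrow>
            real (card (nondivisible_entries N p))
              \<le> C * (real (card (partitions N)))\<^sup>2 * real N powr (- (1 / (12 * real p))))"
    using nondivisible_bound unfolding pcount_def .
  obtain C N0 where C: "C > 0" and bound: "\<And>N p. N \<ge> N0 \<Longrightarrow> prime p \<Longrightarrow> real p \<le> prime_bound N \<Longrightarrow>
      real (card (nondivisible_entries N p)) \<le> C * (real (card (partitions N)))\<^sup>2 * real N powr (- (1 / (12 * real p)))"
    using bnd by blast
  let ?S = "\<lambda>N. {p::nat. prime p \<and> real p \<le> prime_bound N}"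
  let ?f = "\<lambda>N. real (card (nondivisible_entries N (\<Prod>(?S N)))) / (real (card (partitions N)))\<^sup>2"
  \<comment> \<open>At most l = log N primes occur, and each N^{-1/(12p)} is at most e^{-u^2/12}
    with u = log l because p \<le> l/u^2; the square in the exponent beats the factor l =
    e^u.\<close>
  let ?g = "\<lambda>N::nat. C * (ln (real N) * exp (- ((ln (ln (real N)))\<^sup>2 / 12)))"
  have ev: "\<forall>\<^sub>F N in sequentially. ln (ln (real N)) \<ge> 1 \<and> ln (real N) \<ge> 1 \<and> N \<ge> N0"
    by (intro eventually_conj eventually_ge_at_top; real_asymp)
  have le: "?f N \<le> ?g N" if h: "ln (ln (real N)) \<ge> 1" "ln (real N) \<ge> 1" "N \<ge> N0" for N
  proof -
    define l where "l = ln (real N)"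
    define u where "u = ln (ln (real N))"
    define c where "c = (real (card (partitions N)))\<^sup>2"
    have c: "c > 0" using pcount_pos[of N] by (simp add: c_def pcount_def)
    have lu: "l \<ge> 1" "u \<ge> 1" using h by (auto simp: l_def u_def)
    have N: "N \<ge> 1" using h(2) by (cases N) auto
    have u2: "u\<^sup>2 \<ge> 1" using lu by simp
    have pb: "prime_bound N = l / u\<^sup>2" by (simp add: prime_bound_def l_def u_def)
    have "l / u\<^sup>2 \<le> l / 1" using u2 lu by (intro divide_left_mono) auto
    hence pbl: "prime_bound N \<le> l" using pb by simp
    have sub: "?S N \<subseteq> {1..nat \<lfloor>l\<rfloor>}"
    proof
      fix p assume p: "p \<in> ?S N"
      hence "real p \<le> l" using pbl by simp
      thus "p \<in> {1..nat \<lfloor>l\<rfloor>}" using p prime_ge_1_nat[of p] by (simp add: le_nat_floor)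
    qed
    have fin: "finite (?S N)" using finite_subset[OF sub] by simp
    have "card (?S N) \<le> nat \<lfloor>l\<rfloor>" using card_mono[OF _ sub] by simp
    hence cS: "real (card (?S N)) \<le> l" using lu by linarith
    have fe: "finite (nondivisible_entries N p)" for p
      by (rule finite_subset[of _ "partitions N \<times> partitions N"]) (auto simp: nondivisible_entries_def finite_partitions)
    have each: "real (card (nondivisible_entries N p)) \<le> C * c * exp (- (u\<^sup>2 / 12))" if p: "p \<in> ?S N" for p
    proof -
      have p0: "real p > 0" using p prime_gt_0_nat by auto
      have "real p * u\<^sup>2 \<le> l" using p lu pos_le_divide_eq[of "u\<^sup>2" "real p" l] unfolding pb by simp
      hence "u\<^sup>2 \<le> l / real p" using p0 by (simp add: pos_le_divide_eq mult.commute)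
      hence "u\<^sup>2 / 12 \<le> l / real p / 12" by (rule divide_right_mono) simp
      hence le1: "exp (- (l / real p / 12)) \<le> exp (- (u\<^sup>2 / 12))" by simp
      have Np: "real N powr (- (1 / (12 * real p))) = exp (- (l / real p / 12))"
        using N by (simp add: powr_def l_def mult.commute)
      have "real (card (nondivisible_entries N p)) \<le> C * c * real N powr (- (1 / (12 * real p)))"
        unfolding c_def using bound[of N p] p h(3) by auto
      moreover have "0 \<le> C * c" using C c by simp
      hence "C * c * exp (- (l / real p / 12)) \<le> C * c * exp (- (u\<^sup>2 / 12))" by (rule mult_left_mono[OF le1])
      ultimately show ?thesis unfolding Np by (rule order_trans)
    qed
    have "card (nondivisible_entries N (\<Prod>(?S N))) \<le> card (\<Union>p\<in>?S N. nondivisible_entries N p)"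
      by (rule card_mono[OF _ nondivisible_entries_prod_subset[OF fin]]) (use fin fe in auto)
    also have "\<dots> \<le> (\<Sum>p\<in>?S N. card (nondivisible_entries N p))" by (rule card_UN_le[OF fin])
    finally have "real (card (nondivisible_entries N (\<Prod>(?S N)))) \<le> real (\<Sum>p\<in>?S N. card (nondivisible_entries N p))"
      by (simp only: of_nat_le_iff)
    also have "\<dots> = (\<Sum>p\<in>?S N. real (card (nondivisible_entries N p)))" by (rule of_nat_sum)
    also have "\<dots> \<le> real (card (?S N)) * (C * c * exp (- (u\<^sup>2 / 12)))" by (rule sum_bounded_above) (rule each)
    also have "\<dots> \<le> l * (C * c * exp (- (u\<^sup>2 / 12)))" using cS C c by (intro mult_right_mono) auto
    finally have "real (card (nondivisible_entries N (\<Prod>(?S N)))) \<le> (C * (l * exp (- (u\<^sup>2 / 12)))) * c" by (simp add: ac_simps)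
    hence "real (card (nondivisible_entries N (\<Prod>(?S N)))) / c \<le> C * (l * exp (- (u\<^sup>2 / 12)))"
      using c by (simp only: pos_divide_le_eq)
    thus ?thesis by (simp only: c_def l_def u_def)
  qed
  show "?f \<longlonglongrightarrow> 0"
  proof (rule tendsto_sandwich)
    show "\<forall>\<^sub>F N in sequentially. 0 \<le> ?f N" by (intro always_eventually allI) simp
    show "\<forall>\<^sub>F N in sequentially. ?f N \<le> ?g N" using ev by eventually_elim (use le in blast)
    show "(\<lambda>_. 0 :: real) \<longlonglongrightarrow> 0" by simp
    have "(\<lambda>N::nat. ln (real N) * exp (- ((ln (ln (real N)))\<^sup>2 / 12))) \<longlonglongrightarrow> 0" by real_asymp
    from tendsto_mult[OF tendsto_const[of C] this] show "?g \<longlonglongrightarrow> 0" by simp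
  qed
qed

end
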